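(* Let $G$ be a finite nilpotent group. Then $G$ is filled if and only if $G$ is either an elementary abelian 2-group or isomorphic to one of $C_3$, $C_5$, $D_8$, $D_8\times C_2$, $D_8\ast Q_8$ or $(D_8\ast Q_8)\times C_2$.
   Context: $C_n$ is the cyclic group of order $n$, $D_8$ is the dihedral group of order 8, $Q_8$ is the quaternion group of order 8. $D_8\ast Q_8$ is the central product of $D_8$ and $Q_8$ with their centres identified, i.e. the quotient of $D_8\times Q_8$ by the subgroup of order 2 generated by $(z_1,z_2)$, where $z_1,z_2$ are the central involutions of $D_8$ and $Q_8$; it is an extraspecial group of order 32. The trivial group is counted as an elementary abelian 2-group. Let $G$ be a finite group. For $S\subseteq G$ write $SS=\{ab : a,b\in S\}$ ($a$ and $b$ not necessarily distinct). A non-empty subset $S$ of $G$ is product-free if $S\cap SS=\varnothing$. A product-free set $S$ is locally maximal if whenever $\Sigma$ is product-free in $G$ and $S\subseteq\Sigma$, then $S=\Sigma$. A product-free set $S$ fills $G$ (equivalently, is complete) if $G^{*}\subseteq S\cup SS$, where $G^{*}$ is the set of non-identity elements of $G$. The group $G$ is filled if every locally maximal product-free set in $G$ fills $G$. *)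

theory Defs
  imports "HOL-Algebra.Algebra"
begin

section \<open>Filled groups\<close>

definition product_free :: "('a, 'b) monoid_scheme \<Rightarrow> 'a set \<Rightarrow> bool" where
  "product_free G S \<longleftrightarrow> S \<subseteq> carrier G \<and> S \<noteq> {} \<and> S \<inter> (S <#>\<^bsub>G\<^esub> S) = {}"

definition locally_maximal_product_free :: "('a, 'b) monoid_scheme \<Rightarrow> 'a set \<Rightarrow> bool" where
  "locally_maximal_product_free G S \<longleftrightarrow>
     product_free G S \<and> (\<forall>T. product_free G T \<and> S \<subseteq> T \<longrightarrow> S = T)"

definition fills :: "('a, 'b) monoid_scheme \<Rightarrow> 'a set \<Rightarrow> bool" where
  "fills G S \<longleftrightarrow> product_free G S \<and> carrier G - {\<one>\<^bsub>G\<^esub>} \<subseteq> S \<union> (S <#>\<^bsub>G\<^esub> S)"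

definition filled :: "('a, 'b) monoid_scheme \<Rightarrow> bool" where
  "filled G \<longleftrightarrow> (\<forall>S. locally_maximal_product_free G S \<longrightarrow> fills G S)"

section \<open>Nilpotent and elementary abelian groups\<close>

(* The commutator convention is that of derived_set in HOL-Algebra.Generated_Groups.
   The index is shifted by one with respect to the usual numbering gamma_1 = G. *)
primrec lower_central_series :: "('a, 'b) monoid_scheme \<Rightarrow> nat \<Rightarrow> 'a set" where
  "lower_central_series G 0 = carrier G"
| "lower_central_series G (Suc n) =
     generate G {h \<otimes>\<^bsub>G\<^esub> g \<otimes>\<^bsub>G\<^esub> inv\<^bsub>G\<^esub> h \<otimes>\<^bsub>G\<^esub> inv\<^bsub>G\<^esub> g | h g.
       h \<in> lower_central_series G n \<and> g \<in> carrier G}"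

definition nilpotent :: "('a, 'b) monoid_scheme \<Rightarrow> bool" where
  "nilpotent G \<longleftrightarrow> (\<exists>n. lower_central_series G n = {\<one>\<^bsub>G\<^esub>})"

(* Intended for prime p; the trivial group is included. *)
definition elementary_abelian :: "nat \<Rightarrow> ('a, 'b) monoid_scheme \<Rightarrow> bool" where
  "elementary_abelian p G \<longleftrightarrow> comm_group G \<and> (\<forall>x \<in> carrier G. x [^]\<^bsub>G\<^esub> p = \<one>\<^bsub>G\<^esub>)"

section \<open>The groups of the classification\<close>

(* Dihedral group of order 2n (n > 0), with rotation r and reflection s:
   the pair (k, e) stands for r^k if e is False and for r^k s if e is True,
   and the product comes from s r = r^(-1) s. *)
definition dihedral_group :: "nat \<Rightarrow> (int \<times> bool) monoid" where
  "dihedral_group n =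
     \<lparr>carrier = {0..<int n} \<times> UNIV,
      monoid.mult = (\<lambda>(a, e) (b, f). ((if e then a - b else a + b) mod int n, e \<noteq> f)),
      one = (0, False)\<rparr>"

(* The tuple (a, b, c, d) stands for the quaternion a + b i + c j + d k. *)
fun hamilton_mult :: "int \<times> int \<times> int \<times> int \<Rightarrow> int \<times> int \<times> int \<times> int \<Rightarrow> int \<times> int \<times> int \<times> int" where
  "hamilton_mult (a1, b1, c1, d1) (a2, b2, c2, d2) =
     (a1 * a2 - b1 * b2 - c1 * c2 - d1 * d2,
      a1 * b2 + b1 * a2 + c1 * d2 - d1 * c2,
      a1 * c2 - b1 * d2 + c1 * a2 + d1 * b2,
      a1 * d2 + b1 * c2 - c1 * b2 + d1 * a2)"

definition Q8 :: "(int \<times> int \<times> int \<times> int) monoid" where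
  "Q8 =
     \<lparr>carrier = {(1, 0, 0, 0), (-1, 0, 0, 0), (0, 1, 0, 0), (0, -1, 0, 0),
                 (0, 0, 1, 0), (0, 0, -1, 0), (0, 0, 0, 1), (0, 0, 0, -1)},
      monoid.mult = hamilton_mult,
      one = (1, 0, 0, 0)\<rparr>"

(* The subscript is the order of the group. *)
abbreviation D8 :: "(int \<times> bool) monoid" where
  "D8 \<equiv> dihedral_group 4"

(* (2, False) = r^2 and (-1, 0, 0, 0) = -1 are the central involutions of D8 and Q8. *)
definition D8_central_Q8 :: "((int \<times> bool) \<times> (int \<times> int \<times> int \<times> int)) set monoid" where
  "D8_central_Q8 = (D8 \<times>\<times> Q8) Mod generate (D8 \<times>\<times> Q8) {((2, False), (-1, 0, 0, 0))}"

end

theory Submission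
  imports Defs
begin

text \<open>Filledness passes to quotients, and a filled abelian group is elementary abelian of exponent 2 or has
  order 3 or 5; a nilpotent group with cyclic abelianization is abelian. Hence in every other nilpotent filled
  group all squares lie in the derived subgroup.

  If the derived subgroup has order two, squaring is a quadratic form over the field with two elements whose
  polar form is the commutator. Filledness forces the radical of this form to consist of at most four
  elements, all of square 1, and the form modulo its radical to be the hyperbolic plane or the
  four-dimensional form of minus type; these four cases are the four non-abelian groups. Conversely, in
  these groups non-central involutions commute only if they agree modulo the center, and every element of
  order 4 is a product of two of them, which makes every locally maximal product-free set fill the group.

  If the derived subgroup is larger, a normal subgroup \<open>N\<close> maximal with \<open>\<bar>(G/N)'\<bar> > 2\<close> yields a filled
  quotient whose derived subgroup has order four. Dividing out a central involution reduces it to the case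
  of order two, so that its structure is explicit, and product-free sets contained in no product-free set
  filling the group rule it out, separately for nilpotency class 3 and 2.\<close>

section \<open>Product-free sets and quotients\<close>

text \<open>All refutations rest on one scheme: a product-free set S and an element g such that no
  product-free T containing S contains g or has g as a product of two members. When all squares lie
  in {1, z}, putting z into S controls T: a member t with t t = z is impossible, so T consists of
  elements of square 1, and g is taken of order 4. What has to be blocked are the factorizations of
  g into two elements of square 1, and the rest of S is designed to bar one factor of each.

  Both surviving forms have Witt index 1: two distinct nonzero singular vectors are never
  orthogonal. The minus type form in dimension four has exactly five singular vectors, and this
  number also excludes class 2 with a derived subgroup of order four, where five elements would need
  pairwise different commutators with one fixed element. In class 3 the obstruction is an element of
  order 8 lying above the rotation of a quotient D8.\<close>

context group
begin

lemma product_free_iff: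
  "product_free G S \<longleftrightarrow> S \<subseteq> carrier G \<and> S \<noteq> {} \<and> (\<forall>x\<in>S. \<forall>y\<in>S. x \<otimes> y \<notin> S)"
  unfolding product_free_def set_mult_def by blast

lemma product_freeD:
  assumes "product_free G S"
  shows "S \<subseteq> carrier G" "S \<noteq> {}" "\<And>x y. x \<in> S \<Longrightarrow> y \<in> S \<Longrightarrow> x \<otimes> y \<notin> S" "\<one> \<notin> S"
proof -
  show *: "S \<subseteq> carrier G" "S \<noteq> {}" "\<And>x y. x \<in> S \<Longrightarrow> y \<in> S \<Longrightarrow> x \<otimes> y \<notin> S"
    using assms unfolding product_free_iff by auto
  show "\<one> \<notin> S" using *(3)[of \<one> \<one>] by auto
qed

lemma fills_iff:
  "fills G S \<longleftrightarrow> product_free G S \<and>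
     (\<forall>g\<in>carrier G. g \<noteq> \<one> \<longrightarrow> g \<in> S \<or> (\<exists>x\<in>S. \<exists>y\<in>S. g = x \<otimes> y))"
  unfolding fills_def set_mult_def by blast

text \<open>Non-empty subsets of product-free sets are product-free, so maximality only has to be
  tested on one-point extensions. The disjuncts are the ways in which adding x creates a product; a
  relation x s = x or s x = x would force s = 1, which is never in a product-free set.\<close>

lemma locally_maximal_iff:
  "locally_maximal_product_free G S \<longleftrightarrow> product_free G S \<and>
     (\<forall>x\<in>carrier G - S. x = \<one> \<or> x \<otimes> x \<in> S \<or>
        (\<exists>s\<in>S. \<exists>t\<in>S. x = s \<otimes> t \<or> s \<otimes> x = t \<or> x \<otimes> s = t))"
    (is "_ \<longleftrightarrow> _ \<and> (\<forall>x\<in>_. ?B x)")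
proof (intro iffI conjI ballI)
  assume lm: "locally_maximal_product_free G S"
  then show pf: "product_free G S" unfolding locally_maximal_product_free_def by blast
  note S = product_freeD[OF pf]
  fix x assume x: "x \<in> carrier G - S"
  have "\<not> product_free G (insert x S)"
    using lm x unfolding locally_maximal_product_free_def by blast
  then obtain u v where uv: "u \<in> insert x S" "v \<in> insert x S" "u \<otimes> v \<in> insert x S"
    using S(1) x unfolding product_free_iff by blast
  have *: "s = \<one>" if "s \<in> carrier G" "x \<otimes> s = x \<or> s \<otimes> x = x" for s
    using that x by auto
  have "x = \<one>" if "u \<otimes> v = x" "u = x \<or> v = x"
    using *[of u] *[of v] that uv(1,2) S(1,4) x by auto
  then show "?B x" using uv S(3) by (cases "u = x"; cases "v = x"; cases "u \<otimes> v = x") auto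
next
  assume "product_free G S \<and> (\<forall>x\<in>carrier G - S. ?B x)"
  then have pf: "product_free G S" and B: "\<And>x. x \<in> carrier G - S \<Longrightarrow> ?B x" by blast+
  have "T \<subseteq> S" if T: "product_free G T" and ST: "S \<subseteq> T" for T
  proof
    fix x assume x: "x \<in> T"
    show "x \<in> S"
    proof (rule ccontr)
      assume "x \<notin> S"
      then show False using B[of x] x ST product_freeD[OF T] by blast
    qed
  qed
  then show "locally_maximal_product_free G S"
    using pf unfolding locally_maximal_product_free_def by blast
qed

text \<open>By finiteness S lies in a maximal product-free set, which is locally maximal. The
  conditions \<open>missed\<close> are imposed on all product-free supersets, so this maximal set
  never has to be determined.\<close>

lemma not_filledI:
  assumes fin: "finite (carrier G)" and S: "product_free G S"
    and g: "g \<in> carrier G" "g \<noteq> \<one>"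
    and missed: "\<And>T. product_free G T \<Longrightarrow> S \<subseteq> T \<Longrightarrow> g \<notin> T"
      "\<And>T x y. product_free G T \<Longrightarrow> S \<subseteq> T \<Longrightarrow> x \<in> T \<Longrightarrow> y \<in> T \<Longrightarrow> g \<noteq> x \<otimes> y"
  shows "\<not> filled G"
proof
  assume filled: "filled G"
  define F where "F = {T. product_free G T}"
  have "F \<subseteq> Pow (carrier G)" unfolding F_def by (auto dest: product_freeD)
  then have "finite F" using fin by (meson finite_Pow_iff finite_subset)
  moreover have "S \<in> F" using S unfolding F_def by simp
  ultimately obtain T where T: "T \<in> F" "S \<subseteq> T" "\<And>U. U \<in> F \<Longrightarrow> T \<subseteq> U \<Longrightarrow> U = T"
    using finite_has_maximal2[of F S] by metis
  then have "locally_maximal_product_free G T"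
    unfolding locally_maximal_product_free_def F_def by blast
  then have "fills G T" using filled unfolding filled_def by blast
  then show False using g T(1,2) missed unfolding fills_iff F_def by blast
qed

end

text \<open>The full preimage T of a locally maximal set S is again locally maximal, hence fills the
  source, and applying h shows that S fills the image. As T is a union of cosets of the kernel,
  relations in the image lift: one factor is lifted arbitrarily and the other is then determined by
  x.\<close>

lemma (in group_hom) filled_image:
  assumes surj: "h ` carrier G = carrier H" and filled: "filled G"
  shows "filled H"
  unfolding filled_def
proof (intro allI impI)
  fix S assume lm: "locally_maximal_product_free H S"
  define T where "T = {x \<in> carrier G. h x \<in> S}"
  have pf: "product_free H S"
    and B: "\<And>x. x \<in> carrier H - S \<Longrightarrow> x = \<one>\<^bsub>H\<^esub> \<or> x \<otimes>\<^bsub>H\<^esub> x \<in> S \<or>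
      (\<exists>s\<in>S. \<exists>t\<in>S. x = s \<otimes>\<^bsub>H\<^esub> t \<or> s \<otimes>\<^bsub>H\<^esub> x = t \<or> x \<otimes>\<^bsub>H\<^esub> s = t)"
    using lm unfolding H.locally_maximal_iff by blast+
  note S = H.product_freeD[OF pf]
  have lift: "\<exists>y\<in>carrier G. h y = x" if "x \<in> carrier H" for x using surj that by (metis imageE)
  have pfT: "product_free G T"
    unfolding G.product_free_iff
  proof (intro conjI)
    show "T \<subseteq> carrier G" unfolding T_def by auto
    show "T \<noteq> {}" using S(1,2) lift unfolding T_def by blast
    show "\<forall>x\<in>T. \<forall>y\<in>T. x \<otimes> y \<notin> T" using S(3) unfolding T_def by auto
  qed
  have "locally_maximal_product_free G T"
    unfolding G.locally_maximal_iff
  proof (intro conjI pfT ballI)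
    fix x assume x: "x \<in> carrier G - T"
    then have hx: "h x \<in> carrier H - S" and xc: "x \<in> carrier G" unfolding T_def by auto
    obtain s0 where s0: "s0 \<in> carrier G" "h s0 \<in> S" using S(1,2) lift by blast
    consider "h x = \<one>\<^bsub>H\<^esub>" | "h x \<otimes>\<^bsub>H\<^esub> h x \<in> S"
      | s t where "s \<in> S" "t \<in> S" "h x = s \<otimes>\<^bsub>H\<^esub> t"
      | s t where "s \<in> S" "t \<in> S" "s \<otimes>\<^bsub>H\<^esub> h x = t"
      | s t where "s \<in> S" "t \<in> S" "h x \<otimes>\<^bsub>H\<^esub> s = t"
      using B[OF hx] by blast
    then show "x = \<one> \<or> x \<otimes> x \<in> T \<or>
      (\<exists>s\<in>T. \<exists>t\<in>T. x = s \<otimes> t \<or> s \<otimes> x = t \<or> x \<otimes> s = t)"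
    proof cases
      \<comment> \<open>An x in the kernel maps the coset of \<open>s0\<close> to itself, so
        \<open>s0\<close> and \<open>s0\<close> times x both lie in T, which excludes x.\<close>
      case 1
      then have "s0 \<in> T" "s0 \<otimes> x \<in> T" using s0 xc unfolding T_def by auto
      then show ?thesis by blast
    next
      case 2
      then show ?thesis using xc unfolding T_def by auto
    next
      case 3
      obtain u where u: "u \<in> carrier G" "h u = s" using 3 S(1) lift by blast
      have "h (inv u \<otimes> x) = t" using u 3 xc S(1) by (auto simp: H.m_assoc[symmetric])
      then have "u \<in> T" "inv u \<otimes> x \<in> T" "x = u \<otimes> (inv u \<otimes> x)"
        using u 3 xc unfolding T_def by (auto simp: G.m_assoc[symmetric])
      then show ?thesis by blast
    next
      case 4
      obtain u where u: "u \<in> carrier G" "h u = s" using 4 S(1) lift by blast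
      then have "u \<in> T" "u \<otimes> x \<in> T" using 4 xc unfolding T_def by auto
      then show ?thesis by blast
    next
      case 5
      obtain u where u: "u \<in> carrier G" "h u = s" using 5 S(1) lift by blast
      then have "u \<in> T" "x \<otimes> u \<in> T" using 5 xc unfolding T_def by auto
      then show ?thesis by blast
    qed
  qed
  then have fT: "fills G T" using filled unfolding filled_def by blast
  show "fills H S" unfolding H.fills_iff
  proof (intro conjI pf ballI impI)
    fix g assume g: "g \<in> carrier H" "g \<noteq> \<one>\<^bsub>H\<^esub>"
    obtain u where u: "u \<in> carrier G" "h u = g" using g lift by blast
    then have "u \<noteq> \<one>" using g by auto
    then have "u \<in> T \<or> (\<exists>x\<in>T. \<exists>y\<in>T. u = x \<otimes> y)" using fT u unfolding G.fills_iff by blast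
    then show "g \<in> S \<or> (\<exists>x\<in>S. \<exists>y\<in>S. g = x \<otimes>\<^bsub>H\<^esub> y)"
      using u unfolding T_def by force
  qed
qed

lemma filled_iso:
  assumes "group G" "group H" "G \<cong> H" "filled G"
  shows "filled H"
proof -
  obtain h where h: "h \<in> iso G H" using assms(3) by (auto simp: is_iso_def)
  then interpret group_hom G H h
    using assms(1,2) h by (simp add: group_hom_def group_hom_axioms_def iso_imp_homomorphism)
  show ?thesis using filled_image[OF _ assms(4)] h by (auto simp: iso_def bij_betw_def)
qed

context normal
begin

lemma Mod_group_hom: "group_hom G (G Mod H) ((#>) H)"
  using factorgroup_is_group r_coset_hom_Mod is_group
  by (simp add: group_hom_def group_hom_axioms_def)

lemma Mod_surj: "(#>) H ` carrier G = carrier (G Mod H)"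
  by (simp add: carrier_FactGroup)

lemma filled_Mod: "filled G \<Longrightarrow> filled (G Mod H)"
  using group_hom.filled_image[OF Mod_group_hom Mod_surj] .

lemma Mod_eq_iff:
  assumes "x \<in> carrier G" "y \<in> carrier G"
  shows "H #> x = H #> y \<longleftrightarrow> x \<otimes> inv y \<in> H"
  using assms rcos_module[OF is_group, of y x] rcos_self[of x H] repr_independence[of x H y]
    subgroup_axioms by metis

lemma Mod_eq_one_iff:
  assumes "x \<in> carrier G"
  shows "H #> x = H \<longleftrightarrow> x \<in> H"
  using assms by (meson coset_join1 coset_join2 subset is_subgroup)

end

section \<open>Elementary abelian 2-groups, and quotients of order 3\<close>

context group
begin

text \<open>Every element is its own inverse, so the two quotient conditions of local maximality
  become membership in S S, and no square lies in S because all squares are 1.\<close>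

lemma elementary_abelian_filled:
  assumes "\<And>x. x \<in> carrier G \<Longrightarrow> x \<otimes> x = \<one>"
  shows "filled G"
  unfolding filled_def
proof (intro allI impI)
  fix S assume lm: "locally_maximal_product_free G S"
  then have pf: "product_free G S" unfolding locally_maximal_iff by blast
  note S = product_freeD[OF pf]
  have inv: "inv x = x" if "x \<in> carrier G" for x using assms that by (simp add: inv_equality)
  show "fills G S" unfolding fills_iff
  proof (intro conjI pf ballI impI)
    fix g assume g: "g \<in> carrier G" "g \<noteq> \<one>"
    show "g \<in> S \<or> (\<exists>x\<in>S. \<exists>y\<in>S. g = x \<otimes> y)"
    proof (rule ccontr)
      assume not: "\<not> ?thesis"
      then obtain s t where st: "s \<in> S" "t \<in> S" "s \<otimes> g = t \<or> g \<otimes> s = t"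
        using lm g(2) S(4) assms[OF g(1)] DiffI[OF g(1)] unfolding locally_maximal_iff by metis
      then have "s \<in> carrier G" "t \<in> carrier G" using S(1) by auto
      then have "g = inv s \<otimes> t \<or> g = t \<otimes> inv s"
        using st(3) g(1) inv_solve_left'[of g s t] inv_solve_right'[of g t s] by auto
      then have "g = s \<otimes> t \<or> g = t \<otimes> s" using inv \<open>s \<in> carrier G\<close> by simp
      then show False using not st by blast
    qed
  qed
qed

end

text \<open>S is a whole nontrivial coset of the kernel and S S is the other one. Multiplying x by
  an element of the kernel stays in S, so no product-free set is larger than S, and n is never
  reached.\<close>

lemma (in group_hom) not_filled_kernel_index_3:
  assumes fin: "finite (carrier G)" and n: "n \<in> carrier G" "n \<noteq> \<one>" "h n = \<one>\<^bsub>H\<^esub>"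
    and x: "x \<in> carrier G" "h x \<noteq> \<one>\<^bsub>H\<^esub>" "h (x \<otimes> x \<otimes> x) = \<one>\<^bsub>H\<^esub>"
    and cover: "\<And>g. g \<in> carrier G \<Longrightarrow> h g = \<one>\<^bsub>H\<^esub> \<or> h g = h x \<or> h g = h (x \<otimes> x)"
  shows "\<not> filled G"
proof -
  define S where "S = {g \<in> carrier G. h g = h x}"
  have xx: "h (x \<otimes> x) \<noteq> h x" using x by simp
  have "x \<in> S" using x unfolding S_def by simp
  have pf: "product_free G S"
    unfolding G.product_free_iff
  proof (intro conjI ballI)
    show "S \<subseteq> carrier G" "S \<noteq> {}" using x unfolding S_def by auto
    fix a b assume "a \<in> S" "b \<in> S"
    then show "a \<otimes> b \<notin> S" using xx x(1) unfolding S_def by auto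
  qed
  have T12: "h g \<noteq> \<one>\<^bsub>H\<^esub>" "h g \<noteq> h (x \<otimes> x)" if T: "product_free G T" "S \<subseteq> T" "g \<in> T" for T g
  proof -
    note TD = G.product_freeD[OF T(1)]
    have gc: "g \<in> carrier G" using T TD by auto
    show "h g \<noteq> \<one>\<^bsub>H\<^esub>"
    proof
      assume "h g = \<one>\<^bsub>H\<^esub>"
      then have "x \<otimes> g \<in> S" using x(1) gc unfolding S_def by simp
      then show False using TD(3)[OF _ \<open>g \<in> T\<close>] \<open>x \<in> S\<close> T by blast
    qed
    show "h g \<noteq> h (x \<otimes> x)"
    proof
      assume "h g = h (x \<otimes> x)"
      then have "inv x \<otimes> g \<in> S" unfolding S_def using gc x(1) by (simp add: H.m_assoc[symmetric])
      moreover have "x \<otimes> (inv x \<otimes> g) = g" using gc x(1) by (simp add: G.m_assoc[symmetric])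
      ultimately show False using TD(3)[of x "inv x \<otimes> g"] T \<open>x \<in> S\<close> by auto
    qed
  qed
  show ?thesis
  proof (rule G.not_filledI[OF fin pf n(1,2)])
    fix T assume T: "product_free G T" "S \<subseteq> T"
    note TD = G.product_freeD[OF T(1)]
    show "n \<notin> T" using T12(1)[OF T] n by blast
    fix a b assume ab: "a \<in> T" "b \<in> T"
    have c: "a \<in> carrier G" "b \<in> carrier G" using ab TD by auto
    have "h a = h x" "h b = h x"
      using T12[OF T] cover c ab by blast+
    then have "h (a \<otimes> b) = h (x \<otimes> x)" using c x(1) by simp
    also have "\<dots> \<noteq> \<one>\<^bsub>H\<^esub>" using x by auto
    finally show "n \<noteq> a \<otimes> b" using n by blast
  qed
qed

section \<open>Cyclic groups\<close>

lemma integer_mod_group_product_free_iff: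
  assumes "n > 0"
  shows "product_free (integer_mod_group n) S \<longleftrightarrow>
    S \<subseteq> {0..<int n} \<and> S \<noteq> {} \<and> (\<forall>x\<in>S. \<forall>y\<in>S. (x + y) mod int n \<notin> S)"
  using assms by (simp add: group.product_free_iff carrier_integer_mod_group)

lemma mod_add_cases:
  assumes "(x::int) \<in> {0..<n}" "y \<in> {0..<n}"
  shows "(x + y) mod n = (if x + y < n then x + y else x + y - n)"
proof (cases "x + y < n")
  case False
  have "(x + y) mod n = (x + y - n) mod n" by simp
  also have "\<dots> = x + y - n" using assms False by (intro mod_pos_pos_trivial) auto
  finally show ?thesis using False by simp
qed (use assms in auto)

text \<open>The odd residues of an initial interval are product-free because their sums are even as
  long as nothing wraps around; the missed element is an odd residue beyond the interval. The right
  length of the interval depends on n modulo 4.\<close>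

lemma not_filled_integer_mod_group_odd:
  assumes "odd n" "n \<ge> 7"
  shows "\<not> filled (integer_mod_group n)"
proof -
  have n0: "n > 0" using assms by simp
  note pf_iff = integer_mod_group_product_free_iff[OF n0]
  define N where "N = int n"
  have n: "odd N" "N \<ge> 7" using assms unfolding N_def by auto
  note fin = group.not_filledI[of "integer_mod_group n"]
  have "N mod 4 = 1 \<or> N mod 4 = 3" using n(1) by presburger
  then consider k where "N = 4 * k + 3" "k \<ge> 1" | k where "N = 4 * k + 1" "k \<ge> 2"
  proof
    assume "N mod 4 = 1"
    then show ?thesis using n by (intro that(2)[of "N div 4"]) presburger+
  next
    assume "N mod 4 = 3"
    then show ?thesis using n by (intro that(1)[of "N div 4"]) presburger+
  qed
  then show ?thesis
  proof cases
    case 1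
    \<comment> \<open>The largest sum is 4k + 2 = N - 1, so no sum wraps around. Every residue
      outside S is 0, a sum of two members, or an x with N + 1 - x in S, and in the last case x + (N
      + 1 - x) = 1 is in S.\<close>
    define S where "S = {s. odd s \<and> 0 < s \<and> s \<le> 2 * k + 1}"
    have m: "(x + y) mod N = (if x + y < N then x + y else x + y - N)"
      if "x \<in> {0..<N}" "y \<in> {0..<N}" for x y using mod_add_cases[OF that] .
    have pf: "product_free (integer_mod_group n) S"
      unfolding pf_iff N_def[symmetric]
    proof (intro conjI ballI)
      show "S \<subseteq> {0..<N}" unfolding S_def using 1 by auto
      have "1 \<in> S" unfolding S_def using 1 by auto
      then show "S \<noteq> {}" by auto
      fix x y assume "x \<in> S" "y \<in> S"
      moreover from this have "(x + y) mod N = x + y"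
        unfolding S_def using 1 by (intro mod_pos_pos_trivial) auto
      ultimately show "(x + y) mod N \<notin> S" unfolding S_def by auto
    qed
    have TS: "T \<subseteq> S" if T: "product_free (integer_mod_group n) T" "S \<subseteq> T" for T
    proof
      fix x assume x: "x \<in> T"
      have T': "T \<subseteq> {0..<N}" "\<And>u v. u \<in> T \<Longrightarrow> v \<in> T \<Longrightarrow> (u + v) mod N \<notin> T"
        using T(1) unfolding pf_iff N_def by auto
      have xr: "0 \<le> x" "x < N" using x T' by auto
      have s: "s \<in> T" if "odd s" "0 < s" "s \<le> 2 * k + 1" for s
        using that T(2) unfolding S_def by auto
      show "x \<in> S"
      proof (rule ccontr)
        assume "x \<notin> S"
        then consider "x = 0" | "even x" "0 < x" "x \<le> 2 * k + 2" | "even x" "x > 2 * k + 2"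
          | "odd x" "x > 2 * k + 1" using xr unfolding S_def by force
        from this show False
        proof cases
          case 1
          then show False using T'(2)[OF x x] x n by auto
        next
          case 2
          then have "x - 1 \<in> T" "1 \<in> T" using \<open>k \<ge> 1\<close> by (auto intro!: s)
          then show False using T'(2)[of "x - 1" 1] x xr by simp
        next
          case 3
          then have "x - (2 * k + 1) \<in> T" "2 * k + 1 \<in> T" using xr 1 by (auto intro!: s)
          then show False using T'(2)[of "x - (2 * k + 1)" "2 * k + 1"] x xr by simp
        next
          case p: 4
          then have "x \<ge> 2 * k + 3" by presburger
          then have "N + 1 - x \<in> T" "1 \<in> T" using p xr 1 by (auto intro!: s)
          then show False using T'(2)[of x "N + 1 - x"] x xr n by simp
        qed
      qed
    qed
    show ?thesis
    proof (rule fin[OF _ _ pf, of "4 * k + 1"])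
      fix T assume T: "product_free (integer_mod_group n) T" "S \<subseteq> T"
      show "4 * k + 1 \<notin> T" using TS[OF T] 1 unfolding S_def by auto
      fix x y assume "x \<in> T" "y \<in> T"
      then have xy: "x \<in> S" "y \<in> S" using TS[OF T] by auto
      then have "(x + y) mod N = x + y"
        unfolding S_def using 1 by (intro mod_pos_pos_trivial) auto
      then show "4 * k + 1 \<noteq> x \<otimes>\<^bsub>integer_mod_group n\<^esub> y"
        using xy unfolding S_def N_def[symmetric] mult_integer_mod_group
        by (metis (no_types, lifting) dvd_add_right_iff mem_Collect_eq even_mult_iff even_numeral odd_add odd_one)
    qed (use 1 n0 N_def in \<open>auto simp: carrier_integer_mod_group\<close>)
  next
    case 2
    \<comment> \<open>The interval ends at 2k - 1, because 2k + 1 doubles to 1. It leaves only 4k =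
      -1 undecided, and adding this residue produces, besides even sums, just the odd sum 4k + 4k =
      4k - 1. Hence 4k - 3 is missed.\<close>
    define S where "S = insert (4 * k) {s. odd s \<and> 0 < s \<and> s \<le> 2 * k - 1}"
    have m: "(x + y) mod N = (if x + y < N then x + y else x + y - N)"
      if "x \<in> {0..<N}" "y \<in> {0..<N}" for x y using mod_add_cases[OF that] .
    have SN: "S \<subseteq> {0..<N}" unfolding S_def using 2 by auto
    have sums: "(x + y) mod N = 4 * k - 1 \<or> even ((x + y) mod N) \<and> (x + y) mod N \<le> 4 * k - 2"
      if "x \<in> S" "y \<in> S" for x y
    proof -
      have "x \<in> {0..<N}" "y \<in> {0..<N}" using that SN by auto
      from m[OF this] show ?thesis using that 2 unfolding S_def
        by (auto split: if_splits)
    qed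
    have pf: "product_free (integer_mod_group n) S"
      unfolding pf_iff N_def[symmetric]
    proof (intro conjI ballI SN)
      show "S \<noteq> {}" unfolding S_def by auto
      fix x y assume "x \<in> S" "y \<in> S"
      from sums[OF this] show "(x + y) mod N \<notin> S" unfolding S_def using 2 by auto
    qed
    have TS: "T \<subseteq> S" if T: "product_free (integer_mod_group n) T" "S \<subseteq> T" for T
    proof
      fix x assume x: "x \<in> T"
      have T': "T \<subseteq> {0..<N}" "\<And>u v. u \<in> T \<Longrightarrow> v \<in> T \<Longrightarrow> (u + v) mod N \<notin> T"
        using T(1) unfolding pf_iff N_def by auto
      have xr: "0 \<le> x" "x < N" using x T' by auto
      have s: "s \<in> T" if "odd s" "0 < s" "s \<le> 2 * k - 1" for s
        using that T(2) unfolding S_def by auto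
      show "x \<in> S"
      proof (rule ccontr)
        assume "x \<notin> S"
        then have "x \<noteq> 4 * k" "\<not> (odd x \<and> 0 < x \<and> x \<le> 2 * k - 1)" unfolding S_def by auto
        then have "x = 0 \<or> even x \<and> 0 < x \<and> x \<le> 2 * k \<or> even x \<and> x > 2 * k \<and> x \<le> 4 * k - 2
          \<or> x = 2 * k + 1 \<or> odd x \<and> x \<ge> 2 * k + 3" using xr 2 by presburger
        then consider "x = 0" | "even x" "0 < x" "x \<le> 2 * k" | "even x" "x > 2 * k" "x \<le> 4 * k - 2"
          | "x = 2 * k + 1" | "odd x" "x \<ge> 2 * k + 3" by blast
        then show False
        proof cases
          case 1
          then show False using T'(2)[OF x x] x n by auto
        next
          case 2
          then have "x - 1 \<in> T" "1 \<in> T" using \<open>k \<ge> 2\<close> by (auto intro!: s)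
          then show False using T'(2)[of "x - 1" 1] x xr by simp
        next
          case 3
          then have "x - (2 * k - 1) \<in> T" "2 * k - 1 \<in> T" using xr 2 by (auto intro!: s)
          then show False using T'(2)[of "x - (2 * k - 1)" "2 * k - 1"] x xr by simp
        next
          case 4
          then have "(x + x) mod N = 1" using 2 m[of x x] xr by auto
          then show False using T'(2)[OF x x] s[of 1] 2 by simp
        next
          case 5
          then have "N + 1 - x \<in> T" "1 \<in> T" using xr 2 by (auto intro!: s)
          then show False using T'(2)[of x "N + 1 - x"] x xr n by simp
        qed
      qed
    qed
    show ?thesis
    proof (rule fin[OF _ _ pf, of "4 * k - 3"])
      fix T assume T: "product_free (integer_mod_group n) T" "S \<subseteq> T"
      show "4 * k - 3 \<notin> T" using TS[OF T] 2 unfolding S_def by auto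
      fix x y assume "x \<in> T" "y \<in> T"
      then have xy: "x \<in> S" "y \<in> S" using TS[OF T] by auto
      show "4 * k - 3 \<noteq> x \<otimes>\<^bsub>integer_mod_group n\<^esub> y"
        unfolding N_def[symmetric] mult_integer_mod_group
      proof
        assume e: "4 * k - 3 = (x + y) mod N"
        have "odd (4 * k - 3)" by presburger
        then show False using sums[OF xy] unfolding e[symmetric] by auto
      qed
    qed (use 2 n0 N_def in \<open>auto simp: carrier_integer_mod_group\<close>)
  qed
qed

text \<open>The sums of {2, 5, 8} are 0, 3, 4, 6, 7, while 1 and 9 double into the set. So the set
  is locally maximal without producing 1 or 9.\<close>

lemma not_filled_integer_mod_group_10: "\<not> filled (integer_mod_group 10)"
proof -
  let ?S = "{2, 5, 8 :: int}"
  have 10: "(10::nat) > 0" by simp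
  note pf_iff = integer_mod_group_product_free_iff[OF 10]
  have pf: "product_free (integer_mod_group 10) ?S" unfolding pf_iff by auto
  have TS: "T \<subseteq> ?S" if T: "product_free (integer_mod_group 10) T" "?S \<subseteq> T" for T
  proof
    fix x assume x: "x \<in> T"
    have T': "T \<subseteq> {0..<10}" "\<And>u v. u \<in> T \<Longrightarrow> v \<in> T \<Longrightarrow> (u + v) mod 10 \<notin> T"
      using T(1) unfolding pf_iff by auto
    have "x \<in> {0..<10}" using x T' by blast
    then have "x \<in> {0,1,2,3,4,5,6,7,8,9}" by auto
    then show "x \<in> ?S"
      using T'(2)[OF x x] T'(2)[of 2 2] T'(2)[of 2 5] T'(2)[of 5 8] T'(2)[of 8 8] T(2) x
      by auto
  qed
  show ?thesis
  proof (rule group.not_filledI[OF _ _ pf, of 1])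
    fix T assume T: "product_free (integer_mod_group 10) T" "?S \<subseteq> T"
    show "1 \<notin> T" using TS[OF T] by auto
    fix x y assume "x \<in> T" "y \<in> T"
    then have "x \<in> ?S" "y \<in> ?S" using TS[OF T] by auto
    then show "1 \<noteq> x \<otimes>\<^bsub>integer_mod_group 10\<^esub> y" by auto
  qed (auto simp: carrier_integer_mod_group)
qed

lemma filled_integer_mod_group_3: "filled (integer_mod_group 3)"
  unfolding filled_def
proof (intro allI impI)
  fix S assume lm: "locally_maximal_product_free (integer_mod_group 3) S"
  then have pf: "product_free (integer_mod_group 3) S" unfolding locally_maximal_product_free_def by blast
  have 3: "(3::nat) > 0" by simp
  have S: "S \<subseteq> {0..<3}" "S \<noteq> {}" "\<And>u v. u \<in> S \<Longrightarrow> v \<in> S \<Longrightarrow> (u + v) mod 3 \<notin> S"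
    using pf unfolding integer_mod_group_product_free_iff[OF 3] by auto
  have c: "{0..<3} = {0, 1, 2::int}" by auto
  have "1 \<in> S \<or> 2 \<in> S" using S(1,2) S(3)[of 0 0] c by auto
  moreover have "\<exists>x\<in>S. \<exists>y\<in>S. 2 = (x + y) mod 3" if "1 \<in> S"
    using that by (intro bexI[of _ 1]) auto
  moreover have "\<exists>x\<in>S. \<exists>y\<in>S. 1 = (x + y) mod 3" if "2 \<in> S"
    using that by (intro bexI[of _ 2]) auto
  ultimately show "fills (integer_mod_group 3) S"
    unfolding group.fills_iff[OF group_integer_mod_group]
    using pf c by (auto simp: carrier_integer_mod_group)
qed

text \<open>Two members x and y with y = 2 x are forbidden, which confines a product-free set to one
  of the pairs {1, 4} and {2, 3}. Each pair is product-free and its sums contain the other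
  pair.\<close>

lemma filled_integer_mod_group_5: "filled (integer_mod_group 5)"
  unfolding filled_def
proof (intro allI impI)
  fix S assume lm: "locally_maximal_product_free (integer_mod_group 5) S"
  then have pf: "product_free (integer_mod_group 5) S" unfolding locally_maximal_product_free_def by blast
  have 5: "(5::nat) > 0" by simp
  note pf_iff = integer_mod_group_product_free_iff[OF 5]
  have S: "S \<subseteq> {0..<5}" "S \<noteq> {}" "\<And>u v. u \<in> S \<Longrightarrow> v \<in> S \<Longrightarrow> (u + v) mod 5 \<notin> S"
    using pf unfolding pf_iff by auto
  have c: "{0..<5} = {0, 1, 2, 3, 4::int}" by auto
  have pfs: "product_free (integer_mod_group 5) {1, 4}" "product_free (integer_mod_group 5) {2, 3}"
    unfolding pf_iff by auto
  have "0 \<notin> S" using S(3)[of 0 0] by auto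
  moreover have "\<not> (1 \<in> S \<and> 2 \<in> S)" "\<not> (2 \<in> S \<and> 4 \<in> S)" "\<not> (1 \<in> S \<and> 3 \<in> S)" "\<not> (3 \<in> S \<and> 4 \<in> S)"
    using S(3)[of 1 1] S(3)[of 2 2] S(3)[of 3 3] S(3)[of 4 4] by auto
  moreover have "x = 0 \<or> x = 1 \<or> x = 2 \<or> x = 3 \<or> x = 4" if "x \<in> S" for x
    using subsetD[OF S(1) that] by simp presburger
  ultimately have "(\<forall>x\<in>S. x = 1 \<or> x = 4) \<or> (\<forall>x\<in>S. x = 2 \<or> x = 3)" by metis
  then have "S \<subseteq> {1, 4} \<or> S \<subseteq> {2, 3}" by auto
  then have "S = {1, 4} \<or> S = {2, 3}"
    using lm pfs unfolding locally_maximal_product_free_def by metis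
  then have "\<forall>g\<in>{1, 2, 3, 4}. g \<in> S \<or> (\<exists>x\<in>S. \<exists>y\<in>S. g = (x + y) mod 5)"
    by (elim disjE) simp_all
  then show "fills (integer_mod_group 5) S"
    unfolding group.fills_iff[OF group_integer_mod_group]
    using pf c by (simp add: carrier_integer_mod_group)
qed

section \<open>Abelian filled groups\<close>

context group
begin

lemma integer_mod_group_iso:
  assumes fin: "finite (carrier G)" and x: "x \<in> carrier G" "ord x = order G"
  shows "integer_mod_group (order G) \<cong> G"
proof -
  let ?n = "order G"
  let ?f = "\<lambda>k::int. x [^] k"
  have n: "?n > 0" using fin order_gt_0_iff_finite by simp
  have c: "carrier (integer_mod_group ?n) = {0..<int ?n}" using n by (simp add: carrier_integer_mod_group)
  have eq: "x [^] (i::int) = x [^] j \<longleftrightarrow> int ?n dvd (j - i)" for i j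
    using int_pow_eq[OF x(1)] x(2) by simp
  have "?f \<in> hom (integer_mod_group ?n) G"
  proof (rule homI)
    fix a b
    have "x [^] ((a + b) mod int ?n) = x [^] (a + b)" unfolding eq by (simp add: minus_mod_eq_mult_div)
    then show "x [^] (a \<otimes>\<^bsub>integer_mod_group ?n\<^esub> b) = x [^] a \<otimes> x [^] b"
      using x(1) by (simp add: int_pow_mult)
  qed (use x in simp)
  moreover have inj: "inj_on ?f {0..<int ?n}"
  proof (rule inj_onI)
    fix i j assume ij: "i \<in> {0..<int ?n}" "j \<in> {0..<int ?n}" "x [^] i = x [^] j"
    then have "int ?n dvd (j - i)" using eq by simp
    then have "j mod int ?n = i mod int ?n" by (simp add: mod_eq_dvd_iff)
    then show "i = j" using ij by simp
  qed
  moreover have "?f ` {0..<int ?n} = carrier G"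
  proof (rule card_subset_eq[OF fin])
    show "?f ` {0..<int ?n} \<subseteq> carrier G" using x by auto
    show "card (?f ` {0..<int ?n}) = card (carrier G)"
      using card_image[OF inj] by (simp add: order_def)
  qed
  ultimately have "?f \<in> iso (integer_mod_group ?n) G" unfolding iso_def bij_betw_def c by blast
  then show ?thesis unfolding is_iso_def by blast
qed

lemma ord_prime_order:
  assumes "Factorial_Ring.prime (order G)" "x \<in> carrier G" "x \<noteq> \<one>"
  shows "ord x = order G"
  using assms ord_dvd_group_order[OF assms(2)] ord_eq_1[OF assms(2)]
  by (metis prime_nat_iff)

lemma not_filled_cyclic_odd:
  assumes "finite (carrier G)" "x \<in> carrier G" "ord x = order G" "odd (order G)" "order G \<ge> 7"
  shows "\<not> filled G"
  using filled_iso[OF is_group group_integer_mod_group] not_filled_integer_mod_group_odd assms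
    group.iso_sym[OF group_integer_mod_group integer_mod_group_iso] by blast

lemma not_filled_cyclic_10:
  assumes "finite (carrier G)" "x \<in> carrier G" "ord x = order G" "order G = 10"
  shows "\<not> filled G"
  using filled_iso[OF is_group group_integer_mod_group] not_filled_integer_mod_group_10 assms
    group.iso_sym[OF group_integer_mod_group integer_mod_group_iso] by metis

lemma prime_order_subgroup:
  assumes "finite (carrier G)" "Factorial_Ring.prime p" "p dvd order G"
  obtains H where "subgroup H G" "card H = p"
  using sylow_thm[OF assms(2) is_group, of 1] assms by (metis dvdE power_one_right)

lemma subgroup_normalI:
  assumes "subgroup H G" "\<And>x h. x \<in> carrier G \<Longrightarrow> h \<in> H \<Longrightarrow> x \<otimes> h \<otimes> inv x \<in> H"
  shows "H \<lhd> G"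
  using assms normal_inv_iff by blast

end

lemma (in normal) card_Mod:
  "order (G Mod H) * card H = order G"
  by (simp add: FactGroup_def lagrange order_def subgroup_axioms)

text \<open>The converse of Lagrange's theorem for abelian groups, needed to obtain quotients of
  prescribed order. One prime p is removed from e at a time: a subgroup of order p in the quotient
  by a subgroup of order e / p is pulled back.\<close>

lemma (in comm_group) subgroup_of_order:
  assumes fin: "finite (carrier G)" and "e dvd order G"
  shows "\<exists>N. subgroup N G \<and> card N = e"
  using assms(2)
proof (induction e rule: less_induct)
  case (less e)
  have o0: "order G > 0" using fin order_gt_0_iff_finite by simp
  show ?case
  proof (cases "e = 1")
    case True
    then show ?thesis using triv_subgroup by fastforce
  next
    case False
    then obtain p where p: "Factorial_Ring.prime p" "p dvd e" using prime_factor_nat by blast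
    then obtain e' where e': "e = p * e'" by (elim dvdE)
    have "e > 0" using less.prems o0 by (meson dvd_pos_nat)
    then have "e' > 0" using e' by simp
    then have "e' < e" using e' prime_gt_1_nat[OF p(1)] by simp
    moreover have "e' dvd order G" using less.prems e' dvd_mult_right by blast
    ultimately obtain N where N: "subgroup N G" "card N = e'" using less.IH by blast
    interpret N: normal N G using subgroup_imp_normal N by blast
    interpret h: group_hom G "G Mod N" "(#>) N" by (rule N.Mod_group_hom)
    have "order (G Mod N) * e' = order G" using N.card_Mod N(2) by simp
    moreover obtain d where "order G = p * e' * d" using less.prems e' by (auto elim: dvdE)
    ultimately have "p dvd order (G Mod N)" using \<open>e' > 0\<close> by auto
    moreover have "finite (carrier (G Mod N))" using N.Mod_surj fin by (metis finite_imageI)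
    ultimately obtain K where K: "subgroup K (G Mod N)" "card K = p"
      using h.H.prime_order_subgroup p(1) by blast
    define P where "P = {g \<in> carrier G. N #> g \<in> K}"
    note K' = subgroup.m_closed[OF K(1)] subgroup.m_inv_closed[OF K(1)] subgroup.one_closed[OF K(1)]
    have "subgroup P G"
    proof (rule subgroupI)
      show "P \<subseteq> carrier G" unfolding P_def by auto
      have "N #> \<one> = \<one>\<^bsub>G Mod N\<^esub>" by (rule h.hom_one)
      then have "\<one> \<in> P" using K'(3) unfolding P_def by (metis (no_types, lifting) mem_Collect_eq one_closed)
      then show "P \<noteq> {}" by blast
      fix a b assume ab: "a \<in> P" "b \<in> P"
      have "N #> inv a = inv\<^bsub>G Mod N\<^esub> (N #> a)" using ab by (intro h.hom_inv) (auto simp: P_def)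
      then show "inv a \<in> P" using K'(2) ab unfolding P_def by auto
      have "N #> (a \<otimes> b) = (N #> a) \<otimes>\<^bsub>G Mod N\<^esub> (N #> b)" using ab by (intro h.hom_mult) (auto simp: P_def)
      then show "a \<otimes> b \<in> P" using K'(1) ab unfolding P_def by auto
    qed
    \<comment> \<open>The preimage is the disjoint union of the p cosets that are the elements of
      \<open>K\<close>, each of size e'.\<close>
    moreover have "P = \<Union>K"
    proof
      show "P \<subseteq> \<Union>K" unfolding P_def using rcos_self N.is_subgroup by blast
      show "\<Union>K \<subseteq> P"
      proof
        fix g assume "g \<in> \<Union>K"
        then obtain C where C: "C \<in> K" "g \<in> C" by blast
        then have "C \<in> carrier (G Mod N)" using subgroup.subset[OF K(1)] by blast
        then obtain y where y: "y \<in> carrier G" "C = N #> y" using N.Mod_surj by blast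
        then have "g \<in> carrier G" using C(2) r_coset_subset_G N.subset by blast
        moreover have "N #> g = C" using repr_independence[of g N y] C y N.is_subgroup by simp
        ultimately show "g \<in> P" using C unfolding P_def by simp
      qed
    qed
    moreover have "card (\<Union>K) = e' * p"
    proof -
      have KR: "K \<subseteq> rcosets N" using subgroup.subset[OF K(1)] by (simp add: FactGroup_def)
      have "e' * card K = card (\<Union>K)"
      proof (rule card_partition)
        show "finite K" using KR fin rcosets_finite
          by (meson N.is_subgroup \<open>finite (carrier (G Mod N))\<close> finite_subset subgroup.subset[OF K(1)])
        show "finite (\<Union>K)" using KR fin rcosets_part_G[OF N.is_subgroup]
          by (metis Union_mono finite_subset)
        show "card c = e'" if "c \<in> K" for c
          using card_rcosets_equal[of c N] that KR N.subset N(2) by auto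
        show "c1 \<inter> c2 = {}" if "c1 \<in> K" "c2 \<in> K" "c1 \<noteq> c2" for c1 c2
          using rcos_disjoint[OF N.is_subgroup] that KR by (auto simp: pairwise_def disjnt_def)
      qed
      then show ?thesis using K(2) by simp
    qed
    ultimately show ?thesis using e' by (metis mult.commute)
  qed
qed

lemma (in comm_group) filled_quotient:
  assumes fin: "finite (carrier G)" and f: "filled G" and d: "d dvd order G"
  obtains N where "comm_group (G Mod N)" "finite (carrier (G Mod N))" "filled (G Mod N)"
    "order (G Mod N) = d" "N \<lhd> G"
proof -
  obtain e where e: "order G = d * e" using d by (elim dvdE)
  have o0: "order G > 0" using fin order_gt_0_iff_finite by simp
  then have "e > 0" using e by auto
  obtain N where N: "subgroup N G" "card N = e" using subgroup_of_order[OF fin, of e] e by auto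
  interpret N: normal N G using subgroup_imp_normal N by blast
  have "order (G Mod N) * e = d * e" using N.card_Mod N(2) e by simp
  then have "order (G Mod N) = d" using \<open>e > 0\<close> by simp
  moreover have "finite (carrier (G Mod N))" using N.Mod_surj fin by (metis finite_imageI)
  moreover have "comm_group (G Mod N)" using abelian_FactGroup N(1) by blast
  ultimately show thesis using that N.filled_Mod[OF f] N.normal_axioms by blast
qed


section \<open>Abelian groups that are not filled\<close>

context group
begin

text \<open>The set {z} alone blocks a central square root g of z. If z is in T, then every member
  of T has square 1; for g = x y with x and y in T, centrality of g gives y y = (x g)(x g) = g g =
  z, a contradiction.\<close>

lemma not_filled_central_square_root:
  assumes fin: "finite (carrier G)" and z: "z \<in> carrier G" "z \<noteq> \<one>"
    and sq: "\<And>x. x \<in> carrier G \<Longrightarrow> x \<otimes> x = \<one> \<or> x \<otimes> x = z" "z \<otimes> z = \<one>"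
    and g: "g \<in> carrier G" "g \<otimes> g = z" "\<And>x. x \<in> carrier G \<Longrightarrow> g \<otimes> x = x \<otimes> g"
  shows "\<not> filled G"
proof (rule not_filledI[OF fin, of "{z}" g])
  show "product_free G {z}" using z sq(2) unfolding product_free_iff by auto
  show "g \<noteq> \<one>" using g(2) z by auto
  fix T assume T: "product_free G T" "{z} \<subseteq> T"
  note TD = product_freeD[OF T(1)]
  have inv: "x \<otimes> x = \<one>" if "x \<in> T" for x
    using sq(1)[of x] TD(1) TD(3)[OF that that] that T by auto
  show "g \<notin> T" using inv[of g] g(2) z by auto
  fix x y assume xy: "x \<in> T" "y \<in> T"
  show "g \<noteq> x \<otimes> y"
  proof
    assume e: "g = x \<otimes> y"
    have c: "x \<in> carrier G" "y \<in> carrier G" using xy TD by auto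
    have "x \<otimes> g = y" using e inv[OF xy(1)] c by (simp add: m_assoc[symmetric])
    then have "y \<otimes> y = x \<otimes> (g \<otimes> x) \<otimes> g" using c g(1) by (metis m_assoc m_closed)
    also have "\<dots> = (x \<otimes> x) \<otimes> (g \<otimes> g)" using g(3)[of x] c g(1) by (simp add: m_assoc)
    also have "\<dots> = z" using inv[OF xy(1)] g(2) z by simp
    finally show False using inv[OF xy(2)] z by simp
  qed
qed (rule g(1))

end

text \<open>Here G is the product of N and the cyclic group of x. The set S is the coset x N with
  the point x replaced by x^3, where x = x^3 x^3. Products of two members have x-exponent 2, 4 or 1
  modulo 5, so N is never reached. Absence of involutions in N bars x^3 n for n other than 1,
  because its square x n n then lies in S.\<close>

lemma (in comm_group) not_filled_order_5_times_odd:
  assumes fin: "finite (carrier G)" and N: "N \<lhd> G"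
    and odd: "\<And>n. n \<in> N \<Longrightarrow> n \<otimes> n = \<one> \<Longrightarrow> n = \<one>" and card: "card N \<ge> 3"
    and x: "x \<in> carrier G" "x [^] (5::nat) = \<one>" "x \<notin> N"
    and cover: "\<And>g. g \<in> carrier G \<Longrightarrow> \<exists>i<5. \<exists>n\<in>N. g = x [^] (i::nat) \<otimes> n"
  shows "\<not> filled G"
proof -
  interpret N: normal N G by fact
  have pw: "x [^] (i::nat) \<otimes> n \<otimes> (x [^] (j::nat) \<otimes> m) = x [^] (i + j) \<otimes> (n \<otimes> m)"
    if "n \<in> N" "m \<in> N" for i j n m
    using that x(1) by (simp add: nat_pow_mult[symmetric] m_ac)
  have x5: "x [^] (i::nat) = x [^] (i mod 5)" for i
  proof -
    have "x [^] i = x [^] (5 * (i div 5) + i mod 5)" by simp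
    also have "\<dots> = (x [^] (5::nat)) [^] (i div 5) \<otimes> x [^] (i mod 5)"
      unfolding nat_pow_pow[OF x(1)] nat_pow_mult[OF x(1)] ..
    finally show ?thesis using x by simp
  qed
  \<comment> \<open>If 5 does not divide i, some power of x^i equals x, which is outside N; the case
    distinction supplies the inverse of i modulo 5.\<close>
  have xN: "i mod 5 = 0" if "x [^] (i::nat) \<in> N" for i
  proof (rule ccontr)
    assume "i mod 5 \<noteq> 0"
    then consider "i mod 5 = 1" | "i mod 5 = 2" | "i mod 5 = 3" | "i mod 5 = 4" by linarith
    then have "\<exists>j. (i mod 5) * j mod 5 = 1"
    proof cases
      case 2 then show ?thesis by (intro exI[of _ 3]) simp
    next
      case 3 then show ?thesis by (intro exI[of _ 2]) simp
    next
      case 4 then show ?thesis by (intro exI[of _ 4]) simp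
    qed (auto intro: exI[of _ 1])
    then obtain j where "i * j mod 5 = 1" by (auto simp: mod_mult_left_eq)
    then have "x [^] (i * j) = x" using x5[of "i * j"] x by simp
    moreover have "(x [^] i) [^] j \<in> N" using that by (induction j) auto
    ultimately show False using x by (simp add: nat_pow_pow)
  qed
  have uniq: "i = j \<and> n = m" if "x [^] i \<otimes> n = x [^] j \<otimes> m" "i < 5" "j < 5" "n \<in> N" "m \<in> N" for i j :: nat and n m
  proof -
    have "x [^] ((5 - j) + i) \<otimes> (\<one> \<otimes> n) = x [^] ((5 - j) + j) \<otimes> (\<one> \<otimes> m)"
      using pw[of \<one> n "5 - j" i] pw[of \<one> m "5 - j" j] that by simp
    also have "\<dots> = m" using that x by simp
    finally have e: "x [^] (i + (5 - j)) \<otimes> n = m" using that by (simp add: add.commute)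
    then have "x [^] (i + (5 - j)) = m \<otimes> inv n" using that x by (simp add: inv_solve_right)
    then have "(i + (5 - j)) mod 5 = 0" using xN that by simp
    then have "i = j" using that(2,3) by presburger
    then show ?thesis using that x by simp
  qed
  define C where "C = (\<lambda>(i::nat) A. (\<lambda>n. x [^] i \<otimes> n) ` (A::'a set))"
  have Cmem: "x [^] (k::nat) \<otimes> n \<in> C i A \<longleftrightarrow> k mod 5 = i \<and> n \<in> A" if "n \<in> N" "A \<subseteq> N" "i < 5" for k n i A
    using uniq[of "k mod 5" n i] that x5[of k] unfolding C_def by (auto simp: image_iff)
  define S where "S = C 1 (N - {\<one>}) \<union> C 3 {\<one>}"
  have Smem: "x [^] (k::nat) \<otimes> n \<in> S \<longleftrightarrow> k mod 5 = 1 \<and> n \<noteq> \<one> \<or> k mod 5 = 3 \<and> n = \<one>" if "n \<in> N" for k n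
    unfolding S_def using that by (auto simp: Cmem)
  have S_elim: "\<exists>k n. g = x [^] (k::nat) \<otimes> n \<and> n \<in> N \<and> (k = 1 \<and> n \<noteq> \<one> \<or> k = 3 \<and> n = \<one>)" if gS: "g \<in> S" for g
  proof -
    obtain n where "g = x [^] (1::nat) \<otimes> n \<and> n \<in> N \<and> n \<noteq> \<one> \<or> g = x [^] (3::nat) \<otimes> \<one>"
      using gS unfolding S_def C_def by blast
    then show ?thesis using N.one_closed by metis
  qed
  \<comment> \<open>Elements n of N and x x n of its coset are barred by a choice of m for which x m
    and x m n, respectively x m and x m^-1 n, both lie in x (N - {1}). Such an m has to avoid two
    values, which requires three elements in N.\<close>
  have nontriv: "\<exists>n\<in>N. n \<noteq> \<one> \<and> n \<noteq> m" for m
  proof (rule ccontr)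
    assume "\<not> ?thesis"
    then have "N \<subseteq> {\<one>, m}" by blast
    then have "card N \<le> card {\<one>, m}" by (rule card_mono[rotated]) simp
    also have "\<dots> \<le> 2" by (simp add: card_insert_if)
    finally show False using card by simp
  qed
  have pf: "product_free G S"
    unfolding product_free_iff
  proof (intro conjI ballI)
    show "S \<subseteq> carrier G" unfolding S_def C_def using x by auto
    show "S \<noteq> {}" unfolding S_def C_def by auto
    fix a b assume "a \<in> S" "b \<in> S"
    then obtain k n l m where *: "a = x [^] (k::nat) \<otimes> n" "n \<in> N" "k = 1 \<and> n \<noteq> \<one> \<or> k = 3 \<and> n = \<one>"
      "b = x [^] (l::nat) \<otimes> m" "m \<in> N" "l = 1 \<and> m \<noteq> \<one> \<or> l = 3 \<and> m = \<one>" using S_elim by meson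
    then have "a \<otimes> b = x [^] (k + l) \<otimes> (n \<otimes> m)" by (simp add: pw)
    then show "a \<otimes> b \<notin> S" using * Smem[of "n \<otimes> m" "k + l"] by auto
  qed
  have TS: "g \<in> S" if T: "product_free G T" "S \<subseteq> T" "g \<in> T" for T g
  proof (rule ccontr)
    assume gS: "g \<notin> S"
    note TD = product_freeD[OF T(1)]
    obtain k n where kn: "k < 5" "n \<in> N" "g = x [^] (k::nat) \<otimes> n" using cover T(3) TD(1) by blast
    have ST: "x [^] (l::nat) \<otimes> m \<in> T" if "m \<in> N" "l = 1 \<and> m \<noteq> \<one> \<or> l = 3 \<and> m = \<one>" for l m
      using that Smem[of m l] T(2) by auto
    consider "k = 0" | "k = 1" "n = \<one>" | "k = 2" | "k = 3" "n \<noteq> \<one>" | "k = 4" "n = \<one>" | "k = 4" "n \<noteq> \<one>"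
    proof -
      have "k = 0 \<or> k = 1 \<or> k = 2 \<or> k = 3 \<or> k = 4" using kn(1) by linarith
      moreover have "\<not> (k = 1 \<and> n \<noteq> \<one> \<or> k = 3 \<and> n = \<one>)" using Smem[of n k] kn gS by auto
      ultimately show ?thesis using that by metis
    qed
    then show False
    proof cases
      case 1
      obtain m where m: "m \<in> N" "m \<noteq> \<one>" "m \<noteq> inv n" using nontriv by blast
      have "m \<otimes> n \<noteq> \<one>" using m kn by (metis N.mem_carrier inv_equality)
      then have "x [^] (1::nat) \<otimes> m \<in> T" "x [^] (1::nat) \<otimes> (m \<otimes> n) \<in> T"
        using m kn by (intro ST; simp)+
      then show False using TD(3)[OF _ T(3), of "x [^] (1::nat) \<otimes> m"] kn m 1 pw[of m n 1 0] by simp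
    next
      case 2
      have "x [^] (3::nat) \<otimes> \<one> \<in> T" by (intro ST) auto
      then show False using TD(3)[of "x [^] (3::nat) \<otimes> \<one>" "x [^] (3::nat) \<otimes> \<one>"] kn 2 pw[of \<one> \<one> 3 3] x5[of 6] T(3)
        by simp
    next
      case 3
      obtain m where m: "m \<in> N" "m \<noteq> \<one>" "m \<noteq> n" using nontriv by blast
      have "inv m \<otimes> n \<noteq> \<one>" using m kn by (metis N.mem_carrier inv_equality inv_inv N.m_inv_closed)
      then have "x [^] (1::nat) \<otimes> m \<in> T" "x [^] (1::nat) \<otimes> (inv m \<otimes> n) \<in> T"
        using m kn by (intro ST; simp)+
      moreover have "m \<otimes> (inv m \<otimes> n) = n" using m kn by (simp add: m_assoc[symmetric])
      ultimately show False using TD(3)[of "x [^] (1::nat) \<otimes> m" "x [^] (1::nat) \<otimes> (inv m \<otimes> n)"] kn m 3 pw[of m "inv m \<otimes> n" 1 1] T(3)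
        by (simp add: numeral_2_eq_2)
    next
      case 4
      then have "n \<otimes> n \<noteq> \<one>" using odd kn by blast
      then have "x [^] (1::nat) \<otimes> (n \<otimes> n) \<in> T" using kn by (intro ST; simp)
      then show False using TD(3)[OF T(3) T(3)] kn 4 pw[of n n 3 3] x5[of 6] by simp
    next
      case 5
      have "x [^] (3::nat) \<otimes> \<one> \<in> T" by (intro ST) auto
      then show False using TD(3)[OF T(3) T(3)] kn 5 pw[of \<one> \<one> 4 4] x5[of 8] by simp
    next
      case 6
      have "x [^] (3::nat) \<otimes> \<one> \<in> T" "x [^] (1::nat) \<otimes> n \<in> T" by (intro ST; use 6 kn in auto)+
      then show False using TD(3)[of "x [^] (3::nat) \<otimes> \<one>" "x [^] (1::nat) \<otimes> n"] kn 6 pw[of \<one> n 3 1] T(3) by simp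
    qed
  qed
  obtain n where n: "n \<in> N" "n \<noteq> \<one>" using nontriv by blast
  have "n \<notin> S" using Smem[of n 0] n by simp
  show ?thesis
  proof (rule not_filledI[OF fin pf, of n])
    fix T assume T: "product_free G T" "S \<subseteq> T"
    show "n \<notin> T" using TS[OF T] \<open>n \<notin> S\<close> by blast
    fix a b assume "a \<in> T" "b \<in> T"
    then have "a \<in> S" "b \<in> S" using TS[OF T] by auto
    then obtain k n' l m where *: "a = x [^] (k::nat) \<otimes> n'" "n' \<in> N" "k = 1 \<and> n' \<noteq> \<one> \<or> k = 3 \<and> n' = \<one>"
      "b = x [^] (l::nat) \<otimes> m" "m \<in> N" "l = 1 \<and> m \<noteq> \<one> \<or> l = 3 \<and> m = \<one>" using S_elim by meson
    then have "a \<otimes> b = x [^] (k + l) \<otimes> (n' \<otimes> m)" by (simp add: pw)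
    moreover have "(k + l) mod 5 \<noteq> 0" using * by auto
    ultimately show "n \<noteq> a \<otimes> b"
      using Cmem[of "n' \<otimes> m" N 0 "k + l"] Cmem[of n N 0 0] * n by auto
  qed (use n in auto)
qed

declare mult_FactGroup [simp del]

context group
begin

lemma exists_prime_order_element:
  assumes fin: "finite (carrier G)" and p: "Factorial_Ring.prime p" "p dvd order G"
  obtains x where "x \<in> carrier G" "ord x = p"
proof -
  obtain H where H: "subgroup H G" "card H = p" using prime_order_subgroup assms by blast
  interpret H: group "G\<lparr>carrier := H\<rparr>" using H(1) by (rule subgroup.subgroup_is_group) (rule is_group)
  have oH: "order (G\<lparr>carrier := H\<rparr>) = p" using H(2) by (simp add: order_def)
  have "\<not> H \<subseteq> {\<one>}"
    using card_mono[of "{\<one>}" H] H(2) prime_gt_1_nat[OF p(1)] by auto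
  then obtain x where x: "x \<in> H" "x \<noteq> \<one>" by blast
  then have "x \<in> carrier G" using subgroup.subset[OF H(1)] by blast
  moreover have "x [^] p = \<one>"
    using H.pow_order_eq_1[of x] oH x nat_pow_consistent[of x p H] by simp
  then have "ord x dvd p" using pow_eq_id \<open>x \<in> carrier G\<close> by blast
  then have "ord x = p" using ord_eq_1[OF \<open>x \<in> carrier G\<close>] x(2) p(1) by (metis prime_nat_iff)
  ultimately show thesis by (rule that)
qed

lemma exists_nontrivial:
  assumes "order G > 1"
  obtains x where "x \<in> carrier G" "x \<noteq> \<one>"
proof -
  have "\<not> carrier G \<subseteq> {\<one>}" using card_mono[of "{\<one>}" "carrier G"] assms by (auto simp: order_def)
  then show thesis using that by blast
qed

lemma cyclic_elements:
  assumes fin: "finite (carrier G)" and x: "x \<in> carrier G" "ord x = order G" and g: "g \<in> carrier G"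
  obtains i :: nat where "i < order G" "g = x [^] i"
proof -
  let ?n = "order G"
  have n: "?n > 0" using fin order_gt_0_iff_finite by simp
  have "{0..?n - 1} = {..<?n}" using n by auto
  then have inj: "inj_on (\<lambda>i. x [^] i) {..<?n}" using ord_inj[OF x(1)] x(2) by simp
  have "(\<lambda>i. x [^] i) ` {..<?n} = carrier G"
  proof (rule card_subset_eq[OF fin])
    show "(\<lambda>i. x [^] i) ` {..<?n} \<subseteq> carrier G" using x by auto
    show "card ((\<lambda>i. x [^] i) ` {..<?n}) = card (carrier G)"
      using card_image[OF inj] by (simp add: order_def)
  qed
  then show thesis using g that by blast
qed

text \<open>A nontrivial kernel would supply the element n of
  \<open>not_filled_kernel_index_3\<close>, so a filled group with a quotient of order 3 coincides
  with it.\<close>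

lemma filled_order_3:
  assumes fin: "finite (carrier G)" and f: "filled G" and N: "N \<lhd> G" "order (G Mod N) = 3"
  shows "order G = 3"
proof (rule ccontr)
  assume not: "order G \<noteq> 3"
  interpret N: normal N G by fact
  interpret h: group_hom G "G Mod N" "(#>) N" by (rule N.Mod_group_hom)
  have "card N \<noteq> 1" using N.card_Mod N(2) not by auto
  have finN: "finite N" using fin N.subset finite_subset by blast
  have "\<not> N \<subseteq> {\<one>}"
  proof
    assume "N \<subseteq> {\<one>}"
    then have "N = {\<one>}" using N.one_closed by blast
    then show False using \<open>card N \<noteq> 1\<close> by simp
  qed
  then obtain n where n: "n \<in> N" "n \<noteq> \<one>" by blast
  have finQ: "finite (carrier (G Mod N))" using N.Mod_surj fin by (metis finite_imageI)
  have p3: "Factorial_Ring.prime (order (G Mod N))" using N(2) by simp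
  obtain y where y: "y \<in> carrier (G Mod N)" "y \<noteq> \<one>\<^bsub>G Mod N\<^esub>"
    using h.H.exists_nontrivial N(2) by (metis one_less_numeral_iff semiring_norm(77))
  have oy: "h.H.ord y = order (G Mod N)" using h.H.ord_prime_order[OF p3] y by blast
  obtain x where x: "x \<in> carrier G" "N #> x = y" using y(1) N.Mod_surj by (metis imageE)
  have y2: "y [^]\<^bsub>G Mod N\<^esub> (2::nat) = N #> (x \<otimes> x)"
  proof -
    have "x [^] (2::nat) = x \<otimes> x" using x by (simp add: numeral_2_eq_2)
    then show ?thesis using h.hom_nat_pow[OF x(1), of 2] x(2) by simp
  qed
  have "\<not> filled G"
  proof (rule h.not_filled_kernel_index_3[OF fin _ n(2) _ x(1)])
    show "n \<in> carrier G" using n by simp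
    show "N #> n = \<one>\<^bsub>G Mod N\<^esub>" using N.Mod_eq_one_iff[of n] n by simp
    show "N #> x \<noteq> \<one>\<^bsub>G Mod N\<^esub>" using x y by simp
    have "N #> (x \<otimes> x \<otimes> x) = y [^]\<^bsub>G Mod N\<^esub> (3::nat)"
    proof -
      have "x [^] (3::nat) = x \<otimes> x \<otimes> x" using x by (simp add: numeral_3_eq_3)
      then show ?thesis using h.hom_nat_pow[OF x(1), of 3] x(2) by simp
    qed
    then show "N #> (x \<otimes> x \<otimes> x) = \<one>\<^bsub>G Mod N\<^esub>"
      using h.H.pow_order_eq_1[OF y(1)] N(2) by simp
    fix g assume g: "g \<in> carrier G"
    obtain i :: nat where i: "i < 3" "N #> g = y [^]\<^bsub>G Mod N\<^esub> i"
      using h.H.cyclic_elements[OF finQ y(1) oy h.hom_closed[OF g]] N(2) by metis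
    then have "N #> g = N #> (x [^] i)" using h.hom_nat_pow[OF x(1)] x(2) by simp
    moreover have "x [^] i = \<one> \<or> x [^] i = x \<or> x [^] i = x \<otimes> x"
      using i(1) x(1) by (auto simp: less_Suc_eq numeral_3_eq_3)
    ultimately show "N #> g = \<one>\<^bsub>G Mod N\<^esub> \<or> N #> g = N #> x \<or> N #> g = N #> (x \<otimes> x)"
      using h.hom_one by metis
  qed
  then show False using f by blast
qed

end

context comm_group
begin

text \<open>Elements of order 5 and 2 have a product of order 10, so the group is cyclic.\<close>

lemma not_filled_order_10:
  assumes fin: "finite (carrier G)" and o: "order G = 10"
  shows "\<not> filled G"
proof -
  obtain x where x: "x \<in> carrier G" "ord x = 5" using exists_prime_order_element[of 5] fin o by auto
  obtain y where y: "y \<in> carrier G" "ord y = 2" using exists_prime_order_element[of 2] fin o by auto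
  let ?w = "x \<otimes> y"
  have w: "?w \<in> carrier G" using x y by simp
  have "ord ?w dvd 10" using ord_dvd_group_order[OF w] o by simp
  moreover have "\<not> ord ?w dvd 2"
  proof
    assume "ord ?w dvd 2"
    then have "?w [^] (2::nat) = \<one>" using pow_eq_id[OF w] by blast
    moreover have "y [^] (2::nat) = \<one>" using pow_eq_id[OF y(1)] y by simp
    ultimately have "x [^] (2::nat) = \<one>" using x y by (simp add: nat_pow_distrib)
    then show False using pow_eq_id[OF x(1)] x by simp
  qed
  moreover have "\<not> ord ?w dvd 5"
  proof
    assume "ord ?w dvd 5"
    then have "?w [^] (5::nat) = \<one>" using pow_eq_id[OF w] by blast
    moreover have "x [^] (5::nat) = \<one>" using pow_eq_id[OF x(1)] x by simp
    ultimately have "y [^] (5::nat) = \<one>" using x y by (simp add: nat_pow_distrib)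
    then show False using pow_eq_id[OF y(1)] y by simp
  qed
  moreover have "d = 10" if "d dvd 10" "\<not> d dvd 2" "\<not> d dvd 5" for d :: nat
  proof -
    have "d \<le> 10" using that(1) by (intro dvd_imp_le) auto
    then have "d = 0 \<or> d = 1 \<or> d = 2 \<or> d = 3 \<or> d = 4 \<or> d = 5 \<or> d = 6 \<or> d = 7 \<or> d = 8 \<or> d = 9 \<or> d = 10"
      by presburger
    then show ?thesis using that by (elim disjE) simp_all
  qed
  ultimately have "ord ?w = order G" using o by simp
  then show ?thesis using not_filled_cyclic_10[OF fin w _ o] by blast
qed

text \<open>Either the group is cyclic of odd order at least 7, or it has exponent 5 and splits over
  a subgroup of order 5, so that \<open>not_filled_order_5_times_odd\<close> applies.\<close>

lemma not_filled_order_25: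
  assumes fin: "finite (carrier G)" and o: "order G = 25"
  shows "\<not> filled G"
proof (cases "\<exists>x\<in>carrier G. ord x = 25")
  case True
  then show ?thesis using not_filled_cyclic_odd fin o by auto
next
  case False
  have d25: "d = 1 \<or> d = 5 \<or> d = 25" if "d dvd 25" for d :: nat
  proof -
    have "\<exists>k\<le>2. d = 5 ^ k" using divides_primepow_nat[of 5 d 2] that by simp
    then obtain k :: nat where "k = 0 \<or> k = 1 \<or> k = 2" "d = 5 ^ k" by (auto simp: le_Suc_eq numeral_2_eq_2)
    then show ?thesis by auto
  qed
  have p5: "x [^] (5::nat) = \<one>" if "x \<in> carrier G" for x
  proof -
    have "ord x dvd 25" using ord_dvd_group_order[OF that] o by simp
    then have "ord x dvd 5" using d25[of "ord x"] False that by auto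
    then show ?thesis using pow_eq_id[OF that] by blast
  qed
  obtain N where N: "subgroup N G" "card N = 5" using subgroup_of_order[OF fin, of 5] o by auto
  interpret N: normal N G using subgroup_imp_normal N by blast
  interpret h: group_hom G "G Mod N" "(#>) N" by (rule N.Mod_group_hom)
  have oQ: "order (G Mod N) = 5" using N.card_Mod N(2) o by simp
  have finQ: "finite (carrier (G Mod N))" using N.Mod_surj fin by (metis finite_imageI)
  have "\<not> carrier G \<subseteq> N"
  proof
    assume "carrier G \<subseteq> N"
    then have "card (carrier G) \<le> card N" using fin N.subset by (meson card_mono finite_subset)
    then show False using N(2) o by (simp add: order_def)
  qed
  then obtain x where x: "x \<in> carrier G" "x \<notin> N" by blast
  have "N #> x \<noteq> \<one>\<^bsub>G Mod N\<^esub>" using N.Mod_eq_one_iff x by simp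
  then have ox: "h.H.ord (N #> x) = order (G Mod N)"
    using h.H.ord_prime_order[OF _ h.hom_closed[OF x(1)]] oQ by simp
  show ?thesis
  proof (rule not_filled_order_5_times_odd[OF fin N.normal_axioms _ _ x(1) p5[OF x(1)] x(2)])
    show "3 \<le> card N" using N by simp
    show "n = \<one>" if n: "n \<in> N" "n \<otimes> n = \<one>" for n
    proof -
      have nc: "n \<in> carrier G" using n by simp
      have "n [^] (5::nat) = (n \<otimes> n) \<otimes> ((n \<otimes> n) \<otimes> n)"
        using nc by (simp add: numeral_eq_Suc m_assoc)
      then show ?thesis using p5[OF nc] n(2) nc by simp
    qed
    fix g assume g: "g \<in> carrier G"
    obtain i :: nat where i: "i < 5" "N #> g = (N #> x) [^]\<^bsub>G Mod N\<^esub> i"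
      using h.H.cyclic_elements[OF finQ h.hom_closed[OF x(1)] ox h.hom_closed[OF g]] oQ by metis
    then have "N #> g = N #> (x [^] i)" using h.hom_nat_pow[OF x(1)] by simp
    then have "g \<otimes> inv (x [^] i) \<in> N" using N.Mod_eq_iff g x(1) by simp
    moreover have "g = x [^] i \<otimes> (g \<otimes> inv (x [^] i))"
      using g x(1) by (simp add: m_lcomm)
    ultimately show "\<exists>i<5. \<exists>n\<in>N. g = x [^] (i::nat) \<otimes> n" using i(1) by blast
  qed
qed

text \<open>N is chosen maximal among the subgroups whose quotient still has a nontrivial square.
  Then every nontrivial subgroup of the quotient contains all its squares, which forces the squares
  to take only one nontrivial value, and \<open>not_filled_central_square_root\<close> applies to G
  modulo N.\<close>

lemma not_filled_2_group:
  assumes fin: "finite (carrier G)" and ord2: "\<And>x. x \<in> carrier G \<Longrightarrow> \<exists>k. x [^] ((2::nat) ^ k) = \<one>"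
    and x0: "x0 \<in> carrier G" "x0 \<otimes> x0 \<noteq> \<one>"
  shows "\<not> filled G"
proof -
  define F where "F = {N. subgroup N G \<and> (\<exists>x\<in>carrier G. x \<otimes> x \<notin> N)}"
  have "F \<subseteq> Pow (carrier G)" unfolding F_def using subgroup.subset by blast
  then have "finite F" using fin by (meson finite_Pow_iff finite_subset)
  moreover have "{\<one>} \<in> F" unfolding F_def using triv_subgroup x0 by auto
  ultimately obtain N where N: "N \<in> F" "\<And>P. P \<in> F \<Longrightarrow> N \<subseteq> P \<Longrightarrow> P = N"
    using finite_has_maximal[of F] by blast
  obtain g where g: "g \<in> carrier G" "g \<otimes> g \<notin> N" and Nsub: "subgroup N G" using N(1) unfolding F_def by blast
  interpret N: normal N G using subgroup_imp_normal Nsub by blast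
  interpret h: group_hom G "G Mod N" "(#>) N" by (rule N.Mod_group_hom)
  have absorb: "\<exists>n\<in>N. \<exists>i::int. x \<otimes> x = n \<otimes> u [^] i"
    if u: "u \<in> carrier G" "u \<notin> N" and x: "x \<in> carrier G" for u x
  proof -
    define P where "P = {n \<otimes> u [^] i | n (i::int). n \<in> N}"
    have "subgroup P G"
    proof (rule subgroupI)
      show "P \<subseteq> carrier G" unfolding P_def using u by auto
      show "P \<noteq> {}" unfolding P_def using N.one_closed by blast
      fix a assume "a \<in> P"
      then obtain n i where a: "a = n \<otimes> u [^] (i::int)" "n \<in> N" unfolding P_def by blast
      then have "inv a = inv n \<otimes> u [^] (- i)" using u by (simp add: inv_mult int_pow_neg)
      then show "inv a \<in> P" unfolding P_def using a by blast
      fix b assume "b \<in> P"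
      then obtain m j where b: "b = m \<otimes> u [^] (j::int)" "m \<in> N" unfolding P_def by blast
      have "a \<otimes> b = (n \<otimes> m) \<otimes> u [^] (i + j)" using a b u by (simp add: int_pow_mult m_ac)
      then show "a \<otimes> b \<in> P" unfolding P_def using a b by blast
    qed
    moreover have "N \<subseteq> P"
    proof
      fix n assume "n \<in> N"
      then have "n = n \<otimes> u [^] (0::int)" by simp
      then show "n \<in> P" unfolding P_def using \<open>n \<in> N\<close> by blast
    qed
    moreover have "u \<in> P"
    proof -
      have "u = \<one> \<otimes> u [^] (1::int)" using u by simp
      then show ?thesis unfolding P_def using N.one_closed by blast
    qed
    ultimately have "P \<notin> F" using N(2) u(2) by blast
    then have "x \<otimes> x \<in> P" using \<open>subgroup P G\<close> x unfolding F_def by blast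
    then show ?thesis unfolding P_def by blast
  qed
  have fourth: "(x \<otimes> x) \<otimes> (x \<otimes> x) \<in> N" if x: "x \<in> carrier G" for x
  proof (rule ccontr)
    let ?y = "x \<otimes> x"
    assume not: "?y \<otimes> ?y \<notin> N"
    have y: "?y \<in> carrier G" using x by simp
    obtain n and i :: int where n: "n \<in> N" "?y = n \<otimes> (?y \<otimes> ?y) [^] i" using absorb[OF _ not x] y by auto
    have "?y \<otimes> ?y = ?y [^] (2::int)" using int_pow_mult[OF y, of 1 1] y by simp
    then have "(?y \<otimes> ?y) [^] i = ?y [^] (2 * i)" using y by (simp add: int_pow_pow)
    then have "n = ?y \<otimes> ?y [^] (- (2 * i))"
      using n y by (metis N.mem_carrier int_pow_closed int_pow_neg inv_solve_right)
    also have "\<dots> = ?y [^] (1 - 2 * i)" using int_pow_mult[OF y, of 1 "- (2 * i)"] y by simp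
    finally have yN: "?y [^] (1 - 2 * i) \<in> N" using n by simp
    obtain k where k: "?y [^] ((2::nat) ^ k) = \<one>" using ord2[OF y] by blast
    then have k': "?y [^] ((2::int) ^ k) = \<one>" by (metis int_pow_int of_nat_numeral of_nat_power)
    \<comment> \<open>The exponent 1 - 2 i is odd and the order of \<open>?y\<close> divides a power
      of 2, so \<open>?y\<close> is itself a power of the element \<open>?y\<close> to the 1 - 2 i
      of N.\<close>
    have "coprime (1 - 2 * i) ((2::int) ^ k)" by (simp add: coprime_right_2_iff_odd)
    then obtain a b where ab: "a * (1 - 2 * i) + b * 2 ^ k = 1" using bezout_int[of "1 - 2 * i" "2 ^ k"] by auto
    have "?y = ?y [^] (a * (1 - 2 * i) + b * 2 ^ k)" using y ab by simp
    also have "\<dots> = (?y [^] (1 - 2 * i)) [^] a \<otimes> (?y [^] ((2::int) ^ k)) [^] b"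
      unfolding int_pow_mult[OF y] int_pow_pow[OF y] mult.commute[of _ a] mult.commute[of _ b] ..
    also have "\<dots> = (?y [^] (1 - 2 * i)) [^] a" using k' y by simp
    also have "\<dots> \<in> N" using yN Nsub by (simp add: subgroup_int_pow_closed)
    finally show False using not by simp
  qed
  let ?Q = "G Mod N" and ?m = "N #> (g \<otimes> g)"
  have finQ: "finite (carrier ?Q)" using N.Mod_surj fin by (metis finite_imageI)
  have hm: "(N #> a) \<otimes>\<^bsub>?Q\<^esub> (N #> b) = N #> (a \<otimes> b)" if "a \<in> carrier G" "b \<in> carrier G" for a b
    using h.hom_mult[OF that] by simp
  have one: "N #> a = \<one>\<^bsub>?Q\<^esub> \<longleftrightarrow> a \<in> N" if "a \<in> carrier G" for a
    using N.Mod_eq_one_iff[OF that] by simp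
  have sq: "N #> (x \<otimes> x) = \<one>\<^bsub>?Q\<^esub> \<or> N #> (x \<otimes> x) = ?m" if x: "x \<in> carrier G" for x
  proof (cases "x \<otimes> x \<in> N")
    case False
    let ?u = "x \<otimes> x"
    have u: "?u \<in> carrier G" using x by simp
    obtain n and i :: int where n: "n \<in> N" "g \<otimes> g = n \<otimes> ?u [^] i" using absorb[OF u False g(1)] by auto
    have u2: "?u \<otimes> ?u \<in> N" using fourth[OF x] .
    have "?u \<otimes> ?u = ?u [^] (2::int)" using int_pow_mult[OF u, of 1 1] u by simp
    then have even: "?u [^] (2 * j) \<in> N" for j :: int
      using u2 u by (metis int_pow_pow subgroup_int_pow_closed[OF Nsub])
    have "odd i"
    proof
      assume "even i"
      then have "?u [^] i \<in> N" using even by (metis evenE)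
      then show False using n g(2) by simp
    qed
    then obtain j where "i = 1 + 2 * j" by (metis oddE add.commute)
    then have "g \<otimes> g = n \<otimes> ?u [^] (2 * j) \<otimes> ?u" using n(2) u int_pow_mult[OF u, of 1 "2 * j"] n(1) by (simp add: m_ac)
    then have "g \<otimes> g \<otimes> inv ?u = n \<otimes> ?u [^] (2 * j)" using u n(1) by (simp add: m_assoc)
    then have "g \<otimes> g \<otimes> inv ?u \<in> N" using even n(1) by simp
    then have "?m = N #> ?u" using N.Mod_eq_iff[of "g \<otimes> g" ?u] g u by simp
    then show ?thesis by simp
  qed (use one m_closed[OF x x] in blast)
  have "\<not> filled ?Q"
  proof (rule h.H.not_filled_central_square_root[OF finQ, of ?m "N #> g"])
    show "?m \<in> carrier ?Q" "N #> g \<in> carrier ?Q" using g by (auto intro: h.hom_closed simp del: mult_FactGroup)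
    show "?m \<noteq> \<one>\<^bsub>?Q\<^esub>" using one[of "g \<otimes> g"] g m_closed by blast
    show "?m \<otimes>\<^bsub>?Q\<^esub> ?m = \<one>\<^bsub>?Q\<^esub>" using hm one fourth[OF g(1)] g(1) m_closed by metis
    show "(N #> g) \<otimes>\<^bsub>?Q\<^esub> (N #> g) = ?m" using hm g(1) by metis
    fix A assume "A \<in> carrier ?Q"
    then obtain x where x: "x \<in> carrier G" "A = N #> x" using N.Mod_surj by blast
    show "A \<otimes>\<^bsub>?Q\<^esub> A = \<one>\<^bsub>?Q\<^esub> \<or> A \<otimes>\<^bsub>?Q\<^esub> A = ?m" using sq[OF x(1)] hm[OF x(1) x(1)] x(2) by metis
    show "(N #> g) \<otimes>\<^bsub>?Q\<^esub> A = A \<otimes>\<^bsub>?Q\<^esub> (N #> g)" using hm g(1) x m_comm by metis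
  qed
  then show ?thesis using N.filled_Mod by blast
qed

text \<open>A prime p of size at least 7 gives a cyclic quotient of order p. The prime 3 forces
  order 3. The prime 5 forces order 5, because any further prime factor would produce a quotient of
  order 10 or 25. What remains is a 2-group.\<close>

theorem filled_abelian_cases:
  assumes fin: "finite (carrier G)" and f: "filled G"
  shows "(\<forall>x\<in>carrier G. x \<otimes> x = \<one>) \<or> order G = 3 \<or> order G = 5"
proof -
  have o0: "order G > 0" using fin order_gt_0_iff_finite by simp
  have big: "p < 7" if p: "Factorial_Ring.prime p" "p dvd order G" for p
  proof (rule ccontr)
    assume "\<not> p < 7"
    obtain N where N: "comm_group (G Mod N)" "finite (carrier (G Mod N))" "filled (G Mod N)"
      "order (G Mod N) = p" using filled_quotient[OF fin f p(2)] .
    interpret Q: comm_group "G Mod N" by fact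
    obtain y where y: "y \<in> carrier (G Mod N)" "y \<noteq> \<one>\<^bsub>G Mod N\<^esub>"
      using Q.exists_nontrivial N(4) \<open>\<not> p < 7\<close> by auto
    have "odd p" using p(1) \<open>\<not> p < 7\<close> by (simp add: prime_odd_nat)
    then show False
      using Q.not_filled_cyclic_odd[OF N(2) y(1)] Q.ord_prime_order[OF _ y] N(3,4) p(1) \<open>\<not> p < 7\<close> by simp
  qed
  have three: "order G = 3" if 3: "3 dvd order G"
  proof -
    obtain N where "N \<lhd> G" "order (G Mod N) = 3" using filled_quotient[OF fin f 3] by blast
    then show ?thesis using filled_order_3[OF fin f] by blast
  qed
  have five: "order G = 5" if 5: "5 dvd order G"
  proof (rule ccontr)
    assume n5: "order G \<noteq> 5"
    obtain m where m: "order G = 5 * m" using 5 by (elim dvdE)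
    then have "m \<noteq> 1" using n5 by auto
    then obtain q where q: "Factorial_Ring.prime q" "q dvd m" using prime_factor_nat by blast
    then have "q < 7" using big m by simp
    moreover have "q \<noteq> 0" "q \<noteq> 1" "q \<noteq> 4" "q \<noteq> 6" using q(1) prime_odd_nat[of q] by (auto simp: prime_nat_iff)
    moreover have "q \<noteq> 3" using three m q(2) by auto
    ultimately have "q = 2 \<or> q = 5" by presburger
    then show False
    proof
      assume "q = 2"
      then have "10 dvd order G" using m q(2) by auto
      then obtain N where N: "comm_group (G Mod N)" "finite (carrier (G Mod N))" "filled (G Mod N)"
        "order (G Mod N) = 10" using filled_quotient[OF fin f] by blast
      then show False using comm_group.not_filled_order_10 by blast
    next
      assume "q = 5"
      then have "25 dvd order G" using m q(2) by auto
      then obtain N where N: "comm_group (G Mod N)" "finite (carrier (G Mod N))" "filled (G Mod N)"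
        "order (G Mod N) = 25" using filled_quotient[OF fin f] by blast
      then show False using comm_group.not_filled_order_25 by blast
    qed
  qed
  show ?thesis
  proof (cases "3 dvd order G \<or> 5 dvd order G")
    case True
    then show ?thesis using three five by blast
  next
    case False
    have two: "p = 2" if p: "Factorial_Ring.prime p" "p dvd order G" for p
    proof -
      have "p \<noteq> 0" "p \<noteq> 1" "p \<noteq> 4" "p \<noteq> 6" using p(1) prime_odd_nat[of p] by (auto simp: prime_nat_iff)
      moreover have "p \<noteq> 3" "p \<noteq> 5" using p(2) False by auto
      ultimately show ?thesis using big[OF p] by presburger
    qed
    obtain m where m: "order G = 2 ^ multiplicity 2 (order G) * m" "\<not> 2 dvd m"
      using multiplicity_decompose'[of "order G" 2] o0 by auto
    have "m = 1"
    proof (rule ccontr)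
      assume "m \<noteq> 1"
      then obtain q where q: "Factorial_Ring.prime q" "q dvd m" using prime_factor_nat by blast
      then have "q = 2" using two m(1) by (metis dvd_mult)
      then show False using q m(2) by simp
    qed
    then have "x [^] ((2::nat) ^ multiplicity 2 (order G)) = \<one>" if "x \<in> carrier G" for x
      using pow_order_eq_1[OF that] m(1) by simp
    then show ?thesis using not_filled_2_group[OF fin] f by blast
  qed
qed

end

declare lower_central_series.simps(2) [simp del]

section \<open>The lower central series\<close>

context group
begin

lemma inv_cancel_assoc:
  assumes "a \<in> carrier G" "b \<in> carrier G"
  shows "inv a \<otimes> (a \<otimes> b) = b" "a \<otimes> (inv a \<otimes> b) = b"
  using assms by (simp_all add: m_assoc[symmetric])

lemma lower_central_series_normal: "lower_central_series G n \<lhd> G"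
proof (induction n)
  case 0
  show ?case by (simp add: normal_self)
next
  case (Suc n)
  interpret L: normal "lower_central_series G n" G by (rule Suc)
  show ?case unfolding lower_central_series.simps
  proof (rule normal_generateI, safe)
    fix h g assume hg: "h \<in> lower_central_series G n" "g \<in> carrier G"
    show "h \<otimes> g \<otimes> inv h \<otimes> inv g \<in> carrier G" using hg by simp
    fix y assume y: "y \<in> carrier G"
    have *: "y \<otimes> h \<otimes> inv y \<in> lower_central_series G n" "y \<otimes> g \<otimes> inv y \<in> carrier G"
      using L.inv_op_closed2 hg y by auto
    have "y \<otimes> (h \<otimes> g \<otimes> inv h \<otimes> inv g) \<otimes> inv y =
      (y \<otimes> h \<otimes> inv y) \<otimes> (y \<otimes> g \<otimes> inv y) \<otimes> inv (y \<otimes> h \<otimes> inv y) \<otimes> inv (y \<otimes> g \<otimes> inv y)"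
      using hg y by (simp add: m_assoc inv_mult_group inv_cancel_assoc)
    then show "\<exists>h' g'. y \<otimes> (h \<otimes> g \<otimes> inv h \<otimes> inv g) \<otimes> inv y = h' \<otimes> g' \<otimes> inv h' \<otimes> inv g' \<and>
      h' \<in> lower_central_series G n \<and> g' \<in> carrier G" using * by blast
  qed
qed

lemma lower_central_series_subset: "lower_central_series G n \<subseteq> carrier G"
  using lower_central_series_normal normal_imp_subgroup subgroup.subset by blast

lemma lower_central_series_subgroup: "subgroup (lower_central_series G n) G"
  using lower_central_series_normal normal_imp_subgroup by blast

lemma commutator_in_lower_central_series:
  "h \<in> lower_central_series G n \<Longrightarrow> g \<in> carrier G \<Longrightarrow>
     h \<otimes> g \<otimes> inv h \<otimes> inv g \<in> lower_central_series G (Suc n)"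
  unfolding lower_central_series.simps by (rule generate.incl) blast

lemma lower_central_series_Suc_subset: "lower_central_series G (Suc n) \<subseteq> lower_central_series G n"
proof -
  interpret L: normal "lower_central_series G n" G by (rule lower_central_series_normal)
  show ?thesis unfolding lower_central_series.simps
  proof (rule generate_subgroup_incl[OF _ L.is_subgroup], safe)
    fix h g assume hg: "h \<in> lower_central_series G n" "g \<in> carrier G"
    have "h \<otimes> (g \<otimes> inv h \<otimes> inv g) \<in> lower_central_series G n"
      using hg L.inv_op_closed2[of g "inv h"] by simp
    then show "h \<otimes> g \<otimes> inv h \<otimes> inv g \<in> lower_central_series G n"
      using hg by (simp add: m_assoc)
  qed
qed

lemma lower_central_series_antimono:
  "m \<le> n \<Longrightarrow> lower_central_series G n \<subseteq> lower_central_series G m"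
  using lower_central_series_Suc_subset by (rule lift_Suc_antimono_le)

lemma commutator_eq_one_iff:
  assumes "h \<in> carrier G" "g \<in> carrier G"
  shows "h \<otimes> g \<otimes> inv h \<otimes> inv g = \<one> \<longleftrightarrow> h \<otimes> g = g \<otimes> h"
proof -
  have "h \<otimes> g \<otimes> inv h \<otimes> inv g = (h \<otimes> g) \<otimes> inv (g \<otimes> h)" using assms by (simp add: m_assoc inv_mult_group)
  then show ?thesis using assms by (metis inv_solve_right' l_one m_closed one_closed r_inv)
qed

lemma commutes_mod_normalI:
  assumes N: "N \<lhd> G" and hg: "h \<in> carrier G" "g \<in> carrier G" "h \<otimes> g \<otimes> inv h \<otimes> inv g \<in> N"
  shows "(N #> h) \<otimes>\<^bsub>G Mod N\<^esub> (N #> g) = (N #> g) \<otimes>\<^bsub>G Mod N\<^esub> (N #> h)"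
proof -
  interpret N: normal N G by fact
  interpret h: group_hom G "G Mod N" "(#>) N" by (rule N.Mod_group_hom)
  have "h \<otimes> g \<otimes> inv h \<otimes> inv g = (h \<otimes> g) \<otimes> inv (g \<otimes> h)" using hg by (simp add: m_assoc inv_mult_group)
  then have "(h \<otimes> g) \<otimes> inv (g \<otimes> h) \<in> N" using hg(3) by simp
  then have "N #> (h \<otimes> g) = N #> (g \<otimes> h)" using N.Mod_eq_iff hg m_closed by blast
  then show ?thesis using h.hom_mult hg by metis
qed

end

lemma (in group_hom) lower_central_series_image:
  assumes surj: "h ` carrier G = carrier H"
  shows "h ` lower_central_series G n = lower_central_series H n"
proof (induction n)
  case 0
  then show ?case using surj by simp
next
  case (Suc n)
  let ?A = "{x \<otimes> g \<otimes> inv x \<otimes> inv g | x g. x \<in> lower_central_series G n \<and> g \<in> carrier G}"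
  let ?B = "{x \<otimes>\<^bsub>H\<^esub> g \<otimes>\<^bsub>H\<^esub> inv\<^bsub>H\<^esub> x \<otimes>\<^bsub>H\<^esub> inv\<^bsub>H\<^esub> g | x g. x \<in> lower_central_series H n \<and> g \<in> carrier H}"
  have sub: "lower_central_series G n \<subseteq> carrier G" by (rule G.lower_central_series_subset)
  have "h ` ?A = ?B"
  proof
    show "h ` ?A \<subseteq> ?B"
    proof safe
      fix x g assume xg: "x \<in> lower_central_series G n" "g \<in> carrier G"
      then have "h (x \<otimes> g \<otimes> inv x \<otimes> inv g) = h x \<otimes>\<^bsub>H\<^esub> h g \<otimes>\<^bsub>H\<^esub> inv\<^bsub>H\<^esub> h x \<otimes>\<^bsub>H\<^esub> inv\<^bsub>H\<^esub> h g"
        using sub by auto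
      then show "\<exists>x' g'. h (x \<otimes> g \<otimes> inv x \<otimes> inv g) = x' \<otimes>\<^bsub>H\<^esub> g' \<otimes>\<^bsub>H\<^esub> inv\<^bsub>H\<^esub> x' \<otimes>\<^bsub>H\<^esub> inv\<^bsub>H\<^esub> g'
        \<and> x' \<in> lower_central_series H n \<and> g' \<in> carrier H" using xg Suc surj by blast
    qed
    show "?B \<subseteq> h ` ?A"
    proof safe
      fix x' g' assume "x' \<in> lower_central_series H n" "g' \<in> carrier H"
      then obtain x g where xg: "x \<in> lower_central_series G n" "g \<in> carrier G" "x' = h x" "g' = h g"
        using Suc surj by blast
      then have "h (x \<otimes> g \<otimes> inv x \<otimes> inv g) = x' \<otimes>\<^bsub>H\<^esub> g' \<otimes>\<^bsub>H\<^esub> inv\<^bsub>H\<^esub> x' \<otimes>\<^bsub>H\<^esub> inv\<^bsub>H\<^esub> g'"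
        using sub by auto
      then show "x' \<otimes>\<^bsub>H\<^esub> g' \<otimes>\<^bsub>H\<^esub> inv\<^bsub>H\<^esub> x' \<otimes>\<^bsub>H\<^esub> inv\<^bsub>H\<^esub> g' \<in> h ` ?A" using xg by (intro image_eqI[of _ h, OF sym]) auto
    qed
  qed
  moreover have "?A \<subseteq> carrier G" using sub by auto
  ultimately show ?case using generate_img[of ?A] by (simp add: lower_central_series.simps)
qed

lemma (in group_hom) nilpotent_image:
  assumes "h ` carrier G = carrier H" "nilpotent G"
  shows "nilpotent H"
proof -
  obtain n where "lower_central_series G n = {\<one>}" using assms(2) unfolding nilpotent_def by blast
  then have "lower_central_series H n = {\<one>\<^bsub>H\<^esub>}" using lower_central_series_image[OF assms(1), of n] by simp
  then show ?thesis unfolding nilpotent_def by blast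
qed

section \<open>Squares in the lower central series, and the abelianization\<close>

context group
begin

text \<open>Modulo the next term L the term K is central, so the elements of K with square in L form
  a subgroup P, and only generators c = [y, g] of K need checking. For these [y y, g] = [y, c] c c,
  where [y, c] is in L, and [y y, g] is in L because y y is in K by induction.\<close>

lemma square_in_lower_central_series:
  assumes sq: "\<And>x. x \<in> carrier G \<Longrightarrow> x \<otimes> x \<in> lower_central_series G 1"
    and "x \<in> lower_central_series G n"
  shows "x \<otimes> x \<in> lower_central_series G (Suc n)"
  using assms(2)
proof (induction n arbitrary: x)
  case 0
  then show ?case using sq by simp
next
  case (Suc m)
  let ?K = "lower_central_series G (Suc m)" and ?L = "lower_central_series G (Suc (Suc m))"
  interpret K: normal ?K G by (rule lower_central_series_normal)
  interpret L: normal ?L G by (rule lower_central_series_normal)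
  interpret h: group_hom G "G Mod ?L" "(#>) ?L" by (rule L.Mod_group_hom)
  let ?h = "\<lambda>x. ?L #> x" and ?m = "\<lambda>a b. a \<otimes>\<^bsub>G Mod ?L\<^esub> b"
  have central: "?m (?h k) (?h g) = ?m (?h g) (?h k)" if "k \<in> ?K" "g \<in> carrier G" for k g
    using commutes_mod_normalI[OF lower_central_series_normal _ that(2) commutator_in_lower_central_series[OF that]]
      K.mem_carrier[OF that(1)] by blast
  have one: "?h a = \<one>\<^bsub>G Mod ?L\<^esub> \<longleftrightarrow> a \<in> ?L" if "a \<in> carrier G" for a
    using L.Mod_eq_one_iff[OF that] by simp
  define P where "P = {k \<in> ?K. k \<otimes> k \<in> ?L}"
  have "subgroup P G"
  proof (rule subgroupI)
    show "P \<subseteq> carrier G" unfolding P_def by auto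
    have "\<one> \<in> P" unfolding P_def using K.one_closed L.one_closed by simp
    then show "P \<noteq> {}" by blast
    fix a assume a: "a \<in> P"
    have "inv a \<otimes> inv a = inv (a \<otimes> a)" using a unfolding P_def by (simp add: inv_mult_group)
    then show "inv a \<in> P" using a unfolding P_def by simp
    fix b assume b: "b \<in> P"
    have ab: "a \<in> carrier G" "b \<in> carrier G" using a b unfolding P_def by auto
    have ha: "?m (?h a) (?h a) = \<one>\<^bsub>G Mod ?L\<^esub>" "?m (?h b) (?h b) = \<one>\<^bsub>G Mod ?L\<^esub>"
      using a b one[of "a \<otimes> a"] one[of "b \<otimes> b"] h.hom_mult[OF ab(1) ab(1)] h.hom_mult[OF ab(2) ab(2)] ab
      unfolding P_def by auto
    have c: "?h a \<in> carrier (G Mod ?L)" "?h b \<in> carrier (G Mod ?L)" using ab h.hom_closed by blast+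
    have "?h ((a \<otimes> b) \<otimes> (a \<otimes> b)) = ?m (?m (?h a) (?m (?h b) (?h a))) (?h b)"
      using ab c by (simp add: h.H.m_assoc del: one_FactGroup)
    also have "?m (?h b) (?h a) = ?m (?h a) (?h b)" using central a ab unfolding P_def by auto
    also have "?m (?m (?h a) (?m (?h a) (?h b))) (?h b) = ?m (?m (?h a) (?h a)) (?m (?h b) (?h b))"
      using c by (simp add: h.H.m_assoc del: one_FactGroup)
    also have "\<dots> = \<one>\<^bsub>G Mod ?L\<^esub>" using ha h.H.l_one h.H.one_closed by metis
    finally have "(a \<otimes> b) \<otimes> (a \<otimes> b) \<in> ?L" using one[of "(a \<otimes> b) \<otimes> (a \<otimes> b)"] ab by (meson m_closed)
    then show "a \<otimes> b \<in> P" using a b unfolding P_def by simp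
  qed
  moreover have "{h \<otimes> g \<otimes> inv h \<otimes> inv g | h g. h \<in> lower_central_series G m \<and> g \<in> carrier G} \<subseteq> P"
  proof safe
    fix y g assume y: "y \<in> lower_central_series G m" and g: "g \<in> carrier G"
    have yc: "y \<in> carrier G" using y lower_central_series_subset by blast
    let ?c = "y \<otimes> g \<otimes> inv y \<otimes> inv g"
    have cK: "?c \<in> ?K" using commutator_in_lower_central_series[OF y g] .
    have cc: "?c \<in> carrier G" using yc g by simp
    have "y \<otimes> y \<in> ?K" using Suc.IH[OF y] .
    then have l: "(y \<otimes> y) \<otimes> g \<otimes> inv (y \<otimes> y) \<otimes> inv g \<in> ?L" using commutator_in_lower_central_series g by blast
    have "y \<otimes> ?c \<otimes> inv y \<otimes> inv ?c = inv (?c \<otimes> y \<otimes> inv ?c \<otimes> inv y)"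
      using yc cc by (simp add: inv_mult_group m_assoc)
    then have l2: "y \<otimes> ?c \<otimes> inv y \<otimes> inv ?c \<in> ?L"
      using commutator_in_lower_central_series[OF cK yc] L.m_inv_closed by simp
    have "(y \<otimes> y) \<otimes> g \<otimes> inv (y \<otimes> y) \<otimes> inv g = (y \<otimes> ?c \<otimes> inv y \<otimes> inv ?c) \<otimes> (?c \<otimes> ?c)"
      using yc g by (simp add: inv_mult_group m_assoc inv_cancel_assoc)
    then have "?c \<otimes> ?c = inv (y \<otimes> ?c \<otimes> inv y \<otimes> inv ?c) \<otimes> ((y \<otimes> y) \<otimes> g \<otimes> inv (y \<otimes> y) \<otimes> inv g)"
      using yc g cc by (simp add: inv_solve_left)
    then have "?c \<otimes> ?c \<in> ?L" using l l2 L.m_closed L.m_inv_closed by simp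
    then show "?c \<in> P" unfolding P_def using cK by blast
  qed
  ultimately have "?K \<subseteq> P" unfolding lower_central_series.simps(2)[of G m]
    by (rule generate_subgroup_incl[rotated])
  then show ?case using Suc.prems unfolding P_def by blast
qed

text \<open>Modulo the term with index 2 the derived subgroup is central, so the quotient is
  generated by x and central elements and is abelian. Hence the terms with index 1 and 2 agree, the
  series is constant from there on, and nilpotency makes it trivial.\<close>

lemma nilpotent_cyclic_abelianization:
  assumes nil: "nilpotent G" and x: "x \<in> carrier G"
    and cyc: "\<And>g. g \<in> carrier G \<Longrightarrow> \<exists>i u. u \<in> lower_central_series G 1 \<and> g = x [^] (i::nat) \<otimes> u"
  shows "lower_central_series G 1 = {\<one>}"
proof -
  let ?K = "lower_central_series G 1" and ?L = "lower_central_series G 2"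
  interpret K: normal ?K G by (rule lower_central_series_normal)
  interpret L: normal ?L G by (rule lower_central_series_normal)
  interpret h: group_hom G "G Mod ?L" "(#>) ?L" by (rule L.Mod_group_hom)
  let ?h = "\<lambda>x. ?L #> x" and ?m = "\<lambda>a b. a \<otimes>\<^bsub>G Mod ?L\<^esub> b"
  have S2: "Suc 1 = 2" by simp
  have central: "?m (?h k) (?h g) = ?m (?h g) (?h k)" if "k \<in> ?K" "g \<in> carrier G" for k g
    using commutes_mod_normalI[OF lower_central_series_normal _ that(2) commutator_in_lower_central_series[OF that]]
      K.mem_carrier[OF that(1)] unfolding S2 by blast
  have comm: "?h (a \<otimes> b) = ?h (b \<otimes> a)" if ab: "a \<in> carrier G" "b \<in> carrier G" for a b
  proof -
    obtain i u where a: "u \<in> ?K" "a = x [^] (i::nat) \<otimes> u" using cyc ab by blast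
    obtain j v where b: "v \<in> ?K" "b = x [^] (j::nat) \<otimes> v" using cyc ab by blast
    let ?i = "?h (x [^] i)" and ?j = "?h (x [^] j)"
    have c: "?i \<in> carrier (G Mod ?L)" "?j \<in> carrier (G Mod ?L)" "?h u \<in> carrier (G Mod ?L)" "?h v \<in> carrier (G Mod ?L)"
      using x a b by (auto intro!: h.hom_closed)
    have ij: "?m ?i ?j = ?m ?j ?i"
      using h.hom_mult x by (metis nat_pow_closed nat_pow_comm)
    have u: "?m (?h u) ?j = ?m ?j (?h u)" "?m (?h v) ?i = ?m ?i (?h v)" "?m (?h u) (?h v) = ?m (?h v) (?h u)"
      by (rule central[OF a(1) nat_pow_closed[OF x]], rule central[OF b(1) nat_pow_closed[OF x]],
          rule central[OF a(1) K.mem_carrier[OF b(1)]])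
    have "?h (a \<otimes> b) = ?m (?m ?i (?m (?h u) ?j)) (?h v)" using a b x c by (simp add: h.H.m_assoc del: one_FactGroup)
    also have "\<dots> = ?m (?m ?i ?j) (?m (?h u) (?h v))" using c unfolding u(1) by (simp add: h.H.m_assoc)
    also have "\<dots> = ?m (?m ?j (?m ?i (?h v))) (?h u)" using c unfolding ij u(3) by (simp add: h.H.m_assoc)
    also have "\<dots> = ?h (b \<otimes> a)" unfolding u(2)[symmetric] using a b x c by (simp add: h.H.m_assoc del: one_FactGroup)
    finally show ?thesis .
  qed
  have "lower_central_series G (Suc 0) \<subseteq> ?L"
    unfolding lower_central_series.simps(2)[of G 0]
  proof (rule generate_subgroup_incl[OF _ L.is_subgroup], safe)
    fix a b assume "a \<in> lower_central_series G 0" "b \<in> carrier G"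
    then have ab: "a \<in> carrier G" "b \<in> carrier G" by auto
    have "a \<otimes> b \<otimes> inv (b \<otimes> a) \<in> ?L" using comm[OF ab] L.Mod_eq_iff[of "a \<otimes> b" "b \<otimes> a"] ab by simp
    then show "a \<otimes> b \<otimes> inv a \<otimes> inv b \<in> ?L" using ab by (simp add: m_assoc inv_mult_group)
  qed
  then have KL: "?K \<subseteq> ?L" by simp
  have "?K \<subseteq> lower_central_series G (Suc n)" for n
  proof (induction n)
    case (Suc n)
    have "lower_central_series G (Suc 1) \<subseteq> lower_central_series G (Suc (Suc n))"
      unfolding lower_central_series.simps(2)[of G "Suc n"] lower_central_series.simps(2)[of G 1]
      by (rule mono_generate) (use Suc in auto)
    then show ?case using KL unfolding S2 by blast
  qed simp
  moreover obtain n where n: "lower_central_series G n = {\<one>}" using nil unfolding nilpotent_def by blast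
  moreover have "lower_central_series G (Suc n) \<subseteq> lower_central_series G n" by (rule lower_central_series_Suc_subset)
  ultimately have "?K \<subseteq> {\<one>}" by blast
  then show ?thesis using K.one_closed by blast
qed

text \<open>A quotient of order 3 already forces order 3; an abelianization of order 5 is cyclic and
  has to be combined with nilpotency.\<close>

lemma nilpotent_filled_cases:
  assumes fin: "finite (carrier G)" and nil: "nilpotent G" and f: "filled G"
  shows "(\<forall>x\<in>carrier G. x \<otimes> x \<in> lower_central_series G 1) \<or> order G = 3 \<or> order G = 5"
proof -
  let ?D = "lower_central_series G 1"
  interpret D: normal ?D G by (rule lower_central_series_normal)
  interpret h: group_hom G "G Mod ?D" "(#>) ?D" by (rule D.Mod_group_hom)
  have finQ: "finite (carrier (G Mod ?D))" using D.Mod_surj fin by (metis finite_imageI)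
  interpret Q: comm_group "G Mod ?D"
  proof (rule h.H.group_comm_groupI)
    fix A B assume "A \<in> carrier (G Mod ?D)" "B \<in> carrier (G Mod ?D)"
    then obtain a b where ab: "a \<in> carrier G" "b \<in> carrier G" "A = ?D #> a" "B = ?D #> b"
      unfolding D.Mod_surj[symmetric] by (elim imageE)
    have "a \<otimes> b \<otimes> inv a \<otimes> inv b \<in> ?D" using commutator_in_lower_central_series[of a 0 b] ab(1,2) by simp
    from commutes_mod_normalI[OF D.normal_axioms ab(1,2) this]
    show "A \<otimes>\<^bsub>G Mod ?D\<^esub> B = B \<otimes>\<^bsub>G Mod ?D\<^esub> A"
      unfolding ab(3,4) .
  qed
  consider "\<forall>x\<in>carrier (G Mod ?D). x \<otimes>\<^bsub>G Mod ?D\<^esub> x = \<one>\<^bsub>G Mod ?D\<^esub>"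
    | "order (G Mod ?D) = 3" | "order (G Mod ?D) = 5"
    using Q.filled_abelian_cases[OF finQ D.filled_Mod[OF f]] by blast
  then show ?thesis
  proof cases
    case 1
    have "x \<otimes> x \<in> ?D" if x: "x \<in> carrier G" for x
    proof -
      have "?D #> (x \<otimes> x) = \<one>\<^bsub>G Mod ?D\<^esub>" using 1 h.hom_mult[OF x x] h.hom_closed[OF x] by metis
      then show ?thesis using D.Mod_eq_one_iff[of "x \<otimes> x"] m_closed[OF x x] unfolding one_FactGroup by blast
    qed
    then show ?thesis by blast
  next
    case 2
    then show ?thesis using filled_order_3[OF fin f D.normal_axioms] by blast
  next
    case 3
    then obtain y where y: "y \<in> carrier (G Mod ?D)" "y \<noteq> \<one>\<^bsub>G Mod ?D\<^esub>" using h.H.exists_nontrivial by auto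
    have oy: "h.H.ord y = order (G Mod ?D)" using h.H.ord_prime_order[OF _ y] 3 by simp
    obtain x where x: "x \<in> carrier G" "?D #> x = y" using y(1) D.Mod_surj by (metis imageE)
    have "?D = {\<one>}"
    proof (rule nilpotent_cyclic_abelianization[OF nil x(1)])
      fix g assume g: "g \<in> carrier G"
      obtain i :: nat where "?D #> g = y [^]\<^bsub>G Mod ?D\<^esub> i"
        using h.H.cyclic_elements[OF finQ y(1) oy h.hom_closed[OF g]] by metis
      then have "?D #> g = ?D #> (x [^] i)" using h.hom_nat_pow[OF x(1)] x(2) by simp
      then have "g \<otimes> inv (x [^] i) \<in> ?D" using D.Mod_eq_iff g x(1) by simp
      then have "inv (x [^] i) \<otimes> (g \<otimes> inv (x [^] i)) \<otimes> x [^] i \<in> ?D" using D.inv_op_closed1 x(1) by simp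
      moreover have "inv (x [^] i) \<otimes> (g \<otimes> inv (x [^] i)) \<otimes> x [^] i = inv (x [^] i) \<otimes> g"
        using g x(1) by (simp add: m_assoc)
      moreover have "g = x [^] i \<otimes> (inv (x [^] i) \<otimes> g)" using g x(1) by (simp add: m_assoc[symmetric])
      ultimately show "\<exists>i u. u \<in> ?D \<and> g = x [^] (i::nat) \<otimes> u" by metis
    qed
    then have "card ?D = 1" by simp
    then show ?thesis using D.card_Mod 3 by simp
  qed
qed

text \<open>Any nontrivial element of the last nontrivial term works: commutators with it and its
  square lie in the next term, which is trivial.\<close>

lemma nilpotent_central_involution:
  assumes nil: "nilpotent G"
    and sq: "\<And>x. x \<in> carrier G \<Longrightarrow> x \<otimes> x \<in> lower_central_series G 1"
    and nontriv: "lower_central_series G 1 \<noteq> {\<one>}"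
  obtains z where "z \<in> lower_central_series G 1" "z \<noteq> \<one>" "z \<otimes> z = \<one>"
    "\<And>x. x \<in> carrier G \<Longrightarrow> x \<otimes> z = z \<otimes> x"
proof -
  let ?L = "lower_central_series G"
  obtain n where n: "?L n = {\<one>}" using nil unfolding nilpotent_def by blast
  define m where "m = (LEAST n. ?L n = {\<one>})"
  have m: "?L m = {\<one>}" unfolding m_def using n by (rule LeastI)
  have "m \<noteq> 0"
  proof
    assume "m = 0"
    then have "?L 0 = {\<one>}" using m by simp
    then have "?L 1 \<subseteq> {\<one>}" using lower_central_series_Suc_subset[of 0] by simp
    then show False using nontriv subgroup.one_closed[OF lower_central_series_subgroup[of 1]] by blast
  qed
  then obtain k where k: "m = Suc k" using not0_implies_Suc by blast
  then have "?L k \<noteq> {\<one>}" using not_less_Least[of k "\<lambda>n. ?L n = {\<one>}"] unfolding m_def by auto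
  then obtain z where z: "z \<in> ?L k" "z \<noteq> \<one>"
    using subgroup.one_closed[OF lower_central_series_subgroup[of k]] by blast
  have "k \<noteq> 0" using nontriv m k by auto
  then have "z \<in> ?L 1" using z lower_central_series_antimono[of 1 k] by auto
  moreover have "z \<otimes> z = \<one>" using square_in_lower_central_series[OF sq z(1)] m k by simp
  moreover have "x \<otimes> z = z \<otimes> x" if x: "x \<in> carrier G" for x
    using commutator_in_lower_central_series[OF z(1) x] m k commutator_eq_one_iff[of z x] x z(1)
      lower_central_series_subset by force
  ultimately show thesis using that z(2) by blast
qed

end

section \<open>Groups that are not filled\<close>

context group
begin

text \<open>The target is g = a b s, with g g = z. Up to factors in M it can be split as 1 times g,
  a times b s, b times a s and a b times s, or with the two positions exchanged. S bars the cosets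
  of a b, a s and b s completely, and z in S bars every element of square z, so each splitting loses
  a factor. The hypothesis \<open>cover\<close> admits further elements provided that they or their
  cofactors in g have square z. One application has s central and b b = 1; the other, the wreath
  product type, needs [s, b] = b b nontrivial.\<close>

lemma not_filled_dihedral_type:
  assumes fin: "finite (carrier G)"
    and z: "z \<in> carrier G" "z \<noteq> \<one>" "z \<otimes> z = \<one>" "z \<notin> R"
    and R: "subgroup R G" "\<And>r. r \<in> R \<Longrightarrow> r \<otimes> r = \<one>" "r0 \<in> R" "r0 \<noteq> \<one>"
    and cen: "\<And>r x. r \<in> R \<Longrightarrow> x \<in> carrier G \<Longrightarrow> x \<otimes> r = r \<otimes> x" "\<And>x. x \<in> carrier G \<Longrightarrow> x \<otimes> z = z \<otimes> x"
    and a: "a \<in> carrier G" "a \<otimes> a = \<one>"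
    and b: "b \<in> carrier G" "b \<otimes> b \<in> R" "b \<otimes> a = z \<otimes> (a \<otimes> b)"
    and s: "s \<in> carrier G" "s \<otimes> s = \<one>" "s \<otimes> a = a \<otimes> s" "s \<otimes> b = (b \<otimes> b) \<otimes> (b \<otimes> s)"
    and M: "M = R \<union> (\<lambda>r. z \<otimes> r) ` R" and sM: "s \<notin> M" "a \<otimes> s \<notin> M"
    and cover: "\<And>x. x \<in> carrier G \<Longrightarrow>
      (\<exists>m\<in>M. x \<in> {m, m \<otimes> a, m \<otimes> b, m \<otimes> (a \<otimes> b), m \<otimes> s, m \<otimes> (a \<otimes> s), m \<otimes> (b \<otimes> s), m \<otimes> (a \<otimes> (b \<otimes> s))})
      \<or> x \<otimes> x = z \<or> (inv x \<otimes> (a \<otimes> (b \<otimes> s))) \<otimes> (inv x \<otimes> (a \<otimes> (b \<otimes> s))) = z"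
  shows "\<not> filled G"
proof -
  have RM: "r \<in> M" if "r \<in> R" for r using that M by blast
  have R1: "\<one> \<in> R" using R(1) by (rule subgroup.one_closed)
  have Rm: "r \<otimes> r' \<in> R" if "r \<in> R" "r' \<in> R" for r r' using R(1) that by (rule subgroup.m_closed)
  have Rc: "r \<in> carrier G" if "r \<in> R" for r using R(1) that by (rule subgroup.mem_carrier)
  have zM: "z \<in> M" using M R1 z(1) by force
  have Mc: "m \<in> carrier G" if "m \<in> M" for m using that M Rc z(1) by auto
  have Mcen: "x \<otimes> m = m \<otimes> x" if "m \<in> M" "x \<in> carrier G" for m x
  proof -
    consider "m \<in> R" | r where "r \<in> R" "m = z \<otimes> r" using \<open>m \<in> M\<close> M by blast
    then show ?thesis
    proof cases
      case 2
      have "x \<otimes> (z \<otimes> r) = z \<otimes> (x \<otimes> r)" using that 2 cen(2) z(1) Rc by (simp add: m_assoc[symmetric])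
      then show ?thesis using 2 cen(1)[OF 2(1) that(2)] that(2) z(1) Rc by (simp add: m_assoc)
    qed (use cen that in auto)
  qed
  have Mlc: "x \<otimes> (m \<otimes> y) = m \<otimes> (x \<otimes> y)" if "m \<in> M" "x \<in> carrier G" "y \<in> carrier G" for m x y
    using that Mcen Mc by (simp add: m_assoc[symmetric])
  have Mmul: "m \<otimes> n \<in> M" if mn: "m \<in> M" "n \<in> M" for m n
  proof -
    have cases: "\<exists>r\<in>R. m = r \<or> m = z \<otimes> r" if "m \<in> M" for m using that M by blast
    obtain r r' where r: "r \<in> R" "m = r \<or> m = z \<otimes> r" "r' \<in> R" "n = r' \<or> n = z \<otimes> r'"
      using cases mn by meson
    have "z \<otimes> r \<otimes> (z \<otimes> r') = r \<otimes> r'"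
      using r(1,3) Rc z(1,3) Mlc[OF zM, of r r'] by (simp add: m_assoc inv_cancel_assoc) (metis m_assoc m_closed l_one)
    moreover have "r \<otimes> (z \<otimes> r') = z \<otimes> (r \<otimes> r')" using r(1,3) Rc Mlc[OF zM] by simp
    ultimately show ?thesis using r Rm[OF r(1,3)] Rc z(1) M by (auto simp: m_assoc)
  qed
  have zcan: "z \<otimes> (z \<otimes> x) = x" if "x \<in> carrier G" for x using that z by (simp add: m_assoc[symmetric])
  have rcan: "r \<otimes> (r \<otimes> x) = x" if "x \<in> carrier G" "r \<in> R" for x r using that R(2) Rc by (simp add: m_assoc[symmetric])
  have Msq: "m \<otimes> m = \<one>" if mM: "m \<in> M" for m
  proof -
    consider "m \<in> R" | r where "r \<in> R" "m = z \<otimes> r" using \<open>m \<in> M\<close> M by blast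
    then show ?thesis
    proof cases
      case 2
      have "z \<otimes> r \<otimes> (z \<otimes> r) = z \<otimes> (z \<otimes> (r \<otimes> r))" using 2 Rc z(1) Mlc[OF zM, of r r] by (simp add: m_assoc)
      then show ?thesis using 2 R(2) z by simp
    qed (use R in auto)
  qed
  have mcan: "m \<otimes> (m \<otimes> x) = x" if "x \<in> carrier G" "m \<in> M" for x m using that Msq Mc by (simp add: m_assoc[symmetric])
  have Minv: "inv m = m" if "m \<in> M" for m using Msq[OF that] Mc[OF that] by (simp add: inv_equality)
  define \<beta> where "\<beta> = b \<otimes> b"
  have bR: "\<beta> \<in> R" using b unfolding \<beta>_def by simp
  note \<beta> = RM[OF bR]
  note [simp] = Mc Rc RM zM \<beta> bR
  have rules: "a \<otimes> a = \<one>" "b \<otimes> b = \<beta>" "s \<otimes> s = \<one>" "b \<otimes> a = z \<otimes> (a \<otimes> b)" "s \<otimes> a = a \<otimes> s" "s \<otimes> b = \<beta> \<otimes> (b \<otimes> s)"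
    "\<And>x. x \<in> carrier G \<Longrightarrow> a \<otimes> (a \<otimes> x) = x" "\<And>x. x \<in> carrier G \<Longrightarrow> b \<otimes> (b \<otimes> x) = \<beta> \<otimes> x"
    "\<And>x. x \<in> carrier G \<Longrightarrow> s \<otimes> (s \<otimes> x) = x" "\<And>x. x \<in> carrier G \<Longrightarrow> b \<otimes> (a \<otimes> x) = z \<otimes> (a \<otimes> (b \<otimes> x))"
    "\<And>x. x \<in> carrier G \<Longrightarrow> s \<otimes> (a \<otimes> x) = a \<otimes> (s \<otimes> x)" "\<And>x. x \<in> carrier G \<Longrightarrow> s \<otimes> (b \<otimes> x) = \<beta> \<otimes> (b \<otimes> (s \<otimes> x))"
    "\<And>m. m \<in> M \<Longrightarrow> a \<otimes> m = m \<otimes> a" "\<And>m. m \<in> M \<Longrightarrow> b \<otimes> m = m \<otimes> b" "\<And>m. m \<in> M \<Longrightarrow> s \<otimes> m = m \<otimes> s"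
    "\<And>m x. m \<in> M \<Longrightarrow> x \<in> carrier G \<Longrightarrow> a \<otimes> (m \<otimes> x) = m \<otimes> (a \<otimes> x)"
    "\<And>m x. m \<in> M \<Longrightarrow> x \<in> carrier G \<Longrightarrow> b \<otimes> (m \<otimes> x) = m \<otimes> (b \<otimes> x)"
    "\<And>m x. m \<in> M \<Longrightarrow> x \<in> carrier G \<Longrightarrow> s \<otimes> (m \<otimes> x) = m \<otimes> (s \<otimes> x)"
    using a b s z Mcen Mlc unfolding \<beta>_def by (auto simp: m_assoc[symmetric])
  have AC: "\<And>m n. m \<in> M \<Longrightarrow> n \<in> M \<Longrightarrow> m \<otimes> n = n \<otimes> m"
    "\<And>m n x. m \<in> M \<Longrightarrow> n \<in> M \<Longrightarrow> x \<in> carrier G \<Longrightarrow> m \<otimes> (n \<otimes> x) = n \<otimes> (m \<otimes> x)"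
    using Mcen Mlc by auto
  note nf = m_assoc rules Msq mcan z(1) a(1) b(1) s(1)
  have aM: "a \<notin> M"
  proof
    assume "a \<in> M"
    then have "b \<otimes> a = a \<otimes> b" using Mcen b by simp
    then have "z \<otimes> (a \<otimes> b) = \<one> \<otimes> (a \<otimes> b)" using b a by simp
    then show False using z(1,2) a(1) b(1) by (metis m_closed one_closed r_cancel)
  qed
  have anti: "b \<otimes> a \<noteq> a \<otimes> b"
    using b(1,3) a(1) z(1,2) by (metis m_closed one_closed r_cancel l_one)
  have bM: "b \<notin> M" using anti Mcen[of b a] a by auto
  have sepM: "n \<otimes> x \<noteq> m" if "x \<in> carrier G" "x \<notin> M" "n \<in> M" "m \<in> M" for n m x
    using that mcan[of x n] Mmul[of n m] by auto
  have comm_a: "a \<otimes> (n \<otimes> x) = (n \<otimes> x) \<otimes> a \<longleftrightarrow> a \<otimes> x = x \<otimes> a" if "n \<in> M" "x \<in> carrier G" for n x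
    using that a(1) Mlc[of n a x] by (simp add: m_assoc)
  have anti_ab: "a \<otimes> b \<noteq> z \<otimes> (a \<otimes> b)" using anti b(3) by simp
  have nocomm: "a \<otimes> b \<noteq> b \<otimes> a" "a \<otimes> (a \<otimes> b) \<noteq> (a \<otimes> b) \<otimes> a" "a \<otimes> (b \<otimes> s) \<noteq> (b \<otimes> s) \<otimes> a"
  proof -
    show "a \<otimes> b \<noteq> b \<otimes> a" using anti by simp
    show "a \<otimes> (a \<otimes> b) \<noteq> (a \<otimes> b) \<otimes> a"
    proof
      assume "a \<otimes> (a \<otimes> b) = (a \<otimes> b) \<otimes> a"
      then have "b = z \<otimes> b" by (simp add: nf)
      then show False using z(1,2) b(1) by (metis l_one one_closed r_cancel)
    qed
    show "a \<otimes> (b \<otimes> s) \<noteq> (b \<otimes> s) \<otimes> a"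
    proof
      assume "a \<otimes> (b \<otimes> s) = (b \<otimes> s) \<otimes> a"
      then have "\<one> \<otimes> (a \<otimes> (b \<otimes> s)) = z \<otimes> (a \<otimes> (b \<otimes> s))" by (simp add: nf)
      then show False using z(1,2) a(1) b(1) s(1) by (metis m_closed one_closed r_cancel)
    qed
  qed
  have icomm: "a \<otimes> s = s \<otimes> a" "a \<otimes> (a \<otimes> s) = (a \<otimes> s) \<otimes> a" by (simp_all add: nf)
  have asM: "s \<notin> M" "a \<otimes> s \<notin> M" using sM .
  have neq0: "n \<otimes> x \<noteq> m \<otimes> y" if "n \<in> M" "m \<in> M" "x \<in> carrier G" "y \<in> carrier G"
    "a \<otimes> x = x \<otimes> a" "a \<otimes> y \<noteq> y \<otimes> a" for n m x y
    using comm_a that by metis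
  have neq1: "n \<otimes> x \<noteq> m \<otimes> y" if nm: "n \<in> M" "m \<in> M" and xy: "x \<in> carrier G" "y \<in> carrier G" and not: "y \<otimes> inv x \<notin> M" for n m x y
  proof
    assume "n \<otimes> x = m \<otimes> y"
    then have "m \<otimes> (n \<otimes> x) = y" using mcan nm xy by simp
    then have "y \<otimes> inv x = m \<otimes> n" using nm xy by (simp add: m_assoc inv_solve_right')
    then show False using not Mmul nm by simp
  qed
  have inv: "inv a = a" "inv s = s" "inv b = \<beta> \<otimes> b"
    using a s b inv_equality[of "\<beta> \<otimes> b" b] by (auto simp: inv_equality nf)
  \<comment> \<open>\<open>L\<close> selects one element of each pair {r, z r}: 1 from {1, z}, and z
    r otherwise. With a nontrivial r0 in R the twist gives R L = M, so that R a and L s together bar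
    the whole coset M a s, while z still stays outside L L.\<close>
  define L where "L = {m. m = \<one> \<or> (\<exists>r\<in>R. r \<noteq> \<one> \<and> m = z \<otimes> r)}"
  have LM [simp]: "m \<in> M" if "m \<in> L" for m using that M R1 unfolding L_def by auto
  define S where "S = {x. x = z \<or> (\<exists>r\<in>R. x = r \<otimes> a) \<or> (\<exists>r\<in>R. x = r \<otimes> b) \<or> (\<exists>m\<in>L. x = m \<otimes> s)}"
  \<comment> \<open>Distinctness of the cosets of M. Commuting with a separates 1, a, s, a s from b,
    a b, b s, and within each class a common factor is cancelled.\<close>
  have ne: "n \<noteq> m \<otimes> a" "n \<noteq> m \<otimes> b" "n \<noteq> m \<otimes> s" "n \<otimes> a \<noteq> m" "n \<otimes> b \<noteq> m" "n \<otimes> s \<noteq> m"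
    "n \<otimes> a \<noteq> m \<otimes> b" "n \<otimes> b \<noteq> m \<otimes> a" "n \<otimes> a \<noteq> m \<otimes> s" "n \<otimes> s \<noteq> m \<otimes> a" "n \<otimes> b \<noteq> m \<otimes> s" "n \<otimes> s \<noteq> m \<otimes> b"
    "n \<otimes> (a \<otimes> b) \<noteq> m" "n \<otimes> (a \<otimes> b) \<noteq> m \<otimes> a" "n \<otimes> (a \<otimes> b) \<noteq> m \<otimes> b" "n \<otimes> (a \<otimes> b) \<noteq> m \<otimes> s"
    "n \<otimes> (a \<otimes> s) \<noteq> m" "n \<otimes> (a \<otimes> s) \<noteq> m \<otimes> a" "n \<otimes> (a \<otimes> s) \<noteq> m \<otimes> b" "n \<otimes> (a \<otimes> s) \<noteq> m \<otimes> s"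
    "n \<otimes> (b \<otimes> s) \<noteq> m" "n \<otimes> (b \<otimes> s) \<noteq> m \<otimes> a" "n \<otimes> (b \<otimes> s) \<noteq> m \<otimes> b" "n \<otimes> (b \<otimes> s) \<noteq> m \<otimes> s"
    if nm: "n \<in> M" "m \<in> M" for n m
  proof -
    note [simp] = a(1) b(1) s(1) z(1)
    have bs: "b \<otimes> s \<notin> M" "a \<otimes> b \<notin> M"
      using nocomm(2,3) Mcen a(1) by (metis, metis)
    show "n \<noteq> m \<otimes> a" "n \<otimes> a \<noteq> m" using sepM[of a] aM nm by auto
    show "n \<noteq> m \<otimes> b" "n \<otimes> b \<noteq> m" using sepM[of b] bM nm by auto
    show "n \<noteq> m \<otimes> s" "n \<otimes> s \<noteq> m" using sepM[of s] asM nm by auto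
    show "n \<otimes> a \<noteq> m \<otimes> b" "n \<otimes> b \<noteq> m \<otimes> a" "n \<otimes> b \<noteq> m \<otimes> s" "n \<otimes> s \<noteq> m \<otimes> b"
      "n \<otimes> (a \<otimes> b) \<noteq> m \<otimes> a" "n \<otimes> (a \<otimes> b) \<noteq> m \<otimes> s"  "n \<otimes> (a \<otimes> s) \<noteq> m \<otimes> b"
      "n \<otimes> (b \<otimes> s) \<noteq> m \<otimes> a" "n \<otimes> (b \<otimes> s) \<noteq> m \<otimes> s"
      using neq0[OF nm] neq0[OF nm(2,1)] nocomm icomm by (metis a(1) b(1) s(1) m_closed)+
    have eqa: "a \<otimes> x \<noteq> a \<otimes> y \<Longrightarrow> x \<noteq> y" and eqb: "b \<otimes> x \<noteq> b \<otimes> y \<Longrightarrow> x \<noteq> y" for x y by auto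
    show "n \<otimes> a \<noteq> m \<otimes> s" by (rule eqa) (use nm sepM[of "a \<otimes> s" m n] asM in \<open>simp add: nf\<close>)
    show "n \<otimes> s \<noteq> m \<otimes> a" by (rule eqa) (use nm sepM[of "a \<otimes> s" n m] asM in \<open>simp add: nf\<close>)
    show "n \<otimes> (a \<otimes> s) \<noteq> m \<otimes> a" by (rule eqa) (use nm sepM[of s n m] asM in \<open>simp add: nf\<close>)
    show "n \<otimes> (a \<otimes> s) \<noteq> m \<otimes> s" using nm sepM[of a n m] aM by (simp add: m_assoc[symmetric])
    show "n \<otimes> (a \<otimes> b) \<noteq> m \<otimes> b" using nm sepM[of a n m] aM by (simp add: m_assoc[symmetric])
    show "n \<otimes> (b \<otimes> s) \<noteq> m \<otimes> b"
      by (rule eqb) (use nm sepM[of s "n \<otimes> \<beta>" "m \<otimes> \<beta>"] asM Mmul in \<open>simp add: nf\<close>)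
    show "n \<otimes> (a \<otimes> b) \<noteq> m" "n \<otimes> (a \<otimes> s) \<noteq> m" "n \<otimes> (b \<otimes> s) \<noteq> m"
      using sepM nm bs asM by auto
  qed
  have zR: "z \<otimes> r \<notin> R" if "r \<in> R" for r
  proof
    assume "z \<otimes> r \<in> R"
    then have "(z \<otimes> r) \<otimes> r \<in> R" using that Rm by blast
    then show False using that R(2) z(1,4) Rc by (simp add: m_assoc)
  qed
  have Smem: "n \<in> S \<longleftrightarrow> n = z" "n \<otimes> a \<in> S \<longleftrightarrow> n \<in> R" "n \<otimes> b \<in> S \<longleftrightarrow> n \<in> R" "n \<otimes> s \<in> S \<longleftrightarrow> n \<in> L"
    "n \<otimes> (a \<otimes> b) \<notin> S" "n \<otimes> (a \<otimes> s) \<notin> S" "n \<otimes> (b \<otimes> s) \<notin> S" if n: "n \<in> M" for n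
    using n ne[OF n] a(1) b(1) s(1) zM unfolding S_def by auto
  have Smem2: "n \<otimes> (m \<otimes> a) \<in> S \<longleftrightarrow> n \<otimes> m \<in> R" "n \<otimes> (m \<otimes> b) \<in> S \<longleftrightarrow> n \<otimes> m \<in> R"
    "n \<otimes> (m \<otimes> s) \<in> S \<longleftrightarrow> n \<otimes> m \<in> L" "n \<otimes> (m \<otimes> (a \<otimes> b)) \<notin> S" "n \<otimes> (m \<otimes> (a \<otimes> s)) \<notin> S" "n \<otimes> (m \<otimes> (b \<otimes> s)) \<notin> S"
    if "n \<in> M" "m \<in> M" for n m
    using Smem[OF Mmul[OF that]] that a(1) b(1) s(1) by (simp_all add: m_assoc)
  have Smem3: "n \<otimes> (m \<otimes> (k \<otimes> (a \<otimes> b))) \<notin> S" "n \<otimes> (m \<otimes> (k \<otimes> (b \<otimes> s))) \<notin> S" if "n \<in> M" "m \<in> M" "k \<in> M" for n m k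
    using Smem2(4,6)[OF Mmul[OF that(1,2)] that(3)] that a(1) b(1) s(1) by (simp_all add: m_assoc)
  have oneM: "\<one> \<in> M" using R1 by simp
  have rr1: "r \<otimes> r' = \<one> \<longleftrightarrow> r = r'" if "r \<in> M" "r' \<in> M" for r r'
    using that Msq mcan by (metis Mc r_one)
  have pf: "product_free G S"
    unfolding product_free_iff
  proof (intro conjI ballI)
    show "S \<subseteq> carrier G" unfolding S_def using z(1) a(1) b(1) s(1) by (auto dest: LM)
    show "S \<noteq> {}" unfolding S_def by blast
    have ne_z: "r \<noteq> z" if "r \<in> R" for r using that z(4) by blast
    have zr1: "z \<otimes> r = z \<longleftrightarrow> r = \<one>" if "r \<in> R" for r using that z(1) by (metis Rc l_cancel_one)
    have LL: "m \<otimes> m' \<noteq> z" if "m \<in> L" "m' \<in> L" for m m'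
    proof -
      from that consider "m = \<one>" "m' = \<one>" | r where "r \<in> R" "r \<noteq> \<one>" "m = \<one>" "m' = z \<otimes> r"
        | r where "r \<in> R" "r \<noteq> \<one>" "m = z \<otimes> r" "m' = \<one>"
        | r r' where "r \<in> R" "r' \<in> R" "m = z \<otimes> r" "m' = z \<otimes> r'" unfolding L_def by blast
      then show ?thesis
      proof cases
        case 4
        then have "m \<otimes> m' = r \<otimes> r'" using z(1) Mlc[OF zM, of r r'] by (simp add: m_assoc zcan)
        then show ?thesis using ne_z[OF Rm] 4 by simp
      qed (use z(1,2) zr1 in \<open>simp_all\<close>)
    qed
    have zL: "z \<otimes> m \<notin> L" if "m \<in> L" for m
      using that z(1,2) zr1 zcan zR unfolding L_def by (auto simp: zcan)
    fix u v assume "u \<in> S" "v \<in> S"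
    then show "u \<otimes> v \<notin> S" 
      unfolding S_def[THEN eqset_imp_iff, unfolded mem_Collect_eq, of u] S_def[THEN eqset_imp_iff, unfolded mem_Collect_eq, of v]
      using z(1,2) oneM zR[unfolded AC(1)[OF zM RM]] zL[unfolded AC(1)[OF zM LM]]
      by (elim disjE bexE; hypsubst) (simp_all add: nf AC Smem Smem2 Smem3 Mmul Rm LL ne_z)
  qed
  let ?g = "a \<otimes> (b \<otimes> s)"
  have gg: "?g \<otimes> ?g = z" by (simp add: nf) (simp add: nf AC)
  have g1: "?g \<noteq> \<one>" using gg z by auto
  have gc: "?g \<in> carrier G" using a b s by simp
  have key: "?g \<notin> T" "\<And>x y. x \<in> T \<Longrightarrow> y \<in> T \<Longrightarrow> ?g \<noteq> x \<otimes> y" if T: "product_free G T" "S \<subseteq> T" for T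
  proof -
    note TD = product_freeD[OF T(1)]
    have "z \<in> T" using T(2) unfolding S_def by blast
    then have sq: "t \<otimes> t \<noteq> z" if "t \<in> T" for t using TD(3)[OF that that] by auto
    show "?g \<notin> T" using sq gg by blast
    have inT: "r \<otimes> a \<in> T" "r \<otimes> b \<in> T" if "r \<in> R" for r using T(2) that unfolding S_def by blast+
    have inTs: "m \<otimes> s \<in> T" if "m \<in> L" for m using T(2) that unfolding S_def by blast
    have L1: "\<one> \<in> L" "z \<otimes> r0 \<in> L" using R(3,4) unfolding L_def by auto
    \<comment> \<open>Both halves of M x s are reached: (r x) s for the half in R, and (r r0 x)(z r0
      s) = z r x s for the half in z R.\<close>
    have bars: "m \<otimes> (x \<otimes> s) \<notin> T" if x: "x \<in> carrier G" "\<And>r. r \<in> R \<Longrightarrow> r \<otimes> x \<in> T" and m: "m \<in> M" for m x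
    proof -
      consider "m \<in> R" | r where "r \<in> R" "m = z \<otimes> r" using m M by blast
      then show ?thesis
      proof cases
        case 1
        have "(m \<otimes> x) \<otimes> (\<one> \<otimes> s) = m \<otimes> (x \<otimes> s)" using x(1) s(1) m by (simp add: m_assoc)
        then show ?thesis using TD(3)[OF x(2)[OF 1] inTs[OF L1(1)]] by simp
      next
        case 2
        have "((r \<otimes> r0) \<otimes> x) \<otimes> ((z \<otimes> r0) \<otimes> s) = (r \<otimes> r0) \<otimes> ((z \<otimes> r0) \<otimes> (x \<otimes> s))"
          using x(1) s(1) 2 R(3) z(1) Mlc[of "z \<otimes> r0" x s] Mmul[OF zM RM[OF R(3)]] by (simp add: m_assoc)
        also have "\<dots> = ((r \<otimes> r0) \<otimes> (z \<otimes> r0)) \<otimes> (x \<otimes> s)" using x(1) s(1) 2 R(3) z(1) by (simp add: m_assoc)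
        also have "(r \<otimes> r0) \<otimes> (z \<otimes> r0) = z \<otimes> r" using 2 R(3) z(1) by (simp add: nf AC Mmul)
        finally show ?thesis using TD(3)[OF x(2)[OF Rm[OF 2(1) R(3)]] inTs[OF L1(2)]] 2 by simp
      qed
    qed
    have bas: "m \<otimes> (a \<otimes> s) \<notin> T" "m \<otimes> (b \<otimes> s) \<notin> T" if "m \<in> M" for m
      using bars[OF a(1) inT(1) that] bars[OF b(1) inT(2) that] by auto
    have bab: "r \<otimes> (a \<otimes> b) \<notin> T" "z \<otimes> (r \<otimes> (a \<otimes> b)) \<notin> T" if r: "r \<in> R" for r
    proof -
      have "(r \<otimes> a) \<otimes> (\<one> \<otimes> b) = r \<otimes> (a \<otimes> b)" "(r \<otimes> b) \<otimes> (\<one> \<otimes> a) = z \<otimes> (r \<otimes> (a \<otimes> b))"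
        using r a(1) b(1) z(1) by (simp_all add: nf AC)
      then show "r \<otimes> (a \<otimes> b) \<notin> T" "z \<otimes> (r \<otimes> (a \<otimes> b)) \<notin> T"
        using TD(3)[OF inT(1)[OF r] inT(2)[OF R1]] TD(3)[OF inT(2)[OF r] inT(1)[OF R1]] by auto
    qed
    then have bab: "m \<otimes> (a \<otimes> b) \<notin> T" if "m \<in> M" for m
      using that M z(1) a(1) b(1) Rc by (auto simp: m_assoc)
    fix x y assume xy: "x \<in> T" "y \<in> T"
    show "?g \<noteq> x \<otimes> y"
    proof
      assume e: "?g = x \<otimes> y"
      have c: "x \<in> carrier G" "y \<in> carrier G" using xy TD by auto
      have y: "y = inv x \<otimes> ?g" using e c gc by (simp add: inv_solve_left)
      obtain m where m: "m \<in> M" "x \<in> {m, m \<otimes> a, m \<otimes> b, m \<otimes> (a \<otimes> b), m \<otimes> s, m \<otimes> (a \<otimes> s), m \<otimes> (b \<otimes> s), m \<otimes> ?g}"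
        using cover[OF c(1)] sq[OF xy(1)] sq[OF xy(2)] y by blast
      have invm: "inv (m \<otimes> w) = inv w \<otimes> m" if "w \<in> carrier G" for w using that m(1) by (simp add: inv_mult_group Minv)
      have inv1: "inv m = m" using Minv m(1) by simp
      have y1: "y = m \<otimes> ?g" if "x = m" using y that inv1 by simp
      have y2: "y = m \<otimes> (b \<otimes> s)" if "x = m \<otimes> a" using y that invm[OF a(1)] m(1) by (simp add: inv nf)
      have y3: "y = (m \<otimes> z) \<otimes> (a \<otimes> s)" if "x = m \<otimes> b"
        using y that invm[OF b(1)] m(1) by (simp add: inv nf AC)
      have y5: "y = (m \<otimes> \<beta>) \<otimes> (a \<otimes> b)" if "x = m \<otimes> s" using y that invm[OF s(1)] m(1) by (simp add: inv nf AC)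
      have x8: "x \<otimes> x = z" if "x = m \<otimes> ?g" using that m(1) gg by (simp add: nf AC)
      have y4: "y = m \<otimes> s" if "x = m \<otimes> (a \<otimes> b)"
        using y that m(1) by (simp add: inv1 inv inv_mult_group nf AC)
      have y1': "y \<otimes> y = z" if "x = m" using y1[OF that] m(1) gg by (simp add: nf AC)
      have "x \<noteq> m" "x \<noteq> m \<otimes> ?g" using y1' x8 sq xy by auto
      moreover have "x \<noteq> m \<otimes> a" using y2 bas(2)[OF m(1)] xy(2) by auto
      moreover have "x \<noteq> m \<otimes> b" using y3 bas(1)[OF Mmul[OF m(1) zM]] xy(2) by auto
      moreover have "x \<noteq> m \<otimes> (a \<otimes> b)" using bab m(1) xy(1) by auto
      moreover have "x \<noteq> m \<otimes> s" using y5 bab[OF Mmul[OF m(1) \<beta>]] xy(2) by auto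
      moreover have "x \<noteq> m \<otimes> (a \<otimes> s)" "x \<noteq> m \<otimes> (b \<otimes> s)" using bas m(1) xy(1) by auto
      ultimately show False using m(2) by simp
    qed
  qed
  show ?thesis by (rule not_filledI[OF fin pf gc g1]) (use key in auto)
qed

end

section \<open>Commuting elements of order 4 with independent squares\<close>

context group
begin

lemma normal_mult_iff:
  assumes "M \<lhd> G" "m \<in> M" "u \<in> carrier G"
  shows "m \<otimes> u \<in> M \<longleftrightarrow> u \<in> M" "u \<otimes> m \<in> M \<longleftrightarrow> u \<in> M"
proof -
  interpret M: normal M G by fact
  show "m \<otimes> u \<in> M \<longleftrightarrow> u \<in> M"
    using assms(2,3) inv_cancel_assoc(1)[of m u] M.m_closed M.m_inv_closed M.mem_carrier by metis
  have "u \<otimes> m \<otimes> inv m = u" using assms(2,3) by (simp add: m_assoc)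
  then show "u \<otimes> m \<in> M \<longleftrightarrow> u \<in> M"
    using assms(2,3) M.m_closed M.m_inv_closed by metis
qed

lemma normal_commute_iff:
  assumes "M \<lhd> G" "u \<in> carrier G" "v \<in> carrier G"
  shows "u \<otimes> v \<in> M \<longleftrightarrow> v \<otimes> u \<in> M"
proof -
  interpret M: normal M G by fact
  have *: "v \<otimes> u \<in> M" if "u \<otimes> v \<in> M" "u \<in> carrier G" "v \<in> carrier G" for u v
  proof -
    have "inv u \<otimes> (u \<otimes> v) \<otimes> u \<in> M" using M.inv_op_closed1 that by blast
    then show ?thesis using that by (simp add: m_assoc[symmetric])
  qed
  then show ?thesis using assms(2,3) by blast
qed

text \<open>The set is M together with the coset of g, described through membership so that closure
  is checked without naming coset representatives; g g in M keeps the two cosets closed under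
  products.\<close>

lemma subgroup_extend_involution:
  assumes Mn: "M \<lhd> G" and g: "g \<in> carrier G" and gg: "g \<otimes> g \<in> M"
  shows "subgroup {p \<in> carrier G. p \<in> M \<or> g \<otimes> p \<in> M} G" (is "subgroup ?P G")
proof -
  interpret M: normal M G by fact
  show ?thesis
  proof (rule subgroupI)
    show "?P \<subseteq> carrier G" by auto
    show "?P \<noteq> {}" using M.one_closed by auto
      fix a assume a: "a \<in> ?P"
      then have ac: "a \<in> carrier G" by blast
      have "g \<otimes> inv a \<in> M" if "g \<otimes> a \<in> M"
      proof -
        have "inv (g \<otimes> a) \<in> M" using that by simp
        then have "inv a \<otimes> inv g \<in> M" using ac g by (simp add: inv_mult_group)
        then have "(inv a \<otimes> inv g) \<otimes> (g \<otimes> g) \<in> M" using gg by simp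
        then have "inv a \<otimes> g \<in> M" using ac g by (simp add: m_assoc inv_cancel_assoc)
        then show ?thesis using normal_commute_iff[OF Mn] ac g by simp
      qed
      then show "inv a \<in> ?P" using a ac by auto
      fix b assume b: "b \<in> ?P"
      then have bc: "b \<in> carrier G" by blast
      have 1: "g \<otimes> (a \<otimes> b) \<in> M" if "g \<otimes> a \<in> M" "b \<in> M"
        using M.m_closed[OF that] ac bc g by (simp add: m_assoc)
      have 2: "g \<otimes> (a \<otimes> b) \<in> M" if "a \<in> M" "g \<otimes> b \<in> M"
      proof -
        have "b \<otimes> g \<in> M" using normal_commute_iff[OF Mn] bc g that by simp
        then have "a \<otimes> (b \<otimes> g) \<in> M" using that by simp
        then have "(a \<otimes> b) \<otimes> g \<in> M" using ac bc g by (simp add: m_assoc)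
        then show ?thesis using normal_commute_iff[OF Mn, of g "a \<otimes> b"] ac bc g by simp
      qed
      have 3: "a \<otimes> b \<in> M" if "g \<otimes> a \<in> M" "g \<otimes> b \<in> M"
      proof -
        have "a \<otimes> g \<in> M" using normal_commute_iff[OF Mn] ac g that by simp
        then have "(a \<otimes> g) \<otimes> (g \<otimes> b) \<in> M" using that by simp
        then have "b \<otimes> (a \<otimes> (g \<otimes> g)) \<in> M"
          using normal_commute_iff[OF Mn, of "a \<otimes> (g \<otimes> g)" b] ac bc g by (simp add: m_assoc)
        then have "(b \<otimes> a) \<otimes> (g \<otimes> g) \<in> M" using ac bc g by (simp add: m_assoc)
        then have "b \<otimes> a \<in> M" using normal_mult_iff(2)[OF Mn gg] ac bc by simp
        then show ?thesis using normal_commute_iff[OF Mn] ac bc by simp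
      qed
      show "a \<otimes> b \<in> ?P" using a b 1 2 3 ac bc M.m_closed by auto
  qed
qed

text \<open>The elements x and y generate H of type C4 x C4, with K as its group of squares. In H
  the set {x, y, w} with x y w = 1 has as products only k, l, k l and the inverses of x, y, w; it
  misses l x. To pass from H to G, a subgroup M is chosen maximal with intersection K with H, which
  gives G = H M, and x (M - K) is added. The resulting S has no larger product-free superset and
  still misses l x.\<close>

lemma not_filled_C4_times_C4:
  assumes fin: "finite (carrier G)"
    and K: "subgroup K G" "K = {\<one>, k, l, k \<otimes> l}"
    and cen: "\<And>n g. n \<in> K \<Longrightarrow> g \<in> carrier G \<Longrightarrow> g \<otimes> n = n \<otimes> g"
    and sqK: "\<And>g. g \<in> carrier G \<Longrightarrow> g \<otimes> g \<in> K"
    and comK: "\<And>g h. g \<in> carrier G \<Longrightarrow> h \<in> carrier G \<Longrightarrow> g \<otimes> h \<otimes> inv g \<otimes> inv h \<in> K"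
    and x: "x \<in> carrier G" "x \<otimes> x = k" and y: "y \<in> carrier G" "y \<otimes> y = l" and xy: "y \<otimes> x = x \<otimes> y"
    and kl: "k \<otimes> k = \<one>" "l \<otimes> l = \<one>" "k \<noteq> \<one>" "l \<noteq> \<one>" "k \<noteq> l"
  shows "\<not> filled G"
proof -
  have Kc: "n \<in> carrier G" if "n \<in> K" for n using K(1) that by (rule subgroup.mem_carrier)
  have Kmul: "n \<otimes> m \<in> K" if "n \<in> K" "m \<in> K" for n m using K(1) that by (rule subgroup.m_closed)
  have Kin: "\<one> \<in> K" "k \<in> K" "l \<in> K" using K(2) by auto
  have klne: "k \<otimes> l \<noteq> \<one>" "k \<otimes> l \<noteq> k" "k \<otimes> l \<noteq> l"
  proof -
    show "k \<otimes> l \<noteq> \<one>" using kl Kc Kin by (metis inv_equality inv_inv inv_unique)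
    show "k \<otimes> l \<noteq> k" "k \<otimes> l \<noteq> l" using kl Kc[OF Kin(2)] Kc[OF Kin(3)] by simp_all
  qed
  note [simp] = Kc Kin
  have lc: "g \<otimes> (n \<otimes> u) = n \<otimes> (g \<otimes> u)" if "n \<in> K" "g \<in> carrier G" "u \<in> carrier G" for g n u
    using that cen by (simp add: m_assoc[symmetric])
  have nf: "x \<otimes> x = k" "y \<otimes> y = l" "y \<otimes> x = x \<otimes> y" "k \<otimes> k = \<one>" "l \<otimes> l = \<one>"
    "\<And>u. u \<in> carrier G \<Longrightarrow> x \<otimes> (x \<otimes> u) = k \<otimes> u" "\<And>u. u \<in> carrier G \<Longrightarrow> y \<otimes> (y \<otimes> u) = l \<otimes> u"
    "\<And>u. u \<in> carrier G \<Longrightarrow> y \<otimes> (x \<otimes> u) = x \<otimes> (y \<otimes> u)"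
    "\<And>u. u \<in> carrier G \<Longrightarrow> k \<otimes> (k \<otimes> u) = u" "\<And>u. u \<in> carrier G \<Longrightarrow> l \<otimes> (l \<otimes> u) = u"
    "\<And>n. n \<in> K \<Longrightarrow> x \<otimes> n = n \<otimes> x" "\<And>n u. n \<in> K \<Longrightarrow> u \<in> carrier G \<Longrightarrow> x \<otimes> (n \<otimes> u) = n \<otimes> (x \<otimes> u)"
    "\<And>n. n \<in> K \<Longrightarrow> y \<otimes> n = n \<otimes> y" "\<And>n u. n \<in> K \<Longrightarrow> u \<in> carrier G \<Longrightarrow> y \<otimes> (n \<otimes> u) = n \<otimes> (y \<otimes> u)"
    "l \<otimes> k = k \<otimes> l" "\<And>u. u \<in> carrier G \<Longrightarrow> l \<otimes> (k \<otimes> u) = k \<otimes> (l \<otimes> u)"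
    using x y xy kl cen lc Kc[OF Kin(2)] Kc[OF Kin(3)] by (auto simp: m_assoc[symmetric])
  note nf = m_assoc nf x(1) y(1)
  \<comment> \<open>w is the inverse of x y, since x y has square k l.\<close>
  define w where "w = k \<otimes> (l \<otimes> (x \<otimes> y))"
  have wc: "w \<in> carrier G" unfolding w_def using x y by simp
  have Ksq: "n \<otimes> n = \<one>" if "n \<in> K" for n using that unfolding K(2) by (auto simp: nf)
  have Kinv: "inv n = n" if "n \<in> K" for n using Ksq[OF that] that by (simp add: inv_equality)
  have xK: "x \<notin> K" "y \<notin> K" using Ksq x y kl by auto
  have xyK: "x \<otimes> y \<notin> K" using Ksq[of "x \<otimes> y"] klne(1) by (auto simp: nf)
  have wK: "w \<notin> K"
  proof
    assume "w \<in> K"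
    then have "k \<otimes> (l \<otimes> w) \<in> K" using Kmul by simp
    then show False using xyK unfolding w_def by (simp add: nf)
  qed
  have conj: "g \<otimes> m \<otimes> inv g \<in> P" if P: "subgroup P G" "K \<subseteq> P" "g \<in> carrier G" "m \<in> P" for g m P
  proof -
    have mc: "m \<in> carrier G" using subgroup.mem_carrier[OF P(1,4)] .
    have "g \<otimes> m \<otimes> inv g = (g \<otimes> m \<otimes> inv g \<otimes> inv m) \<otimes> m" using P(3) mc by (simp add: m_assoc)
    then show ?thesis using comK[OF P(3) mc] P(2,4) subgroup.m_closed[OF P(1)] by (metis subsetD)
  qed
  have Kn: "K \<lhd> G" using subgroup_normalI[OF K(1)] conj[OF K(1) order_refl] by blast
  define H1 where "H1 = {p \<in> carrier G. p \<in> K \<or> x \<otimes> p \<in> K}"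
  have H1: "subgroup H1 G" unfolding H1_def by (rule subgroup_extend_involution[OF Kn x(1)]) (simp add: x)
  have "K \<subseteq> H1" unfolding H1_def by auto
  then have H1n: "H1 \<lhd> G" using subgroup_normalI[OF H1] conj[OF H1] by blast
  define H where "H = {p \<in> carrier G. p \<in> H1 \<or> y \<otimes> p \<in> H1}"
  have Hs: "subgroup H G" unfolding H_def
    by (rule subgroup_extend_involution[OF H1n y(1)]) (simp add: y(2) subsetD[OF \<open>K \<subseteq> H1\<close>])
  note Hmul = subgroup.m_closed[OF Hs] and Hc = subgroup.mem_carrier[OF Hs] and Hinv = subgroup.m_inv_closed[OF Hs]
  have HK: "n \<in> H" if "n \<in> K" for n using that \<open>K \<subseteq> H1\<close> unfolding H_def by auto
  have Hxy: "x \<in> H" "y \<in> H" using x y \<open>K \<subseteq> H1\<close> unfolding H_def H1_def by auto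
  then have Hw: "w \<in> H" unfolding w_def using HK Hmul by simp
  have Hcases: "\<exists>n\<in>K. h = n \<or> h = n \<otimes> x \<or> h = n \<otimes> y \<or> h = n \<otimes> (x \<otimes> y)" if hH: "h \<in> H" for h
  proof -
    have h: "h \<in> carrier G" using Hc hH .
    \<comment> \<open>The cosets of K in H are recovered by multiplying back with x, y or x y, whose
      squares are k, l and k l.\<close>
    have q: "k \<otimes> (x \<otimes> q) = (k \<otimes> q) \<otimes> x" "l \<otimes> (y \<otimes> q) = (l \<otimes> q) \<otimes> y"
      "k \<otimes> (l \<otimes> (x \<otimes> (y \<otimes> q))) = (k \<otimes> (l \<otimes> q)) \<otimes> (x \<otimes> y)" if "q \<in> K" for q
      using that by (simp_all add: nf)
    have e: "k \<otimes> (x \<otimes> (x \<otimes> h)) = h" "l \<otimes> (y \<otimes> (y \<otimes> h)) = h" "k \<otimes> (l \<otimes> (x \<otimes> (y \<otimes> (x \<otimes> (y \<otimes> h))))) = h"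
      using h by (simp_all add: nf)
    consider "h \<in> K" | "x \<otimes> h \<in> K" | "y \<otimes> h \<in> K" | "x \<otimes> (y \<otimes> h) \<in> K"
      using hH unfolding H_def H1_def by blast
    then show ?thesis
    proof cases
      case 2
      then show ?thesis using q(1)[OF 2] Kmul[OF Kin(2) 2] unfolding e by metis
    next
      case 3
      then show ?thesis using q(2)[OF 3] Kmul[OF Kin(3) 3] unfolding e by metis
    next
      case 4
      then show ?thesis using q(3)[OF 4] Kmul[OF Kin(2) Kmul[OF Kin(3) 4]] unfolding e by metis
    qed blast
  qed
  define F where "F = {M. subgroup M G \<and> K \<subseteq> M \<and> M \<inter> H \<subseteq> K}"
  have "F \<subseteq> Pow (carrier G)" unfolding F_def using subgroup.subset by blast
  then have "finite F" using fin by (meson finite_Pow_iff finite_subset)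
  moreover have "K \<in> F" unfolding F_def using K(1) by blast
  ultimately obtain M where M: "M \<in> F" "\<And>P. P \<in> F \<Longrightarrow> M \<subseteq> P \<Longrightarrow> P = M"
    using finite_has_maximal[of F] by blast
  have M': "subgroup M G" "K \<subseteq> M" "M \<inter> H \<subseteq> K" using M(1) unfolding F_def by auto
  have Mn: "M \<lhd> G" using subgroup_normalI[OF M'(1)] conj[OF M'(1,2)] by blast
  interpret M: normal M G by (rule Mn)
  have Mmem: "h \<in> M \<Longrightarrow> h \<in> H \<Longrightarrow> h \<in> K" for h using M'(3) by blast
  \<comment> \<open>If g lay outside H M, adjoining g to M would keep the intersection with H inside
    K, against the maximality of M.\<close>
  have cover: "\<exists>h\<in>H. \<exists>m\<in>M. g = h \<otimes> m" if g: "g \<in> carrier G" for g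
  proof (rule ccontr)
    assume not: "\<not> ?thesis"
    define P where "P = {p \<in> carrier G. p \<in> M \<or> g \<otimes> p \<in> M}"
    have gg: "g \<otimes> g \<in> M" using sqK[OF g] M'(2) by blast
    have "subgroup P G" unfolding P_def by (rule subgroup_extend_involution[OF Mn g gg])
    moreover have "P \<inter> H \<subseteq> K"
    proof
      fix h assume h: "h \<in> P \<inter> H"
      then have hc: "h \<in> carrier G" using Hc by blast
      have "g \<otimes> h \<notin> M"
      proof
        assume m: "g \<otimes> h \<in> M"
        have "g = inv h \<otimes> (h \<otimes> (g \<otimes> h) \<otimes> inv h)" using g hc by (simp add: m_assoc inv_cancel_assoc)
        moreover have "h \<otimes> (g \<otimes> h) \<otimes> inv h \<in> M" using M.inv_op_closed2 hc m by simp
        moreover have "inv h \<in> H" using Hinv h by blast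
        ultimately show False using not by blast
      qed
      then show "h \<in> K" using h Mmem unfolding P_def by blast
    qed
    moreover have "M \<subseteq> P" unfolding P_def using M.subset by blast
    ultimately have "P = M" using M(2)[of P] M'(2) unfolding F_def by blast
    moreover have "g \<in> P" unfolding P_def using g gg by simp
    ultimately have "g \<in> M" by blast
    moreover have "g = \<one> \<otimes> g" using g by simp
    ultimately show False using not HK[OF Kin(1)] by blast
  qed
  define Y where "Y = {x \<otimes> m | m. m \<in> M \<and> m \<notin> K}"
  define S where "S = {x, y, w} \<union> Y"
  have XM: "u \<notin> M" "u \<in> H" "u \<in> carrier G" if "u \<in> {x, y, w}" for u
    using that Mmem Hxy Hw xK wK Hc by auto
  have YM: "u \<notin> M" "u \<notin> H" "u \<in> carrier G" "x \<otimes> u \<in> M" "u \<otimes> x \<in> M" if uY: "u \<in> Y" for u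
  proof -
    obtain m where m: "u = x \<otimes> m" "m \<in> M" "m \<notin> K" using uY unfolding Y_def by blast
    then have mc: "m \<in> carrier G" by simp
    show u: "u \<in> carrier G" using m x mc by simp
    show "u \<notin> M" using normal_mult_iff(2)[OF Mn m(2) x(1)] XM(1)[of x] m by simp
    show "u \<notin> H"
    proof
      assume "u \<in> H"
      then have "inv x \<otimes> u \<in> H" using Hmul Hinv Hxy by blast
      then have "m \<in> H" using m(1) x mc by (simp add: inv_cancel_assoc)
      then show False using Mmem m by blast
    qed
    have "x \<otimes> u = k \<otimes> m" using m(1) mc by (simp add: nf)
    moreover have "k \<in> M" using M'(2) by auto
    ultimately show "x \<otimes> u \<in> M" using m by simp
    then show "u \<otimes> x \<in> M" using normal_commute_iff[OF Mn x(1) u] by simp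
  qed
  have YY: "u \<otimes> v \<in> M" if "u \<in> Y" "v \<in> Y" for u v
  proof -
    have c: "u \<in> carrier G" "v \<in> carrier G" using YM that by auto
    have "(u \<otimes> x) \<otimes> (x \<otimes> v) \<in> M" using YM that by simp
    moreover have "(u \<otimes> x) \<otimes> (x \<otimes> v) = k \<otimes> (u \<otimes> v)" using c lc[of k u v] by (simp add: nf)
    moreover have "k \<in> M" using M'(2) by auto
    ultimately show ?thesis using normal_mult_iff(1)[OF Mn, of k "u \<otimes> v"] c by simp
  qed
  have YX: "u \<otimes> v \<notin> H" "u \<otimes> v \<notin> Y" "v \<otimes> u \<notin> H" "v \<otimes> u \<notin> Y" if uv: "u \<in> Y" "v \<in> {x, y, w}" for u v
  proof -
    note u = YM[OF uv(1)] and v = XM[OF uv(2)]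
    show "u \<otimes> v \<notin> H"
    proof
      assume "u \<otimes> v \<in> H"
      then have "(u \<otimes> v) \<otimes> inv v \<in> H" using Hmul Hinv v by blast
      then show False using u v by (simp add: m_assoc)
    qed
    show "v \<otimes> u \<notin> H"
    proof
      assume "v \<otimes> u \<in> H"
      then have "inv v \<otimes> (v \<otimes> u) \<in> H" using Hmul Hinv v by blast
      then show False using u v by (simp add: inv_cancel_assoc)
    qed
    have "(x \<otimes> u) \<otimes> v \<notin> M" using normal_mult_iff(1)[OF Mn u(4) v(3)] v(1) by simp
    then show "u \<otimes> v \<notin> Y" using YM(4)[of "u \<otimes> v"] x u v by (auto simp: m_assoc)
    have "v \<otimes> (u \<otimes> x) \<notin> M" using normal_mult_iff(2)[OF Mn u(5) v(3)] v(1) by simp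
    then show "v \<otimes> u \<notin> Y" using YM(5)[of "v \<otimes> u"] x u v by (auto simp: m_assoc)
  qed
  have prods: "x \<otimes> y = y \<otimes> x" "x \<otimes> x = k" "y \<otimes> y = l" "w \<otimes> w = k \<otimes> l" "x \<otimes> w = l \<otimes> y" "w \<otimes> x = l \<otimes> y"
    "y \<otimes> w = k \<otimes> x" "w \<otimes> y = k \<otimes> x"
    unfolding w_def by (simp_all add: nf)
  have neK: "n \<otimes> u \<noteq> m" if "n \<in> K" "m \<in> K" "u \<in> carrier G" "u \<notin> K" for n m u
    using that normal_mult_iff(1)[OF Kn] by blast
  have nexy: "n \<otimes> x \<noteq> y" "n \<otimes> y \<noteq> x" "n \<otimes> x \<noteq> w" "n \<otimes> y \<noteq> w" "n \<otimes> (x \<otimes> y) \<noteq> x" "n \<otimes> (x \<otimes> y) \<noteq> y" if n: "n \<in> K" for n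
  proof -
    have eqx: "x \<otimes> u \<noteq> x \<otimes> v \<Longrightarrow> u \<noteq> v" and eqy: "y \<otimes> u \<noteq> y \<otimes> v \<Longrightarrow> u \<noteq> v" for u v by auto
    show "n \<otimes> x \<noteq> y" by (rule eqx) (use n neK[of \<one> "n \<otimes> k" "x \<otimes> y"] xyK Kmul in \<open>simp add: nf\<close>)
    show "n \<otimes> y \<noteq> x" by (rule eqx) (use n neK[of n k "x \<otimes> y"] xyK Kmul in \<open>simp add: nf\<close>)
    show "n \<otimes> x \<noteq> w" unfolding w_def by (rule eqx) (use n neK[of "l" "n \<otimes> k" "y"] xK Kmul in \<open>simp add: nf\<close>)
    show "n \<otimes> y \<noteq> w" unfolding w_def by (rule eqy) (use n neK[of "k" "n \<otimes> l" "x"] xK Kmul in \<open>simp add: nf\<close>)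
    show "n \<otimes> (x \<otimes> y) \<noteq> x" by (rule eqx) (use n neK[of "n \<otimes> k" k y] xK Kmul in \<open>simp add: nf\<close>)
    show "n \<otimes> (x \<otimes> y) \<noteq> y" by (rule eqy) (use n neK[of "n \<otimes> l" l x] xK Kmul in \<open>simp add: nf\<close>)
  qed
  have XX: "u \<otimes> v \<in> {k, l, k \<otimes> l, y \<otimes> x, l \<otimes> y, k \<otimes> x}" if "u \<in> {x, y, w}" "v \<in> {x, y, w}" for u v
    using that prods by (elim insertE emptyE) simp_all
  have XXX: "u \<otimes> v \<notin> {x, y, w, l \<otimes> x}" "u \<otimes> v \<in> H" if uv: "u \<in> {x, y, w}" "v \<in> {x, y, w}" for u v
  proof -
    show "u \<otimes> v \<in> H" using Hmul XM uv by blast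
    have K1: "n \<notin> {x, y, w, l \<otimes> x}" if "n \<in> K" for n
      using that xK wK neK[of l n x] x(1) by auto
    have "y \<otimes> x \<noteq> w" unfolding w_def using klne(1) x(1) y(1) r_cancel_one'[of "x \<otimes> y" "k \<otimes> l"] by (auto simp: nf)
    moreover have "y \<otimes> x \<noteq> x" "y \<otimes> x \<noteq> y" using nexy(5,6)[of \<one>] x(1) y(1) xy by auto
    moreover have "y \<otimes> x \<noteq> l \<otimes> x" using xK(2) x(1) y(1) by auto
    moreover have "l \<otimes> y \<noteq> x" "l \<otimes> y \<noteq> w" using nexy by auto
    moreover have "l \<otimes> y \<noteq> y" using kl(4) y(1) by simp
    moreover have "l \<otimes> y \<noteq> l \<otimes> x" using nexy(1)[of \<one>] x(1) y(1) by auto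
    moreover have "k \<otimes> x \<noteq> y" "k \<otimes> x \<noteq> w" using nexy by auto
    moreover have "k \<otimes> x \<noteq> x" "k \<otimes> x \<noteq> l \<otimes> x" using kl(3,5) x(1) by simp_all
    ultimately show "u \<otimes> v \<notin> {x, y, w, l \<otimes> x}"
      using XX[OF uv] K1[of k] K1[of l] K1[OF Kmul[OF Kin(2,3)]] by (elim insertE emptyE) auto
  qed
  have S_cases: "u \<in> {x, y, w} \<or> u \<in> Y" if "u \<in> S" for u using that unfolding S_def by blast
  have pf: "product_free G S"
    unfolding product_free_iff
  proof (intro conjI ballI)
    show "S \<subseteq> carrier G" unfolding S_def using XM(3) YM(3) by blast
    show "S \<noteq> {}" unfolding S_def by blast
    fix u v assume "u \<in> S" "v \<in> S"
    then consider "u \<in> {x, y, w}" "v \<in> {x, y, w}" | "u \<in> {x, y, w}" "v \<in> Y" | "u \<in> Y" "v \<in> {x, y, w}" | "u \<in> Y" "v \<in> Y"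
      using S_cases by blast
    then show "u \<otimes> v \<notin> S"
    proof cases
      case 1 then show ?thesis using XXX[OF 1] YM(2) unfolding S_def by blast
    next
      case 2 then show ?thesis using YX(3,4)[OF 2(2,1)] XM(2) unfolding S_def by blast
    next
      case 3 then show ?thesis using YX(1,2)[OF 3] XM(2) unfolding S_def by blast
    next
      case 4 then show ?thesis using YY[OF 4] XM(1) YM(1) unfolding S_def by blast
    qed
  qed
  have lxc: "l \<otimes> x \<in> carrier G" using x(1) by simp
  have lxM: "l \<otimes> x \<notin> M" using normal_mult_iff(1)[OF Mn subsetD[OF M'(2) Kin(3)] x(1)] XM(1)[of x] by simp
  have lxH: "l \<otimes> x \<in> H" using Hmul HK Hxy by simp
  have TS: "t \<in> S" if T: "product_free G T" "S \<subseteq> T" "t \<in> T" for T t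
  proof (rule ccontr)
    assume tS: "t \<notin> S"
    note TD = product_freeD[OF T(1)]
    have tc: "t \<in> carrier G" using T TD by auto
    have inT: "x \<in> T" "y \<in> T" "w \<in> T" using T(2) unfolding S_def by auto
    have inY: "x \<otimes> m \<in> T" if "m \<in> M" "m \<notin> K" for m using T(2) that unfolding S_def Y_def by blast
    obtain h m where hm: "h \<in> H" "m \<in> M" "t = h \<otimes> m" using cover[OF tc] by blast
    show False
    proof (cases "m \<in> K")
      case True
      then have "t \<in> H" using hm Hmul HK by simp
      then obtain n where n: "n \<in> K" "t = n \<or> t = n \<otimes> x \<or> t = n \<otimes> y \<or> t = n \<otimes> (x \<otimes> y)" using Hcases by blast
      have n4: "n = \<one> \<or> n = k \<or> n = l \<or> n = k \<otimes> l" using n(1) unfolding K(2) by blast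
      \<comment> \<open>These identities write each nontrivial element of H outside {x, y, w} as a
        product u v, or as a t with t u = v, where u and v are among x, y, w.\<close>
      have eqs: "x \<otimes> x = k" "y \<otimes> y = l" "w \<otimes> w = k \<otimes> l" "y \<otimes> w = k \<otimes> x" "(l \<otimes> x) \<otimes> w = y" "((k \<otimes> l) \<otimes> x) \<otimes> y = w"
        "x \<otimes> w = l \<otimes> y" "(k \<otimes> y) \<otimes> w = x" "((k \<otimes> l) \<otimes> y) \<otimes> x = w" "x \<otimes> y = x \<otimes> y"
        "(k \<otimes> (x \<otimes> y)) \<otimes> x = y" "(l \<otimes> (x \<otimes> y)) \<otimes> y = x" "(k \<otimes> l) \<otimes> (x \<otimes> y) = w"
        unfolding w_def by (simp_all add: nf)
      have no: "u \<otimes> v \<noteq> t" "t \<otimes> u \<noteq> v" if "u \<in> T" "v \<in> T" for u v using TD(3) that T(3) by blast+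
      have "t \<noteq> \<one>" using TD(4) T(3) by blast
      moreover have "t \<noteq> x" "t \<noteq> y" "t \<noteq> w" using tS unfolding S_def by auto
      moreover have "t \<noteq> k" "t \<noteq> l" "t \<noteq> k \<otimes> l" "t \<noteq> k \<otimes> x" "t \<noteq> l \<otimes> y" "t \<noteq> x \<otimes> y"
        using no(1)[OF inT(1,1)] no(1)[OF inT(2,2)] no(1)[OF inT(3,3)] no(1)[OF inT(2,3)] no(1)[OF inT(1,3)] no(1)[OF inT(1,2)] eqs by auto
      moreover have "t \<noteq> l \<otimes> x" using no(2)[OF inT(3,2)] eqs(5) by auto
      moreover have "t \<noteq> (k \<otimes> l) \<otimes> x" using no(2)[OF inT(2,3)] eqs(6) by auto
      moreover have "t \<noteq> k \<otimes> y" using no(2)[OF inT(3,1)] eqs(8) by auto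
      moreover have "t \<noteq> (k \<otimes> l) \<otimes> y" using no(2)[OF inT(1,3)] eqs(9) by auto
      moreover have "t \<noteq> k \<otimes> (x \<otimes> y)" using no(2)[OF inT(1,2)] eqs(11) by auto
      moreover have "t \<noteq> l \<otimes> (x \<otimes> y)" using no(2)[OF inT(2,1)] eqs(12) by auto
      moreover have "t \<noteq> (k \<otimes> l) \<otimes> (x \<otimes> y)" using \<open>t \<noteq> w\<close> eqs(13) by auto
      ultimately show False using n4 n(2) x(1) y(1) by (elim disjE) simp_all
    next
      case False
      obtain n where n: "n \<in> K" "h = n \<or> h = n \<otimes> x \<or> h = n \<otimes> y \<or> h = n \<otimes> (x \<otimes> y)" using Hcases hm(1) by blast
      have mc: "m \<in> carrier G" using hm by simp
      have nM: "n' \<otimes> m \<in> M" "n' \<otimes> m \<notin> K" if "n' \<in> K" for n'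
      proof -
        show "n' \<otimes> m \<in> M" using that M'(2) hm(2) by auto
        show "n' \<otimes> m \<notin> K" using normal_mult_iff(1)[OF Kn that mc] False by simp
      qed
      have e: "t = x \<otimes> (n \<otimes> m)" if "h = n \<otimes> x" using that hm(3) n(1) mc by (simp add: nf)
      have "t \<in> Y" if "h = n \<otimes> x" using e[OF that] nM[OF n(1)] unfolding Y_def by blast
      then have "h \<noteq> n \<otimes> x" using tS unfolding S_def by blast
      \<comment> \<open>The three cosets of M other than that of x are obtained from x (M - K) by
        left multiplication with x, w and y, because x x = k, w x = l y and y x = x y.\<close>
      moreover have "h \<noteq> n"
      proof
        assume "h = n"
        then have "x \<otimes> (x \<otimes> ((k \<otimes> n) \<otimes> m)) = t" using hm(3) n(1) mc lc[OF n(1), of k] by (simp add: nf)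
        then show False using TD(3)[OF inT(1) inY[OF nM[OF Kmul[OF Kin(2) n(1)]]]] T(3) by simp
      qed
      moreover have "h \<noteq> n \<otimes> y"
      proof
        assume "h = n \<otimes> y"
        then have "w \<otimes> (x \<otimes> ((l \<otimes> n) \<otimes> m)) = t" using hm(3) n(1) mc lc[OF n(1), of k] unfolding w_def by (simp add: nf)
        then show False using TD(3)[OF inT(3) inY[OF nM[OF Kmul[OF Kin(3) n(1)]]]] T(3) by simp
      qed
      moreover have "h \<noteq> n \<otimes> (x \<otimes> y)"
      proof
        assume "h = n \<otimes> (x \<otimes> y)"
        then have "y \<otimes> (x \<otimes> (n \<otimes> m)) = t" using hm(3) n(1) mc by (simp add: nf)
        then show False using TD(3)[OF inT(2) inY[OF nM[OF n(1)]]] T(3) by simp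
      qed
      ultimately show False using n(2) by blast
    qed
  qed
  have gS: "l \<otimes> x \<notin> S"
  proof -
    have "l \<otimes> x \<noteq> x" using kl(4) x(1) by simp
    then show ?thesis using nexy YM(2) lxH unfolding S_def by auto
  qed
  have gSS: "l \<otimes> x \<noteq> u \<otimes> v" if uvS: "u \<in> S" "v \<in> S" for u v
  proof -
    consider "u \<in> {x, y, w}" "v \<in> {x, y, w}" | "u \<in> {x, y, w}" "v \<in> Y" | "u \<in> Y" "v \<in> {x, y, w}" | "u \<in> Y" "v \<in> Y"
      using S_cases uvS by blast
    then show ?thesis
    proof cases
      case 1 then show ?thesis using XXX(1)[OF 1] by auto
    next
      case 2 then show ?thesis using YX(3)[OF 2(2,1)] lxH by metis
    next
      case 3 then show ?thesis using YX(1)[OF 3] lxH by metis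
    next
      case 4 then show ?thesis using YY[OF 4] lxM by metis
    qed
  qed
  have "l \<otimes> x \<noteq> \<one>" using neK[of l \<one> x] x(1) xK by simp
  then show ?thesis by (rule not_filledI[OF fin pf lxc]) (use TS gS gSS in blast)+
qed

end

text \<open>The image is D8 with rotation h c and reflection h t, whereas c has order 8 and c^4 = z
  lies in the kernel. S consists of c^-1, of the coset of c c punctured at c c z = c^-2, and of the
  coset of t. In a product-free superset c^-1 remains alone in its coset and c c z stays out as the
  square of c^-1. But c z could only arise from c^-1 and c c z, in one of the two orders, so it is
  missed.\<close>

lemma (in group_hom) not_filled_dihedral_quotient:
  assumes fin: "finite (carrier G)"
    and c: "c \<in> carrier G" and t: "t \<in> carrier G" and z: "z \<in> carrier G" "h z = \<one>\<^bsub>H\<^esub>" "z \<noteq> \<one>" "z \<otimes> z = \<one>"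
    and c4: "(c \<otimes> c) \<otimes> (c \<otimes> c) = z"
    and tt: "h t \<otimes>\<^bsub>H\<^esub> h t = \<one>\<^bsub>H\<^esub>" and ctc: "h c \<otimes>\<^bsub>H\<^esub> (h t \<otimes>\<^bsub>H\<^esub> h c) = h t"
    and cc: "h (c \<otimes> c) \<noteq> \<one>\<^bsub>H\<^esub>"
    and tc: "h t \<noteq> \<one>\<^bsub>H\<^esub>" "h t \<noteq> h c" "h t \<noteq> h (c \<otimes> c)" "h t \<noteq> h (inv c)"
    and cover: "\<And>g. g \<in> carrier G \<Longrightarrow> \<exists>u\<in>{\<one>, c, c \<otimes> c, inv c}. h g = h u \<or> h g = h t \<otimes>\<^bsub>H\<^esub> h u"
  shows "\<not> filled G"
proof -
  let ?A = "h c" and ?B = "h t" and ?m = "\<lambda>a b. a \<otimes>\<^bsub>H\<^esub> b" and ?I = "inv\<^bsub>H\<^esub> h c" and ?e = "\<one>\<^bsub>H\<^esub>"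
  have Ac: "?A \<in> carrier H" "?B \<in> carrier H" "?I \<in> carrier H" using c t by auto
  have IA: "?m ?I ?A = ?e" "?m ?A ?I = ?e" "\<And>u. u \<in> carrier H \<Longrightarrow> ?m ?I (?m ?A u) = u" "\<And>u. u \<in> carrier H \<Longrightarrow> ?m ?A (?m ?I u) = u"
    using Ac H.inv_cancel_assoc by auto
  have A4: "?m ?A (?m ?A (?m ?A ?A)) = ?e"
  proof -
    have "h ((c \<otimes> c) \<otimes> (c \<otimes> c)) = ?e" using c4 z by simp
    then show ?thesis using c Ac by (simp add: H.m_assoc)
  qed
  have A3: "?m ?A (?m ?A ?A) = ?I" using A4 Ac by (metis H.inv_equality H.m_assoc H.m_closed)
  have AA: "?m ?A ?A \<noteq> ?e" using cc c by simp
  have II: "?m ?I ?I = ?m ?A ?A" using A3 Ac by (metis H.inv_cancel_assoc(1) H.m_closed IA(1) H.r_one)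
  have AI: "?A \<noteq> ?I" using AA IA by auto
  have A1: "?A \<noteq> ?e" using AA Ac by auto
  have A2: "?m ?A ?A \<noteq> ?A" using A1 Ac by simp
  have A2I: "?m ?A ?A \<noteq> ?I" using A3 A1 Ac by (metis A4 H.m_assoc H.m_closed H.r_cancel_one IA(1,2))
  have I1: "?I \<noteq> ?e" using A1 Ac H.inv_eq_1_iff by blast
  have B: "?B \<noteq> ?e" "?B \<noteq> ?A" "?B \<noteq> ?m ?A ?A" "?B \<noteq> ?I" using tc c by auto
  have AB: "?m ?A ?B = ?m ?B ?I" "?m ?I ?B = ?m ?B ?A" "\<And>u. u \<in> carrier H \<Longrightarrow> ?m ?A (?m ?B u) = ?m ?B (?m ?I u)"
    "\<And>u. u \<in> carrier H \<Longrightarrow> ?m ?I (?m ?B u) = ?m ?B (?m ?A u)"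
  proof -
    show 1: "?m ?A ?B = ?m ?B ?I"
      using ctc Ac by (metis H.inv_solve_right H.m_assoc H.m_closed)
    show 2: "?m ?I ?B = ?m ?B ?A"
      using ctc Ac IA by (metis H.m_closed)
    show "?m ?A (?m ?B u) = ?m ?B (?m ?I u)" if "u \<in> carrier H" for u using 1 Ac that by (metis H.m_assoc)
    show "?m ?I (?m ?B u) = ?m ?B (?m ?A u)" if "u \<in> carrier H" for u using 2 Ac that by (metis H.m_assoc)
  qed
  have BB: "?m ?B ?B = ?e" "\<And>u. u \<in> carrier H \<Longrightarrow> ?m ?B (?m ?B u) = u"
    using tt Ac by (auto simp: H.m_assoc[symmetric])
  have Bne: "?m ?B ?A \<noteq> ?e" "?m ?B ?I \<noteq> ?e" "?m ?B (?m ?A ?A) \<noteq> ?e" "?m ?B ?A \<noteq> ?A" "?m ?B ?A \<noteq> ?I" "?m ?B ?A \<noteq> ?m ?A ?A" "?m ?B ?A \<noteq> ?B"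
    "?m ?B ?I \<noteq> ?A" "?m ?B ?I \<noteq> ?I" "?m ?B ?I \<noteq> ?m ?A ?A" "?m ?B ?I \<noteq> ?B"
    "?m ?B (?m ?A ?A) \<noteq> ?A" "?m ?B (?m ?A ?A) \<noteq> ?I" "?m ?B (?m ?A ?A) \<noteq> ?m ?A ?A" "?m ?B (?m ?A ?A) \<noteq> ?B"
  proof -
    \<comment> \<open>An equation B u = v is turned into B = v w with w the inverse of u, so each
      inequality follows from those assumed for B.\<close>
    have s: "?m ?B u \<noteq> v" if "?B \<noteq> ?m v w" "?m u w = ?e" "u \<in> carrier H" "w \<in> carrier H" for u v w
      using that Ac by (metis H.m_assoc H.r_one)
    have IAA: "?m ?I (?m ?A ?A) = ?A" "?m ?A (?m ?A ?I) = ?A" "?m ?I ?I = ?m ?A ?A" "?m ?A (?m ?A (?m ?A ?A)) = ?e"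
      "?m ?A (?m ?A ?A) = ?I" using IA Ac II A4 A3 by auto
    have AA2: "?m (?m ?A ?A) (?m ?A ?A) = ?e" using A4 Ac by (simp add: H.m_assoc)
    show "?m ?B ?A \<noteq> ?e" "?m ?B ?A \<noteq> ?A" "?m ?B ?A \<noteq> ?I" "?m ?B ?A \<noteq> ?m ?A ?A"
      by - (rule s[where w="?I"]; use B Ac IA IAA in \<open>simp add: H.m_assoc\<close>)+
    show "?m ?B ?I \<noteq> ?e" "?m ?B ?I \<noteq> ?A" "?m ?B ?I \<noteq> ?I" "?m ?B ?I \<noteq> ?m ?A ?A"
      by - (rule s[where w="?A"]; use B Ac IA IAA in \<open>simp add: H.m_assoc\<close>)+
    show "?m ?B (?m ?A ?A) \<noteq> ?e" "?m ?B (?m ?A ?A) \<noteq> ?A" "?m ?B (?m ?A ?A) \<noteq> ?I" "?m ?B (?m ?A ?A) \<noteq> ?m ?A ?A"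
      by - (rule s[OF _ AA2]; use B Ac IAA(1,5) AA2 in simp)+
    show "?m ?B ?A \<noteq> ?B" "?m ?B ?I \<noteq> ?B" "?m ?B (?m ?A ?A) \<noteq> ?B" using A1 I1 AA Ac by simp_all
  qed
  note Qfacts = AA AI A1 A2 A2I I1 B Bne AI[symmetric] A1[symmetric] A2[symmetric] A2I[symmetric]
  have tab: "?m ?I (?m ?A ?A) = ?A" "?m ?I ?B = ?m ?B ?A" "?m (?m ?A ?A) ?I = ?A"
    "?m (?m ?A ?A) (?m ?A ?A) = ?e" "?m (?m ?A ?A) ?B = ?m ?B (?m ?A ?A)"
  proof -
    show "?m ?I (?m ?A ?A) = ?A" "?m ?I ?B = ?m ?B ?A" "?m (?m ?A ?A) ?I = ?A" "?m (?m ?A ?A) (?m ?A ?A) = ?e"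
      using IA AB A4 Ac by (simp_all add: H.m_assoc)
    have "?m (?m ?A ?A) ?B = ?m ?B (?m ?I ?I)" using AB(1,3) Ac by (simp add: H.m_assoc)
    then show "?m (?m ?A ?A) ?B = ?m ?B (?m ?A ?A)" unfolding II .
  qed
  have prod_cases: "?m a b \<in> {?A, ?e, ?m ?B ?A, ?m ?B ?I, ?m ?B (?m ?A ?A)} \<or> a = ?I \<and> b = ?I"
    "?m a b = ?A \<Longrightarrow> a = ?I \<and> b = ?m ?A ?A \<or> a = ?m ?A ?A \<and> b = ?I"
    if "a = ?I \<or> a = ?m ?A ?A \<or> a = ?B" "b = ?I \<or> b = ?m ?A ?A \<or> b = ?B" for a b
  proof -
    show "?m a b \<in> {?A, ?e, ?m ?B ?A, ?m ?B ?I, ?m ?B (?m ?A ?A)} \<or> a = ?I \<and> b = ?I"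
      using that by (elim disjE) (simp_all add: tab BB)
    show "a = ?I \<and> b = ?m ?A ?A \<or> a = ?m ?A ?A \<and> b = ?I" if "?m a b = ?A"
      using that \<open>a = ?I \<or> a = ?m ?A ?A \<or> a = ?B\<close> \<open>b = ?I \<or> b = ?m ?A ?A \<or> b = ?B\<close>
        tab BB(1) II Qfacts by metis
  qed
  define S where "S = {g \<in> carrier G. g = inv c \<or> (h g = ?m ?A ?A \<and> g \<noteq> (c \<otimes> c) \<otimes> z) \<or> h g = ?B}"
  have cz: "c \<otimes> z = z \<otimes> c" unfolding c4[symmetric] using c by (simp add: G.m_assoc)
  have czl: "c \<otimes> (z \<otimes> u) = z \<otimes> (c \<otimes> u)" if "u \<in> carrier G" for u using cz c z that by (simp add: G.m_assoc[symmetric])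
  have zzl: "z \<otimes> (z \<otimes> u) = u" if "u \<in> carrier G" for u using z that by (simp add: G.m_assoc[symmetric])
  have c4': "c \<otimes> (c \<otimes> (c \<otimes> c)) = z" using c4 c by (simp add: G.m_assoc)
  have ii: "inv c \<otimes> inv c = (c \<otimes> c) \<otimes> z"
  proof -
    have "(c \<otimes> c) \<otimes> ((c \<otimes> c) \<otimes> z) = \<one>" using c4 c z by (simp add: G.m_assoc[symmetric])
    then have "inv (c \<otimes> c) = (c \<otimes> c) \<otimes> z" using c z by (metis G.inv_equality G.inv_inv G.inv_unique' G.m_closed)
    then show ?thesis using c by (simp add: G.inv_mult_group)
  qed
  have ccS: "c \<otimes> c \<in> S" unfolding S_def using c z(1,3) by simp
  have icS: "inv c \<in> S" "t \<in> S" unfolding S_def using c t by auto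
  have hS: "h u = ?I \<and> u = inv c \<or> h u = ?m ?A ?A \<and> u \<noteq> (c \<otimes> c) \<otimes> z \<or> h u = ?B" "u \<in> carrier G" if "u \<in> S" for u
  proof -
    have "u = inv c \<or> h u = ?m ?A ?A \<and> u \<noteq> (c \<otimes> c) \<otimes> z \<or> h u = ?B" "u \<in> carrier G"
      using that unfolding S_def by blast+
    moreover have "h (inv c) = ?I" using c by simp
    ultimately show "h u = ?I \<and> u = inv c \<or> h u = ?m ?A ?A \<and> u \<noteq> (c \<otimes> c) \<otimes> z \<or> h u = ?B" "u \<in> carrier G"
      by metis+
  qed
  have Smem: "u \<in> S \<Longrightarrow> h u = ?I \<or> h u = ?m ?A ?A \<or> h u = ?B" for u using hS by blast
  have pf: "product_free G S"
    unfolding G.product_free_iff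
  proof (intro conjI ballI)
    show "S \<subseteq> carrier G" unfolding S_def by auto
    show "S \<noteq> {}" using ccS by auto
    fix u v assume uv: "u \<in> S" "v \<in> S"
    have m: "h (u \<otimes> v) = ?m (h u) (h v)" using uv hS(2) by simp
    show "u \<otimes> v \<notin> S"
    proof (cases "u = inv c \<and> v = inv c")
      case True
      have hz: "h ((c \<otimes> c) \<otimes> z) = ?m ?A ?A" using c z Ac by simp
      then have "(c \<otimes> c) \<otimes> z \<noteq> inv c" using A2I c by (metis hom_inv)
      then have "(c \<otimes> c) \<otimes> z \<notin> S" unfolding S_def using hz B(3) by auto
      then show ?thesis using True ii by simp
    next
      case False
      then have "\<not> (h (u \<otimes> v) = ?I \<or> h (u \<otimes> v) = ?m ?A ?A \<or> h (u \<otimes> v) = ?B)"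
        using prod_cases(1)[OF Smem[OF uv(1)] Smem[OF uv(2)]] hS(1)[OF uv(1)] hS(1)[OF uv(2)] Qfacts
        unfolding m by (metis (no_types, lifting) insert_iff empty_iff)
      then show ?thesis using Smem by blast
    qed
  qed
  have T: "h g = ?I \<and> g = inv c \<or> h g = ?m ?A ?A \<and> g \<noteq> (c \<otimes> c) \<otimes> z \<or> h g = ?B"
    if T: "product_free G T" "S \<subseteq> T" "g \<in> T" for T g
  proof -
    note TD = G.product_freeD[OF T(1)]
    have gc: "g \<in> carrier G" using T TD by auto
    have no: "u \<otimes> v \<noteq> g" "g \<otimes> u \<noteq> v" "u \<otimes> g \<noteq> v" if "u \<in> S" "v \<in> S" for u v using TD(3) that T(2,3) by blast+
    have inS: "u \<in> S" if "u \<in> carrier G" "h u = ?B" for u using that unfolding S_def by simp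
    have n1: "h g \<noteq> ?e" using no(3)[OF icS(2) inS[of "t \<otimes> g"]] t gc Ac by auto
    have n2: "h g \<noteq> ?m ?B ?A"
    proof
      assume "h g = ?m ?B ?A"
      then have "c \<otimes> g \<in> S" using c gc Ac AB IA by (intro inS) auto
      then show False using no(1)[OF icS(1), of "c \<otimes> g"] c gc by (simp add: G.inv_cancel_assoc)
    qed
    have n3: "h g \<noteq> ?m ?B ?I"
    proof
      assume "h g = ?m ?B ?I"
      then have "g \<otimes> c \<in> S" using c gc Ac AB IA by (intro inS) (auto simp: H.m_assoc)
      then show False using no(1)[OF _ icS(1), of "g \<otimes> c"] c gc by (simp add: G.m_assoc)
    qed
    have n4: "h g \<noteq> ?m ?B (?m ?A ?A)"
    proof
      assume "h g = ?m ?B (?m ?A ?A)"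
      then have "h (g \<otimes> inv (c \<otimes> c)) = ?B" using c gc Ac IA by (simp add: H.m_assoc G.inv_mult_group)
      then have "g \<otimes> inv (c \<otimes> c) \<in> S" using c gc by (intro inS) auto
      then show False using no(1)[OF _ ccS, of "g \<otimes> inv (c \<otimes> c)"] c gc by (simp add: G.m_assoc)
    qed
    \<comment> \<open>A second element g of the coset of c^-1 would give g c^-1 in the punctured
      coset of c c, since only g = c^-1 hits the puncture.\<close>
    have n5: "h g = ?I \<Longrightarrow> g = inv c"
    proof (rule ccontr)
      assume g: "h g = ?I" "g \<noteq> inv c"
      have "g \<otimes> inv c \<noteq> (c \<otimes> c) \<otimes> z"
      proof
        assume "g \<otimes> inv c = (c \<otimes> c) \<otimes> z"
        then have "g \<otimes> inv c = inv c \<otimes> inv c" using ii by simp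
        then show False using g(2) gc c by simp
      qed
      moreover have "h (g \<otimes> inv c) = ?m ?A ?A" using g gc c II by simp
      ultimately have "g \<otimes> inv c \<in> S" unfolding S_def using gc c by simp
      then show False using no(2)[OF icS(1)] by blast
    qed
    \<comment> \<open>The element c z is barred by its square (c z)(c z) = c c, and every other g
      over h c is the product of g c in S and c^-1.\<close>
    have n6: "h g \<noteq> ?A"
    proof
      assume g: "h g = ?A"
      show False
      proof (cases "g = c \<otimes> z")
        case True
        then have "g \<otimes> g = c \<otimes> c" using c z czl zzl by (simp add: G.m_assoc cz)
        then show False using TD(3)[OF T(3) T(3)] ccS T(2) by auto
      next
        case False
        have "g \<otimes> c \<noteq> (c \<otimes> c) \<otimes> z"
        proof
          assume "g \<otimes> c = (c \<otimes> c) \<otimes> z"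
          then have "g \<otimes> c = (c \<otimes> z) \<otimes> c" using c z czl cz by (simp add: G.m_assoc)
          then show False using False gc c z by simp
        qed
        then have "g \<otimes> c \<in> S" unfolding S_def using gc c g by simp
        then show False using no(1)[OF _ icS(1), of "g \<otimes> c"] c gc by (simp add: G.m_assoc)
      qed
    qed
    have n7: "g \<noteq> (c \<otimes> c) \<otimes> z" using no(1)[OF icS(1) icS(1)] ii by metis
    obtain u where "u \<in> {\<one>, c, c \<otimes> c, inv c}" "h g = h u \<or> h g = ?m ?B (h u)" using cover[OF gc] by blast
    then have "h g = ?e \<or> h g = ?A \<or> h g = ?m ?A ?A \<or> h g = ?I \<or> h g = ?B \<or> h g = ?m ?B ?A \<or> h g = ?m ?B (?m ?A ?A) \<or> h g = ?m ?B ?I"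
      using c Ac by auto
    then show ?thesis using n1 n2 n3 n4 n5 n6 n7 by blast
  qed
  show ?thesis
  proof (rule G.not_filledI[OF fin pf, of "c \<otimes> z"])
    show "c \<otimes> z \<in> carrier G" using c z by simp
    have hcz: "h (c \<otimes> z) = ?A" using c z Ac by simp
    then show "c \<otimes> z \<noteq> \<one>" using A1 by auto
    fix T' assume T': "product_free G T'" "S \<subseteq> T'"
    show "c \<otimes> z \<notin> T'" using T[OF T'] hcz Qfacts by metis
    fix u v assume uv: "u \<in> T'" "v \<in> T'"
    have uc: "u \<in> carrier G" "v \<in> carrier G" using uv G.product_freeD(1)[OF T'(1)] by auto
    show "c \<otimes> z \<noteq> u \<otimes> v"
    proof
      assume e: "c \<otimes> z = u \<otimes> v"
      have m: "?m (h u) (h v) = ?A" using e hcz uc by simp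
      have "u = inv c \<and> h v = ?m ?A ?A \<and> v \<noteq> (c \<otimes> c) \<otimes> z \<or> v = inv c \<and> h u = ?m ?A ?A \<and> u \<noteq> (c \<otimes> c) \<otimes> z"
        using T[OF T' uv(1)] T[OF T' uv(2)] prod_cases(2)[OF _ _ m] Qfacts by metis
      then show False
      proof
        assume a: "u = inv c \<and> h v = ?m ?A ?A \<and> v \<noteq> (c \<otimes> c) \<otimes> z"
        then have "c \<otimes> (c \<otimes> z) = v" using e c uc by (simp add: G.inv_cancel_assoc)
        then show False using a c z by (simp add: G.m_assoc)
      next
        assume a: "v = inv c \<and> h u = ?m ?A ?A \<and> u \<noteq> (c \<otimes> c) \<otimes> z"
        then have "(c \<otimes> z) \<otimes> c = u" using e c uc by (simp add: G.m_assoc)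
        then show False using a c z czl by (simp add: G.m_assoc cz)
      qed
    qed
  qed
qed

section \<open>Squares in a central subgroup of order two\<close>

text \<open>Z is a vector space over the field with two elements, and R is a hyperplane avoiding s.
  A subgroup maximal without s has index 2 in Z: if neither y nor s y were in it, y could be
  adjoined.\<close>

lemma (in group) central_complement:
  assumes fin: "finite (carrier G)" and Z: "subgroup Z G"
    and cen: "\<And>x g. x \<in> Z \<Longrightarrow> g \<in> carrier G \<Longrightarrow> g \<otimes> x = x \<otimes> g"
    and sq: "\<And>x. x \<in> Z \<Longrightarrow> x \<otimes> x = \<one>" and s: "s \<in> Z" "s \<noteq> \<one>"
  obtains R where "subgroup R G" "R \<subseteq> Z" "s \<notin> R" "Z = R \<union> (\<lambda>r. s \<otimes> r) ` R"
proof -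
  have Zc: "x \<in> carrier G" if "x \<in> Z" for x using subgroup.mem_carrier[OF Z that] .
  define F where "F = {R. subgroup R G \<and> R \<subseteq> Z \<and> s \<notin> R}"
  have "F \<subseteq> Pow (carrier G)" unfolding F_def using subgroup.subset by blast
  then have "finite F" using fin by (meson finite_Pow_iff finite_subset)
  moreover have "{\<one>} \<in> F" unfolding F_def using triv_subgroup subgroup.one_closed[OF Z] s(2) by auto
  ultimately obtain R where R: "R \<in> F" "\<And>P. P \<in> F \<Longrightarrow> R \<subseteq> P \<Longrightarrow> P = R"
    using finite_has_maximal[of F] by blast
  have R': "subgroup R G" "R \<subseteq> Z" "s \<notin> R" using R(1) unfolding F_def by auto
  have Rn: "R \<lhd> G"
  proof (rule subgroup_normalI[OF R'(1)])
    fix x h assume "x \<in> carrier G" "h \<in> R"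
    then show "x \<otimes> h \<otimes> inv x \<in> R" using cen[of h x] R'(2) Zc[of h] by (auto simp: m_assoc)
  qed
  have "y \<in> R \<or> s \<otimes> y \<in> R" if y: "y \<in> Z" for y
  proof (rule ccontr)
    assume not: "\<not> ?thesis"
    define P where "P = {p \<in> carrier G. p \<in> R \<or> y \<otimes> p \<in> R}"
    have P: "subgroup P G" unfolding P_def
      by (rule subgroup_extend_involution[OF Rn Zc[OF y]]) (simp add: sq[OF y] subgroup.one_closed[OF R'(1)])
    have yy: "y \<otimes> (y \<otimes> p) = p" if "p \<in> carrier G" for p using that sq[OF y] Zc[OF y] by (simp add: m_assoc[symmetric])
    have "P \<subseteq> Z"
    proof
      fix p assume "p \<in> P"
      then have "p \<in> Z \<or> y \<otimes> p \<in> Z" "p \<in> carrier G" using R'(2) unfolding P_def by auto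
      then show "p \<in> Z" using subgroup.m_closed[OF Z y] yy by metis
    qed
    moreover have "s \<notin> P"
    proof
      assume "s \<in> P"
      then have "y \<otimes> s \<in> R" using R'(3) unfolding P_def by blast
      then show False using not cen[OF s(1) Zc[OF y]] by simp
    qed
    moreover have "R \<subseteq> P" unfolding P_def using subgroup.subset[OF R'(1)] by blast
    ultimately have "P = R" using R(2) P unfolding F_def by blast
    moreover have "y \<in> P" unfolding P_def using Zc[OF y] sq[OF y] subgroup.one_closed[OF R'(1)] by simp
    ultimately show False using not by blast
  qed
  moreover have "s \<otimes> (s \<otimes> y) = y" if "y \<in> Z" for y
    using sq[OF s(1)] Zc[OF s(1)] Zc[OF that] by (simp add: m_assoc[symmetric])
  ultimately have "Z \<subseteq> R \<union> (\<lambda>r. s \<otimes> r) ` R" by (metis UnI1 UnI2 image_eqI subsetI)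
  moreover have "R \<union> (\<lambda>r. s \<otimes> r) ` R \<subseteq> Z" using R'(2) subgroup.m_closed[OF Z s(1)] by auto
  ultimately show thesis using that R' by blast
qed

section \<open>Squaring as a quadratic form\<close>

locale quadratic_group = group G for G (structure) +
  fixes z
  assumes fin: "finite (carrier G)"
    and z_closed [simp]: "z \<in> carrier G" and z_not_one: "z \<noteq> \<one>" and zz [simp]: "z \<otimes> z = \<one>"
    and z_central: "x \<in> carrier G \<Longrightarrow> x \<otimes> z = z \<otimes> x"
    and square: "x \<in> carrier G \<Longrightarrow> x \<otimes> x = \<one> \<or> x \<otimes> x = z"
begin

text \<open>The polar form and the quadratic form are encoded with opposite signs:
  \<open>com\<close> true means the value 0 of the commutator, while \<open>q\<close> true means the
  value 1 of squaring.\<close>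

definition com :: "'a \<Rightarrow> 'a \<Rightarrow> bool" where "com x y \<longleftrightarrow> x \<otimes> y = y \<otimes> x"

definition q :: "'a \<Rightarrow> bool" where "q x \<longleftrightarrow> x \<otimes> x = z"

lemma z_left: "x \<in> carrier G \<Longrightarrow> u \<in> carrier G \<Longrightarrow> x \<otimes> (z \<otimes> u) = z \<otimes> (x \<otimes> u)"
  using z_central[of x] by (simp add: m_assoc[symmetric])

lemma zz_left [simp]: "u \<in> carrier G \<Longrightarrow> z \<otimes> (z \<otimes> u) = u"
  by (simp add: m_assoc[symmetric])

lemma z_mult_neq [simp]: "u \<in> carrier G \<Longrightarrow> z \<otimes> u \<noteq> u"
  using z_not_one by simp

lemma square_if: "x \<in> carrier G \<Longrightarrow> x \<otimes> x = (if q x then z else \<one>)"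
  using square unfolding q_def by auto

lemma inv_if: "x \<in> carrier G \<Longrightarrow> inv x = (if q x then z \<otimes> x else x)"
  by (rule inv_equality) (auto simp: square_if m_assoc)

text \<open>Squares in {1, z} already force commutators into {1, z}: x y agrees up to z with its
  inverse y^-1 x^-1, and each of these inverses agrees up to z with the element itself.\<close>

lemma commutator_if:
  assumes x: "x \<in> carrier G" and y: "y \<in> carrier G"
  shows "x \<otimes> y = (if com x y then y \<otimes> x else z \<otimes> (y \<otimes> x))"
proof -
  have "x \<otimes> y = ((x \<otimes> y) \<otimes> (x \<otimes> y)) \<otimes> inv (x \<otimes> y)" using x y by (simp add: m_assoc)
  also have "inv (x \<otimes> y) = inv y \<otimes> inv x" using x y by (simp add: inv_mult_group)
  finally obtain s where s: "s = \<one> \<or> s = z" "x \<otimes> y = s \<otimes> (inv y \<otimes> inv x)"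
    using square[of "x \<otimes> y"] x y by auto
  obtain s1 where s1: "s1 = \<one> \<or> s1 = z" "inv y = s1 \<otimes> y" using inv_if[OF y] y by (metis l_one)
  obtain s2 where s2: "s2 = \<one> \<or> s2 = z" "inv x = s2 \<otimes> x" using inv_if[OF x] x by (metis l_one)
  have "x \<otimes> y = y \<otimes> x \<or> x \<otimes> y = z \<otimes> (y \<otimes> x)"
    using s(1) s1(1) s2(1) x y z_left[OF y x] unfolding s(2) s1(2) s2(2)
    by (elim disjE) (simp_all add: m_assoc)
  then show ?thesis unfolding com_def by auto
qed

lemma com_sym: "com x y \<longleftrightarrow> com y x"
  unfolding com_def by auto

lemma com_refl [simp]: "com x x"
  unfolding com_def by simp

lemma com_one [simp]: "x \<in> carrier G \<Longrightarrow> com x \<one>" "x \<in> carrier G \<Longrightarrow> com \<one> x"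
  unfolding com_def by simp_all

lemma com_z [simp]: "x \<in> carrier G \<Longrightarrow> com x z" "x \<in> carrier G \<Longrightarrow> com z x"
  unfolding com_def by (simp_all add: z_central)

text \<open>Additivity of the polar form in one argument; sums of bits become equivalences because
  \<open>com\<close> is the negated value.\<close>

lemma com_mult [simp]:
  assumes w: "w \<in> carrier G" and x: "x \<in> carrier G" and y: "y \<in> carrier G"
  shows "com w (x \<otimes> y) \<longleftrightarrow> (com w x \<longleftrightarrow> com w y)"
proof -
  have "w \<otimes> (x \<otimes> y) = (w \<otimes> x) \<otimes> y" using w x y by (simp add: m_assoc)
  also have "\<dots> = (if com w x then x \<otimes> (w \<otimes> y) else z \<otimes> (x \<otimes> (w \<otimes> y)))"
    using w x y by (simp add: commutator_if[OF w x] m_assoc)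
  also have "\<dots> = (if com w x \<longleftrightarrow> com w y then x \<otimes> y \<otimes> w else z \<otimes> (x \<otimes> y \<otimes> w))"
    using w x y z_left[OF x, of "y \<otimes> w"] by (simp add: commutator_if[OF w y] m_assoc)
  finally have e: "w \<otimes> (x \<otimes> y) = (if com w x \<longleftrightarrow> com w y then x \<otimes> y \<otimes> w else z \<otimes> (x \<otimes> y \<otimes> w))" .
  then show ?thesis unfolding com_def[of w "x \<otimes> y"] using w x y z_mult_neq[of "x \<otimes> y \<otimes> w"] by (auto split: if_splits)
qed

lemma com_mult_left [simp]:
  assumes "w \<in> carrier G" "x \<in> carrier G" "y \<in> carrier G"
  shows "com (x \<otimes> y) w \<longleftrightarrow> (com x w \<longleftrightarrow> com y w)"
  using com_mult[OF assms] com_sym by simp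

lemma com_inv [simp]:
  assumes "w \<in> carrier G" "x \<in> carrier G"
  shows "com w (inv x) \<longleftrightarrow> com w x" "com (inv x) w \<longleftrightarrow> com x w"
  using assms com_sym[of _ w] by (auto simp: inv_if)

text \<open>The polarization identity q(x y) = q(x) + q(y) + [x, y] with exclusive or as addition;
  the negation in \<open>com\<close> accounts for the inner equality.\<close>

lemma q_mult [simp]:
  assumes x: "x \<in> carrier G" and y: "y \<in> carrier G"
  shows "q (x \<otimes> y) \<longleftrightarrow> (q x \<noteq> (q y = com x y))"
proof -
  have yx: "y \<otimes> x = (if com x y then x \<otimes> y else z \<otimes> (x \<otimes> y))"
    using commutator_if[OF y x] com_sym by simp
  have "(x \<otimes> y) \<otimes> (x \<otimes> y) = x \<otimes> ((y \<otimes> x) \<otimes> y)" using x y by (simp add: m_assoc)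
  also have "\<dots> = (if com x y then \<one> else z) \<otimes> ((x \<otimes> x) \<otimes> (y \<otimes> y))"
    unfolding yx using x y z_left[OF x, of "x \<otimes> (y \<otimes> y)"] by (simp add: m_assoc)
  also have "\<dots> = (if com x y then \<one> else z) \<otimes> ((if q x then z else \<one>) \<otimes> (if q y then z else \<one>))"
    using x y by (simp add: square_if)
  finally show ?thesis unfolding q_def[of "x \<otimes> y"] using z_not_one by (auto split: if_splits)
qed

lemma q_inv [simp]: "x \<in> carrier G \<Longrightarrow> q (inv x) \<longleftrightarrow> q x"
  by (auto simp: inv_if) (simp_all add: q_def z_not_one[symmetric])

lemma q_simps [simp]: "\<not> q \<one>" "\<not> q z"
  using z_not_one unfolding q_def by auto

definition central :: "'a \<Rightarrow> bool" where "central c \<longleftrightarrow> c \<in> carrier G \<and> (\<forall>x\<in>carrier G. com c x)"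

lemma centralD: "central c \<Longrightarrow> c \<in> carrier G" "central c \<Longrightarrow> x \<in> carrier G \<Longrightarrow> com c x"
  unfolding central_def by auto

lemma subgroup_central: "subgroup {c. central c} G"
  by (rule subgroupI) (auto simp: central_def intro: exI[of _ \<one>])

lemma filled_central:
  assumes f: "filled G" and c: "central c"
  shows "\<not> q c"
proof
  assume "q c"
  then have "\<not> filled G"
    using not_filled_central_square_root[OF fin z_closed z_not_one square zz, of c] centralD[OF c]
    unfolding q_def com_def by blast
  then show False using f by blast
qed

text \<open>i and j generate Q8. Let E be the set of elements with \<open>q\<close> that commute
  with both. If every e in E had a partner in E not commuting with it, then z together with j C0 and
  k C0, where k = i j and C0 is a transversal of E modulo z, would block j. Indeed, bilinearity
  shows that in j = u v with u and v of square 1 one factor commutes with i and not with j, so it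
  lies in i E; and i e is barred because e can be written as a product of two elements of E.\<close>

lemma filled_quaternion_pair:
  assumes f: "filled G" and ij: "i \<in> carrier G" "j \<in> carrier G" "q i" "q j" "\<not> com i j"
  obtains e where "e \<in> carrier G" "com i e" "com j e" "q e"
    "\<forall>x\<in>carrier G. com i x \<longrightarrow> com j x \<longrightarrow> q x \<longrightarrow> com x e"
proof -
  have "\<not> filled G" if *: "\<And>e. e \<in> carrier G \<Longrightarrow> com i e \<Longrightarrow> com j e \<Longrightarrow> q e \<Longrightarrow>
      \<exists>x\<in>carrier G. com i x \<and> com j x \<and> q x \<and> \<not> com x e"
  proof -
    define E where "E = {e \<in> carrier G. com i e \<and> com j e \<and> q e}"
    \<comment> \<open>\<open>pick\<close> sees only the unordered pair {x, z x}, hence makes the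
      same choice for x and for z x.\<close>
    define pick :: "'a set \<Rightarrow> 'a" where "pick A = (SOME u. u \<in> A)" for A
    define C0 where "C0 = {x \<in> E. x = pick {x, z \<otimes> x}}"
    let ?k = "i \<otimes> j"
    have zE: "z \<otimes> x \<in> E" if "x \<in> E" for x using that ij unfolding E_def by auto
    have Ec: "x \<in> carrier G" if "x \<in> E" for x using that unfolding E_def by auto
    have XE: "x \<in> E" if "x \<in> C0" for x using that unfolding C0_def by auto
    have swap: "{z \<otimes> x, z \<otimes> (z \<otimes> x)} = {x, z \<otimes> x}" if "x \<in> E" for x using Ec[OF that] by auto
    have X1: "x \<in> C0 \<or> z \<otimes> x \<in> C0" if x: "x \<in> E" for x
    proof -
      have "pick {x, z \<otimes> x} \<in> {x, z \<otimes> x}" unfolding pick_def by (rule someI[of _ x]) blast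
      then show ?thesis
      proof
        assume "pick {x, z \<otimes> x} \<in> {z \<otimes> x}"
        then have "z \<otimes> x = pick {z \<otimes> x, z \<otimes> (z \<otimes> x)}" unfolding swap[OF x] by simp
        then show ?thesis using zE[OF x] unfolding C0_def by blast
      qed (use x C0_def in auto)
    qed
    have X2: "z \<otimes> x \<notin> C0" if x: "x \<in> C0" for x
    proof
      assume "z \<otimes> x \<in> C0"
      then have "z \<otimes> x = pick {x, z \<otimes> x}" using swap[OF XE[OF x]] unfolding C0_def by auto
      moreover have "x = pick {x, z \<otimes> x}" using x unfolding C0_def by blast
      ultimately show False using z_mult_neq[OF Ec[OF XE[OF x]]] by metis
    qed
    define S where "S = {z} \<union> (\<lambda>x. j \<otimes> x) ` C0 \<union> (\<lambda>x. ?k \<otimes> x) ` C0"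
    have kc: "?k \<in> carrier G" using ij by simp
    have cji: "\<not> com j i" using ij com_sym by blast
    note E_simps = E_def
    have iE: "com i x" "com j x" "com x i" "com x j" "q x" "x \<in> carrier G" if "x \<in> C0" for x
      using XE[OF that] com_sym unfolding E_def by auto
    \<comment> \<open>Elements are sorted by commutation with i and j: z commutes with both, j x
      only with j, and k x with neither. The fourth type, commuting with i only, is absent from
      S.\<close>
    have types: "com i (j \<otimes> x) = False" "com j (j \<otimes> x) = True" "com i (?k \<otimes> x) = False" "com j (?k \<otimes> x) = False"
      "j \<otimes> x \<in> carrier G" "?k \<otimes> x \<in> carrier G"
      if "x \<in> C0" for x using iE[OF that] ij cji by auto
    have S_cases: "u = z \<or> (\<exists>x\<in>C0. u = j \<otimes> x) \<or> (\<exists>x\<in>C0. u = ?k \<otimes> x)" if "u \<in> S" for u using that unfolding S_def by blast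
    have Sc: "u \<in> carrier G" if "u \<in> S" for u using S_cases[OF that] types(5,6) by auto
    have S_type: "com i u \<and> com j u \<Longrightarrow> u = z" "\<not> (com i u \<and> \<not> com j u)" "\<not> com i u \<and> com j u \<Longrightarrow> \<exists>x\<in>C0. u = j \<otimes> x"
      "\<not> com i u \<and> \<not> com j u \<Longrightarrow> \<exists>x\<in>C0. u = ?k \<otimes> x" if "u \<in> S" for u
      using S_cases[OF that] types ij(1,2) by auto
    have qk: "q ?k" using ij by simp
    \<comment> \<open>(w x)(w y) = z x y equals z only for y = x^-1 = z x, and C0 never contains
      both x and z x.\<close>
    have pairz: "u \<otimes> v \<noteq> z" if "w \<in> carrier G" "q w" "x \<in> C0" "y \<in> C0" "com w x" "u = w \<otimes> x" "v = w \<otimes> y" for u v w x y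
    proof
      assume e: "u \<otimes> v = z"
      have xy: "x \<in> carrier G" "y \<in> carrier G" using iE that by auto
      have "u \<otimes> v = (w \<otimes> w) \<otimes> (x \<otimes> y)"
        using that xy commutator_if[of x w] com_sym by (simp add: m_assoc) (metis m_assoc)
      then have "z \<otimes> (x \<otimes> y) = z \<otimes> \<one>" using that e xy by (simp add: square_if)
      then have "x \<otimes> y = \<one>" using xy by (metis l_cancel m_closed one_closed z_closed)
      then have "y = z \<otimes> x" using xy iE(5)[OF that(3)] inv_if[of x] by (metis inv_comm inv_equality)
      then show False using X2 that by blast
    qed
    have pf: "product_free G S"
      unfolding product_free_iff
    proof (intro conjI ballI)
      show "S \<subseteq> carrier G" "S \<noteq> {}" using Sc unfolding S_def by auto
      fix u v assume uv: "u \<in> S" "v \<in> S"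
      note c = Sc[OF uv(1)] Sc[OF uv(2)]
      show "u \<otimes> v \<notin> S"
      proof
        assume w: "u \<otimes> v \<in> S"
        have zcase: False if zs: "z \<otimes> s \<in> S" "s \<in> S" for s
        proof -
          have sc: "s \<in> carrier G" using Sc zs by blast
          have inj: "w \<otimes> x = z \<otimes> (w \<otimes> y) \<Longrightarrow> x = z \<otimes> y" if "w \<in> carrier G" "x \<in> carrier G" "y \<in> carrier G" for w x y
            using that z_left[of w y] by (metis l_cancel m_closed z_closed)
          consider "s = z" | x where "x \<in> C0" "s = j \<otimes> x" | x where "x \<in> C0" "s = ?k \<otimes> x" using S_cases \<open>s \<in> S\<close> by blast
          then show False
          proof cases
            case 1
            then have "\<one> \<in> S" using zs by simp
            then show False using S_type(1)[of \<one>] ij z_not_one by simp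
          next
            case 2
            then obtain y where "y \<in> C0" "z \<otimes> s = j \<otimes> y" using S_type(3)[OF zs(1)] types[OF 2(1)] ij sc by auto
            then show False using inj[of j y x] 2 iE ij X2 by metis
          next
            case 3
            then obtain y where "y \<in> C0" "z \<otimes> s = ?k \<otimes> y" using S_type(4)[OF zs(1)] types[OF 3(1)] ij sc by auto
            then show False using inj[of ?k y x] 3 iE kc X2 by metis
          qed
        qed
        consider "u = z" | "v = z" | x y where "x \<in> C0" "y \<in> C0" "u = j \<otimes> x" "v = j \<otimes> y"
          | x y where "x \<in> C0" "y \<in> C0" "u = ?k \<otimes> x" "v = ?k \<otimes> y"
          | x y where "x \<in> C0" "y \<in> C0" "u = j \<otimes> x \<and> v = ?k \<otimes> y \<or> u = ?k \<otimes> x \<and> v = j \<otimes> y"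
          using S_cases[OF uv(1)] S_cases[OF uv(2)] by blast
        then show False
        proof cases
          case 1 then show False using zcase w uv by blast
        next
          case 2 then show False using zcase[of u] w uv z_central c by simp
        next
          case 3
          have "u \<otimes> v = z" using S_type(1)[OF w] types[OF 3(1)] types[OF 3(2)] 3(3,4) ij(1,2) by simp
          then show False using pairz[OF ij(2,4) 3(1,2) iE(2)[OF 3(1)] 3(3,4)] by blast
        next
          case 4
          have "u \<otimes> v = z" using S_type(1)[OF w] types[OF 4(1)] types[OF 4(2)] 4(3,4) ij(1,2) by simp
          moreover have "com ?k x" using iE[OF 4(1)] ij by simp
          ultimately show False using pairz[OF kc qk 4(1,2) _ 4(3,4)] by blast
        next
          case 5
          have "com i (u \<otimes> v) \<and> \<not> com j (u \<otimes> v)" using types[OF 5(1)] types[OF 5(2)] 5(3) ij(1,2) by auto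
          then show False using S_type(2)[OF w] by blast
        qed
      qed
    qed
    have jc: "j \<noteq> \<one>" using ij by auto
    have T: "j \<notin> T" "\<And>x y. x \<in> T \<Longrightarrow> y \<in> T \<Longrightarrow> j \<noteq> x \<otimes> y" if T: "product_free G T" "S \<subseteq> T" for T
    proof -
      note TD = product_freeD[OF T(1)]
      have "z \<in> T" using T(2) unfolding S_def by blast
      then have nq: "\<not> q t" if "t \<in> T" for t using TD(3)[OF that that] unfolding q_def by auto
      show "j \<notin> T" using nq ij by blast
      have bar: "i \<otimes> e \<notin> T" if e: "e \<in> E" for e
      proof -
        have ec: "e \<in> carrier G" using Ec[OF e] .
        obtain x where x: "x \<in> E" "\<not> com x e" using *[OF ec] e unfolding E_def by blast
        obtain x' where x': "x' \<in> C0" "\<not> com x' e" using X1[OF x(1)] x ec Ec[OF x(1)] by auto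
        \<comment> \<open>\<open>?y\<close> has \<open>q\<close> because x' and e do not commute: 1
          + 1 + 1 = 1. Both x' y = e and (z y) x' = e hold, so it does not matter whether C0
          contains y or z y.\<close>
        let ?y = "inv x' \<otimes> e"
        have x'E: "x' \<in> E" using XE x' by blast
        have x'c: "x' \<in> carrier G" using Ec x'E by blast
        have "com x' e = False" using x' by simp
        then have yE: "?y \<in> E" using x'E e ij(1,2) ec x'c unfolding E_def by simp
        have yc: "?y \<in> carrier G" using ec x'c by simp
        have ex: "x' \<otimes> ?y = e" using ec x'c by (simp add: inv_cancel_assoc)
        have yx: "?y \<otimes> x' = z \<otimes> e"
          using commutator_if[OF yc x'c] x' ec x'c ex by (auto simp: com_sym[of e x'])
        have jk: "j \<otimes> ?k = i"
        proof -
          have "j \<otimes> (i \<otimes> j) = (j \<otimes> i) \<otimes> j" using ij by (simp add: m_assoc)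
          also have "\<dots> = z \<otimes> (i \<otimes> (j \<otimes> j))" using commutator_if[OF ij(2,1)] cji ij by (simp add: m_assoc)
          also have "\<dots> = i" using ij z_central[of i] by (simp add: square_if)
          finally show ?thesis .
        qed
        have prod: "(j \<otimes> u) \<otimes> (?k \<otimes> v) = i \<otimes> (u \<otimes> v)" if "u \<in> C0" "v \<in> carrier G" for u v
        proof -
          have "u \<otimes> ?k = ?k \<otimes> u" using iE[OF that(1)] kc ij unfolding com_def[symmetric] by simp
          then have "(j \<otimes> u) \<otimes> (?k \<otimes> v) = (j \<otimes> ?k) \<otimes> (u \<otimes> v)"
            using iE(6)[OF that(1)] that(2) kc ij(2) by (metis m_assoc m_closed)
          then show ?thesis using jk by simp
        qed
        have jX: "j \<otimes> u \<in> T" "?k \<otimes> u \<in> T" if "u \<in> C0" for u using that T(2) unfolding S_def by auto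
        from X1[OF yE] show ?thesis
        proof
          assume "?y \<in> C0"
          then show ?thesis using TD(3)[OF jX(1)[OF x'(1)] jX(2)] prod[OF x'(1) yc] ex by metis
        next
          assume zy: "z \<otimes> ?y \<in> C0"
          have "(z \<otimes> ?y) \<otimes> x' = e" using yx yc x'c ec by (simp add: m_assoc)
          then show ?thesis using TD(3)[OF jX(1)[OF zy] jX(2)[OF x'(1)]] prod[OF zy x'c] by metis
        qed
      qed
      fix u v assume uv: "u \<in> T" "v \<in> T"
      have c: "u \<in> carrier G" "v \<in> carrier G" using uv TD by auto
      \<comment> \<open>If t commutes with i only, then i^-1 t lies in E, so t has the barred form i
        e.\<close>
      have key: "\<not> (com i t \<and> \<not> com j t)" if "t \<in> T" for t
      proof
        assume t: "com i t \<and> \<not> com j t"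
        have tc: "t \<in> carrier G" using that TD by blast
        have "inv i \<otimes> t \<in> E" using t tc ij nq[OF that] com_sym cji unfolding E_def by simp
        from bar[OF this] show False using that tc ij by (simp add: inv_cancel_assoc)
      qed
      show "j \<noteq> u \<otimes> v"
      proof
        assume e: "j = u \<otimes> v"
        have "q (u \<otimes> v)" using e ij by simp
        then have "\<not> com u v" using nq[OF uv(1)] nq[OF uv(2)] c by simp
        moreover have "com j u = com u v" using e c com_sym[of v u] by simp
        moreover have "com j v = com u v" using e c by simp
        moreover have "com i u \<noteq> com i v" using ij e c com_mult[OF ij(1) c] by simp
        ultimately show False using key[OF uv(1)] key[OF uv(2)] by blast
      qed
    qed
    show ?thesis by (rule not_filledI[OF fin pf ij(2) jc]) (use T in auto)
  qed
  then obtain e where "e \<in> carrier G" "com i e" "com j e" "q e"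
    "\<forall>x\<in>carrier G. com i x \<longrightarrow> com j x \<longrightarrow> q x \<longrightarrow> com x e" using f by blast
  then show thesis using that by blast
qed

end

section \<open>Orthogonal splittings forced by filledness, and a criterion for filledness\<close>

context quadratic_group
begin

text \<open>On the centralizer of D the quadratic form vanishes, hence so does its polar form, and
  this centralizer is abelian. By \<open>cover\<close>, every g differs from an element of the
  centralizer by a w that commutes with all of the centralizer; so commuting passes on to all of
  G.\<close>

lemma centralizer_central:
  assumes D: "D \<subseteq> carrier G"
    and nq: "\<And>f. f \<in> carrier G \<Longrightarrow> \<forall>d\<in>D. com d f \<Longrightarrow> \<not> q f"
    and cover: "\<And>g. g \<in> carrier G \<Longrightarrow> \<exists>w\<in>carrier G. (\<forall>f\<in>carrier G. (\<forall>d\<in>D. com d f) \<longrightarrow> com f w) \<and> (\<forall>d\<in>D. com d (w \<otimes> g))"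
    and f: "f \<in> carrier G" "\<forall>d\<in>D. com d f"
  shows "central f"
  unfolding central_def
proof (intro conjI ballI f(1))
  fix g assume g: "g \<in> carrier G"
  obtain w where w: "w \<in> carrier G" "com f w" "\<forall>d\<in>D. com d (w \<otimes> g)" using cover[OF g] f by blast
  have dc: "d \<in> carrier G" if "d \<in> D" for d using D that by blast
  have wg: "w \<otimes> g \<in> carrier G" using w g by simp
  have "\<not> q (w \<otimes> g)" "\<not> q f" using nq w(3) wg f by blast+
  moreover have "\<not> q (f \<otimes> (w \<otimes> g))" using nq[of "f \<otimes> (w \<otimes> g)"] w(3) wg f dc by simp
  ultimately have "com f (w \<otimes> g)" using wg f(1) q_mult[OF f(1) wg] by blast
  then show "com f g" using w g f(1) by simp
qed

text \<open>A non-commuting pair spans a nondegenerate plane, and such a plane splits off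
  orthogonally.\<close>

lemma exists_commuting_translate:
  assumes "u \<in> carrier G" "v \<in> carrier G" "\<not> com u v" "g \<in> carrier G"
  shows "\<exists>w\<in>{\<one>, u, v, u \<otimes> v}. com u (w \<otimes> g) \<and> com v (w \<otimes> g)"
  using assms com_sym[of v u] by (cases "com u g"; cases "com v g"; simp)

text \<open>Two non-commuting elements i and j of order 4 span an anisotropic plane. The element e
  of \<open>filled_quaternion_pair\<close> is not central, so some a orthogonal to i and j pairs
  nontrivially with it, and a, a e span a hyperbolic plane orthogonal to the first; this is the
  minus type. If all elements of order 4 commute, a hyperbolic plane alone is found. In both cases
  filledness or the choice of e makes the form vanish on the orthogonal complement, which is
  therefore the radical.\<close>

lemma filled_structure:
  assumes f: "filled G" and nonab: "x0 \<in> carrier G" "y0 \<in> carrier G" "\<not> com x0 y0"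
  obtains a b where "a \<in> carrier G" "b \<in> carrier G" "\<not> q a" "\<not> q b" "\<not> com a b"
      "\<And>g. g \<in> carrier G \<Longrightarrow> com a g \<Longrightarrow> com b g \<Longrightarrow> central g"
  | a b i j where "a \<in> carrier G" "b \<in> carrier G" "\<not> q a" "\<not> q b" "\<not> com a b"
      "i \<in> carrier G" "j \<in> carrier G" "q i" "q j" "\<not> com i j" "com a i" "com a j" "com b i" "com b j"
      "\<And>g. g \<in> carrier G \<Longrightarrow> com a g \<Longrightarrow> com b g \<Longrightarrow> com i g \<Longrightarrow> com j g \<Longrightarrow> central g"
proof -
  have sym: "com u v \<longleftrightarrow> com v u" for u v by (rule com_sym)
  show thesis
  proof (cases "\<exists>i\<in>carrier G. \<exists>j\<in>carrier G. q i \<and> q j \<and> \<not> com i j")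
    case True
    then obtain i j where ij: "i \<in> carrier G" "j \<in> carrier G" "q i" "q j" "\<not> com i j" by blast
    obtain e where e': "e \<in> carrier G" "com i e" "com j e" "q e"
      "\<forall>x\<in>carrier G. com i x \<longrightarrow> com j x \<longrightarrow> q x \<longrightarrow> com x e"
      by (rule filled_quaternion_pair[OF f ij])
    then have e: "e \<in> carrier G" "com i e" "com j e" "q e"
      "\<And>x. x \<in> carrier G \<Longrightarrow> com i x \<Longrightarrow> com j x \<Longrightarrow> q x \<Longrightarrow> com x e" by blast+
    have "\<not> central e" using filled_central[OF f] e(4) by blast
    then obtain g where g: "g \<in> carrier G" "\<not> com e g" using e(1) unfolding central_def by blast
    obtain w where w: "w \<in> {\<one>, i, j, i \<otimes> j}" "com i (w \<otimes> g)" "com j (w \<otimes> g)" using exists_commuting_translate[OF ij(1,2,5) g(1)] by blast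
    have wc: "w \<in> carrier G" using w(1) ij by auto
    have ew: "com e w" using w(1) ij e sym[of e] by auto
    \<comment> \<open>a commutes with i and j but not with e, so \<open>q\<close> fails for a by the
      choice of e, and it fails for a e as 0 + 1 + 1 = 0.\<close>
    let ?a = "w \<otimes> g" let ?b = "?a \<otimes> e"
    have ac: "?a \<in> carrier G" using wc g by simp
    have ea: "\<not> com e ?a" "\<not> com ?a e" using ew wc g e(1) sym[of ?a e] by auto
    have qa: "\<not> q ?a" using e(5)[OF ac w(2,3)] ea by blast
    have bc: "?b \<in> carrier G" using ac e by simp
    have qb: "\<not> q ?b" using qa ea e ac by simp
    have ab: "\<not> com ?a ?b" using ea ac e by simp
    have abij: "com ?a i" "com ?a j" "com ?b i" "com ?b j"
    proof -
      show "com ?a i" "com ?a j" using w sym by blast+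
      then show "com ?b i" "com ?b j" using ac e ij sym[of e] by simp_all
    qed
    have cen: "central u" if u: "u \<in> carrier G" "com ?a u" "com ?b u" "com i u" "com j u" for u
    proof (rule centralizer_central[of "{?a, ?b, i, j}"])
      show "{?a, ?b, i, j} \<subseteq> carrier G" using ac bc ij by simp
      show "\<not> q v" if "v \<in> carrier G" "\<forall>d\<in>{?a, ?b, i, j}. com d v" for v
      proof
        \<comment> \<open>v commutes with e, which is a^-1 b. The element a v also has
          \<open>q\<close> and commutes with i and j, so it commutes with e as well, and then a
          would commute with e.\<close>
        assume qv: "q v"
        have c: "com ?a v" "com ?b v" "com i v" "com j v" using that(2) by blast+
        then have "com e v" using that(1) ac e(1) by simp
        have "q (?a \<otimes> v)" using qa qv c(1) ac that(1) q_mult by blast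
        moreover have "com i (?a \<otimes> v)" "com j (?a \<otimes> v)" using c(3,4) abij(1,2) ij ac that(1) sym by (simp_all)
        ultimately have "com (?a \<otimes> v) e" using e(5) ac that(1) by blast
        then have "com ?a e" using \<open>com e v\<close> ac that(1) e(1) sym[of v e] by simp
        then show False using ea by blast
      qed
      show "\<exists>w\<in>carrier G. (\<forall>f\<in>carrier G. (\<forall>d\<in>{?a, ?b, i, j}. com d f) \<longrightarrow> com f w) \<and> (\<forall>d\<in>{?a, ?b, i, j}. com d (w \<otimes> g'))"
        if g': "g' \<in> carrier G" for g'
      proof -
        obtain w1 where w1: "w1 \<in> {\<one>, ?a, ?b, ?a \<otimes> ?b}" "com ?a (w1 \<otimes> g')" "com ?b (w1 \<otimes> g')"
          using exists_commuting_translate[OF ac bc ab g'] by blast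
        have w1c: "w1 \<in> carrier G" using w1(1) ac bc by auto
        obtain w2 where w2: "w2 \<in> {\<one>, i, j, i \<otimes> j}" "com i (w2 \<otimes> (w1 \<otimes> g'))" "com j (w2 \<otimes> (w1 \<otimes> g'))"
          using exists_commuting_translate[OF ij(1,2,5) m_closed[OF w1c g']] by blast
        have w2c: "w2 \<in> carrier G" using w2(1) ij by auto
        have "com ?a w2" "com ?b w2" using w2(1) abij ij ac bc by (auto simp del: com_mult_left)
        then have "com ?a (w2 \<otimes> (w1 \<otimes> g'))" "com ?b (w2 \<otimes> (w1 \<otimes> g'))"
          using w1(2,3) com_mult[OF ac w2c, of "w1 \<otimes> g'"] com_mult[OF bc w2c, of "w1 \<otimes> g'"] w1c g' by blast+
        moreover have "com f (w2 \<otimes> w1)" if "f \<in> carrier G" "\<forall>d\<in>{?a, ?b, i, j}. com d f" for f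
        proof -
          have c: "com f ?a" "com f ?b" "com f i" "com f j" using that(2) sym by blast+
          have "com f w1" "com f w2" using w1(1) w2(1) c com_mult[OF that(1) ac bc] com_mult[OF that(1) ij(1,2)] com_one(1)[OF that(1)] by blast+
          then show ?thesis using w1c w2c that(1) com_mult[OF that(1) w2c w1c] by blast
        qed
        moreover have "w2 \<otimes> w1 \<otimes> g' = w2 \<otimes> (w1 \<otimes> g')" using w1c w2c g' by (simp add: m_assoc)
        ultimately show ?thesis using w2(2,3) w1c w2c by (intro bexI[of _ "w2 \<otimes> w1"]) auto
      qed
      show "u \<in> carrier G" "\<forall>d\<in>{?a, ?b, i, j}. com d u" using u by auto
    qed
    show thesis using that(2)[OF ac bc qa qb ab ij abij cen] .
  next
    case False
    then have allcom: "com i j" if "i \<in> carrier G" "j \<in> carrier G" "q i" "q j" for i j using that by blast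
    \<comment> \<open>At most one of \<open>x0\<close> and \<open>y0\<close> has \<open>q\<close>;
      replacing it by their product gives a non-commuting pair of elements of square 1.\<close>
    have "\<exists>a\<in>carrier G. \<exists>b\<in>carrier G. \<not> q a \<and> \<not> q b \<and> \<not> com a b"
    proof -
      consider "\<not> q x0" "\<not> q y0" | "q x0" "\<not> q y0" | "\<not> q x0" "q y0" using allcom nonab by blast
      then show ?thesis
      proof cases
        case 1 then show ?thesis using nonab by blast
      next
        case 2
        have "\<not> q (x0 \<otimes> y0)" "\<not> com y0 (x0 \<otimes> y0)" using 2 nonab sym[of y0 x0] by simp_all
        then show ?thesis using 2 nonab by (metis m_closed)
      next
        case 3
        have "\<not> q (x0 \<otimes> y0)" "\<not> com x0 (x0 \<otimes> y0)" using 3 nonab by simp_all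
        then show ?thesis using 3 nonab by (metis m_closed)
      qed
    qed
    then obtain a b where ab: "a \<in> carrier G" "b \<in> carrier G" "\<not> q a" "\<not> q b" "\<not> com a b" by blast
    have cen: "central u" if u: "u \<in> carrier G" "com a u" "com b u" for u
    proof (rule centralizer_central[of "{a, b}"])
      show "{a, b} \<subseteq> carrier G" using ab by simp
      show "\<not> q v" if "v \<in> carrier G" "\<forall>d\<in>{a, b}. com d v" for v
      proof
        \<comment> \<open>a b and a v are elements of order 4, which commute by assumption, whereas
          their commutator equals that of a and b.\<close>
        assume qv: "q v"
        have c: "com a v" "com b v" using that(2) by blast+
        have "q (a \<otimes> b)" using ab by simp
        moreover have "q (a \<otimes> v)" using qv c(1) ab that(1) by simp
        ultimately have "com (a \<otimes> b) (a \<otimes> v)" using allcom ab that(1) by simp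
        then show False using ab that(1) c sym[of b a] by simp
      qed
      show "\<exists>w\<in>carrier G. (\<forall>f\<in>carrier G. (\<forall>d\<in>{a, b}. com d f) \<longrightarrow> com f w) \<and> (\<forall>d\<in>{a, b}. com d (w \<otimes> g'))"
        if g': "g' \<in> carrier G" for g'
      proof -
        obtain w where w: "w \<in> {\<one>, a, b, a \<otimes> b}" "com a (w \<otimes> g')" "com b (w \<otimes> g')"
          using exists_commuting_translate[OF ab(1,2,5) g'] by blast
        have "com f w" if "f \<in> carrier G" "\<forall>d\<in>{a, b}. com d f" for f
        proof -
          have "com f a" "com f b" using that(2) sym by blast+
          then show ?thesis using w(1) com_mult[OF that(1) ab(1,2)] com_one(1)[OF that(1)] by blast
        qed
        then show ?thesis using w ab by (intro bexI[of _ w]) auto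
      qed
      show "u \<in> carrier G" "\<forall>d\<in>{a, b}. com d u" using u by auto
    qed
    show thesis using that(1)[OF ab cen] .
  qed
qed

text \<open>Taking complements twice splits the center as a product of {1, z}, {1, s} and R. A
  nontrivial R would supply the element r0 that \<open>not_filled_dihedral_type\<close> needs, with
  s central and b b = 1; so R is trivial and at most four central elements remain.\<close>

lemma filled_center:
  assumes f: "filled G" and ab: "a \<in> carrier G" "b \<in> carrier G" "\<not> q a" "\<not> q b" "\<not> com a b"
    and cover: "\<And>g s. g \<in> carrier G \<Longrightarrow> central s \<Longrightarrow>
      (\<exists>c. central c \<and> g \<in> {c, c \<otimes> a, c \<otimes> b, c \<otimes> (a \<otimes> b)}) \<or> q g \<or> q (inv g \<otimes> (a \<otimes> (b \<otimes> s)))"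
  obtains r where "central r" "\<forall>c. central c \<longrightarrow> c \<in> {\<one>, z, r, z \<otimes> r}" "r = \<one> \<or> r \<noteq> \<one> \<and> r \<noteq> z"
proof -
  let ?Z = "{c. central c}"
  have cz: "central z" unfolding central_def by simp
  have cen: "g \<otimes> x = x \<otimes> g" if "central x" "g \<in> carrier G" for x g
    using centralD[OF that(1)] that(2) com_def by auto
  have sq: "x \<otimes> x = \<one>" if "central x" for x
    using filled_central[OF f that] centralD(1)[OF that] by (simp add: square_if)
  obtain R1 where R1: "subgroup R1 G" "R1 \<subseteq> ?Z" "z \<notin> R1" "?Z = R1 \<union> (\<lambda>r. z \<otimes> r) ` R1"
    using central_complement[OF fin subgroup_central, of z] cen sq cz z_not_one by auto
  show thesis
  proof (cases "R1 = {\<one>}")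
    case True
    then have "c \<in> {\<one>, z, \<one>, z \<otimes> \<one>}" if "central c" for c using R1(4) that by auto
    moreover have "central \<one>" using subgroup.one_closed[OF subgroup_central] by simp
    ultimately show thesis using that by blast
  next
    case False
    then obtain s where s: "s \<in> R1" "s \<noteq> \<one>" using subgroup.one_closed[OF R1(1)] by blast
    obtain R where R: "subgroup R G" "R \<subseteq> R1" "s \<notin> R" "R1 = R \<union> (\<lambda>r. s \<otimes> r) ` R"
      using central_complement[OF fin R1(1), of s] cen sq R1(2) s by blast
    have sc: "central s" using s R1(2) by blast
    have "R = {\<one>}"
    proof (rule ccontr)
      assume "R \<noteq> {\<one>}"
      then obtain r0 where r0: "r0 \<in> R" "r0 \<noteq> \<one>" using subgroup.one_closed[OF R(1)] by blast
      define M where "M = R \<union> (\<lambda>r. z \<otimes> r) ` R"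
      have Rcen: "central r" if "r \<in> R" for r using that R(2) R1(2) by blast
      have Mcen: "central m" if "m \<in> M" for m
        using that Rcen cz subgroup.m_closed[OF subgroup_central] unfolding M_def by auto
      have Zcov: "\<exists>m\<in>M. c = m \<or> c = m \<otimes> s" if "central c" for c
      proof -
        have "c \<in> R1 \<union> (\<lambda>r. z \<otimes> r) ` R1" unfolding R1(4)[symmetric] using that by simp
        then obtain r1 where r1: "r1 \<in> R1" "c = r1 \<or> c = z \<otimes> r1" by (elim UnE imageE) auto
        have "r1 \<in> R \<union> (\<lambda>r. s \<otimes> r) ` R" using r1(1) unfolding R(4)[symmetric] .
        then obtain r where r: "r \<in> R" "r1 = r \<or> r1 = s \<otimes> r" by (elim UnE imageE) auto
        have rc: "r \<in> carrier G" "s \<in> carrier G" using centralD(1)[OF Rcen[OF r(1)]] centralD(1)[OF sc] by auto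
        have "s \<otimes> r = r \<otimes> s" using cen[OF sc rc(1)] by simp
        then have "c = r \<or> c = r \<otimes> s \<or> c = z \<otimes> r \<or> c = (z \<otimes> r) \<otimes> s" using r1(2) r(2) rc by (auto simp: m_assoc)
        moreover have "r \<in> M" "z \<otimes> r \<in> M" using r(1) unfolding M_def by auto
        ultimately show ?thesis by blast
      qed
      have sM: "s \<notin> M"
      proof
        assume "s \<in> M"
        then obtain r where r: "r \<in> R" "s = z \<otimes> r" using R(3) unfolding M_def by blast
        then have "s \<otimes> r = z \<otimes> (r \<otimes> r)" using centralD(1)[OF Rcen[OF r(1)]] by (simp add: m_assoc)
        then have "s \<otimes> r = z" using sq[OF Rcen[OF r(1)]] by simp
        moreover have "s \<otimes> r \<in> R1" using subgroup.m_closed[OF R1(1) s(1)] R(2) r(1) by blast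
        ultimately show False using R1(3) by simp
      qed
      have acen: "\<not> central (a \<otimes> s)" using centralD(2)[of "a \<otimes> s" b] ab sc centralD(1)[OF sc] centralD(2)[OF sc ab(2)] by auto
      have nq: "x \<otimes> x = \<one>" if "x \<in> carrier G" "\<not> q x" for x using that square_if by simp
      have "\<not> filled G"
      proof (rule not_filled_dihedral_type[OF fin, of z R r0 a b s M])
        show "z \<notin> R" using R1(3) R(2) by blast
        show "\<And>r. r \<in> R \<Longrightarrow> r \<otimes> r = \<one>" using sq Rcen by blast
        show "\<And>r x. r \<in> R \<Longrightarrow> x \<in> carrier G \<Longrightarrow> x \<otimes> r = r \<otimes> x" using cen Rcen by blast
        show "a \<otimes> a = \<one>" using nq ab by blast
        show "b \<otimes> b \<in> R" using nq[OF ab(2,4)] subgroup.one_closed[OF R(1)] by simp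
        show "b \<otimes> a = z \<otimes> (a \<otimes> b)" using commutator_if[OF ab(2,1)] ab(5) com_sym by simp
        show "s \<otimes> s = \<one>" using sq sc by blast
        show "s \<otimes> a = a \<otimes> s" using cen[OF sc ab(1)] by simp
        show "s \<otimes> b = b \<otimes> b \<otimes> (b \<otimes> s)" using cen[OF sc ab(2)] nq[OF ab(2,4)] centralD(1)[OF sc] ab by simp
        show "a \<otimes> s \<notin> M" using acen Mcen by blast
        fix x assume x: "x \<in> carrier G"
        let ?g = "a \<otimes> (b \<otimes> s)"
        consider c where "central c" "x \<in> {c, c \<otimes> a, c \<otimes> b, c \<otimes> (a \<otimes> b)}" | "q x" | "q (inv x \<otimes> ?g)"
          using cover[OF x sc] by blast
        then show "(\<exists>m\<in>M. x \<in> {m, m \<otimes> a, m \<otimes> b, m \<otimes> (a \<otimes> b), m \<otimes> s, m \<otimes> (a \<otimes> s), m \<otimes> (b \<otimes> s), m \<otimes> ?g})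
          \<or> x \<otimes> x = z \<or> inv x \<otimes> ?g \<otimes> (inv x \<otimes> ?g) = z"
        proof cases
          case 1
          then obtain m where m: "m \<in> M" "c = m \<or> c = m \<otimes> s" using Zcov by blast
          have mc: "m \<in> carrier G" "s \<in> carrier G" using centralD(1) Mcen m(1) sc by auto
          have sw: "s \<otimes> a = a \<otimes> s" "s \<otimes> b = b \<otimes> s" "s \<otimes> (a \<otimes> b) = a \<otimes> (b \<otimes> s)"
            using cen[OF sc, of a] cen[OF sc, of b] cen[OF sc, of "a \<otimes> b"] ab mc by (auto simp: m_assoc)
          show ?thesis using 1(2) m mc ab sw by (auto simp: m_assoc)
        next
          case 2 then show ?thesis unfolding q_def by blast
        next
          case 3 then show ?thesis unfolding q_def by blast
        qed
      qed (use ab r0 R z_central z_not_one sM M_def centralD(1)[OF sc] in auto)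
      then show False using f by blast
    qed
    then have "R1 = {\<one>, s}" using R(4) centralD(1)[OF sc] by auto
    then have "c \<in> {\<one>, z, s, z \<otimes> s}" if "central c" for c using R1(4) that by auto
    moreover have "s \<noteq> z" using R1(3) s by blast
    ultimately show thesis using that[OF sc] s(2) by blast
  qed
qed

text \<open>If z is not in S, no square lies in S and S is closed under inversion, so the quotient
  conditions of local maximality become membership in S S. If z is in S, every member has square 1
  and every nontrivial element of square 1 is in S or S S. In addition S meets {x, z x} for each
  non-central x of square 1, and an element of order 4 factors through such representatives.\<close>

lemma filledI:
  assumes r: "central r" "\<And>c. central c \<Longrightarrow> c \<in> {\<one>, z, r, z \<otimes> r}" "\<And>c. central c \<Longrightarrow> \<not> q c"
    and tot: "\<And>x y. x \<in> carrier G \<Longrightarrow> y \<in> carrier G \<Longrightarrow> \<not> q x \<Longrightarrow> \<not> q y \<Longrightarrow> com x y \<Longrightarrow> \<not> central x \<Longrightarrow> \<not> central y \<Longrightarrow> central (x \<otimes> y)"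
    and gen: "\<And>g. g \<in> carrier G \<Longrightarrow> q g \<Longrightarrow> \<exists>x\<in>carrier G. \<exists>y\<in>carrier G. \<not> q x \<and> \<not> q y \<and> \<not> central x \<and> \<not> central y \<and> g = x \<otimes> y"
  shows "filled G"
  unfolding filled_def
proof (intro allI impI)
  fix S assume lm: "locally_maximal_product_free G S"
  have pf: "product_free G S"
    and B: "\<And>x. x \<in> carrier G \<Longrightarrow> x \<notin> S \<Longrightarrow> x = \<one> \<or> x \<otimes> x \<in> S \<or>
      (\<exists>s\<in>S. \<exists>t\<in>S. x = s \<otimes> t \<or> s \<otimes> x = t \<or> x \<otimes> s = t)"
    using lm unfolding locally_maximal_iff by blast+
  note S = product_freeD[OF pf]
  have Sc: "x \<in> carrier G" if "x \<in> S" for x using that S by blast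
  have left: "x = inv s \<otimes> t" if "s \<otimes> x = t" "s \<in> carrier G" "x \<in> carrier G" for x s t
    using that by (auto simp: inv_cancel_assoc)
  have right: "x = t \<otimes> inv s" if "x \<otimes> s = t" "s \<in> carrier G" "x \<in> carrier G" for x s t
    using that by (auto simp: m_assoc)
  have sq1: "x \<otimes> x \<notin> S" if "x \<in> carrier G" "z \<notin> S" for x
    using square[OF that(1)] that(2) S(4) by auto
  \<comment> \<open>Here z t is the inverse of t. If it were missing, local maximality would express
    it through two members s and u of S, and moving factors across turns this relation into a
    product of two members that is again a member.\<close>
  have invS: "z \<otimes> t \<in> S" if zS: "z \<notin> S" and t: "t \<in> S" "q t" for t
  proof (rule ccontr)
    assume not: "z \<otimes> t \<notin> S"
    have tc: "t \<in> carrier G" using Sc t by blast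
    have ztc: "z \<otimes> t \<in> carrier G" using tc by simp
    have "z \<otimes> t \<noteq> \<one>" using t(2) tc by (metis com_z(2) q_mult q_simps z_closed)
    have A: "z \<otimes> t \<noteq> s \<otimes> u" if su: "s \<in> S" "u \<in> S" for s u
    proof
      assume e: "z \<otimes> t = s \<otimes> u"
      have c: "s \<in> carrier G" "u \<in> carrier G" using su Sc by auto
      have t': "t = z \<otimes> (s \<otimes> u)" using e tc by (metis zz_left)
      have "s \<otimes> t = u" if "q s" 
        using that c square_if[of s] z_left[OF c(1), of "s \<otimes> u"] unfolding t' by (simp add: m_assoc[symmetric])
      moreover have "t \<otimes> u = s" if "q u"
        using that c square_if[of u] z_central[of s] unfolding t' by (simp add: m_assoc)
      moreover have "u \<otimes> s = t" if "\<not> q s" "\<not> q u"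
      proof -
        have "inv u = u" "inv s = s" using that c by (simp_all add: inv_if)
        then have "inv (s \<otimes> u) = u \<otimes> s" using inv_mult_group[OF c] by simp
        moreover have "inv (s \<otimes> u) = t" using e[symmetric] tc t(2) inv_if[OF ztc] by simp
        ultimately show ?thesis by simp
      qed
      ultimately show False using S(3) su t(1) by blast
    qed
    have B': "z \<otimes> t \<noteq> z \<otimes> (s \<otimes> u)" if "s \<in> S" "u \<in> S" for s u
    proof
      assume "z \<otimes> t = z \<otimes> (s \<otimes> u)"
      then have "t = s \<otimes> u" using tc Sc that by (metis zz_left m_closed)
      then show False using S(3) that t(1) by blast
    qed
    from B[OF ztc not] obtain s u where su: "s \<in> S" "u \<in> S" "s \<otimes> (z \<otimes> t) = u \<or> (z \<otimes> t) \<otimes> s = u"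
      using A \<open>z \<otimes> t \<noteq> \<one>\<close> sq1[OF ztc zS] by blast
    have c: "s \<in> carrier G" "u \<in> carrier G" using su Sc by auto
    have "z \<otimes> t = inv s \<otimes> u \<or> z \<otimes> t = u \<otimes> inv s" using su(3) left right c ztc by blast
    then have "z \<otimes> t = s \<otimes> u \<or> z \<otimes> t = z \<otimes> (s \<otimes> u) \<or> z \<otimes> t = u \<otimes> s \<or> z \<otimes> t = z \<otimes> (u \<otimes> s)"
      using c z_left[of u s] by (auto simp: inv_if m_assoc split: if_splits)
    then show False using A B' su by blast
  qed
  show "fills G S" unfolding fills_iff
  proof (intro conjI pf ballI impI)
    fix g assume g: "g \<in> carrier G" "g \<noteq> \<one>"
    show "g \<in> S \<or> (\<exists>x\<in>S. \<exists>y\<in>S. g = x \<otimes> y)"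
    proof (cases "z \<in> S")
      case False
      show ?thesis
      proof (rule ccontr)
        assume not: "\<not> ?thesis"
        then obtain s t where st: "s \<in> S" "t \<in> S" "s \<otimes> g = t \<or> g \<otimes> s = t" using B[OF g(1)] g(2) sq1[OF g(1) False] by blast
        have c: "s \<in> carrier G" "t \<in> carrier G" using st Sc by auto
        have "inv s \<in> S" using invS[OF False st(1)] st(1) c by (simp add: inv_if)
        moreover have "g = inv s \<otimes> t \<or> g = t \<otimes> inv s" using st(3) left right c g by blast
        ultimately show False using not st by blast
      qed
    next
      case True
      have nq: "\<not> q s" if "s \<in> S" for s using S(3)[OF that that] True unfolding q_def by auto
      have inv: "inv s = s" if "s \<in> S" for s using nq[OF that] Sc[OF that] by (simp add: inv_if)
      have bar: "\<exists>s\<in>S. \<exists>t\<in>S. x = s \<otimes> t" if x: "x \<in> carrier G" "x \<notin> S" "x \<noteq> \<one>" "\<not> q x" for x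
      proof -
        have "x \<otimes> x \<notin> S" using x(1,4) S(4) by (simp add: square_if)
        then obtain s t where st: "s \<in> S" "t \<in> S" "x = s \<otimes> t \<or> s \<otimes> x = t \<or> x \<otimes> s = t" using B[OF x(1,2)] x(3) by blast
        then have "x = s \<otimes> t \<or> x = t \<otimes> s" using left right Sc x(1) inv by metis
        then show ?thesis using st by blast
      qed
      \<comment> \<open>If x and z x were both missing, each would be a product of two commuting
        members, one of which is central by \<open>tot\<close>. That factor is r or z r; as z is in
        S, only one of these can be a member, so the same c occurs for x and for z x, and cancelling
        it leaves both t and z t in S.\<close>
      have lift: "x \<in> S \<or> z \<otimes> x \<in> S" if x: "x \<in> carrier G" "\<not> q x" "\<not> central x" for x
      proof (rule ccontr)
        assume not: "\<not> ?thesis"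
        have c1: "central \<one>" "central z" unfolding central_def by simp_all
        have zxc: "z \<otimes> x \<in> carrier G" using x by simp
        have zx: "\<not> q (z \<otimes> x)" "\<not> central (z \<otimes> x)" "z \<otimes> x \<noteq> \<one>"
        proof -
          show "\<not> q (z \<otimes> x)" using x by simp
          show zx: "\<not> central (z \<otimes> x)"
          proof
            assume "central (z \<otimes> x)"
            then have "central (z \<otimes> (z \<otimes> x))" using subgroup.m_closed[OF subgroup_central] c1(2) by simp
            then show False using x by simp
          qed
          then show "z \<otimes> x \<noteq> \<one>" using c1 by auto
        qed
        have dec: "\<exists>c t. c \<in> S \<and> t \<in> S \<and> central c \<and> c \<noteq> z \<and> y = c \<otimes> t" if y: "y \<in> carrier G" "\<not> q y" "\<not> central y" "y \<notin> S" "z \<otimes> y \<notin> S" for y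
        proof -
          have "y \<noteq> \<one>" using y c1 by auto
          then obtain s t where st: "s \<in> S" "t \<in> S" "y = s \<otimes> t" using bar y by blast
          have c: "s \<in> carrier G" "t \<in> carrier G" using st Sc by auto
          have "s \<noteq> z"
          proof
            assume "s = z"
            then have "z \<otimes> y = t" using st c by simp
            then show False using y(5) st by simp
          qed
          have "t \<noteq> z"
          proof
            assume "t = z"
            then have "z \<otimes> y = s" using st c z_central by simp
            then show False using y(5) st by simp
          qed
          have "com s t" using y(2) st nq c by simp
          then have "central s \<or> central t" using tot[OF c] nq st y(3) by blast
          then show ?thesis
          proof
            assume "central t"
            then have "y = t \<otimes> s" using st(3) \<open>com s t\<close> unfolding com_def by simp
            then show ?thesis using st \<open>central t\<close> \<open>t \<noteq> z\<close> by blast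
          qed (use st \<open>s \<noteq> z\<close> in blast)
        qed
        obtain c t where ct: "c \<in> S" "t \<in> S" "central c" "c \<noteq> z" "x = c \<otimes> t" using dec[OF x] not by blast
        obtain c' t' where ct': "c' \<in> S" "t' \<in> S" "central c'" "c' \<noteq> z" "z \<otimes> x = c' \<otimes> t'" using dec[OF zxc zx(1,2)] not x(1) by auto
        have cc: "c \<in> carrier G" "t \<in> carrier G" "t' \<in> carrier G" "c' \<in> carrier G" using ct ct' Sc by auto
        have rc: "r \<in> carrier G" using centralD(1)[OF r(1)] .
        have "c \<noteq> \<one>" "c' \<noteq> \<one>" using ct ct' S(4) by auto
        then have "(c = r \<or> c = z \<otimes> r) \<and> (c' = r \<or> c' = z \<otimes> r)" using r(2)[OF ct(3)] r(2)[OF ct'(3)] ct(4) ct'(4) by blast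
        moreover have "\<not> (r \<in> S \<and> z \<otimes> r \<in> S)" using S(3)[OF True] by blast
        ultimately have "c = c'" using ct(1) ct'(1) by blast
        then have "c \<otimes> (z \<otimes> t) = c \<otimes> t'" using ct(5) ct'(5) cc z_left[of c t] by simp
        then have "z \<otimes> t = t'" using cc by simp
        then show False using S(3)[OF True ct(2)] ct'(2) by simp
      qed
      show ?thesis
      proof (cases "q g")
        case False
        then show ?thesis using bar g by blast
      next
        case qg: True
        obtain x y where xy: "x \<in> carrier G" "y \<in> carrier G" "\<not> q x" "\<not> q y" "\<not> central x" "\<not> central y" "g = x \<otimes> y"
          using gen[OF g(1) qg] by blast
        obtain x' where x': "x' \<in> S" "x' = x \<or> x' = z \<otimes> x" using lift xy by blast
        obtain y' where y': "y' \<in> S" "y' = y \<or> y' = z \<otimes> y" using lift xy by blast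
        \<comment> \<open>Since x and y do not commute, exchanging the factors changes the product
          by z; so one of the two orders of x' and y' yields g, whichever representatives are in
          S.\<close>
        have "\<not> com x y" using qg xy by simp
        then have yx: "y \<otimes> x = z \<otimes> (x \<otimes> y)" using commutator_if[OF xy(2,1)] com_sym by simp
        have "x' \<otimes> y' = g \<or> y' \<otimes> x' = g"
          using x'(2) y'(2) xy(1,2,7) yx z_left[of x y] z_left[of y x] by (elim disjE) (simp_all add: m_assoc)
        then show ?thesis using x' y' by blast
      qed
    qed
  qed
qed

end

section \<open>Central squares and commutators\<close>

locale class2_group = group G for G (structure) +
  fixes K
  assumes finG: "finite (carrier G)"
    and K: "subgroup K G" and K_central: "k \<in> K \<Longrightarrow> x \<in> carrier G \<Longrightarrow> x \<otimes> k = k \<otimes> x"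
    and K_square: "k \<in> K \<Longrightarrow> k \<otimes> k = \<one>"
    and square_in_K: "x \<in> carrier G \<Longrightarrow> x \<otimes> x \<in> K"
    and commutator_in_K: "x \<in> carrier G \<Longrightarrow> y \<in> carrier G \<Longrightarrow> x \<otimes> y \<otimes> inv x \<otimes> inv y \<in> K"
begin

definition kappa :: "'a \<Rightarrow> 'a \<Rightarrow> 'a" where "kappa x y = x \<otimes> y \<otimes> inv x \<otimes> inv y"

lemma K_closed: "k \<in> K \<Longrightarrow> k \<in> carrier G"
  using subgroup.mem_carrier[OF K] .

lemma K_mult: "k \<in> K \<Longrightarrow> l \<in> K \<Longrightarrow> k \<otimes> l \<in> K"
  using subgroup.m_closed[OF K] .

lemma K_left: "k \<in> K \<Longrightarrow> x \<in> carrier G \<Longrightarrow> y \<in> carrier G \<Longrightarrow> x \<otimes> (k \<otimes> y) = k \<otimes> (x \<otimes> y)"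
  using K_central[of k x] K_closed by (simp add: m_assoc[symmetric])

lemma K_cancel: "k \<in> K \<Longrightarrow> x \<in> carrier G \<Longrightarrow> k \<otimes> (k \<otimes> x) = x"
  using K_square K_closed by (simp add: m_assoc[symmetric])

lemma kappa_in_K: "x \<in> carrier G \<Longrightarrow> y \<in> carrier G \<Longrightarrow> kappa x y \<in> K"
  unfolding kappa_def by (rule commutator_in_K)

lemma kappa_closed: "x \<in> carrier G \<Longrightarrow> y \<in> carrier G \<Longrightarrow> kappa x y \<in> carrier G"
  using kappa_in_K K_closed by blast

lemma mult_kappa: "x \<in> carrier G \<Longrightarrow> y \<in> carrier G \<Longrightarrow> x \<otimes> y = kappa x y \<otimes> (y \<otimes> x)"
  unfolding kappa_def by (simp add: m_assoc inv_cancel_assoc)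

lemma kappa_eqI:
  assumes "x \<in> carrier G" "y \<in> carrier G" "k \<in> K" "x \<otimes> y = k \<otimes> (y \<otimes> x)"
  shows "kappa x y = k"
proof -
  have "kappa x y \<otimes> (y \<otimes> x) = k \<otimes> (y \<otimes> x)" using mult_kappa[OF assms(1,2)] assms(4) by simp
  then show ?thesis using assms kappa_closed K_closed by (metis m_closed r_cancel)
qed

text \<open>Exchanging the arguments inverts a commutator, and commutators have square 1.\<close>

lemma kappa_sym:
  assumes "x \<in> carrier G" "y \<in> carrier G"
  shows "kappa y x = kappa x y"
proof (rule kappa_eqI)
  show "y \<otimes> x = kappa x y \<otimes> (x \<otimes> y)"
    using mult_kappa[OF assms] K_cancel[OF kappa_in_K[OF assms], of "y \<otimes> x"] assms by simp
qed (use assms kappa_in_K in auto)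

text \<open>x is moved past y and w one at a time, and the commutators that appear are
  central.\<close>

lemma kappa_mult:
  assumes "x \<in> carrier G" "y \<in> carrier G" "w \<in> carrier G"
  shows "kappa x (y \<otimes> w) = kappa x y \<otimes> kappa x w"
proof (rule kappa_eqI)
  have "x \<otimes> (y \<otimes> w) = kappa x y \<otimes> (y \<otimes> (x \<otimes> w))"
    using mult_kappa[OF assms(1,2)] assms kappa_closed by (simp add: m_assoc[symmetric])
  also have "\<dots> = kappa x y \<otimes> (kappa x w \<otimes> (y \<otimes> (w \<otimes> x)))"
    using mult_kappa[OF assms(1,3)] K_left[OF kappa_in_K[OF assms(1,3)] assms(2), of "w \<otimes> x"] assms by simp
  finally show "x \<otimes> (y \<otimes> w) = kappa x y \<otimes> kappa x w \<otimes> (y \<otimes> w \<otimes> x)"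
    using assms kappa_closed by (simp add: m_assoc)
qed (use assms kappa_in_K K_mult in auto)

lemma kappa_mult_left:
  assumes "x \<in> carrier G" "y \<in> carrier G" "w \<in> carrier G"
  shows "kappa (y \<otimes> w) x = kappa y x \<otimes> kappa w x"
  using kappa_mult[OF assms] kappa_sym assms by simp

lemma kappa_refl: "x \<in> carrier G \<Longrightarrow> kappa x x = \<one>"
  unfolding kappa_def by (simp add: m_assoc)

lemma kappa_K: "k \<in> K \<Longrightarrow> x \<in> carrier G \<Longrightarrow> kappa x k = \<one>" "k \<in> K \<Longrightarrow> x \<in> carrier G \<Longrightarrow> kappa k x = \<one>"
  by (rule kappa_eqI; use K_central K_closed subgroup.one_closed[OF K] in simp)+

lemma square_mult:
  assumes "x \<in> carrier G" "y \<in> carrier G"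
  shows "(x \<otimes> y) \<otimes> (x \<otimes> y) = kappa x y \<otimes> ((x \<otimes> x) \<otimes> (y \<otimes> y))"
proof -
  have "(x \<otimes> y) \<otimes> (x \<otimes> y) = x \<otimes> ((y \<otimes> x) \<otimes> y)" using assms by (simp add: m_assoc)
  also have "y \<otimes> x = kappa x y \<otimes> (x \<otimes> y)" using mult_kappa[OF assms(2,1)] kappa_sym[OF assms] by simp
  also have "x \<otimes> (kappa x y \<otimes> (x \<otimes> y) \<otimes> y) = kappa x y \<otimes> (x \<otimes> (x \<otimes> y \<otimes> y))"
    using assms kappa_closed K_left[OF kappa_in_K[OF assms] assms(1), of "x \<otimes> y \<otimes> y"] by (simp add: m_assoc)
  finally show ?thesis using assms by (simp add: m_assoc)
qed

lemma filled_no_C4_C4: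
  assumes f: "filled G" and card: "K = {\<one>, k, l, k \<otimes> l}" "k \<noteq> \<one>" "l \<noteq> \<one>" "k \<noteq> l"
    and xy: "x \<in> carrier G" "y \<in> carrier G" "x \<otimes> x = k" "y \<otimes> y = l"
  shows "kappa x y \<noteq> \<one>"
proof
  assume "kappa x y = \<one>"
  then have "y \<otimes> x = x \<otimes> y" using mult_kappa[OF xy(1,2)] xy by simp
  moreover have "k \<in> K" "l \<in> K" using card by auto
  ultimately have "\<not> filled G"
    using not_filled_C4_times_C4[OF finG K card(1) K_central square_in_K commutator_in_K xy(1,3,2,4)] K_square card by blast
  then show False using f by blast
qed

text \<open>The group has order 32 and is isomorphic to the wreath product of \<open>C\<^sub>2 \<times> C\<^sub>2\<close> by \<open>C\<^sub>2\<close>;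
  the witness comes from \<open>not_filled_dihedral_type\<close> with \<open>r\<close> and \<open>r a b\<close> in the role of the reflections.\<close>

lemma not_filled_wreath_type:
  assumes K4: "K = {\<one>, k, l, k \<otimes> l}" "k \<noteq> \<one>" "l \<noteq> \<one>" "k \<noteq> l"
    and abr: "a \<in> carrier G" "b \<in> carrier G" "r \<in> carrier G" "a \<otimes> a = \<one>" "b \<otimes> b = \<one>" "r \<otimes> r = \<one>"
    and kap: "kappa a b = l" "kappa r b = k" "kappa r a = \<one>"
    and cover: "\<And>g. g \<in> carrier G \<Longrightarrow> \<exists>m\<in>K. \<exists>u\<in>{\<one>, a, b, a \<otimes> b}. g = m \<otimes> u \<or> g = m \<otimes> (r \<otimes> u)"
  shows "\<not> filled G"
proof -
  have kK: "k \<in> K" "l \<in> K" "\<one> \<in> K" using K4 by auto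
  note [simp] = abr(1-3) K_closed kK
  have rules: "a \<otimes> a = \<one>" "b \<otimes> b = \<one>" "r \<otimes> r = \<one>" "b \<otimes> a = l \<otimes> (a \<otimes> b)" "b \<otimes> r = k \<otimes> (r \<otimes> b)" "a \<otimes> r = r \<otimes> a"
    "k \<otimes> k = \<one>" "l \<otimes> l = \<one>" "l \<otimes> k = k \<otimes> l"
    using abr kap mult_kappa[of b a] mult_kappa[of b r] mult_kappa[of r a] kappa_sym[of a b] kappa_sym[of r b] K_square K_central by auto
  have left: "\<And>x. x \<in> carrier G \<Longrightarrow> a \<otimes> (a \<otimes> x) = x" "\<And>x. x \<in> carrier G \<Longrightarrow> b \<otimes> (b \<otimes> x) = x" "\<And>x. x \<in> carrier G \<Longrightarrow> r \<otimes> (r \<otimes> x) = x"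
    "\<And>x. x \<in> carrier G \<Longrightarrow> b \<otimes> (a \<otimes> x) = l \<otimes> (a \<otimes> (b \<otimes> x))" "\<And>x. x \<in> carrier G \<Longrightarrow> b \<otimes> (r \<otimes> x) = k \<otimes> (r \<otimes> (b \<otimes> x))"
    "\<And>x. x \<in> carrier G \<Longrightarrow> a \<otimes> (r \<otimes> x) = r \<otimes> (a \<otimes> x)" "\<And>x. x \<in> carrier G \<Longrightarrow> k \<otimes> (k \<otimes> x) = x" "\<And>x. x \<in> carrier G \<Longrightarrow> l \<otimes> (l \<otimes> x) = x"
    "\<And>x. x \<in> carrier G \<Longrightarrow> l \<otimes> (k \<otimes> x) = k \<otimes> (l \<otimes> x)"
    using rules by (simp_all add: m_assoc[symmetric])
  have cent: "a \<otimes> k = k \<otimes> a" "a \<otimes> l = l \<otimes> a" "b \<otimes> k = k \<otimes> b" "b \<otimes> l = l \<otimes> b" "r \<otimes> k = k \<otimes> r" "r \<otimes> l = l \<otimes> r"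
    "\<And>x. x \<in> carrier G \<Longrightarrow> a \<otimes> (k \<otimes> x) = k \<otimes> (a \<otimes> x)" "\<And>x. x \<in> carrier G \<Longrightarrow> a \<otimes> (l \<otimes> x) = l \<otimes> (a \<otimes> x)"
    "\<And>x. x \<in> carrier G \<Longrightarrow> b \<otimes> (k \<otimes> x) = k \<otimes> (b \<otimes> x)" "\<And>x. x \<in> carrier G \<Longrightarrow> b \<otimes> (l \<otimes> x) = l \<otimes> (b \<otimes> x)"
    "\<And>x. x \<in> carrier G \<Longrightarrow> r \<otimes> (k \<otimes> x) = k \<otimes> (r \<otimes> x)" "\<And>x. x \<in> carrier G \<Longrightarrow> r \<otimes> (l \<otimes> x) = l \<otimes> (r \<otimes> x)"
    by - (rule K_central K_left; simp)+
  note nf = m_assoc rules left cent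
  \<comment> \<open>k plays the role of z. Then r a b has square k l in R and [r a b, r] = k, and
    for s = r a one gets [r a, r a b] = k l, the square of r a b, as required.\<close>
  let ?R = "{\<one>, k \<otimes> l}"
  let ?B = "r \<otimes> (a \<otimes> b)" and ?s = "r \<otimes> a"
  have kl: "k \<otimes> l \<noteq> \<one>" "k \<otimes> l \<noteq> k" "k \<otimes> l \<noteq> l"
  proof -
    show "k \<otimes> l \<noteq> \<one>" using K4(4) left(7)[of l] rules(7) by (metis K_closed kK(1,2) r_one)
    show "k \<otimes> l \<noteq> k" "k \<otimes> l \<noteq> l" using K4(2,3) by simp_all
  qed
  have R: "subgroup ?R G"
  proof (rule subgroupI)
    fix x y assume "x \<in> ?R" "y \<in> ?R"
    then show "inv x \<in> ?R" "x \<otimes> y \<in> ?R" using K_square[OF K_mult[OF kK(1,2)]] by (auto simp: inv_equality)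
  qed auto
  have "(\<lambda>x. k \<otimes> x) ` ?R = {k, l}" by (simp add: left(7))
  then have M: "K = ?R \<union> (\<lambda>x. k \<otimes> x) ` ?R" by (subst K4(1)) auto
  have notK: "u \<notin> K" if "u \<in> carrier G" "kappa u b \<noteq> \<one>" for u using kappa_K(2)[of u b] that by auto
  have ksb: "kappa ?s b = k \<otimes> l" using kappa_mult_left[of b r a] kap by simp
  show ?thesis
  proof (rule not_filled_dihedral_type[OF finG, of k ?R "k \<otimes> l" r ?B ?s K])
    show "k \<notin> ?R" using kl(2) K4(2) by auto
    show "subgroup ?R G" by (rule R)
    show "K = ?R \<union> (\<lambda>x. k \<otimes> x) ` ?R" by (rule M)
    show "u \<otimes> u = \<one>" if "u \<in> ?R" for u using that K_square K_mult[OF kK(1,2)] kK(3) by blast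
    show "y \<otimes> u = u \<otimes> y" if "u \<in> ?R" "y \<in> carrier G" for u y
      using that K_central K_mult[OF kK(1,2)] kK(3) by blast
    show "y \<otimes> k = k \<otimes> y" if "y \<in> carrier G" for y using K_central[OF kK(1) that] .
    show "?s \<notin> K" using notK[of ?s] ksb kl by simp
    have "r \<otimes> ?s = a" by (simp add: nf)
    then show "r \<otimes> ?s \<notin> K" using notK[of a] kap K4(3) by simp
    fix x assume x: "x \<in> carrier G"
    obtain m u where mu: "m \<in> K" "u \<in> {\<one>, a, b, a \<otimes> b}" "x = m \<otimes> u \<or> x = m \<otimes> (r \<otimes> u)" using cover[OF x] by blast
    have e: "a = r \<otimes> ?s" "b = (k \<otimes> l) \<otimes> (?B \<otimes> ?s)" "a \<otimes> b = r \<otimes> ?B" "r \<otimes> b = (k \<otimes> l) \<otimes> (r \<otimes> (?B \<otimes> ?s))"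
      by (simp_all add: nf)
    have mk: "m \<otimes> (k \<otimes> l) \<in> K" using mu(1) K_mult kK by simp
    have eq1: "m \<otimes> b = (m \<otimes> (k \<otimes> l)) \<otimes> (?B \<otimes> ?s)" "m \<otimes> (r \<otimes> b) = (m \<otimes> (k \<otimes> l)) \<otimes> (r \<otimes> (?B \<otimes> ?s))"
      using mu(1) e(2,4) by (simp_all add: m_assoc[of m])
    have eq2: "m \<otimes> a = m \<otimes> (r \<otimes> ?s)" "m \<otimes> (a \<otimes> b) = m \<otimes> (r \<otimes> ?B)" using e by simp_all
    have "x = m \<or> x = m \<otimes> a \<or> x = m \<otimes> b \<or> x = m \<otimes> (a \<otimes> b) \<or> x = m \<otimes> r \<or> x = m \<otimes> ?s \<or> x = m \<otimes> (r \<otimes> b) \<or> x = m \<otimes> ?B"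
      using mu by auto
    then have "\<exists>m\<in>K. x \<in> {m, m \<otimes> r, m \<otimes> ?B, m \<otimes> (r \<otimes> ?B), m \<otimes> ?s, m \<otimes> (r \<otimes> ?s), m \<otimes> (?B \<otimes> ?s), m \<otimes> (r \<otimes> (?B \<otimes> ?s))}"
      unfolding eq1 eq2 using mu(1) mk by blast
    then show "(\<exists>m\<in>K. x \<in> {m, m \<otimes> r, m \<otimes> ?B, m \<otimes> (r \<otimes> ?B), m \<otimes> ?s, m \<otimes> (r \<otimes> ?s), m \<otimes> (?B \<otimes> ?s), m \<otimes> (r \<otimes> (?B \<otimes> ?s))})
      \<or> x \<otimes> x = k \<or> inv x \<otimes> (r \<otimes> (?B \<otimes> ?s)) \<otimes> (inv x \<otimes> (r \<otimes> (?B \<otimes> ?s))) = k" by blast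
  qed (use kl(1) K4(2) in \<open>simp_all add: nf\<close>)
qed

end

section \<open>Coordinates in filled quadratic groups\<close>

context quadratic_group
begin

lemma central_mult: "central c \<Longrightarrow> central d \<Longrightarrow> central (c \<otimes> d)"
  using subgroup.m_closed[OF subgroup_central, of c d] by simp

lemma central_z: "central z"
  unfolding central_def by simp

lemma central_decompose:
  assumes "w \<in> carrier G" "g \<in> carrier G" "central (w \<otimes> g)"
  shows "\<exists>c. central c \<and> g = c \<otimes> w"
proof -
  let ?c = "w \<otimes> g"
  have c: "?c \<in> carrier G" "w \<otimes> ?c = ?c \<otimes> w"
    using centralD[OF assms(3)] assms(1) unfolding com_def by auto
  have "g = inv w \<otimes> ?c" using assms by (simp add: inv_cancel_assoc)
  also have "\<dots> = (if q w then z \<otimes> ?c else ?c) \<otimes> w" using assms(1) c by (simp add: inv_if m_assoc)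
  finally show ?thesis using central_mult[OF central_z assms(3)] assms(3) by (metis (full_types))
qed

text \<open>The orthogonal splitting is combined with the bound on the center. To invoke
  \<open>filled_center\<close> when i and j are present, consider an element with nontrivial part v:
  it has order 4 unless its part u is a b, and in that exceptional case its cofactor in a b s has
  order 4.\<close>

lemma filled_cases:
  assumes f: "filled G" and nonab: "x0 \<in> carrier G" "y0 \<in> carrier G" "\<not> com x0 y0"
  shows "\<exists>a\<in>carrier G. \<exists>b\<in>carrier G. \<exists>r. \<not> q a \<and> \<not> q b \<and> \<not> com a b \<and>
    central r \<and> (\<forall>c. central c \<longrightarrow> c \<in> {\<one>, z, r, z \<otimes> r}) \<and> (r = \<one> \<or> r \<noteq> \<one> \<and> r \<noteq> z) \<and>
    ((\<forall>g\<in>carrier G. \<exists>c. central c \<and> (\<exists>u\<in>{\<one>, a, b, a \<otimes> b}. g = c \<otimes> u)) \<or>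
     (\<exists>i\<in>carrier G. \<exists>j\<in>carrier G. q i \<and> q j \<and> \<not> com i j \<and> com a i \<and> com a j \<and> com b i \<and> com b j \<and>
       (\<forall>g\<in>carrier G. \<exists>c. central c \<and> (\<exists>u\<in>{\<one>, a, b, a \<otimes> b}. \<exists>v\<in>{\<one>, i, j, i \<otimes> j}. g = c \<otimes> (v \<otimes> u)))))"
  using filled_structure[OF f nonab]
proof cases
  case (1 a b)
  have dec: "\<exists>c. central c \<and> (\<exists>u\<in>{\<one>, a, b, a \<otimes> b}. g = c \<otimes> u)" if g: "g \<in> carrier G" for g
  proof -
    obtain w where w: "w \<in> {\<one>, a, b, a \<otimes> b}" "com a (w \<otimes> g)" "com b (w \<otimes> g)"
      using exists_commuting_translate[OF 1(1,2,5) g] by blast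
    have wc: "w \<in> carrier G" using w(1) 1(1,2) by auto
    have "central (w \<otimes> g)" using 1(6)[OF _ w(2,3)] wc g by simp
    then show ?thesis using central_decompose[OF wc g] w(1) by blast
  qed
  obtain r where r: "central r" "\<forall>c. central c \<longrightarrow> c \<in> {\<one>, z, r, z \<otimes> r}" "r = \<one> \<or> r \<noteq> \<one> \<and> r \<noteq> z"
  proof (rule filled_center[OF f 1(1-5)])
    fix g s assume g: "g \<in> carrier G"
    obtain c u where cu: "central c" "u \<in> {\<one>, a, b, a \<otimes> b}" "g = c \<otimes> u" using dec[OF g] by blast
    have "c \<otimes> \<one> = c" using centralD(1)[OF cu(1)] by simp
    then have "g \<in> {c, c \<otimes> a, c \<otimes> b, c \<otimes> (a \<otimes> b)}" using cu(2,3) by auto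
    then show "(\<exists>c. central c \<and> g \<in> {c, c \<otimes> a, c \<otimes> b, c \<otimes> (a \<otimes> b)}) \<or> q g \<or> q (inv g \<otimes> (a \<otimes> (b \<otimes> s)))"
      using cu(1) by blast
  qed
  show ?thesis
    by (rule bexI[OF _ 1(1)], rule bexI[OF _ 1(2)], rule exI[of _ r]) (use 1(3-5) r dec in blast)
next
  case (2 a b i j)
  have dec: "\<exists>c. central c \<and> (\<exists>u\<in>{\<one>, a, b, a \<otimes> b}. \<exists>v\<in>{\<one>, i, j, i \<otimes> j}. g = c \<otimes> (v \<otimes> u))" if g: "g \<in> carrier G" for g
  proof -
    obtain u where u: "u \<in> {\<one>, a, b, a \<otimes> b}" "com a (u \<otimes> g)" "com b (u \<otimes> g)"
      using exists_commuting_translate[OF 2(1,2,5) g] by blast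
    have uc: "u \<in> carrier G" using u(1) 2(1,2) by auto
    have ugc: "u \<otimes> g \<in> carrier G" using uc g by simp
    obtain v where v: "v \<in> {\<one>, i, j, i \<otimes> j}" "com i (v \<otimes> (u \<otimes> g))" "com j (v \<otimes> (u \<otimes> g))"
      using exists_commuting_translate[OF 2(6,7,10) ugc] by blast
    have vc: "v \<in> carrier G" using v(1) 2(6,7) by auto
    have "com a v" "com b v" using v(1) 2 by auto
    then have "com a (v \<otimes> (u \<otimes> g))" "com b (v \<otimes> (u \<otimes> g))"
      using com_mult[OF 2(1) vc ugc] com_mult[OF 2(2) vc ugc] u(2,3) by blast+
    then have "central (v \<otimes> (u \<otimes> g))" using 2(15)[OF _ _ _ v(2,3)] vc ugc by simp
    then have "central ((v \<otimes> u) \<otimes> g)" using vc uc g by (simp add: m_assoc)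
    then show ?thesis using central_decompose[of "v \<otimes> u" g] vc uc g u(1) v(1) by blast
  qed
  obtain r where r: "central r" "\<forall>c. central c \<longrightarrow> c \<in> {\<one>, z, r, z \<otimes> r}" "r = \<one> \<or> r \<noteq> \<one> \<and> r \<noteq> z"
  proof (rule filled_center[OF f 2(1-5)])
    fix g s assume g: "g \<in> carrier G" and s: "central s"
    obtain c u v where cu: "central c" "u \<in> {\<one>, a, b, a \<otimes> b}" "v \<in> {\<one>, i, j, i \<otimes> j}" "g = c \<otimes> (v \<otimes> u)"
      using dec[OF g] by blast
    have cc: "c \<in> carrier G" "s \<in> carrier G" using centralD(1) cu(1) s by auto
    have uv: "u \<in> carrier G" "v \<in> carrier G" using cu 2 by auto
    have ncs: "\<not> q c" "\<not> q s" using filled_central[OF f] cu(1) s by auto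
    have cen: "com c x" "com x c" "com s x" "com x s" if "x \<in> carrier G" for x
      using centralD(2)[OF cu(1) that] centralD(2)[OF s that] com_sym by auto
    have uvc: "com u v" "com v u"
    proof -
      show "com u v" using cu(2,3) 2 com_sym by auto
      then show "com v u" using com_sym by blast
    qed
    show "(\<exists>c. central c \<and> g \<in> {c, c \<otimes> a, c \<otimes> b, c \<otimes> (a \<otimes> b)}) \<or> q g \<or> q (inv g \<otimes> (a \<otimes> (b \<otimes> s)))"
    proof (cases "v = \<one>")
      case True
      then have "g = c \<otimes> u" using cu(4) uv by simp
      moreover have "c \<otimes> \<one> = c" using cc by simp
      ultimately have "g \<in> {c, c \<otimes> a, c \<otimes> b, c \<otimes> (a \<otimes> b)}" using cu(2) by auto
      then show ?thesis using cu(1) by blast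
    next
      case False
      then have qv: "q v" using cu(3) 2 by auto
      have qg: "q g = (\<not> q u)" unfolding cu(4) using cc uv qv ncs cen uvc by simp
      show ?thesis
      proof (cases "u = a \<otimes> b")
        case u: True
        have qu: "q u" "q (a \<otimes> (b \<otimes> s))" unfolding u using 2 cc ncs cen by simp_all
        have "com a v" "com b v" using cu(3) 2 by auto
        then have "com v a" "com v b" "\<not> com b a" using com_sym 2(5) by blast+
        then have "com g (a \<otimes> (b \<otimes> s))" unfolding cu(4) u using cc uv cen 2(1,2,5) by simp
        then show ?thesis using qg qu g 2 cc by simp
      next
        case u: False
        then have "\<not> q u" using cu(2) 2 by auto
        then show ?thesis using qg by blast
      qed
    qed
  qed
  show ?thesis
    by (rule bexI[OF _ 2(1)], rule bexI[OF _ 2(2)], rule exI[of _ r]) (use 2(3-14) r dec in blast)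
qed

end

section \<open>Derived subgroups of order four\<close>

text \<open>\<open>U\<close> marks the elements of H whose preimages centralize w. All elements of H
  with \<open>q\<close> are marked, because a preimage commutes with its own square, which is w or z
  w. A quaternion pair in H would make such elements generate H and w central; hence H consists of
  its center times words in a and b. For a preimage c0 of a b one then finds c0^4 = z, and
  \<open>not_filled_dihedral_quotient\<close> applies after dividing out a complement of the image
  of w in the center of H.\<close>

lemma (in group_hom) class3_not_filled:
  assumes fin: "finite (carrier G)" and surj: "h ` carrier G = carrier H"
    and z: "z \<in> carrier G" "z \<noteq> \<one>" "z \<otimes> z = \<one>" "\<And>x. x \<in> carrier G \<Longrightarrow> x \<otimes> z = z \<otimes> x"
    and ker: "\<And>x. x \<in> carrier G \<Longrightarrow> h x = \<one>\<^bsub>H\<^esub> \<longleftrightarrow> x = \<one> \<or> x = z"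
    and w: "w \<in> carrier G" and Q: "quadratic_group H (h w)" and fH: "filled H"
    and nonab: "x0 \<in> carrier H" "y0 \<in> carrier H" "x0 \<otimes>\<^bsub>H\<^esub> y0 \<noteq> y0 \<otimes>\<^bsub>H\<^esub> x0"
    and g0: "g0 \<in> carrier G" "g0 \<otimes> w \<noteq> w \<otimes> g0"
  shows "\<not> filled G"
proof -
  interpret Q: quadratic_group H "h w" by (rule Q)
  let ?m = "\<lambda>x y. x \<otimes>\<^bsub>H\<^esub> y"
  have lift: "\<exists>x\<in>carrier G. h x = y" if "y \<in> carrier H" for y using surj that by (metis imageE)
  have hz: "h z = \<one>\<^bsub>H\<^esub>" using ker[OF z(1)] by simp
  have heq: "x = y \<or> x = z \<otimes> y" if "h x = h y" "x \<in> carrier G" "y \<in> carrier G" for x y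
  proof -
    have "h (x \<otimes> inv y) = \<one>\<^bsub>H\<^esub>" using that by simp
    then have "x \<otimes> inv y = \<one> \<or> x \<otimes> inv y = z" using ker[of "x \<otimes> inv y"] that(2,3) by (metis G.m_closed G.inv_closed)
    then have "x \<otimes> inv y \<otimes> y = \<one> \<otimes> y \<or> x \<otimes> inv y \<otimes> y = z \<otimes> y" by auto
    then show ?thesis using that by (simp add: G.m_assoc)
  qed
  have zl: "x \<otimes> (z \<otimes> y) = z \<otimes> (x \<otimes> y)" if "x \<in> carrier G" "y \<in> carrier G" for x y
    using z(1) z(4)[OF that(1)] that by (metis G.m_assoc)
  have zz: "z \<otimes> (z \<otimes> y) = y" if "y \<in> carrier G" for y using z(1,3) that by (simp add: G.m_assoc[symmetric])
  define C where "C = {x \<in> carrier G. x \<otimes> w = w \<otimes> x}"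
  have Cmult: "x \<otimes> y \<in> C" if "x \<in> C" "y \<in> C" for x y
  proof -
    have c: "x \<in> carrier G" "y \<in> carrier G" "x \<otimes> w = w \<otimes> x" "y \<otimes> w = w \<otimes> y" using that unfolding C_def by auto
    have "x \<otimes> y \<otimes> w = x \<otimes> (w \<otimes> y)" using c w by (simp add: G.m_assoc)
    also have "\<dots> = w \<otimes> (x \<otimes> y)" using c w by (simp add: G.m_assoc[symmetric])
    finally show ?thesis using c unfolding C_def by simp
  qed
  have Cinv: "inv x \<in> C" if "x \<in> C" for x
  proof -
    have c: "x \<in> carrier G" "x \<otimes> w = w \<otimes> x" using that unfolding C_def by auto
    have "inv x \<otimes> w = inv x \<otimes> (w \<otimes> x) \<otimes> inv x" using c w by (simp add: G.m_assoc)
    also have "\<dots> = w \<otimes> inv x" unfolding c(2)[symmetric] using c(1) w by (simp add: G.m_assoc[symmetric])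
    finally show ?thesis using c unfolding C_def by simp
  qed
  have Cz: "z \<in> C" unfolding C_def using z(1) z(4)[OF w] w by auto
  define U where "U y \<longleftrightarrow> (\<exists>x\<in>C. h x = y)" for y
  have Uh: "x \<in> C" if U: "U (h x)" "x \<in> carrier G" for x
  proof -
    obtain x' where x': "x' \<in> C" "h x' = h x" using U unfolding U_def by blast
    then have "x' \<in> carrier G" unfolding C_def by simp
    then have "x = x' \<or> x = z \<otimes> x'" using heq[of x x'] x' that by simp
    then show ?thesis using x' Cmult[OF Cz x'(1)] by auto
  qed
  have Umult: "U (?m x y)" if U: "U x" "U y" for x y
  proof -
    obtain x' y' where "x' \<in> C" "h x' = x" "y' \<in> C" "h y' = y" using U unfolding U_def by blast
    then have "x' \<otimes> y' \<in> C" "h (x' \<otimes> y') = ?m x y" using Cmult unfolding C_def by auto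
    then show ?thesis unfolding U_def by blast
  qed
  have Uinv: "U (inv\<^bsub>H\<^esub> x)" if U: "U x" for x
  proof -
    obtain x' where "x' \<in> C" "h x' = x" using U unfolding U_def by blast
    then have "inv x' \<in> C" "h (inv x') = inv\<^bsub>H\<^esub> x" using Cinv unfolding C_def by auto
    then show ?thesis unfolding U_def by blast
  qed
  have Ucancel: "U y" if "U (?m x y)" "U x" "x \<in> carrier H" "y \<in> carrier H" for x y
    using Umult[OF Uinv[OF that(2)] that(1)] that(3,4) by (simp add: H.inv_cancel_assoc)
  have Ucancel': "U x" if "U (?m x y)" "U y" "x \<in> carrier H" "y \<in> carrier H" for x y
    using Umult[OF that(1) Uinv[OF that(2)]] that(3,4) by (simp add: H.m_assoc)
  have Uone: "U \<one>\<^bsub>H\<^esub>" using Cz hz unfolding U_def by blast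
  have Uq: "U y" if y: "y \<in> carrier H" "Q.q y" for y
  proof -
    obtain x where x: "x \<in> carrier G" "h x = y" using lift[OF y(1)] by blast
    have "h (x \<otimes> x) = h w" using x y(2) unfolding Q.q_def by simp
    then consider "x \<otimes> x = w" | "x \<otimes> x = z \<otimes> w" using heq[of "x \<otimes> x" w] x w by auto
    then have "x \<otimes> w = w \<otimes> x"
    proof cases
      case 1
      then show ?thesis using x by (metis G.m_assoc)
    next
      case 2
      have "z \<otimes> (x \<otimes> w) = x \<otimes> (x \<otimes> x)" unfolding 2 using zl[OF x(1) w] by simp
      also have "\<dots> = (x \<otimes> x) \<otimes> x" using x by (simp add: G.m_assoc)
      also have "\<dots> = z \<otimes> (w \<otimes> x)" unfolding 2 using x(1) w z(1) by (simp add: G.m_assoc)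
      finally have "z \<otimes> (z \<otimes> (x \<otimes> w)) = z \<otimes> (z \<otimes> (w \<otimes> x))" by simp
      then show ?thesis using zz x w by simp
    qed
    then show ?thesis using x unfolding U_def C_def by blast
  qed
  have notall: "\<not> (\<forall>y\<in>carrier H. U y)"
    using Uh[of g0] g0 hom_closed[OF g0(1)] unfolding C_def by blast
  have nqc: "\<not> Q.q c" if "Q.central c" for c using Q.filled_central[OF fH that] .
  have Ucentral: "U c" if c: "Q.central c" and i: "i \<in> carrier H" "Q.q i" for c i
  proof -
    have cc: "c \<in> carrier H" "Q.com c i" using Q.centralD[OF c] i by auto
    have "Q.q (?m c i)" using nqc[OF c] i cc by simp
    then show ?thesis using Ucancel'[OF Uq _ cc(1) i(1)] Uq[OF i] cc i by simp
  qed
  have nonab': "\<not> Q.com x0 y0" using nonab unfolding Q.com_def by simp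
  obtain a b r where ab: "a \<in> carrier H" "b \<in> carrier H" "\<not> Q.q a" "\<not> Q.q b" "\<not> Q.com a b"
    and dec: "(\<forall>g\<in>carrier H. \<exists>c. Q.central c \<and> (\<exists>u\<in>{\<one>\<^bsub>H\<^esub>, a, b, ?m a b}. g = ?m c u)) \<or>
     (\<exists>i\<in>carrier H. \<exists>j\<in>carrier H. Q.q i \<and> Q.q j \<and> \<not> Q.com i j \<and> Q.com a i \<and> Q.com a j \<and> Q.com b i \<and> Q.com b j \<and>
       (\<forall>g\<in>carrier H. \<exists>c. Q.central c \<and> (\<exists>u\<in>{\<one>\<^bsub>H\<^esub>, a, b, ?m a b}. \<exists>v\<in>{\<one>\<^bsub>H\<^esub>, i, j, ?m i j}. g = ?m c (?m v u))))"
    using Q.filled_cases[OF fH nonab(1,2) nonab'] by blast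
  have dec: "\<forall>g\<in>carrier H. \<exists>c. Q.central c \<and> (\<exists>u\<in>{\<one>\<^bsub>H\<^esub>, a, b, ?m a b}. g = ?m c u)"
    using dec
  proof
    assume "\<exists>i\<in>carrier H. \<exists>j\<in>carrier H. Q.q i \<and> Q.q j \<and> \<not> Q.com i j \<and> Q.com a i \<and> Q.com a j \<and> Q.com b i \<and> Q.com b j \<and>
       (\<forall>g\<in>carrier H. \<exists>c. Q.central c \<and> (\<exists>u\<in>{\<one>\<^bsub>H\<^esub>, a, b, ?m a b}. \<exists>v\<in>{\<one>\<^bsub>H\<^esub>, i, j, ?m i j}. g = ?m c (?m v u)))"
    then obtain i j where ij: "i \<in> carrier H" "j \<in> carrier H" "Q.q i" "Q.q j" "Q.com a i" "Q.com b i"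
      and d: "\<forall>g\<in>carrier H. \<exists>c. Q.central c \<and> (\<exists>u\<in>{\<one>\<^bsub>H\<^esub>, a, b, ?m a b}. \<exists>v\<in>{\<one>\<^bsub>H\<^esub>, i, j, ?m i j}. g = ?m c (?m v u))"
      by blast
    have "Q.q (?m a i)" "Q.q (?m b i)" using ab ij by simp_all
    then have "U a" "U b" using Ucancel'[OF Uq Uq[OF ij(1,3)]] ab ij by auto
    moreover have "U i" "U j" using Uq ij by auto
    ultimately have uv: "U u" "U v" if "u \<in> {\<one>\<^bsub>H\<^esub>, a, b, ?m a b}" "v \<in> {\<one>\<^bsub>H\<^esub>, i, j, ?m i j}" for u v
      using that Uone Umult by auto
    have "U g" if g: "g \<in> carrier H" for g
    proof -
      obtain c u v where "Q.central c" "u \<in> {\<one>\<^bsub>H\<^esub>, a, b, ?m a b}" "v \<in> {\<one>\<^bsub>H\<^esub>, i, j, ?m i j}" "g = ?m c (?m v u)"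
        using bspec[OF d g] by blast
      have "U u" "U v" using uv[of u v] \<open>u \<in> _\<close> \<open>v \<in> _\<close> by auto
      then have "U (?m v u)" using Umult by blast
      then show ?thesis using Umult[OF Ucentral[OF _ ij(1,3)]] \<open>Q.central c\<close> \<open>g = _\<close> by blast
    qed
    then show ?thesis using notall by blast
  qed
  let ?c = "?m a b"
  have c: "?c \<in> carrier H" "Q.q ?c" using ab by simp_all
  have Uc: "U ?c" using Uq c .
  \<comment> \<open>As a b is marked, marking a would mark b and then all of H.\<close>
  have nU: "\<not> U a"
  proof
    assume "U a"
    then have "U b" using Ucancel[OF Uc] ab by blast
    have "U g" if g: "g \<in> carrier H" for g
    proof -
      obtain e u where "Q.central e" "u \<in> {\<one>\<^bsub>H\<^esub>, a, b, ?m a b}" "g = ?m e u" using bspec[OF dec g] by blast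
      have "U u" using \<open>u \<in> _\<close> Uone \<open>U a\<close> \<open>U b\<close> Uc by auto
      then show ?thesis using Umult[OF Ucentral[OF _ c]] \<open>Q.central e\<close> \<open>g = _\<close> by blast
    qed
    then show False using notall by blast
  qed
  have invab: "inv\<^bsub>H\<^esub> a = a" "inv\<^bsub>H\<^esub> b = b" "?m a a = \<one>\<^bsub>H\<^esub>" "?m b b = \<one>\<^bsub>H\<^esub>" "\<And>x. x \<in> carrier H \<Longrightarrow> ?m a (?m a x) = x"
    "\<And>x. x \<in> carrier H \<Longrightarrow> ?m b (?m b x) = x"
    using ab Q.inv_if Q.square_if by (auto simp: H.m_assoc[symmetric])
  have ac: "?m a ?c = ?m (inv\<^bsub>H\<^esub> ?c) a" using ab invab by (simp add: H.inv_mult_group H.m_assoc)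
  obtain a0 c0 where a0: "a0 \<in> carrier G" "h a0 = a" and c0: "c0 \<in> carrier G" "h c0 = ?c"
    using lift ab(1) c(1) by metis
  let ?y = "c0 \<otimes> c0"
  have hy: "h ?y = h w" using c0 c(2) unfolding Q.q_def by simp
  have y_cases: "?y = w \<or> ?y = z \<otimes> w" using heq[OF hy] c0 w by simp
  have a0C: "a0 \<otimes> w \<noteq> w \<otimes> a0" using nU a0 unfolding U_def C_def by blast
  have a0y: "a0 \<otimes> ?y \<noteq> ?y \<otimes> a0"
  proof
    assume e: "a0 \<otimes> ?y = ?y \<otimes> a0"
    show False
    proof (cases "?y = w")
      case False
      then have y: "?y = z \<otimes> w" using y_cases by simp
      have "z \<otimes> (a0 \<otimes> w) = z \<otimes> (w \<otimes> a0)" using e zl[OF a0(1) w] a0(1) w z(1) unfolding y by (simp add: G.m_assoc)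
      then show False using a0C a0(1) w z(1) by simp
    qed (use e a0C in simp)
  qed
  have yc: "?y \<in> carrier G" using c0 by simp
  have "h (a0 \<otimes> ?y) = h (?y \<otimes> a0)"
    using a0 hom_mult[OF a0(1) yc] hom_mult[OF yc a0(1)] Q.z_central[of a] ab(1) unfolding hy by simp
  \<comment> \<open>a0 does not centralize c0 c0, so moving it across introduces z. On the other
    hand a0 inverts c0 up to z, hence inverts c0 c0 exactly. Comparing the two gives c0^4 =
    z.\<close>
  then have e1: "a0 \<otimes> ?y = z \<otimes> (?y \<otimes> a0)" using heq[of "a0 \<otimes> ?y" "?y \<otimes> a0"] a0y a0(1) yc by auto
  have "h (a0 \<otimes> c0) = h (inv c0 \<otimes> a0)" using ac a0 c0 by simp
  then have "a0 \<otimes> c0 = inv c0 \<otimes> a0 \<or> a0 \<otimes> c0 = z \<otimes> (inv c0 \<otimes> a0)" using heq[of "a0 \<otimes> c0" "inv c0 \<otimes> a0"] a0(1) c0(1) by auto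
  then have e2: "a0 \<otimes> ?y = inv ?y \<otimes> a0"
  proof
    assume e: "a0 \<otimes> c0 = inv c0 \<otimes> a0"
    have "a0 \<otimes> ?y = (a0 \<otimes> c0) \<otimes> c0" using a0(1) c0(1) by (simp add: G.m_assoc)
    also have "\<dots> = inv c0 \<otimes> (a0 \<otimes> c0)" using arg_cong[OF e, of "\<lambda>x. x \<otimes> c0"] a0(1) c0(1) by (simp add: G.m_assoc)
    finally show ?thesis unfolding e using a0(1) c0(1) by (simp add: G.m_assoc[symmetric] G.inv_mult_group)
  next
    assume e: "a0 \<otimes> c0 = z \<otimes> (inv c0 \<otimes> a0)"
    have "a0 \<otimes> ?y = (a0 \<otimes> c0) \<otimes> c0" using a0(1) c0(1) by (simp add: G.m_assoc)
    also have "\<dots> = z \<otimes> (inv c0 \<otimes> (a0 \<otimes> c0))" using arg_cong[OF e, of "\<lambda>x. x \<otimes> c0"] a0(1) c0(1) z(1) by (simp add: G.m_assoc)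
    also have "\<dots> = z \<otimes> (z \<otimes> (inv c0 \<otimes> (inv c0 \<otimes> a0)))" unfolding e using zl a0(1) c0(1) by simp
    finally show ?thesis using zz a0(1) c0(1) by (simp add: G.m_assoc[symmetric] G.inv_mult_group)
  qed
  have yy: "?y \<otimes> ?y = z"
  proof -
    have "inv ?y \<otimes> a0 = (z \<otimes> ?y) \<otimes> a0" using e1 e2 a0(1) yc z(1) by (simp add: G.m_assoc)
    then have "inv ?y = z \<otimes> ?y" using a0(1) yc z(1) by simp
    then have "?y \<otimes> (z \<otimes> ?y) = \<one>" using yc by (metis G.r_inv)
    then have "z \<otimes> (?y \<otimes> ?y) = \<one>" using zl[OF yc yc] by simp
    then have "z \<otimes> (z \<otimes> (?y \<otimes> ?y)) = z" using z(1) by simp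
    then show ?thesis using zz yc by simp
  qed
  let ?Z = "{x. Q.central x}" and ?v = "h w"
  have cenH: "?m g x = ?m x g" if "Q.central x" "g \<in> carrier H" for x g
    using Q.centralD[OF that(1)] that(2) unfolding Q.com_def by auto
  obtain R where R: "subgroup R H" "R \<subseteq> ?Z" "?v \<notin> R" "?Z = R \<union> (\<lambda>r. ?m ?v r) ` R"
  proof (rule H.central_complement[OF Q.fin Q.subgroup_central, of ?v])
    show "?v \<in> ?Z" using Q.central_z by simp
    show "?v \<noteq> \<one>\<^bsub>H\<^esub>" by (rule Q.z_not_one)
    show "?m x x = \<one>\<^bsub>H\<^esub>" if "x \<in> ?Z" for x using that nqc Q.centralD(1) Q.square_if by simp
  qed (use cenH in auto)
  have Rc: "\<rho> \<in> carrier H" "Q.central \<rho>" if "\<rho> \<in> R" for \<rho> using that R(2) Q.centralD(1) by auto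
  have R1: "\<one>\<^bsub>H\<^esub> \<in> R" using subgroup.one_closed[OF R(1)] .
  \<comment> \<open>Dividing by the preimage of R reduces the center of H to the image of w, so G
    modulo N is D8, while z = c0^4 lies in N.\<close>
  define N where "N = {x \<in> carrier G. h x \<in> R}"
  have Nn: "N \<lhd> G"
  proof (rule G.subgroup_normalI)
    show "subgroup N G"
    proof (rule G.subgroupI)
      show "N \<subseteq> carrier G" "N \<noteq> {}" using R1 unfolding N_def by auto
      fix x y assume "x \<in> N" "y \<in> N"
      then show "inv x \<in> N" "x \<otimes> y \<in> N" using subgroup.m_closed[OF R(1)] subgroup.m_inv_closed[OF R(1)] unfolding N_def by auto
    qed
    fix x n assume x: "x \<in> carrier G" and n: "n \<in> N"
    have "h (x \<otimes> n \<otimes> inv x) = h n" using x n cenH[OF Rc(2), of "h n" "h x"] unfolding N_def by (simp add: H.m_assoc)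
    then show "x \<otimes> n \<otimes> inv x \<in> N" using x n unfolding N_def by simp
  qed
  interpret N: normal N G by (rule Nn)
  interpret p: group_hom G "G Mod N" "(#>) N" by (rule N.Mod_group_hom)
  have peq: "N #> x = N #> y \<longleftrightarrow> ?m (h x) (inv\<^bsub>H\<^esub> (h y)) \<in> R" if "x \<in> carrier G" "y \<in> carrier G" for x y
    using N.Mod_eq_iff[OF that] that unfolding N_def by simp
  have peq': "N #> x = N #> y" if "h x = ?m \<rho> (h y)" "\<rho> \<in> R" "x \<in> carrier G" "y \<in> carrier G" for x y \<rho>
    using peq[OF that(3,4)] that Rc by (simp add: H.m_assoc)
  have pone: "N #> x = \<one>\<^bsub>G Mod N\<^esub> \<longleftrightarrow> h x \<in> R" if "x \<in> carrier G" for x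
    using N.Mod_eq_one_iff[OF that] that unfolding N_def by simp
  have pm: "(N #> x) \<otimes>\<^bsub>G Mod N\<^esub> (N #> y) = N #> (x \<otimes> y)" if "x \<in> carrier G" "y \<in> carrier G" for x y
    using p.hom_mult[OF that] by simp
  have noncen: "x \<notin> R" if "x \<in> carrier H" "\<not> Q.com x a" for x using that Rc(2) Q.centralD(2) ab(1) by blast
  have noncen': "x \<notin> R" if "x \<in> carrier H" "\<not> Q.com x b" for x using that Rc(2) Q.centralD(2) ab(2) by blast
  have ba: "\<not> Q.com b a" using ab(5) Q.com_sym by blast
  show ?thesis
  proof (rule p.not_filled_dihedral_quotient[OF fin c0(1) a0(1) z(1) _ z(2,3) yy])
    show "N #> z = \<one>\<^bsub>G Mod N\<^esub>" using pone z(1) hz R1 by simp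
    show "(N #> a0) \<otimes>\<^bsub>G Mod N\<^esub> (N #> a0) = \<one>\<^bsub>G Mod N\<^esub>"
      unfolding pm[OF a0(1) a0(1)] using pone[of "a0 \<otimes> a0"] a0 invab R1 by (metis G.m_closed hom_mult)
    have "h (c0 \<otimes> (a0 \<otimes> c0)) = ?m \<one>\<^bsub>H\<^esub> (h a0)" using a0 c0 ab invab by (simp add: H.m_assoc)
    from peq'[OF this R1] show "(N #> c0) \<otimes>\<^bsub>G Mod N\<^esub> ((N #> a0) \<otimes>\<^bsub>G Mod N\<^esub> (N #> c0)) = N #> a0"
      using pm a0(1) c0(1) by (metis G.m_closed)
    show "N #> ?y \<noteq> \<one>\<^bsub>G Mod N\<^esub>" using pone[OF yc] hy R(3) by metis
    show "N #> a0 \<noteq> \<one>\<^bsub>G Mod N\<^esub>" using pone[OF a0(1)] noncen'[of a] ab a0(2) by metis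
    show "N #> a0 \<noteq> N #> c0" using peq[OF a0(1) c0(1)] noncen[of "?m a (inv\<^bsub>H\<^esub> ?c)"] ab ba a0(2) c0(2) c(1) by simp
    show "N #> a0 \<noteq> N #> ?y" using peq[OF a0(1) yc] noncen'[of "?m a (inv\<^bsub>H\<^esub> ?v)"] ab a0(2) w unfolding hy by simp
    show "N #> a0 \<noteq> N #> inv c0" using peq[OF a0(1), of "inv c0"] noncen[of "?m a ?c"] ab ba a0(2) c0 c(1) by simp
    fix g assume g: "g \<in> carrier G"
    obtain e u where eu: "Q.central e" "u \<in> {\<one>\<^bsub>H\<^esub>, a, b, ?c}" "h g = ?m e u" using dec hom_closed[OF g] by blast
    have "e \<in> R \<union> (\<lambda>r. ?m ?v r) ` R" unfolding R(4)[symmetric] using eu(1) by simp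
    then obtain \<rho> where \<rho>: "\<rho> \<in> R" "e = \<rho> \<or> e = ?m ?v \<rho>" by blast
    have uc: "u \<in> carrier H" using eu(2) ab by auto
    have rc: "\<rho> \<in> carrier H" using Rc \<rho>(1) by blast
    have hg: "h g = ?m \<rho> u \<or> h g = ?m \<rho> (?m ?v u)"
      using \<rho>(2) eu(3) uc rc Q.z_left[OF rc uc] w by (auto simp: H.m_assoc)
    have invc: "inv\<^bsub>H\<^esub> ?c = ?m ?v ?c" using Q.inv_if[OF c(1)] c(2) by simp
    have av: "?m ?v a = ?m a ?v" using Q.z_central ab(1) by simp
    \<comment> \<open>The classes modulo R are {1, v} times {1, a, b, a b} with v the image of w;
      here each is written as a power of c0 with or without a0 in front.\<close>
    have words: "\<one>\<^bsub>H\<^esub> = h \<one>" "a = h (a0 \<otimes> \<one>)" "b = h (a0 \<otimes> c0)" "?c = h c0" "?m ?v \<one>\<^bsub>H\<^esub> = h ?y" "?m ?v a = h (a0 \<otimes> ?y)"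
      "?m ?v b = h (a0 \<otimes> inv c0)" "?m ?v ?c = h (inv c0)"
    proof -
      show "?m ?v a = h (a0 \<otimes> ?y)" using hom_mult[OF a0(1) yc] a0(2) av unfolding hy by simp
      show "?m ?v \<one>\<^bsub>H\<^esub> = h ?y" unfolding hy using w by simp
      have "h (a0 \<otimes> inv c0) = ?m a (?m ?v ?c)" using a0 c0 invc by simp
      also have "\<dots> = ?m ?v (?m a ?c)" using Q.z_left[OF ab(1) c(1)] .
      finally show "?m ?v b = h (a0 \<otimes> inv c0)" using ab invab by simp
      show "\<one>\<^bsub>H\<^esub> = h \<one>" "a = h (a0 \<otimes> \<one>)" "?c = h c0" using a0 c0 by simp_all
      show "b = h (a0 \<otimes> c0)" using hom_mult[OF a0(1) c0(1)] a0(2) c0(2) invab(5)[OF ab(2)] by simp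
      show "?m ?v ?c = h (inv c0)" using hom_inv[OF c0(1)] unfolding c0(2) invc by (rule sym)
    qed
    let ?W = "{\<one>, c0, ?y, inv c0}"
    have "\<exists>u'\<in>?W. \<exists>t\<in>{\<one>, a0}. h g = ?m \<rho> (h (t \<otimes> u'))"
    proof -
      have one: "\<one> \<otimes> x = x" if "x \<in> ?W" for x using that c0(1) by auto
      have t: "\<exists>u'\<in>?W. \<exists>t\<in>{\<one>, a0}. h g = ?m \<rho> (h (t \<otimes> u'))"
        if "h g = ?m \<rho> (h (t \<otimes> x))" "x \<in> ?W" "t \<in> {\<one>, a0}" for x t using that by blast
      have t1: "\<exists>u'\<in>?W. \<exists>t\<in>{\<one>, a0}. h g = ?m \<rho> (h (t \<otimes> u'))" if x: "h g = ?m \<rho> (h x)" "x \<in> ?W" for x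
        by (rule t[of \<one>]) (use x in \<open>simp_all only: one[OF x(2)] insert_iff simp_thms\<close>)
      note t2 = t[of a0, OF _ _ insertI2[OF singletonI]]
      from hg eu(2) consider "h g = ?m \<rho> \<one>\<^bsub>H\<^esub>" | "h g = ?m \<rho> a" | "h g = ?m \<rho> b" | "h g = ?m \<rho> ?c"
        | "h g = ?m \<rho> (?m ?v \<one>\<^bsub>H\<^esub>)" | "h g = ?m \<rho> (?m ?v a)" | "h g = ?m \<rho> (?m ?v b)" | "h g = ?m \<rho> (?m ?v ?c)" by blast
      then show ?thesis
      proof cases
        case 1 then show ?thesis using t1[of \<one>] unfolding words(1) by blast
      next
        case 2 then show ?thesis using t2[of \<one>] unfolding words(2) by blast
      next
        case 3 then show ?thesis using t2[of c0] unfolding words(3) by blast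
      next
        case 4 then show ?thesis using t1[of c0] unfolding words(4) by blast
      next
        case 5 then show ?thesis using t1[of ?y] unfolding words(5) by blast
      next
        case 6 then show ?thesis using t2[of ?y] unfolding words(6) by blast
      next
        case 7 then show ?thesis using t2[of "inv c0"] unfolding words(7) by blast
      next
        case 8 then show ?thesis using t1[of "inv c0"] unfolding words(8) by blast
      qed
    qed
    then obtain u' t where ut: "u' \<in> ?W" "t \<in> {\<one>, a0}" "h g = ?m \<rho> (h (t \<otimes> u'))" by blast
    have u'c: "u' \<in> carrier G" "t \<in> carrier G" using ut a0 c0 by auto
    have "N #> g = N #> (t \<otimes> u')" using peq'[OF ut(3) \<rho>(1) g] u'c by simp
    then have "N #> g = N #> u' \<or> N #> g = (N #> a0) \<otimes>\<^bsub>G Mod N\<^esub> (N #> u')"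
      using ut(2) pm[OF a0(1) u'c(1)] u'c(1) by auto
    then show "\<exists>u\<in>?W. N #> g = N #> u \<or> N #> g = (N #> a0) \<otimes>\<^bsub>G Mod N\<^esub> (N #> u)" using ut(1) by blast
  qed
qed

section \<open>Class 2 with a four-element group of squares and commutators\<close>

context class2_group
begin

lemma K_mult_neq:
  assumes "n \<in> K" "v \<in> K" "n \<noteq> \<one>" "v \<noteq> \<one>" "n \<noteq> v"
  shows "n \<otimes> v \<noteq> \<one>" "n \<otimes> v \<noteq> n" "n \<otimes> v \<noteq> v"
proof -
  note c = K_closed[OF assms(1)] K_closed[OF assms(2)]
  show "n \<otimes> v \<noteq> \<one>" using K_cancel[OF assms(1) c(2)] c assms(5) by (metis r_one)
  show "n \<otimes> v \<noteq> n" "n \<otimes> v \<noteq> v" using c assms(3,4) by simp_all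
qed

lemma K_eq:
  assumes "card K = 4" "n \<in> K" "v \<in> K" "n \<noteq> \<one>" "v \<noteq> \<one>" "n \<noteq> v"
  shows "K = {\<one>, n, v, n \<otimes> v}"
proof -
  have "card {\<one>, n, v, n \<otimes> v} = 4" using K_mult_neq[OF assms(2-6)] assms(4,5,6) by auto
  moreover have "{\<one>, n, v, n \<otimes> v} \<subseteq> K" using assms(2,3) K_mult subgroup.one_closed[OF K] by simp
  ultimately show ?thesis using assms(1) card_subset_eq[of K "{\<one>, n, v, n \<otimes> v}"] finite_subset[OF subgroup.subset[OF K] finG] by simp
qed

lemma pair_normal:
  assumes "n \<in> K"
  shows "{\<one>, n} \<lhd> G"
proof (rule subgroup_normalI)
  have n: "n \<in> carrier G" using K_closed[OF assms] .
  show "subgroup {\<one>, n} G"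
  proof (rule subgroupI)
    fix x y assume "x \<in> {\<one>, n}" "y \<in> {\<one>, n}"
    then show "inv x \<in> {\<one>, n}" "x \<otimes> y \<in> {\<one>, n}" using n K_square[OF assms] by (auto simp: inv_equality)
  qed (use n in auto)
  fix x h assume x: "x \<in> carrier G" and h: "h \<in> {\<one>, n}"
  then have "h \<in> carrier G" "x \<otimes> h = h \<otimes> x" using K_central[OF assms] n by auto
  then show "x \<otimes> h \<otimes> inv x \<in> {\<one>, n}" using x h by (simp add: m_assoc)
qed

text \<open>Dividing out an involution n of a four-element K leaves one nontrivial value, the image
  of v. Each of the three choices of n thus makes a quotient of G a quadratic group, and playing
  these forms against each other drives the class 2 argument.\<close>

lemma quadratic_Mod:
  assumes n: "n \<in> K" "v \<in> K" "n \<noteq> \<one>" "v \<noteq> \<one>" "n \<noteq> v" and card: "card K = 4"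
  shows "quadratic_group (G Mod {\<one>, n}) ({\<one>, n} #> v)"
    and "x \<in> carrier G \<Longrightarrow> quadratic_group.q (G Mod {\<one>, n}) ({\<one>, n} #> v) ({\<one>, n} #> x) \<longleftrightarrow> x \<otimes> x \<notin> {\<one>, n}"
    and "x \<in> carrier G \<Longrightarrow> y \<in> carrier G \<Longrightarrow>
      quadratic_group.com (G Mod {\<one>, n}) ({\<one>, n} #> x) ({\<one>, n} #> y) \<longleftrightarrow> kappa x y \<in> {\<one>, n}"
proof -
  let ?M = "{\<one>, n}"
  interpret M: normal ?M G by (rule pair_normal[OF n(1)])
  interpret p: group_hom G "G Mod ?M" "(#>) ?M" by (rule M.Mod_group_hom)
  note vc = K_closed[OF n(2)] and nc = K_closed[OF n(1)]
  have lift: "\<exists>x\<in>carrier G. ?M #> x = y" if "y \<in> carrier (G Mod ?M)" for y using M.Mod_surj that by (metis imageE)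
  have pm: "(?M #> x) \<otimes>\<^bsub>G Mod ?M\<^esub> (?M #> y) = ?M #> (x \<otimes> y)" if "x \<in> carrier G" "y \<in> carrier G" for x y
    using p.hom_mult[OF that] by simp
  have notM: "k \<notin> ?M \<longleftrightarrow> ?M #> k = ?M #> v" if k: "k \<in> K" for k
  proof -
    have "?M #> k = ?M #> v \<longleftrightarrow> k \<otimes> v \<in> ?M"
      using M.Mod_eq_iff[OF K_closed[OF k] vc] K_square[OF n(2)] inv_equality[OF _ vc vc] by simp
    also have "\<dots> \<longleftrightarrow> k \<notin> ?M"
    proof -
      have e: "v \<otimes> v = \<one>" "n \<otimes> v \<otimes> v = n" using K_square[OF n(2)] vc nc by (simp_all add: m_assoc)
      have d: "v \<notin> ?M" "n \<otimes> v \<notin> ?M" using n K_mult_neq[OF n] by simp_all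
      have "k \<in> {\<one>, n, v, n \<otimes> v}" using k unfolding K_eq[OF card n, symmetric] .
      then consider "k = \<one>" | "k = n" | "k = v" | "k = n \<otimes> v" by blast
      then show ?thesis
      proof cases
        case 1
        then show ?thesis using d(1) vc by simp
      next
        case 2
        show ?thesis unfolding 2 using d(2) by blast
      next
        case 3
        then show ?thesis using d(1) e(1) by blast
      next
        case 4
        show ?thesis unfolding 4 e(2) using d(2) by blast
      qed
    qed
    finally show ?thesis by simp
  qed
  show Q: "quadratic_group (G Mod ?M) (?M #> v)"
  proof (intro quadratic_group.intro quadratic_group_axioms.intro)
    show "group (G Mod ?M)" by (rule M.factorgroup_is_group)
    show "finite (carrier (G Mod ?M))" using finG M.Mod_surj by (metis finite_imageI)
    show "?M #> v \<in> carrier (G Mod ?M)" using p.hom_closed[OF vc] .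
    show "?M #> v \<noteq> \<one>\<^bsub>G Mod ?M\<^esub>" using M.Mod_eq_one_iff[OF vc] n by simp
    show "(?M #> v) \<otimes>\<^bsub>G Mod ?M\<^esub> (?M #> v) = \<one>\<^bsub>G Mod ?M\<^esub>"
      unfolding pm[OF vc vc] K_square[OF n(2)] using p.hom_one .
    fix y assume "y \<in> carrier (G Mod ?M)"
    then obtain x where x: "x \<in> carrier G" "?M #> x = y" using lift by blast
    show "y \<otimes>\<^bsub>G Mod ?M\<^esub> (?M #> v) = (?M #> v) \<otimes>\<^bsub>G Mod ?M\<^esub> y"
      unfolding x(2)[symmetric] pm[OF x(1) vc] pm[OF vc x(1)] K_central[OF n(2) x(1)] ..
    show "y \<otimes>\<^bsub>G Mod ?M\<^esub> y = \<one>\<^bsub>G Mod ?M\<^esub> \<or> y \<otimes>\<^bsub>G Mod ?M\<^esub> y = ?M #> v"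
      unfolding x(2)[symmetric] pm[OF x(1) x(1)] using notM[OF square_in_K[OF x(1)]] M.Mod_eq_one_iff[of "x \<otimes> x"] x(1) by auto
  qed
  show "quadratic_group.q (G Mod ?M) (?M #> v) (?M #> x) \<longleftrightarrow> x \<otimes> x \<notin> ?M" if "x \<in> carrier G"
    unfolding quadratic_group.q_def[OF Q] pm[OF that that] using notM[OF square_in_K[OF that]] by blast
  show "quadratic_group.com (G Mod ?M) (?M #> x) (?M #> y) \<longleftrightarrow> kappa x y \<in> ?M" if xy: "x \<in> carrier G" "y \<in> carrier G"
  proof -
    have "?M #> (x \<otimes> y) = ?M #> (y \<otimes> x) \<longleftrightarrow> kappa x y \<in> ?M"
      unfolding M.Mod_eq_iff[OF m_closed[OF xy] m_closed[OF xy(2,1)]] using xy by (simp add: kappa_def m_assoc inv_mult_group)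
    then show ?thesis unfolding quadratic_group.com_def[OF Q] pm[OF xy] pm[OF xy(2,1)] .
  qed
qed

text \<open>Modulo {1, n} the element r is central, and \<open>filled_central\<close> gives square 1
  there.\<close>

lemma filled_square_in_pair:
  assumes f: "filled G" and card: "card K = 4" and n: "n \<in> K" "n \<noteq> \<one>"
    and r: "r \<in> carrier G" "\<And>g. g \<in> carrier G \<Longrightarrow> kappa r g \<in> {\<one>, n}"
  shows "r \<otimes> r \<in> {\<one>, n}"
proof -
  let ?M = "{\<one>, n}"
  interpret M: normal ?M G by (rule pair_normal[OF n(1)])
  have "\<not> K \<subseteq> ?M"
  proof
    assume "K \<subseteq> ?M"
    then have "card K \<le> card ?M" by (intro card_mono) auto
    then show False using card card_insert_le_m1[of 2 "{n}" \<one>] by simp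
  qed
  then obtain v where v: "v \<in> K" "v \<noteq> \<one>" "n \<noteq> v" by blast
  interpret Q: quadratic_group "G Mod ?M" "?M #> v" using quadratic_Mod(1)[OF n(1) v(1) n(2) v(2,3) card] .
  have "Q.com (?M #> r) y" if y: "y \<in> carrier (G Mod ?M)" for y
  proof -
    obtain g where "g \<in> carrier G" "?M #> g = y" using M.Mod_surj y by (metis imageE)
    then show ?thesis using quadratic_Mod(3)[OF n(1) v(1) n(2) v(2,3) card r(1)] r(2) by blast
  qed
  then have "Q.central (?M #> r)" unfolding Q.central_def using r(1) M.Mod_surj by blast
  then have "\<not> Q.q (?M #> r)" using Q.filled_central M.filled_Mod[OF f] by blast
  then show ?thesis using quadratic_Mod(2)[OF n(1) v(1) n(2) v(2,3) card r(1)] by blast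
qed

lemma span_induct:
  assumes cover: "\<And>g. g \<in> carrier G \<Longrightarrow> \<exists>m\<in>K. \<exists>u\<in>{\<one>, a, b, a \<otimes> b}. g = m \<otimes> u \<or> g = m \<otimes> (r \<otimes> u)"
    and abr: "a \<in> carrier G" "b \<in> carrier G" "r \<in> carrier G"
    and P: "\<And>m. m \<in> K \<Longrightarrow> P m" "P a" "P b" "P r" "\<And>x y. x \<in> carrier G \<Longrightarrow> y \<in> carrier G \<Longrightarrow> P x \<Longrightarrow> P y \<Longrightarrow> P (x \<otimes> y)"
    and g: "g \<in> carrier G"
  shows "P g"
proof -
  obtain m u where mu: "m \<in> K" "u \<in> {\<one>, a, b, a \<otimes> b}" "g = m \<otimes> u \<or> g = m \<otimes> (r \<otimes> u)" using cover[OF g] by blast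
  have one: "P \<one>" using P(1)[OF subgroup.one_closed[OF K]] .
  have u: "u \<in> carrier G" "P u" using mu(2) one P(2,3) P(5)[OF abr(1,2)] abr by auto
  have "P (m \<otimes> u)" using P(5)[OF K_closed[OF mu(1)] u(1) P(1)[OF mu(1)] u(2)] .
  moreover have "P (m \<otimes> (r \<otimes> u))" using P(5)[OF K_closed[OF mu(1)] _ P(1)[OF mu(1)] P(5)[OF abr(3) u(1) P(4) u(2)]] abr(3) u(1) by simp
  ultimately show ?thesis using mu(3) by blast
qed

lemma kappa_span:
  assumes cover: "\<And>g. g \<in> carrier G \<Longrightarrow> \<exists>m\<in>K. \<exists>u\<in>{\<one>, a, b, a \<otimes> b}. g = m \<otimes> u \<or> g = m \<otimes> (r \<otimes> u)"
    and abr: "a \<in> carrier G" "b \<in> carrier G" "r \<in> carrier G"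
    and n: "n \<in> K" and x: "x \<in> carrier G" "kappa x a \<in> {\<one>, n}" "kappa x b \<in> {\<one>, n}" "kappa x r \<in> {\<one>, n}"
    and g: "g \<in> carrier G"
  shows "kappa x g \<in> {\<one>, n}"
proof (rule span_induct[where P = "\<lambda>g. kappa x g \<in> {\<one>, n}", OF cover abr _ x(2-4) _ g])
  show "kappa x m \<in> {\<one>, n}" if "m \<in> K" for m using kappa_K(1)[OF that x(1)] by simp
  fix y w assume "y \<in> carrier G" "w \<in> carrier G" "kappa x y \<in> {\<one>, n}" "kappa x w \<in> {\<one>, n}"
  then show "kappa x (y \<otimes> w) \<in> {\<one>, n}" using kappa_mult[OF x(1)] K_square[OF n] K_closed[OF n] by auto
qed

text \<open>Each involution of K is used once in \<open>filled_square_in_pair\<close>: with z2 it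
  yields a a = 1, and with z1 for r and z1 z2 for r a it yields r r = 1. If b b = z1, then b is
  replaced by b r, whose square is [b, r] (b b)(r r) = z1 z1 = 1 and which satisfies the same
  commutator relations.\<close>

lemma wreath_configuration_not_filled:
  assumes card: "card K = 4" and z1: "z1 \<in> K" "z1 \<noteq> \<one>"
    and abr: "a \<in> carrier G" "b \<in> carrier G" "r \<in> carrier G"
    and sq: "a \<otimes> a \<in> {\<one>, z1}" "b \<otimes> b \<in> {\<one>, z1}"
    and kap: "kappa a b \<notin> {\<one>, z1}" "kappa r a = \<one>" "kappa r b = z1"
    and cover: "\<And>g. g \<in> carrier G \<Longrightarrow> \<exists>m\<in>K. \<exists>u\<in>{\<one>, a, b, a \<otimes> b}. g = m \<otimes> u \<or> g = m \<otimes> (r \<otimes> u)"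
  shows "\<not> filled G"
proof
  assume f: "filled G"
  define z2 where "z2 = kappa a b"
  have z2: "z2 \<in> K" "z2 \<noteq> \<one>" "z1 \<noteq> z2" using kap(1) kappa_in_K[OF abr(1,2)] unfolding z2_def by auto
  note Keq = K_eq[OF card z1(1) z2(1) z1(2) z2(2,3)]
  note zc = K_closed[OF z1(1)] K_closed[OF z2(1)]
  have kab: "kappa a b = z2" unfolding z2_def ..
  have sym: "kappa a r = \<one>" "kappa b r = z1" using kappa_sym abr kap by auto
  have A: "c \<otimes> c \<in> {\<one>, n}" if "n \<in> K" "n \<noteq> \<one>" "c \<in> carrier G" "kappa c a \<in> {\<one>, n}" "kappa c b \<in> {\<one>, n}" "kappa c r \<in> {\<one>, n}" for c n
    using filled_square_in_pair[OF f card that(1-3) kappa_span[OF cover abr that(1,3-6)]] by blast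
  have "a \<otimes> a \<in> {\<one>, z2}" by (rule A) (use z2 abr kappa_refl kab sym in auto)
  then have aa: "a \<otimes> a = \<one>" using sq(1) z2(3) by auto
  have r1: "r \<otimes> r \<in> {\<one>, z1}" by (rule A) (use z1 abr kappa_refl kap in auto)
  have z3: "z1 \<otimes> z2 \<in> K" "z1 \<otimes> z2 \<noteq> \<one>" "z1 \<otimes> z2 \<noteq> z1"
    using K_mult[OF z1(1) z2(1)] K_mult_neq[OF z1(1) z2(1) z1(2) z2(2,3)] by simp_all
  have "(r \<otimes> a) \<otimes> (r \<otimes> a) \<in> {\<one>, z1 \<otimes> z2}"
    by (rule A) (use z3 abr kappa_refl kappa_mult_left kap(2,3) kab sym in auto)
  then have "r \<otimes> r \<in> {\<one>, z1 \<otimes> z2}" using square_mult[OF abr(3,1)] aa kap(2) abr by simp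
  then have rr: "r \<otimes> r = \<one>" using r1 z3(3) by auto
  have "b \<otimes> b = \<one> \<or> b \<otimes> b = z1" using sq(2) by auto
  then show False
  proof
    assume "b \<otimes> b = \<one>"
    then show False using not_filled_wreath_type[OF Keq z1(2) z2(2,3) abr aa _ rr kab kap(3,2) cover] f by blast
  next
    assume bb: "b \<otimes> b = z1"
    let ?b = "b \<otimes> r"
    have bc: "?b \<in> carrier G" using abr by simp
    have bb': "?b \<otimes> ?b = \<one>" using square_mult[OF abr(2,3)] bb rr sym K_square[OF z1(1)] zc by simp
    have kab': "kappa a ?b = z2" using kappa_mult[OF abr(1,2,3)] kab sym zc by simp
    have krb: "kappa r ?b = z1" using kappa_mult[OF abr(3,2,3)] kap(3) kappa_refl[OF abr(3)] zc by simp
    have "\<exists>m\<in>K. \<exists>u\<in>{\<one>, a, ?b, a \<otimes> ?b}. g = m \<otimes> u \<or> g = m \<otimes> (r \<otimes> u)" if g: "g \<in> carrier G" for g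
    proof -
      have rb: "r \<otimes> b = z1 \<otimes> ?b" using mult_kappa[OF abr(3,2)] kap(3) by simp
      have b: "b = z1 \<otimes> (r \<otimes> ?b)"
      proof -
        have "r \<otimes> ?b = (r \<otimes> b) \<otimes> r" using abr by (simp add: m_assoc)
        also have "\<dots> = z1 \<otimes> (b \<otimes> (r \<otimes> r))" unfolding rb using abr zc by (simp add: m_assoc)
        finally show ?thesis using K_cancel[OF z1(1) abr(2)] rr abr by simp
      qed
      have ar: "a \<otimes> r = r \<otimes> a" using mult_kappa[OF abr(1,3)] sym abr by simp
      have ab: "a \<otimes> b = z1 \<otimes> (r \<otimes> (a \<otimes> ?b))"
      proof -
        have "a \<otimes> b = a \<otimes> (z1 \<otimes> (r \<otimes> ?b))" using b by metis
        also have "\<dots> = z1 \<otimes> ((a \<otimes> r) \<otimes> ?b)" using K_left[OF z1(1) abr(1)] abr by (simp add: m_assoc)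
        finally show ?thesis unfolding ar using abr by (simp add: m_assoc)
      qed
      have rab: "r \<otimes> (a \<otimes> b) = z1 \<otimes> (a \<otimes> ?b)"
      proof -
        have "r \<otimes> (a \<otimes> b) = (a \<otimes> r) \<otimes> b" unfolding ar using abr by (simp add: m_assoc)
        also have "\<dots> = a \<otimes> (z1 \<otimes> ?b)" unfolding rb[symmetric] using abr by (simp add: m_assoc)
        finally show ?thesis using K_left[OF z1(1) abr(1) bc] by simp
      qed
      obtain m u where mu: "m \<in> K" "u \<in> {\<one>, a, b, a \<otimes> b}" "g = m \<otimes> u \<or> g = m \<otimes> (r \<otimes> u)" using cover[OF g] by blast
      have mz: "m \<otimes> z1 \<in> K" using K_mult[OF mu(1) z1(1)] .
      have as: "m \<otimes> (z1 \<otimes> x) = m \<otimes> z1 \<otimes> x" if "x \<in> carrier G" for x using that K_closed[OF mu(1)] zc by (simp add: m_assoc)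
      have "m \<otimes> b = m \<otimes> z1 \<otimes> (r \<otimes> ?b)" using as[of "r \<otimes> ?b"] b abr by (metis m_closed)
      moreover have "m \<otimes> (a \<otimes> b) = m \<otimes> z1 \<otimes> (r \<otimes> (a \<otimes> ?b))" unfolding ab using as abr by simp
      moreover have "m \<otimes> (r \<otimes> b) = m \<otimes> z1 \<otimes> ?b" unfolding rb using as abr by simp
      moreover have "m \<otimes> (r \<otimes> (a \<otimes> b)) = m \<otimes> z1 \<otimes> (a \<otimes> ?b)" unfolding rab using as abr by simp
      ultimately show ?thesis using mu mz by blast
    qed
    from not_filled_wreath_type[OF Keq z1(2) z2(2,3) abr(1) bc abr(3) aa bb' rr kab' krb kap(2) this] f show False by blast
  qed
qed

text \<open>z1 is a nontrivial square x x. If the form modulo z1 contains a quaternion pair, the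
  commutators of x with lifts of the five singular elements are pairwise distinct: equality for two
  of them makes x commute with their product, whose square is outside {1, z1}, contradicting
  \<open>filled_no_C4_C4\<close>. Five values do not fit into K. Otherwise lifts a, b, r generate G
  over K and the pair ([r, a], [r, b]) decides: (1, 1) leaves all commutators in {1, z2}, the mixed
  pairs give the wreath configuration up to exchanging a and b, and (z1, z1) yields commuting
  elements r and a b with squares z1 and z2.\<close>

lemma class2_not_filled:
  assumes card: "card K = 4"
    and gen: "\<And>n. n \<in> K \<Longrightarrow> \<exists>x\<in>carrier G. \<exists>y\<in>carrier G. kappa x y \<notin> {\<one>, n}"
  shows "\<not> filled G"
proof
  assume f: "filled G"
  have "\<exists>x\<in>carrier G. x \<otimes> x \<noteq> \<one>"
  proof (rule ccontr)
    assume *: "\<not> ?thesis"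
    obtain x y where xy: "x \<in> carrier G" "y \<in> carrier G" "kappa x y \<noteq> \<one>" using gen[OF subgroup.one_closed[OF K]] by blast
    then have "x \<otimes> x = \<one>" "y \<otimes> y = \<one>" "(x \<otimes> y) \<otimes> (x \<otimes> y) = \<one>" using * by blast+
    then show False using square_mult[OF xy(1,2)] xy kappa_closed by simp
  qed
  then obtain x where x: "x \<in> carrier G" "x \<otimes> x \<noteq> \<one>" by blast
  define z1 where "z1 = x \<otimes> x"
  have z1: "z1 \<in> K" "z1 \<noteq> \<one>" using square_in_K x unfolding z1_def by auto
  obtain x0 y0 where xy0: "x0 \<in> carrier G" "y0 \<in> carrier G" "kappa x0 y0 \<notin> {\<one>, z1}" using gen[OF z1(1)] by blast
  define v where "v = kappa x0 y0"
  have v: "v \<in> K" "v \<noteq> \<one>" "z1 \<noteq> v" using xy0 kappa_in_K unfolding v_def by auto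
  let ?M = "{\<one>, z1}"
  let ?Q = "G Mod ?M" and ?p = "\<lambda>x. ?M #> x"
  let ?m = "\<lambda>x y. x \<otimes>\<^bsub>?Q\<^esub> y"
  interpret M: normal ?M G by (rule pair_normal[OF z1(1)])
  interpret p: group_hom G ?Q ?p by (rule M.Mod_group_hom)
  note quad = quadratic_Mod[OF z1(1) v(1) z1(2) v(2,3) card]
  interpret Q: quadratic_group ?Q "?p v" using quad(1) .
  have fQ: "filled ?Q" using M.filled_Mod[OF f] .
  have lift: "\<exists>x\<in>carrier G. ?p x = y" if "y \<in> carrier ?Q" for y using M.Mod_surj that by (metis imageE)
  have pm: "?m (?p x) (?p y) = ?p (x \<otimes> y)" if "x \<in> carrier G" "y \<in> carrier G" for x y
    using p.hom_mult[OF that] by simp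
  have nonab: "\<not> Q.com (?p x0) (?p y0)" using quad(3)[OF xy0(1,2)] xy0(3) by blast
  have vc: "v \<in> carrier G" and zc: "z1 \<in> carrier G" using K_closed v(1) z1(1) by auto
  obtain a' b' r' where ab'c: "a' \<in> carrier ?Q" "b' \<in> carrier ?Q"
    and all: "\<not> Q.q a' \<and> \<not> Q.q b' \<and> \<not> Q.com a' b' \<and> Q.central r' \<and>
      (\<forall>c. Q.central c \<longrightarrow> c \<in> {\<one>\<^bsub>?Q\<^esub>, ?p v, r', ?m (?p v) r'}) \<and> (r' = \<one>\<^bsub>?Q\<^esub> \<or> r' \<noteq> \<one>\<^bsub>?Q\<^esub> \<and> r' \<noteq> ?p v) \<and>
      ((\<forall>g\<in>carrier ?Q. \<exists>c. Q.central c \<and> (\<exists>u\<in>{\<one>\<^bsub>?Q\<^esub>, a', b', ?m a' b'}. g = ?m c u)) \<or>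
     (\<exists>i\<in>carrier ?Q. \<exists>j\<in>carrier ?Q. Q.q i \<and> Q.q j \<and> \<not> Q.com i j \<and> Q.com a' i \<and> Q.com a' j \<and> Q.com b' i \<and> Q.com b' j \<and>
       (\<forall>g\<in>carrier ?Q. \<exists>c. Q.central c \<and> (\<exists>u\<in>{\<one>\<^bsub>?Q\<^esub>, a', b', ?m a' b'}. \<exists>v\<in>{\<one>\<^bsub>?Q\<^esub>, i, j, ?m i j}. g = ?m c (?m v u)))))"
    using Q.filled_cases[OF fQ p.hom_closed[OF xy0(1)] p.hom_closed[OF xy0(2)] nonab]
    by (elim bexE exE) (rule that)
  have ab': "a' \<in> carrier ?Q" "b' \<in> carrier ?Q" "\<not> Q.q a'" "\<not> Q.q b'" "\<not> Q.com a' b'"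
    using ab'c all by simp_all
  note all' = all[THEN conjunct2, THEN conjunct2, THEN conjunct2]
  note r' = all'[THEN conjunct1] all'[THEN conjunct2, THEN conjunct1, rule_format]
  have dec: "(\<forall>g\<in>carrier ?Q. \<exists>c. Q.central c \<and> (\<exists>u\<in>{\<one>\<^bsub>?Q\<^esub>, a', b', ?m a' b'}. g = ?m c u)) \<or>
     (\<exists>i\<in>carrier ?Q. \<exists>j\<in>carrier ?Q. Q.q i \<and> Q.q j \<and> \<not> Q.com i j \<and> Q.com a' i \<and> Q.com a' j \<and> Q.com b' i \<and> Q.com b' j)"
    using all'[THEN conjunct2, THEN conjunct2, THEN conjunct2] by blast
  from dec show False
  proof
    assume "\<exists>i\<in>carrier ?Q. \<exists>j\<in>carrier ?Q. Q.q i \<and> Q.q j \<and> \<not> Q.com i j \<and> Q.com a' i \<and> Q.com a' j \<and> Q.com b' i \<and> Q.com b' j"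
    then obtain i j where ij: "i \<in> carrier ?Q" "j \<in> carrier ?Q" "Q.q i" "Q.q j" "\<not> Q.com i j" "Q.com a' i" "Q.com a' j" "Q.com b' i" "Q.com b' j"
      by blast
    obtain l where l: "\<And>y. y \<in> carrier ?Q \<Longrightarrow> l y \<in> carrier G \<and> ?p (l y) = y" using lift by metis
    define f' where "f' y = kappa x (l y)" for y
    have neq: "f' y \<noteq> f' w" if yw: "y \<in> carrier ?Q" "w \<in> carrier ?Q" "\<not> Q.q y" "\<not> Q.q w" "\<not> Q.com y w" for y w
    proof
      assume e: "f' y = f' w"
      have lc: "l y \<in> carrier G" "l w \<in> carrier G" "?p (l y) = y" "?p (l w) = w" using l yw by auto
      have k: "kappa x (l y \<otimes> l w) = \<one>"
        using kappa_mult[OF x(1) lc(1,2)] e K_square[OF kappa_in_K[OF x(1) lc(2)]] unfolding f'_def by simp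
      have "Q.q (?p (l y \<otimes> l w))" using pm[OF lc(1,2)] lc(3,4) yw by (metis Q.q_mult)
      then have s: "(l y \<otimes> l w) \<otimes> (l y \<otimes> l w) \<notin> ?M" using quad(2) lc by blast
      let ?s = "(l y \<otimes> l w) \<otimes> (l y \<otimes> l w)"
      have sK: "?s \<in> K" "?s \<noteq> \<one>" "z1 \<noteq> ?s" using s square_in_K lc by auto
      show False
        using filled_no_C4_C4[OF f K_eq[OF card z1(1) sK(1) z1(2) sK(2,3)] z1(2) sK(2,3) x(1) m_closed[OF lc(1,2)] z1_def[symmetric] refl] k by blast
    qed
    have sy: "Q.com b' a' \<longleftrightarrow> Q.com a' b'" "Q.com i a' \<longleftrightarrow> Q.com a' i" "Q.com j a' \<longleftrightarrow> Q.com a' j" "Q.com i b' \<longleftrightarrow> Q.com b' i" "Q.com j b' \<longleftrightarrow> Q.com b' j"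
       "Q.com j i \<longleftrightarrow> Q.com i j"
      using Q.com_sym by blast+
    \<comment> \<open>Together with a' and b', the elements \<open>?d\<close>, \<open>?e\<close>,
      \<open>?f\<close> represent the five singular points of the minus type form: none has
      \<open>q\<close> and no two commute.\<close>
    let ?c = "?m a' b'"
    let ?d = "?m ?c i" and ?e = "?m ?c j" and ?f = "?m ?c (?m i j)"
    note [simp] = ab' ij sy
    have "f' a' \<noteq> f' b'" "f' a' \<noteq> f' ?d" "f' a' \<noteq> f' ?e" "f' a' \<noteq> f' ?f" "f' b' \<noteq> f' ?d" "f' b' \<noteq> f' ?e" "f' b' \<noteq> f' ?f"
      "f' ?d \<noteq> f' ?e" "f' ?d \<noteq> f' ?f" "f' ?e \<noteq> f' ?f" by (rule neq; simp)+
    then have "card {f' a', f' b', f' ?d, f' ?e, f' ?f} = 5" by simp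
    moreover have "f' y \<in> K" if "y \<in> carrier ?Q" for y unfolding f'_def using kappa_in_K x(1) l that by blast
    then have "{f' a', f' b', f' ?d, f' ?e, f' ?f} \<subseteq> K" by simp
    ultimately show False using card card_mono[of K "{f' a', f' b', f' ?d, f' ?e, f' ?f}"] finite_subset[OF subgroup.subset[OF K] finG] by simp
  next
    assume d: "\<forall>g\<in>carrier ?Q. \<exists>c. Q.central c \<and> (\<exists>u\<in>{\<one>\<^bsub>?Q\<^esub>, a', b', ?m a' b'}. g = ?m c u)"
    obtain a b r where abr: "a \<in> carrier G" "b \<in> carrier G" "r \<in> carrier G" and p: "?p a = a'" "?p b = b'" "?p r = r'"
      using lift ab'(1,2) Q.centralD(1)[OF r'(1)] by metis
    have sq: "a \<otimes> a \<in> ?M" "b \<otimes> b \<in> ?M" using quad(2) abr ab' p by blast+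
    have kab: "kappa a b \<notin> ?M" using quad(3) abr ab' p by blast
    have kr: "kappa r g \<in> ?M" if "g \<in> carrier G" for g
      using quad(3)[OF abr(3) that] Q.centralD(2)[OF r'(1) p.hom_closed[OF that]] p(3) by blast
    have cover: "\<exists>m\<in>K. \<exists>u\<in>{\<one>, a, b, a \<otimes> b}. g = m \<otimes> u \<or> g = m \<otimes> (r \<otimes> u)" if g: "g \<in> carrier G" for g
    proof -
      obtain c u' where cu: "Q.central c" "u' \<in> {\<one>\<^bsub>?Q\<^esub>, a', b', ?m a' b'}" "?p g = ?m c u'" using bspec[OF d p.hom_closed[OF g]] by blast
      obtain u where u: "u \<in> {\<one>, a, b, a \<otimes> b}" "?p u = u'" using cu(2) p pm[OF abr(1,2)] p.hom_one by blast
      have uc: "u \<in> carrier G" using u(1) abr by auto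
      obtain t where t: "t \<in> {\<one>, v, r, v \<otimes> r}" "?p t = c" using r'(2)[OF cu(1)] p pm[OF vc abr(3)] p.hom_one by blast
      have tc: "t \<in> carrier G" using t(1) abr vc by auto
      have "?p g = ?p (t \<otimes> u)" using cu(3) pm[OF tc uc] t(2) u(2) by simp
      then have "g \<otimes> inv (t \<otimes> u) \<in> ?M" using M.Mod_eq_iff[OF g] tc uc by blast
      then obtain m where m: "m \<in> ?M" "g \<otimes> inv (t \<otimes> u) = m" by blast
      have mK: "m \<in> K" using m z1(1) subgroup.one_closed[OF K] by auto
      have "g = m \<otimes> (t \<otimes> u)" using m(2) g tc uc by (auto simp: m_assoc)
      moreover have "m \<otimes> (v \<otimes> u) = (m \<otimes> v) \<otimes> u" "m \<otimes> ((v \<otimes> r) \<otimes> u) = (m \<otimes> v) \<otimes> (r \<otimes> u)" "\<one> \<otimes> u = u"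
        using K_closed[OF mK] vc abr uc by (simp_all add: m_assoc)
      moreover have "m \<otimes> v \<in> K" using K_mult[OF mK v(1)] .
      moreover have "t = \<one> \<or> t = v \<or> t = r \<or> t = v \<otimes> r" using t(1) by blast
      ultimately show ?thesis using u(1) mK by metis
    qed
    define z2 where "z2 = kappa a b"
    have z2: "z2 \<in> K" "z2 \<noteq> \<one>" "z1 \<noteq> z2" using kab kappa_in_K[OF abr(1,2)] unfolding z2_def by auto
    have z2c: "z2 \<in> carrier G" using K_closed[OF z2(1)] .
    note Keq = K_eq[OF card z1(1) z2(1) z1(2) z2(2,3)]
    have kba: "kappa b a = z2" "kappa a b = z2" using kappa_sym[OF abr(1,2)] z2_def by simp_all
    have sym: "kappa a r = kappa r a" "kappa b r = kappa r b" using kappa_sym abr by auto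
    have "kappa r a = \<one> \<or> kappa r a = z1" "kappa r b = \<one> \<or> kappa r b = z1" using kr abr by auto
    then consider "kappa r a = \<one>" "kappa r b = \<one>" | "kappa r a = \<one>" "kappa r b = z1" | "kappa r a = z1" "kappa r b = \<one>" | "kappa r a = z1" "kappa r b = z1"
      by blast
    then show False
    proof cases
      case 1
      have a: "kappa x g \<in> {\<one>, z2}" if "x \<in> {a, b, r}" "g \<in> carrier G" for x g
        by (rule kappa_span[OF cover abr z2(1) _ _ _ _ that(2)])
          (use that(1) abr 1 sym kba kappa_refl in auto)
      have a': "kappa x h \<in> {\<one>, z2}" if "h \<in> {a, b, r}" "x \<in> carrier G" for x h
        using a[OF that] kappa_sym[OF that(2), of h] that(1) abr by auto
      have "kappa x y \<in> {\<one>, z2}" if "x \<in> carrier G" "y \<in> carrier G" for x y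
        by (rule kappa_span[OF cover abr z2(1) that(1) a'[OF _ that(1)] a'[OF _ that(1)] a'[OF _ that(1)] that(2)]) simp_all
      then show False using gen[OF z2(1)] by blast
    next
      case 2
      then show False using wreath_configuration_not_filled[OF card z1 abr sq kab _ _ cover] f by blast
    next
      case 3
      have ab: "a \<otimes> b = z2 \<otimes> (b \<otimes> a)" using mult_kappa[OF abr(1,2)] kba by simp
      have "\<exists>m\<in>K. \<exists>u\<in>{\<one>, b, a, b \<otimes> a}. g = m \<otimes> u \<or> g = m \<otimes> (r \<otimes> u)" if g: "g \<in> carrier G" for g
      proof -
        obtain m u where mu: "m \<in> K" "u \<in> {\<one>, a, b, a \<otimes> b}" "g = m \<otimes> u \<or> g = m \<otimes> (r \<otimes> u)" using cover[OF g] by blast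
        have "m \<otimes> (a \<otimes> b) = m \<otimes> z2 \<otimes> (b \<otimes> a)" unfolding ab using K_closed[OF mu(1)] z2c abr by (simp add: m_assoc)
        moreover have "m \<otimes> (r \<otimes> (a \<otimes> b)) = m \<otimes> z2 \<otimes> (r \<otimes> (b \<otimes> a))"
          unfolding ab using K_closed[OF mu(1)] z2c abr K_left[OF z2(1) abr(3)] by (simp add: m_assoc)
        moreover have "m \<otimes> z2 \<in> K" using K_mult[OF mu(1) z2(1)] .
        ultimately show ?thesis using mu by blast
      qed
      then show False using wreath_configuration_not_filled[OF card z1 abr(2,1,3) sq(2,1) _ 3(2,1)] f kba kab by auto
    next
      case 4
      have A: "c \<otimes> c \<in> {\<one>, n}" if "n \<in> K" "n \<noteq> \<one>" "c \<in> carrier G" "kappa c a \<in> {\<one>, n}" "kappa c b \<in> {\<one>, n}" "kappa c r \<in> {\<one>, n}" for c n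
        using filled_square_in_pair[OF f card that(1-3) kappa_span[OF cover abr that(1,3-6)]] by blast
      have z3: "z1 \<otimes> z2 \<in> K" "z1 \<otimes> z2 \<noteq> \<one>" "z1 \<otimes> z2 \<noteq> z1" "z1 \<otimes> z2 \<noteq> z2"
        using K_mult[OF z1(1) z2(1)] K_mult_neq[OF z1(1) z2(1) z1(2) z2(2,3)] by simp_all
      let ?c = "a \<otimes> b"
      have cc: "?c \<in> carrier G" using abr by simp
      have krc: "kappa r ?c = \<one>" using kappa_mult[OF abr(3,1,2)] 4 K_square[OF z1(1)] by simp
      have kca: "kappa ?c a = z2" using kappa_mult_left[OF abr(1,1,2)] kappa_refl[OF abr(1)] kba z2c by simp
      have kcb: "kappa ?c b = z2" using kappa_mult_left[OF abr(2,1,2)] kappa_refl[OF abr(2)] kba z2c by simp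
      have kcr: "kappa ?c r = \<one>" using kappa_sym[OF abr(3) cc] krc by simp
      have "?c \<otimes> ?c \<in> {\<one>, z2}" by (rule A) (use z2 cc kca kcb kcr in auto)
      \<comment> \<open>The square of a b is z2 (a a)(b b), and both a a and b b lie in {1,
        z1}.\<close>
      moreover have "?c \<otimes> ?c \<noteq> \<one>"
      proof
        assume e: "?c \<otimes> ?c = \<one>"
        have "(a \<otimes> a) \<otimes> (b \<otimes> b) \<in> ?M" using M.m_closed[OF sq] .
        then have s: "z2 \<otimes> ((a \<otimes> a) \<otimes> (b \<otimes> b)) = \<one>" "(a \<otimes> a) \<otimes> (b \<otimes> b) = \<one> \<or> (a \<otimes> a) \<otimes> (b \<otimes> b) = z1"
          using square_mult[OF abr(1,2)] e kba by auto
        have "z2 = \<one> \<or> z2 \<otimes> z1 = \<one>" using s z2c by (metis r_one)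
        then show False using z2(2) z3(2) K_central[OF z1(1) z2c] by auto
      qed
      ultimately have c2: "?c \<otimes> ?c = z2" by blast
      have "r \<otimes> r \<in> {\<one>, z1}" by (rule A) (use z1 abr kappa_refl 4 in auto)
      moreover have "(r \<otimes> ?c) \<otimes> (r \<otimes> ?c) \<in> {\<one>, z1 \<otimes> z2}"
      proof (rule A)
        show "kappa (r \<otimes> ?c) a \<in> {\<one>, z1 \<otimes> z2}" using kappa_mult_left[OF abr(1,3) cc] 4 kca by simp
        show "kappa (r \<otimes> ?c) b \<in> {\<one>, z1 \<otimes> z2}" using kappa_mult_left[OF abr(2,3) cc] 4 kcb by simp
        show "kappa (r \<otimes> ?c) r \<in> {\<one>, z1 \<otimes> z2}" using kappa_mult_left[OF abr(3,3) cc] kappa_refl[OF abr(3)] kcr by simp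
      qed (use z3 abr cc in auto)
      then have "(r \<otimes> r) \<otimes> z2 \<in> {\<one>, z1 \<otimes> z2}" using square_mult[OF abr(3) cc] krc c2 abr z2c by simp
      \<comment> \<open>r r = 1 would put z2 into {1, z1 z2}.\<close>
      ultimately have "r \<otimes> r = z1" using z2 z3(4) z2c by auto
      then show False using filled_no_C4_C4[OF f Keq z1(2) z2(2,3) abr(3) cc _ c2] krc by blast
    qed
  qed
qed

end

section \<open>Reduction to a derived subgroup of order two\<close>

context group
begin

lemma lower_central_series_1_subset:
  assumes S: "subgroup S G" and c: "\<And>x y. x \<in> carrier G \<Longrightarrow> y \<in> carrier G \<Longrightarrow> x \<otimes> y \<otimes> inv x \<otimes> inv y \<in> S"
  shows "lower_central_series G 1 \<subseteq> S"
  unfolding One_nat_def lower_central_series.simps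
  by (rule generate_subgroup_incl[OF _ S]) (use c in auto)

lemma lower_central_series_1_trivial:
  assumes "\<And>x y. x \<in> carrier G \<Longrightarrow> y \<in> carrier G \<Longrightarrow> x \<otimes> y = y \<otimes> x"
  shows "lower_central_series G 1 = {\<one>}"
proof -
  have "lower_central_series G 1 \<subseteq> {\<one>}"
    by (rule lower_central_series_1_subset[OF triv_subgroup]) (use assms commutator_eq_one_iff in blast)
  then show ?thesis using subgroup.one_closed[OF lower_central_series_subgroup[of 1]] by blast
qed

lemma quadratic_groupI:
  assumes fin: "finite (carrier G)" and sq: "\<And>x. x \<in> carrier G \<Longrightarrow> x \<otimes> x \<in> lower_central_series G 1"
    and D: "lower_central_series G 1 = {\<one>, z}" "z \<noteq> \<one>"
  shows "quadratic_group G z"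
proof -
  interpret D: normal "{\<one>, z}" G using lower_central_series_normal[of 1] unfolding D .
  have z: "z \<in> carrier G" using D.subset by simp
  show ?thesis
  proof
    show "finite (carrier G)" "z \<in> carrier G" "z \<noteq> \<one>" by (rule fin z D(2))+
    have "z \<otimes> z \<in> {\<one>, z}" using D.m_closed[of z z] by simp
    then show "z \<otimes> z = \<one>" using z D(2) by auto
    fix x assume x: "x \<in> carrier G"
    have "x \<otimes> z \<otimes> inv x \<in> {\<one>, z}" using D.inv_op_closed2[OF x, of z] by simp
    moreover have "x \<otimes> z = (x \<otimes> z \<otimes> inv x) \<otimes> x" using x z by (simp add: m_assoc)
    ultimately have "x \<otimes> z = x \<or> x \<otimes> z = z \<otimes> x" using x by auto
    then show "x \<otimes> z = z \<otimes> x" using x z D(2) by simp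
    show "x \<otimes> x = \<one> \<or> x \<otimes> x = z" using sq[OF x] unfolding D by simp
  qed
qed

text \<open>If w is not central, \<open>class3_not_filled\<close> applies to the quotient by z.
  Otherwise all squares are central and [x, y]^2 = [x x, y] = 1. Then w has square 1, because w and
  z w have the same square, and if it were nontrivial every commutator would lie in {1, z}. What
  remains is the class 2 case with the derived subgroup as K.\<close>

lemma not_filled_derived_order_4:
  assumes fin: "finite (carrier G)" and sq: "\<And>x. x \<in> carrier G \<Longrightarrow> x \<otimes> x \<in> lower_central_series G 1"
    and z: "z \<in> carrier G" "z \<noteq> \<one>" "z \<otimes> z = \<one>" "\<And>x. x \<in> carrier G \<Longrightarrow> x \<otimes> z = z \<otimes> x"
    and w: "w \<in> carrier G" "w \<noteq> \<one>" "w \<noteq> z" and D: "lower_central_series G 1 = {\<one>, z, w, z \<otimes> w}"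
  shows "\<not> filled G"
proof
  assume f: "filled G"
  let ?D = "lower_central_series G 1"
  note Dsub = lower_central_series_subgroup[of 1]
  have zw: "z \<otimes> w \<noteq> \<one>" "z \<otimes> w \<noteq> z" "z \<otimes> w \<noteq> w"
  proof -
    have "z \<otimes> (z \<otimes> w) = w" using z(1,3) w(1) by (simp add: m_assoc[symmetric])
    then show "z \<otimes> w \<noteq> \<one>" using z(1) w(3) by (metis r_one)
    show "z \<otimes> w \<noteq> z" "z \<otimes> w \<noteq> w" using z(1,2) w(1,2) by simp_all
  qed
  let ?M = "{\<one>, z}"
  have Mn: "?M \<lhd> G"
  proof (rule subgroup_normalI)
    show "subgroup ?M G"
    proof (rule subgroupI)
      fix x y assume "x \<in> ?M" "y \<in> ?M"
      then show "inv x \<in> ?M" "x \<otimes> y \<in> ?M" using z(1,3) by (auto simp: inv_equality)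
    qed (use z(1) in auto)
    fix x h assume x: "x \<in> carrier G" and h: "h \<in> ?M"
    then have "h \<in> carrier G" "x \<otimes> h = h \<otimes> x" using z(1) z(4)[OF x] by auto
    then show "x \<otimes> h \<otimes> inv x \<in> ?M" using x h by (simp add: m_assoc)
  qed
  interpret M: normal ?M G by (rule Mn)
  interpret p: group_hom G "G Mod ?M" "(#>) ?M" by (rule M.Mod_group_hom)
  have one: "\<one>\<^bsub>G Mod ?M\<^esub> = ?M" by simp
  have eq: "?M #> x = \<one>\<^bsub>G Mod ?M\<^esub> \<longleftrightarrow> x = \<one> \<or> x = z" if "x \<in> carrier G" for x
    using M.Mod_eq_one_iff[OF that] by simp
  have e1: "?M #> (z \<otimes> w) = ?M #> w"
    unfolding M.Mod_eq_iff[OF m_closed[OF z(1) w(1)] w(1)] using z(1) w(1) by (simp add: m_assoc)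
  have e2: "?M #> z = ?M #> \<one>" using eq[OF z(1)] p.hom_one by simp
  have DH: "lower_central_series (G Mod ?M) 1 = {\<one>\<^bsub>G Mod ?M\<^esub>, ?M #> w}"
    unfolding p.lower_central_series_image[OF M.Mod_surj, symmetric] D image_insert image_empty e1 e2 p.hom_one by blast
  have wH: "?M #> w \<noteq> \<one>\<^bsub>G Mod ?M\<^esub>" using eq[OF w(1)] w by blast
  have finH: "finite (carrier (G Mod ?M))" using fin M.Mod_surj by (metis finite_imageI)
  have Q: "quadratic_group (G Mod ?M) (?M #> w)"
  proof (rule p.H.quadratic_groupI[OF finH _ DH wH])
    fix y assume "y \<in> carrier (G Mod ?M)"
    then obtain x where x: "x \<in> carrier G" "?M #> x = y" using M.Mod_surj by (metis imageE)
    have "?M #> (x \<otimes> x) \<in> lower_central_series (G Mod ?M) 1"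
      using sq[OF x(1)] unfolding p.lower_central_series_image[OF M.Mod_surj, symmetric] by (rule imageI)
    then show "y \<otimes>\<^bsub>G Mod ?M\<^esub> y \<in> lower_central_series (G Mod ?M) 1" using p.hom_mult[OF x(1,1)] x(2) by metis
  qed
  obtain x0 y0 where nonab: "x0 \<in> carrier (G Mod ?M)" "y0 \<in> carrier (G Mod ?M)" "x0 \<otimes>\<^bsub>G Mod ?M\<^esub> y0 \<noteq> y0 \<otimes>\<^bsub>G Mod ?M\<^esub> x0"
    using p.H.lower_central_series_1_trivial DH wH by (metis insertI1 insertI2 singletonD)
  have wc: "g \<otimes> w = w \<otimes> g" if "g \<in> carrier G" for g
    using p.class3_not_filled[OF fin M.Mod_surj z eq w(1) Q M.filled_Mod[OF f] nonab that] f by blast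
  have wwc: "w \<otimes> w \<in> carrier G" using w(1) by simp
  have Dc: "g \<otimes> d = d \<otimes> g" if d: "d \<in> ?D" and g: "g \<in> carrier G" for d g
  proof -
    have "g \<otimes> (z \<otimes> w) = (z \<otimes> w) \<otimes> g" using z(4)[OF g] wc[OF g] z(1) w(1) g by (metis m_assoc)
    then show ?thesis using d z(4)[OF g] wc[OF g] g unfolding D by auto
  qed
  have com: "x \<otimes> y \<otimes> inv x \<otimes> inv y \<in> ?D" if "x \<in> carrier G" "y \<in> carrier G" for x y
    using commutator_in_lower_central_series[of x 0 y] that by simp
  have ksq: "k \<otimes> k = \<one>" if xy: "x \<in> carrier G" "y \<in> carrier G" and k: "k = x \<otimes> y \<otimes> inv x \<otimes> inv y" for x y k
  proof -
    have kD: "k \<in> ?D" "k \<in> carrier G" using com[OF xy] xy unfolding k by auto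
    have e: "x \<otimes> y = k \<otimes> (y \<otimes> x)" unfolding k using xy by (simp add: m_assoc inv_cancel_assoc)
    have "(x \<otimes> x) \<otimes> y = x \<otimes> (k \<otimes> (y \<otimes> x))" using e xy by (simp add: m_assoc)
    also have "\<dots> = (x \<otimes> k) \<otimes> (y \<otimes> x)" using xy kD by (simp add: m_assoc)
    also have "\<dots> = (k \<otimes> x) \<otimes> (y \<otimes> x)" unfolding Dc[OF kD(1) xy(1)] ..
    also have "\<dots> = k \<otimes> ((x \<otimes> y) \<otimes> x)" using xy kD by (simp add: m_assoc)
    also have "\<dots> = (k \<otimes> k) \<otimes> (y \<otimes> (x \<otimes> x))" unfolding e using xy kD by (simp add: m_assoc)
    also have "y \<otimes> (x \<otimes> x) = (x \<otimes> x) \<otimes> y" using Dc[OF sq[OF xy(1)] xy(2)] .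
    finally have "\<one> \<otimes> ((x \<otimes> x) \<otimes> y) = (k \<otimes> k) \<otimes> ((x \<otimes> x) \<otimes> y)" using xy by simp
    then show ?thesis using kD xy by (metis m_closed one_closed r_cancel)
  qed
  have zwsq: "(z \<otimes> w) \<otimes> (z \<otimes> w) = w \<otimes> w"
  proof -
    have "(z \<otimes> w) \<otimes> (z \<otimes> w) = z \<otimes> ((w \<otimes> z) \<otimes> w)" using z(1) w(1) by (simp add: m_assoc)
    also have "\<dots> = (z \<otimes> z) \<otimes> (w \<otimes> w)" unfolding z(4)[OF w(1)] using z(1) w(1) by (simp add: m_assoc)
    finally show ?thesis using z(3) wwc by simp
  qed
  have ww: "w \<otimes> w = \<one>"
  proof (rule ccontr)
    assume ww: "w \<otimes> w \<noteq> \<one>"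
    have "x \<otimes> y \<otimes> inv x \<otimes> inv y \<in> ?M" if xy: "x \<in> carrier G" "y \<in> carrier G" for x y
    proof -
      have "x \<otimes> y \<otimes> inv x \<otimes> inv y \<in> {\<one>, z, w, z \<otimes> w}" using com[OF xy] unfolding D .
      then show ?thesis using ksq[OF xy refl] ww zwsq by (elim insertE emptyE) auto
    qed
    then have "?D \<subseteq> ?M" by (rule lower_central_series_1_subset[OF M.subgroup_axioms])
    then show False using w unfolding D by blast
  qed
  have Dsq: "k \<otimes> k = \<one>" if "k \<in> ?D" for k using that zwsq ww z(3) unfolding D by (elim insertE emptyE) auto
  interpret class2_group G ?D
    using fin Dsub Dc Dsq sq com by (intro class2_group.intro class2_group_axioms.intro is_group)
  have "\<not> filled G"
  proof (rule class2_not_filled)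
    show c4: "card ?D = 4" unfolding D using zw z(2) w by auto
    show "\<exists>x\<in>carrier G. \<exists>y\<in>carrier G. kappa x y \<notin> {\<one>, n}" if n: "n \<in> ?D" for n
    proof (rule ccontr)
      assume "\<not> ?thesis"
      then have "?D \<subseteq> {\<one>, n}" unfolding kappa_def
        by (intro lower_central_series_1_subset normal_imp_subgroup[OF pair_normal[OF n]]) blast
      then have "card ?D \<le> card {\<one>, n}" by (intro card_mono) auto
      then show False using c4 card_insert_le_m1[of 2 "{n}" \<one>] by simp
    qed
  qed
  then show False using f by blast
qed

text \<open>Maximality of N is used one step above N: dividing out one more central involution must
  bring the derived subgroup down to at most two elements, so that of the quotient by N has exactly
  four and \<open>not_filled_derived_order_4\<close> applies.\<close>

lemma nilpotent_filled_quadratic: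
  assumes fin: "finite (carrier G)" and nil: "nilpotent G" and f: "filled G"
    and sq: "\<And>x. x \<in> carrier G \<Longrightarrow> x \<otimes> x \<in> lower_central_series G 1"
    and nontriv: "lower_central_series G 1 \<noteq> {\<one>}"
  shows "\<exists>z. quadratic_group G z"
proof -
  let ?D = "lower_central_series G 1"
  have Dfin: "finite ?D" using finite_subset[OF lower_central_series_subset fin] .
  have oneD: "\<one> \<in> ?D" using subgroup.one_closed[OF lower_central_series_subgroup] .
  have "card ?D \<le> 2"
  proof (rule ccontr)
    assume big: "\<not> card ?D \<le> 2"
    define F where "F = {N. N \<lhd> G \<and> 2 < card ((\<lambda>x. N #> x) ` ?D)}"
    have "F \<subseteq> Pow (carrier G)" unfolding F_def using normal_imp_subgroup subgroup.subset by blast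
    then have Ffin: "finite F" using finite_subset fin by blast
    have "inj_on (\<lambda>x. {\<one>} #> x) ?D"
      by (intro inj_onI) (simp add: r_coset_def subsetD[OF lower_central_series_subset])
    then have "{\<one>} \<in> F" unfolding F_def using big one_is_normal by (simp add: card_image)
    then have "Max (card ` F) \<in> card ` F" using Ffin by (intro Max_in) auto
    then obtain N where "N \<in> F" "Max (card ` F) = card N" by blast
    then have N: "N \<in> F" "\<And>N'. N' \<in> F \<Longrightarrow> card N' \<le> card N" using Ffin by (auto dest: Max_ge[OF finite_imageI[OF Ffin, of card] imageI])
    interpret N: normal N G using N(1) unfolding F_def by blast
    let ?Q = "G Mod N" and ?p = "\<lambda>x. N #> x"
    let ?m = "\<lambda>x y. x \<otimes>\<^bsub>?Q\<^esub> y"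
    interpret p: group_hom G ?Q ?p by (rule N.Mod_group_hom)
    have lift: "\<exists>x\<in>carrier G. ?p x = y" if "y \<in> carrier ?Q" for y using N.Mod_surj that by (metis imageE)
    have DQ: "lower_central_series ?Q 1 = ?p ` ?D" using p.lower_central_series_image[OF N.Mod_surj, of 1] by simp
    have finQ: "finite (carrier ?Q)" using fin N.Mod_surj by (metis finite_imageI)
    have sqQ: "?m y y \<in> lower_central_series ?Q 1" if y: "y \<in> carrier ?Q" for y
    proof -
      obtain x where x: "x \<in> carrier G" "?p x = y" using lift[OF y] by blast
      have "?p (x \<otimes> x) \<in> lower_central_series ?Q 1" using sq[OF x(1)] unfolding DQ by (rule imageI)
      then show ?thesis using p.hom_mult[OF x(1,1)] x(2) by metis
    qed
    have cardQ: "2 < card (lower_central_series ?Q 1)" unfolding DQ using N(1) unfolding F_def by blast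
    have "lower_central_series ?Q 1 \<noteq> {\<one>\<^bsub>?Q\<^esub>}" using cardQ by (metis One_nat_def card.empty card_insert_disjoint empty_iff finite.emptyI not_less_eq numeral_2_eq_2 less_irrefl_nat less_Suc_eq)
    from p.H.nilpotent_central_involution[OF p.nilpotent_image[OF N.Mod_surj nil] sqQ this]
    obtain z where z: "z \<in> lower_central_series ?Q 1" "z \<noteq> \<one>\<^bsub>?Q\<^esub>" "?m z z = \<one>\<^bsub>?Q\<^esub>"
      "\<And>x. x \<in> carrier ?Q \<Longrightarrow> ?m x z = ?m z x" by metis
    have zc: "z \<in> carrier ?Q" using z(1) p.H.lower_central_series_subset by blast
    \<comment> \<open>The preimage of {1, z} is a normal subgroup larger than N, so it violates the
      condition defining \<open>F\<close>.\<close>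
    define M where "M = {x \<in> carrier G. ?p x = \<one>\<^bsub>?Q\<^esub> \<or> ?p x = z}"
    have Mn: "M \<lhd> G"
    proof (rule subgroup_normalI)
      show "subgroup M G"
      proof (rule subgroupI)
        show "M \<subseteq> carrier G" "M \<noteq> {}" unfolding M_def using p.hom_one by blast+
        fix x assume x: "x \<in> M"
        have "inv\<^bsub>?Q\<^esub> z = z" using p.H.inv_equality[OF z(3) zc zc] .
        then show "inv x \<in> M" using x p.hom_inv[of x] p.H.inv_one unfolding M_def by auto
        fix y assume y: "y \<in> M"
        have "?p (x \<otimes> y) = ?m (?p x) (?p y)" using p.hom_mult[of x y] x y unfolding M_def by blast
        moreover have "?p x = \<one>\<^bsub>?Q\<^esub> \<or> ?p x = z" "?p y = \<one>\<^bsub>?Q\<^esub> \<or> ?p y = z" "x \<otimes> y \<in> carrier G" using x y unfolding M_def by blast+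
        ultimately show "x \<otimes> y \<in> M" unfolding M_def mem_Collect_eq
          using z(3) p.H.l_one[OF zc] p.H.r_one[OF zc] p.H.l_one[OF p.H.one_closed] by metis
      qed
      fix x n assume x: "x \<in> carrier G" and n: "n \<in> M"
      have nc: "n \<in> carrier G" and pn: "?p n = \<one>\<^bsub>?Q\<^esub> \<or> ?p n = z" using n unfolding M_def by auto
      have "?m (?p x) (?p n) = ?m (?p n) (?p x)"
        using pn z(4)[OF p.hom_closed[OF x]] p.H.l_one[OF p.hom_closed[OF x]] p.H.r_one[OF p.hom_closed[OF x]] by metis
      then have "?p (x \<otimes> n) = ?p (n \<otimes> x)" using p.hom_mult[OF x nc] p.hom_mult[OF nc x] by metis
      then have "?p (x \<otimes> n \<otimes> inv x) = ?p (n \<otimes> x \<otimes> inv x)"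
        using p.hom_mult[of "x \<otimes> n" "inv x"] p.hom_mult[of "n \<otimes> x" "inv x"] x nc by (metis inv_closed m_closed)
      also have "n \<otimes> x \<otimes> inv x = n" using x nc by (simp add: m_assoc)
      finally show "x \<otimes> n \<otimes> inv x \<in> M" using n x nc unfolding M_def by auto
    qed
    interpret M: normal M G by (rule Mn)
    have Meq: "M #> x = M #> y \<longleftrightarrow> ?p x = ?p y \<or> ?p x = ?m z (?p y)" if xy: "x \<in> carrier G" "y \<in> carrier G" for x y
    proof -
      have c: "?p x \<in> carrier ?Q" "?p y \<in> carrier ?Q" "inv y \<in> carrier G" using p.hom_closed xy by auto
      have "M #> x = M #> y \<longleftrightarrow> ?p (x \<otimes> inv y) = \<one>\<^bsub>?Q\<^esub> \<or> ?p (x \<otimes> inv y) = z"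
        using M.Mod_eq_iff[OF xy] xy unfolding M_def by simp
      also have "?p (x \<otimes> inv y) = ?m (?p x) (inv\<^bsub>?Q\<^esub> ?p y)" using p.hom_mult[OF xy(1) c(3)] p.hom_inv[OF xy(2)] by metis
      finally show ?thesis using p.H.inv_solve_right'[OF c(1,2), of] c zc by (metis p.H.inv_solve_right' p.H.l_one p.H.one_closed)
    qed
    have "N \<subset> M"
    proof
      show "N \<subseteq> M" unfolding M_def using N.Mod_eq_one_iff N.subset by auto
      obtain x where x: "x \<in> carrier G" "?p x = z" using lift[OF zc] by blast
      then have "x \<in> M" "x \<notin> N" unfolding M_def using N.Mod_eq_one_iff[OF x(1)] z(2) by auto
      then show "N \<noteq> M" by blast
    qed
    then have "card N < card M" using psubset_card_mono finite_subset[OF M.subset fin] by blast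
    then have "M \<notin> F" using N(2)[of M] by linarith
    then have cM: "card ((\<lambda>x. M #> x) ` ?D) \<le> 2" unfolding F_def using Mn by simp
    have "\<not> lower_central_series ?Q 1 \<subseteq> {\<one>\<^bsub>?Q\<^esub>, z}"
    proof
      assume "lower_central_series ?Q 1 \<subseteq> {\<one>\<^bsub>?Q\<^esub>, z}"
      then have "card (lower_central_series ?Q 1) \<le> card {\<one>\<^bsub>?Q\<^esub>, z}" by (intro card_mono) auto
      then show False using cardQ card_insert_le_m1[of 2 "{z}" "\<one>\<^bsub>?Q\<^esub>"] by simp
    qed
    then obtain w where w: "w \<in> lower_central_series ?Q 1" "w \<noteq> \<one>\<^bsub>?Q\<^esub>" "w \<noteq> z" by blast
    have wc: "w \<in> carrier ?Q" using w(1) p.H.lower_central_series_subset by blast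
    obtain x0 where x0: "x0 \<in> ?D" "?p x0 = w" using w(1) unfolding DQ by blast
    have Dc: "x \<in> carrier G" if "x \<in> ?D" for x using lower_central_series_subset that by blast
    have ne: "M #> x0 \<noteq> M #> \<one>"
      using Meq[OF Dc[OF x0(1)] one_closed] p.hom_one w(2,3) x0(2) p.H.r_one[OF zc] by metis
    have two: "M #> x = M #> \<one> \<or> M #> x = M #> x0" if x: "x \<in> ?D" for x
    proof (rule ccontr)
      assume "\<not> ?thesis"
      then have "card {M #> x, M #> \<one>, M #> x0} = 3" using ne by auto
      moreover have "{M #> x, M #> \<one>, M #> x0} \<subseteq> (\<lambda>x. M #> x) ` ?D" using x x0(1) oneD by blast
      then have "card {M #> x, M #> \<one>, M #> x0} \<le> card ((\<lambda>x. M #> x) ` ?D)" using Dfin by (intro card_mono) auto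
      ultimately show False using cM by linarith
    qed
    \<comment> \<open>The derived subgroup meets only the cosets of 1 and x0 modulo M, and each of
      these splits into two values modulo N that differ by z.\<close>
    have "lower_central_series ?Q 1 = {\<one>\<^bsub>?Q\<^esub>, z, w, ?m z w}"
    proof
      show "lower_central_series ?Q 1 \<subseteq> {\<one>\<^bsub>?Q\<^esub>, z, w, ?m z w}"
      proof
        fix y assume "y \<in> lower_central_series ?Q 1"
        then obtain x where x: "x \<in> ?D" "?p x = y" unfolding DQ by blast
        from two[OF x(1)] show "y \<in> {\<one>\<^bsub>?Q\<^esub>, z, w, ?m z w}"
        proof
          assume "M #> x = M #> \<one>"
          then show ?thesis using Meq[OF Dc[OF x(1)] one_closed] x(2) p.hom_one p.H.r_one[OF zc] by (metis insertCI)
        next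
          assume "M #> x = M #> x0"
          then show ?thesis using Meq[OF Dc[OF x(1)] Dc[OF x0(1)]] x(2) x0(2) by blast
        qed
      qed
      show "{\<one>\<^bsub>?Q\<^esub>, z, w, ?m z w} \<subseteq> lower_central_series ?Q 1"
        using z(1) w(1) subgroup.one_closed[OF p.H.lower_central_series_subgroup] subgroup.m_closed[OF p.H.lower_central_series_subgroup]
        by blast
    qed
    from p.H.not_filled_derived_order_4[OF finQ sqQ zc z(2,3,4) wc w(2,3) this] N.filled_Mod[OF f] show False by blast
  qed
  obtain z where z: "z \<in> ?D" "z \<noteq> \<one>" using nontriv oneD by blast
  have "card {\<one>, z} = 2" using z(2) by auto
  then have "?D = {\<one>, z}" using card_seteq[OF Dfin, of "{\<one>, z}"] z(1) oneD \<open>card ?D \<le> 2\<close> by simp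
  then show ?thesis using quadratic_groupI[OF fin sq _ z(2)] by blast
qed

end

section \<open>Normal forms\<close>

text \<open>A common normal form for the four non-abelian groups of the classification: \<open>a\<close> and \<open>b\<close> generate
  \<open>D\<^sub>8\<close>, \<open>i\<close> and \<open>j\<close> generate \<open>Q\<^sub>8\<close> if \<open>E\<close> holds and are trivial otherwise, and \<open>r\<close> generates the
  direct factor \<open>C\<^sub>2\<close> if \<open>T\<close> holds and is trivial otherwise.\<close>

locale quadratic_basis = quadratic_group +
  fixes a b i j r and T E :: bool
  assumes gens [simp]: "a \<in> carrier G" "b \<in> carrier G" "i \<in> carrier G" "j \<in> carrier G"
    and ab: "\<not> q a" "\<not> q b" "\<not> com a b"
    and r: "central r" "\<not> q r" "T \<Longrightarrow> r \<noteq> \<one>" "r \<noteq> z" "\<not> T \<Longrightarrow> r = \<one>"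
    and ij: "E \<Longrightarrow> q i" "E \<Longrightarrow> q j" "E \<Longrightarrow> \<not> com i j" "\<not> E \<Longrightarrow> i = \<one>" "\<not> E \<Longrightarrow> j = \<one>"
    and ab_ij: "com a i" "com a j" "com b i" "com b j"
    and cover: "g \<in> carrier G \<Longrightarrow>
      \<exists>c\<in>{\<one>, z, r, z \<otimes> r}. \<exists>v\<in>{\<one>, i, j, i \<otimes> j}. \<exists>u\<in>{\<one>, a, b, a \<otimes> b}. g = c \<otimes> (v \<otimes> u)"

text \<open>Tuples are exponent vectors for z, r, i, j, a, b. Exponents of generators that the flags
  declare trivial are forced to be False, which makes the normal form unique.\<close>

definition index_set :: "bool \<Rightarrow> bool \<Rightarrow> (bool \<times> bool \<times> bool \<times> bool \<times> bool \<times> bool) set" where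
  "index_set T E = {(s, t, k, l, m, n). (t \<longrightarrow> T) \<and> (k \<or> l \<longrightarrow> E)}"

text \<open>The correction of the exponent of z collects i i = z, j j = z, j i = z i j and b a = z a
  b, one conjunction of exponents for each relation.\<close>

fun index_mult :: "bool \<times> bool \<times> bool \<times> bool \<times> bool \<times> bool \<Rightarrow> bool \<times> bool \<times> bool \<times> bool \<times> bool \<times> bool \<Rightarrow>
    bool \<times> bool \<times> bool \<times> bool \<times> bool \<times> bool" where
  "index_mult (s, t, k, l, m, n) (s', t', k', l', m', n') =
     ((s \<noteq> s') \<noteq> (((k \<and> k') \<noteq> ((l \<and> l') \<noteq> (l \<and> k'))) \<noteq> (n \<and> m')), t \<noteq> t', k \<noteq> k', l \<noteq> l', m \<noteq> m', n \<noteq> n')"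

lemma index_mult_closed: "x \<in> index_set T E \<Longrightarrow> y \<in> index_set T E \<Longrightarrow> index_mult x y \<in> index_set T E"
  unfolding index_set_def by (cases x; cases y) auto

section \<open>Filledness and multiplication in normal form\<close>

context quadratic_basis
begin

lemma r_closed [simp]: "r \<in> carrier G"
  using centralD(1)[OF r(1)] .

lemma com_simps: "com b a \<longleftrightarrow> False" "com i a" "com j a" "com i b" "com j b" "com j i \<longleftrightarrow> com i j"
  "x \<in> carrier G \<Longrightarrow> com x r" "x \<in> carrier G \<Longrightarrow> com r x"
  using ab(3) ab_ij com_sym centralD(2)[OF r(1)] by blast+

lemma com_word:
  assumes "c \<in> {\<one>, z, r, z \<otimes> r}" "v \<in> carrier G" "u \<in> carrier G" "x \<in> carrier G"
  shows "com x (c \<otimes> (v \<otimes> u)) \<longleftrightarrow> (com x v \<longleftrightarrow> com x u)" "q (c \<otimes> (v \<otimes> u)) \<longleftrightarrow> q (v \<otimes> u)" "c \<in> carrier G"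
  using assms r(2) by (auto simp: com_simps)

lemma central_c: "c \<in> {\<one>, z, r, z \<otimes> r} \<Longrightarrow> central c"
  using r(1) unfolding central_def by (auto simp: com_simps)

text \<open>Representatives modulo the center of the non-central elements of square 1: two for the
  hyperbolic plane, and the five points of the elliptic quadric for the minus type form.\<close>

definition mirrors :: "'a set" where
  "mirrors = {a, b} \<union> (if E then {i \<otimes> (a \<otimes> b), j \<otimes> (a \<otimes> b), (i \<otimes> j) \<otimes> (a \<otimes> b)} else {})"

lemma mirrorsD: "w \<in> mirrors \<Longrightarrow> w \<in> carrier G" "w \<in> mirrors \<Longrightarrow> \<not> q w"
  "w \<in> mirrors \<Longrightarrow> w' \<in> mirrors \<Longrightarrow> com w w' \<Longrightarrow> w = w'"
  using ab ab_ij ij(1-3) unfolding mirrors_def by (auto simp: com_simps split: if_splits)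

text \<open>The mirrors span the group modulo its center, so only central elements commute with all
  of them. For the second claim, a nontrivial v has \<open>q\<close> and commutes with u, so v u has
  square 1 exactly when u = a b.\<close>

lemma noncentral_mirror:
  assumes g: "g \<in> carrier G" "\<not> central g"
  shows "\<exists>w\<in>mirrors. \<not> com w g" "\<not> q g \<Longrightarrow> \<exists>c. central c \<and> (\<exists>w\<in>mirrors. g = c \<otimes> w)"
proof -
  obtain c v u where cvu: "c \<in> {\<one>, z, r, z \<otimes> r}" "v \<in> {\<one>, i, j, i \<otimes> j}" "u \<in> {\<one>, a, b, a \<otimes> b}" "g = c \<otimes> (v \<otimes> u)"
    using cover[OF g(1)] by blast
  have vu: "v \<in> carrier G" "u \<in> carrier G" using cvu(2,3) by auto
  have cc: "central c" "c \<in> carrier G" using central_c cvu(1) centralD(1) by blast+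
  have n1: "v \<otimes> u \<noteq> \<one>" using g(2) cc cvu(4) by auto
  note w = com_word(1)[OF cvu(1) vu] com_word(2)[OF cvu(1) vu]
  have e: "\<not> E \<Longrightarrow> v = \<one>" using cvu(2) ij(4,5) by auto
  have ab_m: "a \<in> mirrors" "b \<in> mirrors" unfolding mirrors_def by auto
  have ij_m: "E \<Longrightarrow> i \<otimes> (a \<otimes> b) \<in> mirrors" "E \<Longrightarrow> j \<otimes> (a \<otimes> b) \<in> mirrors" "E \<Longrightarrow> (i \<otimes> j) \<otimes> (a \<otimes> b) \<in> mirrors"
    unfolding mirrors_def by auto
  show "\<exists>w\<in>mirrors. \<not> com w g"
  proof (cases "u = \<one>")
    case True
    then have vE: "v \<noteq> \<one>" using n1 by auto
    with e have vE: "v \<noteq> \<one>" E by blast+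
    have "\<not> com (i \<otimes> (a \<otimes> b)) g \<or> \<not> com (j \<otimes> (a \<otimes> b)) g"
      unfolding cvu(4) using True vE cvu(2) w(1) ij(3)[OF vE(2)] by (auto simp: com_simps ab_ij)
    then show ?thesis using ij_m vE(2) by blast
  next
    case False
    have "\<not> com a g \<or> \<not> com b g" unfolding cvu(4) using False cvu(2,3) w(1) ab(3) by (auto simp: com_simps ab_ij)
    then show ?thesis using ab_m by blast
  qed
  show "\<exists>c. central c \<and> (\<exists>w\<in>mirrors. g = c \<otimes> w)" if nq: "\<not> q g"
  proof -
    have nq': "\<not> q (v \<otimes> u)" using nq w(2)[OF one_closed] cvu(4) by simp
    have "v \<otimes> u \<in> mirrors"
    proof (cases "v = \<one>")
      case True
      then show ?thesis using nq' n1 cvu(3) ab ab_m by auto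
    next
      case False
      then have E using e by blast
      then show ?thesis using False nq' cvu(2,3) ab ij(1-3) ij_m by (auto simp: com_simps ab_ij)
    qed
    then show ?thesis using cc(1) cvu(4) by blast
  qed
qed

text \<open>Commuting mirrors coincide, so commuting non-central elements of square 1 have the same
  mirror and a central product. If g has \<open>q\<close>, a mirror x not commuting with g gives g =
  x (x g), where \<open>q\<close> fails for x g as 0 + 1 + 1 = 0.\<close>

lemma basis_filled: "filled G"
proof (rule filledI[OF r(1)])
  have nq: "\<not> q c" if "c \<in> {\<one>, z, r, z \<otimes> r}" for c using that r(2) by (auto simp: com_simps)
  show cen: "c \<in> {\<one>, z, r, z \<otimes> r}" if c: "central c" for c
  proof -
    obtain d v u where cvu: "d \<in> {\<one>, z, r, z \<otimes> r}" "v \<in> {\<one>, i, j, i \<otimes> j}" "u \<in> {\<one>, a, b, a \<otimes> b}" "c = d \<otimes> (v \<otimes> u)"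
      using cover[OF centralD(1)[OF c]] by blast
    have vu: "v \<in> carrier G" "u \<in> carrier G" using cvu(2,3) by auto
    have "com x v \<longleftrightarrow> com x u" if "x \<in> carrier G" for x
      using com_word(1)[OF cvu(1) vu that] centralD(2)[OF c that] com_sym cvu(4) by simp
    from this[of a] this[of b] this[of i] this[of j] have "u = \<one>" "v = \<one>"
      using cvu(2,3) ab(3) ij(3-5) by (cases E; auto simp: com_simps ab_ij)+
    then show ?thesis using cvu(1,4) com_word(3)[OF cvu(1) vu] by auto
  qed
  show "\<not> q c" if "central c" for c using nq cen[OF that] by blast
  show "central (x \<otimes> y)" if xy: "x \<in> carrier G" "y \<in> carrier G" "\<not> q x" "\<not> q y" "com x y" "\<not> central x" "\<not> central y" for x y
  proof -
    obtain c w c' w' where cw: "central c" "w \<in> mirrors" "x = c \<otimes> w" "central c'" "w' \<in> mirrors" "y = c' \<otimes> w'"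
      using noncentral_mirror(2)[OF xy(1,6,3)] noncentral_mirror(2)[OF xy(2,7,4)] by blast
    note cl = centralD(1)[OF cw(1)] centralD(1)[OF cw(4)] mirrorsD(1)[OF cw(2)] mirrorsD(1)[OF cw(5)]
    have cs: "com c u" "com u c" "com c' u" "com u c'" if "u \<in> carrier G" for u
      using centralD(2)[OF cw(1) that] centralD(2)[OF cw(4) that] com_sym by blast+
    have "com w w'" using xy(5) cl cs unfolding cw(3,6) by simp
    then have e: "w' = w" using mirrorsD(3) cw by blast
    have "w \<otimes> c' = c' \<otimes> w" using cs(4)[OF cl(3)] unfolding com_def .
    then have "x \<otimes> y = (c \<otimes> c') \<otimes> (w \<otimes> w)" unfolding cw(3,6) e using cl by (metis m_assoc m_closed)
    then show ?thesis using square_if[OF cl(3)] central_mult[OF cw(1,4)] central_mult[OF _ central_z] mirrorsD(2)[OF cw(2)] cl by simp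
  qed
  show "\<exists>x\<in>carrier G. \<exists>y\<in>carrier G. \<not> q x \<and> \<not> q y \<and> \<not> central x \<and> \<not> central y \<and> g = x \<otimes> y" if g: "g \<in> carrier G" "q g" for g
  proof -
    have "\<not> central g" using g(2) cen nq by blast
    then obtain x where x: "x \<in> mirrors" "\<not> com x g" using noncentral_mirror(1)[OF g(1)] by blast
    note x' = mirrorsD(1,2)[OF x(1)]
    have "\<not> q (x \<otimes> g)" using x' g x(2) by simp
    moreover have "\<not> com x (x \<otimes> g)" using x' g x(2) by simp
    moreover have "g = x \<otimes> (x \<otimes> g)" using square_if[OF x'(1)] x'(2) g(1) x'(1) by (metis m_assoc l_one)
    moreover have "\<not> central x" using x(2) g(1) centralD(2) by blast
    moreover have "\<not> central (x \<otimes> g)" using calculation(2) centralD(2) x'(1) com_sym by blast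
    ultimately show ?thesis using x' g(1) by (metis m_closed)
  qed
qed

definition pw :: "'a \<Rightarrow> bool \<Rightarrow> 'a" where "pw x s = (if s then x else \<one>)"

fun normal_form :: "bool \<times> bool \<times> bool \<times> bool \<times> bool \<times> bool \<Rightarrow> 'a" where
  "normal_form (s, t, k, l, m, n) = (pw z s \<otimes> pw r t) \<otimes> ((pw i k \<otimes> pw j l) \<otimes> (pw a m \<otimes> pw b n))"

lemma pw_closed [simp]: "x \<in> carrier G \<Longrightarrow> pw x s \<in> carrier G"
  unfolding pw_def by simp

lemma pw_mult_involution: "x \<in> carrier G \<Longrightarrow> x \<otimes> x = \<one> \<Longrightarrow> pw x s \<otimes> pw x s' = pw x (s \<noteq> s')"
  unfolding pw_def by simp

lemma com_pw: "com x y \<Longrightarrow> x \<in> carrier G \<Longrightarrow> y \<in> carrier G \<Longrightarrow> com (pw x s) (pw y t)"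
  unfolding pw_def by simp

lemma dihedral_part_mult:
  "(pw a m \<otimes> pw b n) \<otimes> (pw a m' \<otimes> pw b n') = pw z (n \<and> m') \<otimes> (pw a (m \<noteq> m') \<otimes> pw b (n \<noteq> n'))"
proof -
  have rules: "a \<otimes> a = \<one>" "b \<otimes> b = \<one>" "b \<otimes> a = z \<otimes> (a \<otimes> b)"
    using ab square_if commutator_if[of b a] by (simp_all add: com_simps)
  have left: "a \<otimes> (a \<otimes> x) = x" "b \<otimes> (b \<otimes> x) = x" "b \<otimes> (a \<otimes> x) = z \<otimes> (a \<otimes> (b \<otimes> x))" if "x \<in> carrier G" for x
    using rules that by (simp_all add: m_assoc[symmetric])
  show ?thesis unfolding pw_def by (simp add: m_assoc rules left z_left[OF gens(1)] z_left[OF gens(2)])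
qed

lemma quaternion_part_mult:
  assumes "k \<or> l \<longrightarrow> E" "k' \<or> l' \<longrightarrow> E"
  shows "(pw i k \<otimes> pw j l) \<otimes> (pw i k' \<otimes> pw j l') =
    pw z ((k \<and> k') \<noteq> ((l \<and> l') \<noteq> (l \<and> k'))) \<otimes> (pw i (k \<noteq> k') \<otimes> pw j (l \<noteq> l'))"
proof (cases E)
  case True
  have rules: "i \<otimes> i = z" "j \<otimes> j = z" "j \<otimes> i = z \<otimes> (i \<otimes> j)"
    using ij(1-3)[OF True] square_if commutator_if[of j i] by (simp_all add: com_simps)
  have left: "i \<otimes> (i \<otimes> x) = z \<otimes> x" "j \<otimes> (j \<otimes> x) = z \<otimes> x" "j \<otimes> (i \<otimes> x) = z \<otimes> (i \<otimes> (j \<otimes> x))" if "x \<in> carrier G" for x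
    using rules that by (simp_all add: m_assoc[symmetric])
  show ?thesis unfolding pw_def by (simp add: m_assoc rules left z_left[OF gens(3)] z_left[OF gens(4)] z_central[OF gens(3)] z_central[OF gens(4)])
next
  case False
  then show ?thesis using assms unfolding pw_def by simp
qed

lemma interchange:
  assumes "c \<in> carrier G" "x \<in> carrier G" "y \<in> carrier G" "c' \<in> carrier G" "com x c'"  "y \<in> carrier G"
  shows "(c \<otimes> x) \<otimes> (c' \<otimes> y) = (c \<otimes> c') \<otimes> (x \<otimes> y)"
proof -
  have "(c \<otimes> x) \<otimes> (c' \<otimes> y) = c \<otimes> ((x \<otimes> c') \<otimes> y)" using assms by (simp add: m_assoc)
  also have "x \<otimes> c' = c' \<otimes> x" using assms(5) unfolding com_def .
  finally show ?thesis using assms by (simp add: m_assoc)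
qed

lemma normal_form_mult:
  assumes "x \<in> index_set T E" "y \<in> index_set T E"
  shows "normal_form (index_mult x y) = normal_form x \<otimes> normal_form y"
proof -
  obtain s t k l m n where x: "x = (s, t, k, l, m, n)" by (cases x)
  obtain s' t' k' l' m' n' where y: "y = (s', t', k', l', m', n')" by (cases y)
  have E: "k \<or> l \<longrightarrow> E" "k' \<or> l' \<longrightarrow> E" using assms unfolding x y index_set_def by auto
  let ?c = "pw z s \<otimes> pw r t" and ?c' = "pw z s' \<otimes> pw r t'"
  let ?v = "pw i k \<otimes> pw j l" and ?v' = "pw i k' \<otimes> pw j l'"
  let ?u = "pw a m \<otimes> pw b n" and ?u' = "pw a m' \<otimes> pw b n'"
  let ?e = "(k \<and> k') \<noteq> ((l \<and> l') \<noteq> (l \<and> k'))" and ?f = "n \<and> m'"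
  let ?v'' = "pw i (k \<noteq> k') \<otimes> pw j (l \<noteq> l')" and ?u'' = "pw a (m \<noteq> m') \<otimes> pw b (n \<noteq> n')"
  have zp: "com x (pw z s)" "com x (pw r t)" if "x \<in> carrier G" for x s t
    using that unfolding pw_def by (simp_all add: com_simps)
  have rr: "r \<otimes> r = \<one>" using square_if[of r] r(2) by simp
  have c: "?c \<otimes> ?c' = pw z (s \<noteq> s') \<otimes> pw r (t \<noteq> t')"
    using interchange[of "pw z s" "pw r t" "pw r t'" "pw z s'"] zp(1) pw_mult_involution rr by simp
  have "com ?u ?v'" using com_pw ab_ij by simp
  then have vu: "(?v \<otimes> ?u) \<otimes> (?v' \<otimes> ?u') = (pw z ?e \<otimes> ?v'') \<otimes> (pw z ?f \<otimes> ?u'')"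
    using interchange[of ?v ?u ?u' ?v'] dihedral_part_mult quaternion_part_mult[OF E] by simp
  also have "\<dots> = (pw z ?e \<otimes> pw z ?f) \<otimes> (?v'' \<otimes> ?u'')"
    using interchange[of "pw z ?e" ?v'' ?u'' "pw z ?f"] zp(1) by simp
  also have "pw z ?e \<otimes> pw z ?f = pw z (?e \<noteq> ?f)" by (rule pw_mult_involution) simp_all
  finally have vu: "(?v \<otimes> ?u) \<otimes> (?v' \<otimes> ?u') = pw z (?e \<noteq> ?f) \<otimes> (?v'' \<otimes> ?u'')" .
  have "normal_form x \<otimes> normal_form y = (?c \<otimes> ?c') \<otimes> ((?v \<otimes> ?u) \<otimes> (?v' \<otimes> ?u'))"
    unfolding x y normal_form.simps using zp by (intro interchange) simp_all
  also have "\<dots> = (pw z (s \<noteq> s') \<otimes> pw r (t \<noteq> t')) \<otimes> (pw z (?e \<noteq> ?f) \<otimes> (?v'' \<otimes> ?u''))" unfolding c vu ..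
  also have "\<dots> = (pw z (s \<noteq> s') \<otimes> pw z (?e \<noteq> ?f)) \<otimes> (pw r (t \<noteq> t') \<otimes> (?v'' \<otimes> ?u''))"
    using zp by (intro interchange) simp_all
  also have "pw z (s \<noteq> s') \<otimes> pw z (?e \<noteq> ?f) = pw z ((s \<noteq> s') \<noteq> (?e \<noteq> ?f))" by (rule pw_mult_involution) simp_all
  finally show ?thesis unfolding x y index_mult.simps normal_form.simps by (simp add: m_assoc)
qed

text \<open>Commuting with a, b, i, j reads off the exponents of b, a, j, i in this order; the
  central parts are compared afterwards.\<close>

lemma normal_form_inj: "inj_on normal_form (index_set T E)"
proof (rule inj_onI)
  fix x y assume xy: "x \<in> index_set T E" "y \<in> index_set T E" "normal_form x = normal_form y"
  obtain s t k l m n where x: "x = (s, t, k, l, m, n)" by (cases x)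
  obtain s' t' k' l' m' n' where y: "y = (s', t', k', l', m', n')" by (cases y)
  have ind: "t \<longrightarrow> T" "k \<or> l \<longrightarrow> E" "t' \<longrightarrow> T" "k' \<or> l' \<longrightarrow> E" using xy(1,2) unfolding x y index_set_def by auto
  have probe: "com a (normal_form (s, t, k, l, m, n)) \<longleftrightarrow> \<not> n" "com b (normal_form (s, t, k, l, m, n)) \<longleftrightarrow> \<not> m"
    "E \<Longrightarrow> com i (normal_form (s, t, k, l, m, n)) \<longleftrightarrow> \<not> l" "E \<Longrightarrow> com j (normal_form (s, t, k, l, m, n)) \<longleftrightarrow> \<not> k" for s t k l m n
    using ab(3) ij(3) unfolding pw_def by (simp_all add: pw_def com_simps ab_ij)
  have e: "m' = m" "n' = n" using probe(1,2) xy(3) unfolding x y by metis+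
  have e': "k' = k" "l' = l" using probe(3,4) xy(3) ind unfolding x y by metis+
  have "pw z s \<otimes> pw r t = pw z s' \<otimes> pw r t'" using xy(3) unfolding x y e e' normal_form.simps by simp
  then have eq: "(if s then z else \<one>) \<otimes> (if t then r else \<one>) = (if s' then z else \<one>) \<otimes> (if t' then r else \<one>)"
    unfolding pw_def .
  have "z \<otimes> r \<noteq> \<one>" using r(4) zz_left[OF r_closed] by (metis r_one z_closed)
  note ne = this this[symmetric] r(4) r(4)[symmetric] z_not_one z_not_one[symmetric] z_mult_neq[OF r_closed] z_mult_neq[OF r_closed, symmetric]
  have "s = s' \<and> t = t'"
  proof (cases "r = \<one>")
    case True
    then have "\<not> t" "\<not> t'" using ind r(3) by blast+
    then show ?thesis using eq z_not_one by (cases s; cases s') simp_all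
  next
    case False
    then have "z \<otimes> r \<noteq> z" by simp
    note ne = ne this this[symmetric] False False[symmetric]
    show ?thesis using eq by (cases s; cases s'; cases t; cases t') (simp_all add: ne)
  qed
  then have "s = s'" "t = t'" by simp_all
  then show "x = y" unfolding x y e e' by simp
qed

lemma normal_form_surj: "normal_form ` index_set T E = carrier G"
proof
  show "normal_form ` index_set T E \<subseteq> carrier G" by auto
  show "carrier G \<subseteq> normal_form ` index_set T E"
  proof
    fix g assume gc: "g \<in> carrier G"
    obtain c v u where g: "c \<in> {\<one>, z, r, z \<otimes> r}" "v \<in> {\<one>, i, j, i \<otimes> j}" "u \<in> {\<one>, a, b, a \<otimes> b}" "g = c \<otimes> (v \<otimes> u)"
      using cover[OF gc] by (elim bexE) (rule that)
    have cE: "\<exists>s t. (t \<longrightarrow> T) \<and> c = pw z s \<otimes> pw r t"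
    proof (cases T)
      case True
      have "c = pw z False \<otimes> pw r False \<or> c = pw z True \<otimes> pw r False \<or> c = pw z False \<otimes> pw r True \<or> c = pw z True \<otimes> pw r True"
        using g(1) unfolding pw_def by auto
      then show ?thesis using True by metis
    next
      case False
      have "c = pw z False \<otimes> pw r False \<or> c = pw z True \<otimes> pw r False" using g(1) r(5)[OF False] unfolding pw_def by auto
      then show ?thesis by metis
    qed
    have vE: "\<exists>k l. (k \<or> l \<longrightarrow> E) \<and> v = pw i k \<otimes> pw j l"
    proof (cases E)
      case True
      have "v = pw i False \<otimes> pw j False \<or> v = pw i True \<otimes> pw j False \<or> v = pw i False \<otimes> pw j True \<or> v = pw i True \<otimes> pw j True"
        using g(2) unfolding pw_def by auto
      then show ?thesis using True by metis
    next
      case False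
      have "v = pw i False \<otimes> pw j False" using g(2) ij(4,5)[OF False] unfolding pw_def by auto
      then show ?thesis by metis
    qed
    have "u = pw a False \<otimes> pw b False \<or> u = pw a True \<otimes> pw b False \<or> u = pw a False \<otimes> pw b True \<or> u = pw a True \<otimes> pw b True"
      using g(3) unfolding pw_def by auto
    then obtain m n where "u = pw a m \<otimes> pw b n" by metis
    moreover obtain s t where "t \<longrightarrow> T" "c = pw z s \<otimes> pw r t" using cE by (elim exE conjE) (rule that)
    moreover obtain k l where "k \<or> l \<longrightarrow> E" "v = pw i k \<otimes> pw j l" using vE by (elim exE conjE) (rule that)
    ultimately have "(s, t, k, l, m, n) \<in> index_set T E" "g = normal_form (s, t, k, l, m, n)"
      unfolding g(4) index_set_def by auto
    then show "g \<in> normal_form ` index_set T E" by blast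
  qed
qed

end

text \<open>\<open>index_mult\<close> is the same for all groups, so equal flags mean the same
  multiplication table in normal form.\<close>

lemma quadratic_basis_iso:
  assumes "quadratic_basis G z a b i j r T E" "quadratic_basis H z' a' b' i' j' r' T E"
  shows "G \<cong> H"
proof -
  interpret G: quadratic_basis G z a b i j r T E by (rule assms(1))
  interpret H: quadratic_basis H z' a' b' i' j' r' T E by (rule assms(2))
  define f where "f g = H.normal_form (inv_into (index_set T E) G.normal_form g)" for g
  have fn: "f (G.normal_form x) = H.normal_form x" if "x \<in> index_set T E" for x
    unfolding f_def using G.normal_form_inj that by simp
  have lift: "\<exists>x\<in>index_set T E. G.normal_form x = g" if "g \<in> carrier G" for g
    using that G.normal_form_surj by (metis imageE)
  have "f \<in> iso G H"
  proof (rule isoI)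
    show "f \<in> hom G H"
    proof (rule homI)
      fix g assume "g \<in> carrier G"
      then obtain x where x: "x \<in> index_set T E" "G.normal_form x = g" using lift by blast
      then show "f g \<in> carrier H" using fn[OF x(1)] H.normal_form_surj by blast
      fix g' assume "g' \<in> carrier G"
      then obtain y where y: "y \<in> index_set T E" "G.normal_form y = g'" using lift by blast
      show "f (g \<otimes>\<^bsub>G\<^esub> g') = f g \<otimes>\<^bsub>H\<^esub> f g'"
        using fn[OF index_mult_closed[OF x(1) y(1)]] fn[OF x(1)] fn[OF y(1)]
        unfolding G.normal_form_mult[OF x(1) y(1)] H.normal_form_mult[OF x(1) y(1)] x(2) y(2) by simp
    qed
    have "bij_betw (inv_into (index_set T E) G.normal_form) (carrier G) (index_set T E)"
      using G.normal_form_inj G.normal_form_surj by (intro bij_betw_inv_into) (simp add: bij_betw_def)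
    moreover have "bij_betw H.normal_form (index_set T E) (carrier H)"
      using H.normal_form_inj H.normal_form_surj by (simp add: bij_betw_def)
    ultimately show "bij_betw f (carrier G) (carrier H)" unfolding f_def using bij_betw_trans by (fastforce simp: comp_def)
  qed
  then show ?thesis unfolding is_iso_def by blast
qed

text \<open>\<open>E\<close> records which alternative of \<open>filled_cases\<close> occurs, and
  \<open>T\<close> whether the center is larger than {1, z}.\<close>

lemma (in quadratic_group) filled_basis:
  assumes f: "filled G" and nonab: "x0 \<in> carrier G" "y0 \<in> carrier G" "\<not> com x0 y0"
  shows "\<exists>a b i j r T E. quadratic_basis G z a b i j r T E"
proof -
  obtain a b r where ab: "a \<in> carrier G" "b \<in> carrier G"
    and all: "\<not> q a \<and> \<not> q b \<and> \<not> com a b \<and>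
      central r \<and> (\<forall>c. central c \<longrightarrow> c \<in> {\<one>, z, r, z \<otimes> r}) \<and> (r = \<one> \<or> r \<noteq> \<one> \<and> r \<noteq> z) \<and>
    ((\<forall>g\<in>carrier G. \<exists>c. central c \<and> (\<exists>u\<in>{\<one>, a, b, a \<otimes> b}. g = c \<otimes> u)) \<or>
     (\<exists>i\<in>carrier G. \<exists>j\<in>carrier G. q i \<and> q j \<and> \<not> com i j \<and> com a i \<and> com a j \<and> com b i \<and> com b j \<and>
       (\<forall>g\<in>carrier G. \<exists>c. central c \<and> (\<exists>u\<in>{\<one>, a, b, a \<otimes> b}. \<exists>v\<in>{\<one>, i, j, i \<otimes> j}. g = c \<otimes> (v \<otimes> u)))))"
    using filled_cases[OF f nonab] by (elim bexE exE) (rule that)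
  have ab': "\<not> q a" "\<not> q b" "\<not> com a b" using all by simp_all
  note all' = all[THEN conjunct2, THEN conjunct2, THEN conjunct2]
  note r = all'[THEN conjunct1] and cen = all'[THEN conjunct2, THEN conjunct1, rule_format]
  note r' = all'[THEN conjunct2, THEN conjunct2, THEN conjunct1]
  have nqr: "\<not> q r" using filled_central[OF f r] .
  have rz: "r \<noteq> z" using r' z_not_one by metis
  from all'[THEN conjunct2, THEN conjunct2, THEN conjunct2] show ?thesis
  proof
    assume d: "\<forall>g\<in>carrier G. \<exists>c. central c \<and> (\<exists>u\<in>{\<one>, a, b, a \<otimes> b}. g = c \<otimes> u)"
    have "quadratic_basis G z a b \<one> \<one> r (r \<noteq> \<one>) False"
    proof (intro quadratic_basis.intro quadratic_group_axioms quadratic_basis_axioms.intro)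
      fix g assume "g \<in> carrier G"
      then obtain c u where cu: "central c" "u \<in> {\<one>, a, b, a \<otimes> b}" "g = c \<otimes> u" using d by blast
      have "u \<in> carrier G" using cu(2) ab by auto
      then have "g = c \<otimes> (\<one> \<otimes> u)" using cu(3) by simp
      then show "\<exists>c\<in>{\<one>, z, r, z \<otimes> r}. \<exists>v\<in>{\<one>, \<one>, \<one>, \<one> \<otimes> \<one>}. \<exists>u\<in>{\<one>, a, b, a \<otimes> b}. g = c \<otimes> (v \<otimes> u)"
        using cen[OF cu(1)] cu(2) by blast
    qed (use ab ab' r nqr rz in simp_all)
    then show ?thesis by blast
  next
    assume "\<exists>i\<in>carrier G. \<exists>j\<in>carrier G. q i \<and> q j \<and> \<not> com i j \<and> com a i \<and> com a j \<and> com b i \<and> com b j \<and>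
       (\<forall>g\<in>carrier G. \<exists>c. central c \<and> (\<exists>u\<in>{\<one>, a, b, a \<otimes> b}. \<exists>v\<in>{\<one>, i, j, i \<otimes> j}. g = c \<otimes> (v \<otimes> u)))"
    then obtain i j where ij: "i \<in> carrier G" "j \<in> carrier G" "q i" "q j" "\<not> com i j" "com a i" "com a j" "com b i" "com b j"
      and d: "\<forall>g\<in>carrier G. \<exists>c. central c \<and> (\<exists>u\<in>{\<one>, a, b, a \<otimes> b}. \<exists>v\<in>{\<one>, i, j, i \<otimes> j}. g = c \<otimes> (v \<otimes> u))"
      by (elim bexE conjE) (rule that)
    have "quadratic_basis G z a b i j r (r \<noteq> \<one>) True"
    proof (intro quadratic_basis.intro quadratic_group_axioms quadratic_basis_axioms.intro)
      fix g assume "g \<in> carrier G"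
      then obtain c u v where cu: "central c" "u \<in> {\<one>, a, b, a \<otimes> b}" "v \<in> {\<one>, i, j, i \<otimes> j}" "g = c \<otimes> (v \<otimes> u)" using d by blast
      then show "\<exists>c\<in>{\<one>, z, r, z \<otimes> r}. \<exists>v\<in>{\<one>, i, j, i \<otimes> j}. \<exists>u\<in>{\<one>, a, b, a \<otimes> b}. g = c \<otimes> (v \<otimes> u)"
        using cen[OF cu(1)] by blast
    qed (use ab ab' r nqr rz ij in simp_all)
    then show ?thesis by blast
  qed
qed

section \<open>Direct products with a group of order two, and central products\<close>

context quadratic_group
begin

lemma commutator_eq: "x \<in> carrier G \<Longrightarrow> y \<in> carrier G \<Longrightarrow> x \<otimes> y \<otimes> inv x \<otimes> inv y = (if com x y then \<one> else z)"
  using commutator_if[of x y] by (auto simp: m_assoc inv_cancel_assoc)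

lemma subgroup_z: "subgroup {\<one>, z} G"
proof (rule subgroupI)
  fix x y assume "x \<in> {\<one>, z}" "y \<in> {\<one>, z}"
  then show "inv x \<in> {\<one>, z}" "x \<otimes> y \<in> {\<one>, z}" by (auto simp: inv_if)
qed auto

end

lemma quadratic_basis_times_involution:
  assumes G: "quadratic_basis G z a b i j r False E" and H: "group H" "carrier H = {\<one>\<^bsub>H\<^esub>, t}" "t \<noteq> \<one>\<^bsub>H\<^esub>"
  shows "quadratic_basis (G \<times>\<times> H) (z, \<one>\<^bsub>H\<^esub>) (a, \<one>\<^bsub>H\<^esub>) (b, \<one>\<^bsub>H\<^esub>) (i, \<one>\<^bsub>H\<^esub>) (j, \<one>\<^bsub>H\<^esub>) (\<one>\<^bsub>G\<^esub>, t) True E"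
proof -
  interpret G: quadratic_basis G z a b i j r False E by (rule G)
  interpret H: group H by (rule H(1))
  interpret P: group "G \<times>\<times> H" by (rule DirProd_group[OF G.is_group H(1)])
  have r1: "r = \<one>\<^bsub>G\<^esub>" using G.r(5) by simp
  have t: "t \<in> carrier H" using H(2) by simp
  have "t \<otimes>\<^bsub>H\<^esub> t \<in> {\<one>\<^bsub>H\<^esub>, t}" using H.m_closed[OF t t] H(2) by simp
  then have tt: "t \<otimes>\<^bsub>H\<^esub> t = \<one>\<^bsub>H\<^esub>" using t H(3) by auto
  have Hk: "k = \<one>\<^bsub>H\<^esub> \<or> k = t" if "k \<in> carrier H" for k using that H(2) by simp
  have Hc: "k \<otimes>\<^bsub>H\<^esub> l = l \<otimes>\<^bsub>H\<^esub> k" if "k \<in> carrier H" "l \<in> carrier H" for k l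
    using Hk[OF that(1)] Hk[OF that(2)] t by auto
  have Hs: "k \<otimes>\<^bsub>H\<^esub> k = \<one>\<^bsub>H\<^esub>" if "k \<in> carrier H" for k using Hk[OF that] tt by auto
  interpret P: quadratic_group "G \<times>\<times> H" "(z, \<one>\<^bsub>H\<^esub>)"
  proof (intro quadratic_group.intro P.is_group quadratic_group_axioms.intro)
    have "finite (carrier H)" using H(2) by simp
    then show "finite (carrier (G \<times>\<times> H))" using G.fin by simp
    show "(z, \<one>\<^bsub>H\<^esub>) \<noteq> \<one>\<^bsub>G \<times>\<times> H\<^esub>" using G.z_not_one by simp
    fix x assume "x \<in> carrier (G \<times>\<times> H)"
    then obtain g k where x: "x = (g, k)" "g \<in> carrier G" "k \<in> carrier H" by auto
    show "x \<otimes>\<^bsub>G \<times>\<times> H\<^esub> (z, \<one>\<^bsub>H\<^esub>) = (z, \<one>\<^bsub>H\<^esub>) \<otimes>\<^bsub>G \<times>\<times> H\<^esub> x" using x G.z_central[OF x(2)] by simp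
    show "x \<otimes>\<^bsub>G \<times>\<times> H\<^esub> x = \<one>\<^bsub>G \<times>\<times> H\<^esub> \<or> x \<otimes>\<^bsub>G \<times>\<times> H\<^esub> x = (z, \<one>\<^bsub>H\<^esub>)"
      using x G.square[OF x(2)] Hs by auto
  qed simp_all
  have q: "P.q (g, k) \<longleftrightarrow> G.q g" if "k \<in> carrier H" for g k unfolding P.q_def G.q_def using Hs[OF that] by simp
  have com: "P.com (g, k) (g', l) \<longleftrightarrow> G.com g g'" if "k \<in> carrier H" "l \<in> carrier H" for g g' k l
    unfolding P.com_def G.com_def using Hc[OF that] by simp
  show ?thesis
  proof (intro quadratic_basis.intro P.quadratic_group_axioms quadratic_basis_axioms.intro)
    show "P.central (\<one>\<^bsub>G\<^esub>, t)" unfolding P.central_def using com t by auto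
    fix g assume "g \<in> carrier (G \<times>\<times> H)"
    then obtain x k where g: "g = (x, k)" "x \<in> carrier G" "k \<in> carrier H" by auto
    obtain c v u where cvu: "c \<in> {\<one>\<^bsub>G\<^esub>, z, r, z \<otimes>\<^bsub>G\<^esub> r}" "v \<in> {\<one>\<^bsub>G\<^esub>, i, j, i \<otimes>\<^bsub>G\<^esub> j}" "u \<in> {\<one>\<^bsub>G\<^esub>, a, b, a \<otimes>\<^bsub>G\<^esub> b}" "x = c \<otimes>\<^bsub>G\<^esub> (v \<otimes>\<^bsub>G\<^esub> u)"
      using G.cover[OF g(2)] by (elim bexE) (rule that)
    have vu: "v \<in> carrier G" "u \<in> carrier G" "c \<in> carrier G" using cvu(1-3) by auto
    show "\<exists>c\<in>{\<one>\<^bsub>G \<times>\<times> H\<^esub>, (z, \<one>\<^bsub>H\<^esub>), (\<one>\<^bsub>G\<^esub>, t), (z, \<one>\<^bsub>H\<^esub>) \<otimes>\<^bsub>G \<times>\<times> H\<^esub> (\<one>\<^bsub>G\<^esub>, t)}.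
      \<exists>v\<in>{\<one>\<^bsub>G \<times>\<times> H\<^esub>, (i, \<one>\<^bsub>H\<^esub>), (j, \<one>\<^bsub>H\<^esub>), (i, \<one>\<^bsub>H\<^esub>) \<otimes>\<^bsub>G \<times>\<times> H\<^esub> (j, \<one>\<^bsub>H\<^esub>)}.
      \<exists>u\<in>{\<one>\<^bsub>G \<times>\<times> H\<^esub>, (a, \<one>\<^bsub>H\<^esub>), (b, \<one>\<^bsub>H\<^esub>), (a, \<one>\<^bsub>H\<^esub>) \<otimes>\<^bsub>G \<times>\<times> H\<^esub> (b, \<one>\<^bsub>H\<^esub>)}. g = c \<otimes>\<^bsub>G \<times>\<times> H\<^esub> (v \<otimes>\<^bsub>G \<times>\<times> H\<^esub> u)"
    proof (intro bexI)
      show "g = (c, k) \<otimes>\<^bsub>G \<times>\<times> H\<^esub> ((v, \<one>\<^bsub>H\<^esub>) \<otimes>\<^bsub>G \<times>\<times> H\<^esub> (u, \<one>\<^bsub>H\<^esub>))" using g cvu(4) by simp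
      show "(u, \<one>\<^bsub>H\<^esub>) \<in> {\<one>\<^bsub>G \<times>\<times> H\<^esub>, (a, \<one>\<^bsub>H\<^esub>), (b, \<one>\<^bsub>H\<^esub>), (a, \<one>\<^bsub>H\<^esub>) \<otimes>\<^bsub>G \<times>\<times> H\<^esub> (b, \<one>\<^bsub>H\<^esub>)}" using cvu(3) by auto
      show "(v, \<one>\<^bsub>H\<^esub>) \<in> {\<one>\<^bsub>G \<times>\<times> H\<^esub>, (i, \<one>\<^bsub>H\<^esub>), (j, \<one>\<^bsub>H\<^esub>), (i, \<one>\<^bsub>H\<^esub>) \<otimes>\<^bsub>G \<times>\<times> H\<^esub> (j, \<one>\<^bsub>H\<^esub>)}" using cvu(2) by auto
      show "(c, k) \<in> {\<one>\<^bsub>G \<times>\<times> H\<^esub>, (z, \<one>\<^bsub>H\<^esub>), (\<one>\<^bsub>G\<^esub>, t), (z, \<one>\<^bsub>H\<^esub>) \<otimes>\<^bsub>G \<times>\<times> H\<^esub> (\<one>\<^bsub>G\<^esub>, t)}"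
        using cvu(1) Hk[OF g(3)] t by (auto simp: r1)
    qed
  qed (use t H(3) G.ab G.ij G.ab_ij in \<open>simp_all add: q com\<close>)
qed

text \<open>The direct product with K = {1, z} x {1, z'} is a \<open>class2_group\<close>, and
  dividing out the diagonal involution (z, z') is an instance of \<open>quadratic_Mod\<close>. In
  the quotient the quadratic form and the commutator are the sums of those of the two factors, which
  makes the two parts orthogonal.\<close>

lemma quadratic_basis_central_product:
  assumes G: "quadratic_basis G z a b i0 j0 r False False" and H: "quadratic_group H z'"
    and ij: "i \<in> carrier H" "j \<in> carrier H" "quadratic_group.q H z' i" "quadratic_group.q H z' j" "\<not> quadratic_group.com H i j"
    and coverH: "\<And>h. h \<in> carrier H \<Longrightarrow> \<exists>d\<in>{\<one>\<^bsub>H\<^esub>, z'}. \<exists>v\<in>{\<one>\<^bsub>H\<^esub>, i, j, i \<otimes>\<^bsub>H\<^esub> j}. h = d \<otimes>\<^bsub>H\<^esub> v"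
    and M: "M = generate (G \<times>\<times> H) {(z, z')}"
  shows "quadratic_basis ((G \<times>\<times> H) Mod M) (M #>\<^bsub>G \<times>\<times> H\<^esub> (z, \<one>\<^bsub>H\<^esub>)) (M #>\<^bsub>G \<times>\<times> H\<^esub> (a, \<one>\<^bsub>H\<^esub>)) (M #>\<^bsub>G \<times>\<times> H\<^esub> (b, \<one>\<^bsub>H\<^esub>))
    (M #>\<^bsub>G \<times>\<times> H\<^esub> (\<one>\<^bsub>G\<^esub>, i)) (M #>\<^bsub>G \<times>\<times> H\<^esub> (\<one>\<^bsub>G\<^esub>, j)) \<one>\<^bsub>(G \<times>\<times> H) Mod M\<^esub> False True"
proof -
  interpret G: quadratic_basis G z a b i0 j0 r False False by (rule G)
  interpret H: quadratic_group H z' by (rule H)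
  let ?P = "G \<times>\<times> H"
  interpret P: group ?P by (rule DirProd_group[OF G.is_group H.is_group])
  have inv: "inv\<^bsub>?P\<^esub> (x, y) = (inv\<^bsub>G\<^esub> x, inv\<^bsub>H\<^esub> y)" if "x \<in> carrier G" "y \<in> carrier H" for x y
    using inv_DirProd[OF G.is_group H.is_group that] .
  have triv: "r = \<one>\<^bsub>G\<^esub>" "i0 = \<one>\<^bsub>G\<^esub>" "j0 = \<one>\<^bsub>G\<^esub>" using G.r(5) G.ij(4,5) by simp_all
  let ?n = "(z, z')" and ?v = "(z, \<one>\<^bsub>H\<^esub>)" and ?K = "{\<one>\<^bsub>G\<^esub>, z} \<times> {\<one>\<^bsub>H\<^esub>, z'}"
  have sq: "(x, y) \<otimes>\<^bsub>?P\<^esub> (x, y) = (if G.q x then z else \<one>\<^bsub>G\<^esub>, if H.q y then z' else \<one>\<^bsub>H\<^esub>)"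
    if "x \<in> carrier G" "y \<in> carrier H" for x y using that G.square_if H.square_if by simp
  have comm: "(x, y) \<otimes>\<^bsub>?P\<^esub> (x', y') \<otimes>\<^bsub>?P\<^esub> inv\<^bsub>?P\<^esub> (x, y) \<otimes>\<^bsub>?P\<^esub> inv\<^bsub>?P\<^esub> (x', y') =
      (if G.com x x' then \<one>\<^bsub>G\<^esub> else z, if H.com y y' then \<one>\<^bsub>H\<^esub> else z')"
    if "x \<in> carrier G" "y \<in> carrier H" "x' \<in> carrier G" "y' \<in> carrier H" for x y x' y'
    using that by (simp add: inv G.commutator_eq H.commutator_eq)
  interpret C: class2_group ?P ?K
  proof (intro class2_group.intro P.is_group class2_group_axioms.intro)
    show "finite (carrier ?P)" using G.fin H.fin by simp
    show "subgroup ?K ?P" by (rule DirProd_subgroups[OF G.is_group G.subgroup_z H.is_group H.subgroup_z])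
    show "x \<otimes>\<^bsub>?P\<^esub> k = k \<otimes>\<^bsub>?P\<^esub> x" if "k \<in> ?K" "x \<in> carrier ?P" for k x
      using that G.z_central H.z_central by auto
    show "k \<otimes>\<^bsub>?P\<^esub> k = \<one>\<^bsub>?P\<^esub>" if "k \<in> ?K" for k using that by auto
    show "x \<otimes>\<^bsub>?P\<^esub> x \<in> ?K" if "x \<in> carrier ?P" for x using that sq by (cases x) (simp del: mult_DirProd)
    show "x \<otimes>\<^bsub>?P\<^esub> y \<otimes>\<^bsub>?P\<^esub> inv\<^bsub>?P\<^esub> x \<otimes>\<^bsub>?P\<^esub> inv\<^bsub>?P\<^esub> y \<in> ?K" if "x \<in> carrier ?P" "y \<in> carrier ?P" for x y
      using that comm by (cases x; cases y) (simp del: mult_DirProd inv_DirProd)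
  qed
  have zn: "z \<noteq> \<one>\<^bsub>G\<^esub>" "z' \<noteq> \<one>\<^bsub>H\<^esub>" by (rule G.z_not_one H.z_not_one)+
  have nK: "?n \<in> ?K" and vK: "?v \<in> ?K" and nv: "?n \<noteq> \<one>\<^bsub>?P\<^esub>" "?v \<noteq> \<one>\<^bsub>?P\<^esub>" "?n \<noteq> ?v" using zn by auto
  have card: "card ?K = 4" using zn by (simp add: card_cartesian_product)
  have M': "M = {\<one>\<^bsub>?P\<^esub>, ?n}"
  proof
    show "M \<subseteq> {\<one>\<^bsub>?P\<^esub>, ?n}" unfolding M
      by (rule P.generate_subgroup_incl[OF _ normal_imp_subgroup[OF C.pair_normal[OF nK]]]) simp
    have "\<one>\<^bsub>?P\<^esub> \<in> M" unfolding M by (rule generate.one)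
    moreover have "?n \<in> M" unfolding M by (rule generate.incl) simp
    ultimately show "{\<one>\<^bsub>?P\<^esub>, ?n} \<subseteq> M" by simp
  qed
  note quad = C.quadratic_Mod[OF nK vK nv card, folded M']
  interpret M: normal M ?P unfolding M' by (rule C.pair_normal[OF nK])
  interpret p: group_hom ?P "?P Mod M" "\<lambda>x. M #>\<^bsub>?P\<^esub> x" by (rule M.Mod_group_hom)
  interpret Q: quadratic_group "?P Mod M" "M #>\<^bsub>?P\<^esub> ?v" by (rule quad(1))
  let ?p = "\<lambda>x. M #>\<^bsub>?P\<^esub> x"
  have pm: "?p x \<otimes>\<^bsub>?P Mod M\<^esub> ?p y = ?p (x \<otimes>\<^bsub>?P\<^esub> y)" if "x \<in> carrier ?P" "y \<in> carrier ?P" for x y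
    using p.hom_mult[OF that] by simp
  have inM: "(if A then \<one>\<^bsub>G\<^esub> else z, if B then \<one>\<^bsub>H\<^esub> else z') \<in> M \<longleftrightarrow> (A \<longleftrightarrow> B)" for A B
    unfolding M' using zn by auto
  have q: "Q.q (?p (x, y)) \<longleftrightarrow> (G.q x \<noteq> H.q y)" if "x \<in> carrier G" "y \<in> carrier H" for x y
  proof -
    have "(if G.q x then z else \<one>\<^bsub>G\<^esub>, if H.q y then z' else \<one>\<^bsub>H\<^esub>) \<in> M \<longleftrightarrow> (G.q x \<longleftrightarrow> H.q y)"
      unfolding M' using zn by auto
    then show ?thesis using quad(2)[of "(x, y)"] that sq[OF that] by simp
  qed
  have com: "Q.com (?p (x, y)) (?p (x', y')) \<longleftrightarrow> (G.com x x' \<longleftrightarrow> H.com y y')"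
    if "x \<in> carrier G" "y \<in> carrier H" "x' \<in> carrier G" "y' \<in> carrier H" for x y x' y'
    using quad(3)[of "(x, y)" "(x', y')"] comm[OF that] inM that unfolding C.kappa_def by simp
  have cl: "?p (x, y) \<in> carrier (?P Mod M)" if "x \<in> carrier G" "y \<in> carrier H" for x y
    using p.hom_closed[of "(x, y)"] that by simp
  \<comment> \<open>The two central involutions are identified in the quotient, so the sign of the
    second factor can be absorbed into that of the first.\<close>
  have z'v: "?p (\<one>\<^bsub>G\<^esub>, z') = ?p ?v"
  proof -
    have "(\<one>\<^bsub>G\<^esub>, z') \<otimes>\<^bsub>?P\<^esub> inv\<^bsub>?P\<^esub> ?v = ?n" using G.inv_if[of z] by (simp add: inv)
    then show ?thesis using M.Mod_eq_iff[of "(\<one>\<^bsub>G\<^esub>, z')" ?v] M' by simp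
  qed
  have one: "?p (\<one>\<^bsub>G\<^esub>, \<one>\<^bsub>H\<^esub>) = \<one>\<^bsub>?P Mod M\<^esub>" using p.hom_one unfolding one_DirProd .
  have zz': "?p ?n = \<one>\<^bsub>?P Mod M\<^esub>" using M.Mod_eq_one_iff[of ?n] M' by simp
  show ?thesis
  proof (intro quadratic_basis.intro Q.quadratic_group_axioms quadratic_basis_axioms.intro)
    show "\<one>\<^bsub>?P Mod M\<^esub> \<noteq> ?p ?v" using Q.z_not_one by (rule not_sym)
    show "\<not> Q.q \<one>\<^bsub>?P Mod M\<^esub>" by (rule Q.q_simps)
    show "Q.central \<one>\<^bsub>?P Mod M\<^esub>" unfolding Q.central_def by (metis Q.com_one(2) p.H.one_closed)
    fix g assume "g \<in> carrier (?P Mod M)"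
    then obtain y where "y \<in> carrier ?P" "?p y = g" using M.Mod_surj by (metis imageE)
    then obtain x h where xh: "x \<in> carrier G" "h \<in> carrier H" "?p (x, h) = g" by (cases y) auto
    obtain c v0 u where cu: "c \<in> {\<one>\<^bsub>G\<^esub>, z, r, z \<otimes>\<^bsub>G\<^esub> r}" "v0 \<in> {\<one>\<^bsub>G\<^esub>, i0, j0, i0 \<otimes>\<^bsub>G\<^esub> j0}" "u \<in> {\<one>\<^bsub>G\<^esub>, a, b, a \<otimes>\<^bsub>G\<^esub> b}" "x = c \<otimes>\<^bsub>G\<^esub> (v0 \<otimes>\<^bsub>G\<^esub> u)"
      using G.cover[OF xh(1)] by (elim bexE) (rule that)
    have c: "c \<in> {\<one>\<^bsub>G\<^esub>, z}" "v0 = \<one>\<^bsub>G\<^esub>" "u \<in> carrier G" "c \<in> carrier G" using cu(1-3) triv by auto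
    obtain d v where dv: "d \<in> {\<one>\<^bsub>H\<^esub>, z'}" "v \<in> {\<one>\<^bsub>H\<^esub>, i, j, i \<otimes>\<^bsub>H\<^esub> j}" "h = d \<otimes>\<^bsub>H\<^esub> v" using coverH[OF xh(2)] by blast
    have d: "d \<in> carrier H" "v \<in> carrier H" using dv(1,2) ij(1,2) by auto
    have "(x, h) = (c, d) \<otimes>\<^bsub>?P\<^esub> ((\<one>\<^bsub>G\<^esub>, v) \<otimes>\<^bsub>?P\<^esub> (u, \<one>\<^bsub>H\<^esub>))" using cu(4) c dv(3) d by simp
    then have g: "g = ?p (c, d) \<otimes>\<^bsub>?P Mod M\<^esub> (?p (\<one>\<^bsub>G\<^esub>, v) \<otimes>\<^bsub>?P Mod M\<^esub> ?p (u, \<one>\<^bsub>H\<^esub>))"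
      using xh(3) pm[of "(\<one>\<^bsub>G\<^esub>, v)" "(u, \<one>\<^bsub>H\<^esub>)"] pm[of "(c, d)" "(u, v)"] c d by simp
    have cd: "?p (c, d) = \<one>\<^bsub>?P Mod M\<^esub> \<or> ?p (c, d) = ?p ?v" using c(1) dv(1) one zz' z'v by (elim insertE emptyE; metis)
    have e: "?p (\<one>\<^bsub>G\<^esub>, i \<otimes>\<^bsub>H\<^esub> j) = ?p (\<one>\<^bsub>G\<^esub>, i) \<otimes>\<^bsub>?P Mod M\<^esub> ?p (\<one>\<^bsub>G\<^esub>, j)" using pm[of "(\<one>\<^bsub>G\<^esub>, i)" "(\<one>\<^bsub>G\<^esub>, j)"] ij(1,2) by simp
    have v: "?p (\<one>\<^bsub>G\<^esub>, v) \<in> {\<one>\<^bsub>?P Mod M\<^esub>, ?p (\<one>\<^bsub>G\<^esub>, i), ?p (\<one>\<^bsub>G\<^esub>, j), ?p (\<one>\<^bsub>G\<^esub>, i) \<otimes>\<^bsub>?P Mod M\<^esub> ?p (\<one>\<^bsub>G\<^esub>, j)}"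
      using imageI[OF dv(2), of "\<lambda>v. ?p (\<one>\<^bsub>G\<^esub>, v)"] unfolding image_insert image_empty one e .
    have e': "?p (a \<otimes>\<^bsub>G\<^esub> b, \<one>\<^bsub>H\<^esub>) = ?p (a, \<one>\<^bsub>H\<^esub>) \<otimes>\<^bsub>?P Mod M\<^esub> ?p (b, \<one>\<^bsub>H\<^esub>)" using pm[of "(a, \<one>\<^bsub>H\<^esub>)" "(b, \<one>\<^bsub>H\<^esub>)"] by simp
    have u: "?p (u, \<one>\<^bsub>H\<^esub>) \<in> {\<one>\<^bsub>?P Mod M\<^esub>, ?p (a, \<one>\<^bsub>H\<^esub>), ?p (b, \<one>\<^bsub>H\<^esub>), ?p (a, \<one>\<^bsub>H\<^esub>) \<otimes>\<^bsub>?P Mod M\<^esub> ?p (b, \<one>\<^bsub>H\<^esub>)}"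
      using imageI[OF cu(3), of "\<lambda>u. ?p (u, \<one>\<^bsub>H\<^esub>)"] unfolding image_insert image_empty one e' .
    show "\<exists>c\<in>{\<one>\<^bsub>?P Mod M\<^esub>, ?p ?v, \<one>\<^bsub>?P Mod M\<^esub>, ?p ?v \<otimes>\<^bsub>?P Mod M\<^esub> \<one>\<^bsub>?P Mod M\<^esub>}.
      \<exists>v\<in>{\<one>\<^bsub>?P Mod M\<^esub>, ?p (\<one>\<^bsub>G\<^esub>, i), ?p (\<one>\<^bsub>G\<^esub>, j), ?p (\<one>\<^bsub>G\<^esub>, i) \<otimes>\<^bsub>?P Mod M\<^esub> ?p (\<one>\<^bsub>G\<^esub>, j)}.
      \<exists>u\<in>{\<one>\<^bsub>?P Mod M\<^esub>, ?p (a, \<one>\<^bsub>H\<^esub>), ?p (b, \<one>\<^bsub>H\<^esub>), ?p (a, \<one>\<^bsub>H\<^esub>) \<otimes>\<^bsub>?P Mod M\<^esub> ?p (b, \<one>\<^bsub>H\<^esub>)}. g = c \<otimes>\<^bsub>?P Mod M\<^esub> (v \<otimes>\<^bsub>?P Mod M\<^esub> u)"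
    proof (intro bexI)
      show "g = ?p (c, d) \<otimes>\<^bsub>?P Mod M\<^esub> (?p (\<one>\<^bsub>G\<^esub>, v) \<otimes>\<^bsub>?P Mod M\<^esub> ?p (u, \<one>\<^bsub>H\<^esub>))" by (rule g)
      show "?p (c, d) \<in> {\<one>\<^bsub>?P Mod M\<^esub>, ?p ?v, \<one>\<^bsub>?P Mod M\<^esub>, ?p ?v \<otimes>\<^bsub>?P Mod M\<^esub> \<one>\<^bsub>?P Mod M\<^esub>}" using cd by blast
    qed (rule u v)+
  qed (use ij G.ab in \<open>simp_all add: cl q com del: p.hom_mult\<close>)
qed

section \<open>The groups of the classification\<close>

lemma carrier_D8: "carrier D8 = {0, 1, 2, 3} \<times> UNIV"
  unfolding dihedral_group_def by (auto simp: atLeastLessThan_iff)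

lemma mult_D8 [simp]: "(x, e) \<otimes>\<^bsub>D8\<^esub> (y, f) = ((if e then x - y else x + y) mod 4, e \<noteq> f)"
  unfolding dihedral_group_def by simp

lemma one_D8 [simp]: "\<one>\<^bsub>D8\<^esub> = (0, False)"
  unfolding dihedral_group_def by simp

lemma group_D8: "group D8"
proof (rule groupI)
  show "x \<otimes>\<^bsub>D8\<^esub> y \<in> carrier D8" if "x \<in> carrier D8" "y \<in> carrier D8" for x y
    using that unfolding carrier_D8 by (cases x; cases y) auto
  show "x \<otimes>\<^bsub>D8\<^esub> y \<otimes>\<^bsub>D8\<^esub> w = x \<otimes>\<^bsub>D8\<^esub> (y \<otimes>\<^bsub>D8\<^esub> w)" for x y w
    by (cases x; cases y; cases w) (simp add: mod_simps algebra_simps)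
  show "\<one>\<^bsub>D8\<^esub> \<otimes>\<^bsub>D8\<^esub> x = x" if "x \<in> carrier D8" for x using that unfolding carrier_D8 by auto
  show "\<exists>y\<in>carrier D8. y \<otimes>\<^bsub>D8\<^esub> x = \<one>\<^bsub>D8\<^esub>" if x: "x \<in> carrier D8" for x
  proof (cases "snd x")
    case True
    then show ?thesis using x unfolding carrier_D8 by (intro bexI[of _ x]) auto
  next
    case False
    then show ?thesis using x unfolding carrier_D8 by (intro bexI[of _ "(- fst x mod 4, False)"]) auto
  qed
qed (simp add: carrier_D8)

lemma quadratic_group_D8: "quadratic_group D8 (2, False)"
proof (intro quadratic_group.intro group_D8 quadratic_group_axioms.intro)
  fix x assume "x \<in> carrier D8"
  then show "x \<otimes>\<^bsub>D8\<^esub> (2, False) = (2, False) \<otimes>\<^bsub>D8\<^esub> x" "x \<otimes>\<^bsub>D8\<^esub> x = \<one>\<^bsub>D8\<^esub> \<or> x \<otimes>\<^bsub>D8\<^esub> x = (2, False)"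
    unfolding carrier_D8 by (auto split: if_splits)
qed (simp_all add: carrier_D8)

text \<open>Two reflections whose product is a rotation of order 4 serve as a and b.\<close>

lemma quadratic_basis_D8:
  "quadratic_basis D8 (2, False) (0, True) (1, True) \<one>\<^bsub>D8\<^esub> \<one>\<^bsub>D8\<^esub> \<one>\<^bsub>D8\<^esub> False False"
proof -
  interpret quadratic_group D8 "(2, False)" by (rule quadratic_group_D8)
  show ?thesis
  proof (intro quadratic_basis.intro quadratic_group_D8 quadratic_basis_axioms.intro)
    show "central \<one>\<^bsub>D8\<^esub>" unfolding central_def using one_closed com_one(2) by blast
    fix g assume "g \<in> carrier D8"
    then show "\<exists>c\<in>{\<one>\<^bsub>D8\<^esub>, (2, False), \<one>\<^bsub>D8\<^esub>, (2, False) \<otimes>\<^bsub>D8\<^esub> \<one>\<^bsub>D8\<^esub>}. \<exists>v\<in>{\<one>\<^bsub>D8\<^esub>, \<one>\<^bsub>D8\<^esub>, \<one>\<^bsub>D8\<^esub>, \<one>\<^bsub>D8\<^esub> \<otimes>\<^bsub>D8\<^esub> \<one>\<^bsub>D8\<^esub>}.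
      \<exists>u\<in>{\<one>\<^bsub>D8\<^esub>, (0, True), (1, True), (0, True) \<otimes>\<^bsub>D8\<^esub> (1, True)}. g = c \<otimes>\<^bsub>D8\<^esub> (v \<otimes>\<^bsub>D8\<^esub> u)"
      unfolding carrier_D8 by (elim SigmaE) (auto; (rule bool.exhaust; simp))
  qed (simp_all add: carrier_D8 q_def com_def)
qed

lemma group_Q8: "group Q8"
proof (rule groupI)
  show "x \<otimes>\<^bsub>Q8\<^esub> y \<in> carrier Q8" if "x \<in> carrier Q8" "y \<in> carrier Q8" for x y
    using that unfolding Q8_def by (simp, elim disjE; simp)
  show "x \<otimes>\<^bsub>Q8\<^esub> y \<otimes>\<^bsub>Q8\<^esub> w = x \<otimes>\<^bsub>Q8\<^esub> (y \<otimes>\<^bsub>Q8\<^esub> w)" for x y w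
    by (cases x; cases y; cases w) (simp add: Q8_def algebra_simps)
  show "\<one>\<^bsub>Q8\<^esub> \<otimes>\<^bsub>Q8\<^esub> x = x" for x by (cases x) (simp add: Q8_def)
  show "\<exists>y\<in>carrier Q8. y \<otimes>\<^bsub>Q8\<^esub> x = \<one>\<^bsub>Q8\<^esub>" if "x \<in> carrier Q8" for x
    using that unfolding Q8_def by (simp, elim disjE; simp)
qed (simp add: Q8_def)

lemma quadratic_group_Q8: "quadratic_group Q8 (-1, 0, 0, 0)"
proof (intro quadratic_group.intro group_Q8 quadratic_group_axioms.intro)
  fix x assume x: "x \<in> carrier Q8"
  show "x \<otimes>\<^bsub>Q8\<^esub> (-1, 0, 0, 0) = (-1, 0, 0, 0) \<otimes>\<^bsub>Q8\<^esub> x" by (cases x) (simp add: Q8_def)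
  show "x \<otimes>\<^bsub>Q8\<^esub> x = \<one>\<^bsub>Q8\<^esub> \<or> x \<otimes>\<^bsub>Q8\<^esub> x = (-1, 0, 0, 0)" using x unfolding Q8_def by (simp, elim disjE; simp)
qed (simp_all add: Q8_def)

lemma quadratic_basis_D8_central_Q8: "\<exists>z a b i j r. quadratic_basis D8_central_Q8 z a b i j r False True"
proof -
  interpret Q: quadratic_group Q8 "(-1, 0, 0, 0)" by (rule quadratic_group_Q8)
  have "\<exists>d\<in>{\<one>\<^bsub>Q8\<^esub>, (-1, 0, 0, 0)}. \<exists>v\<in>{\<one>\<^bsub>Q8\<^esub>, (0, 1, 0, 0), (0, 0, 1, 0), (0, 1, 0, 0) \<otimes>\<^bsub>Q8\<^esub> (0, 0, 1, 0)}. h = d \<otimes>\<^bsub>Q8\<^esub> v"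
    if "h \<in> carrier Q8" for h using that unfolding Q8_def by (simp, elim disjE; simp)
  note cov = this
  have f: "(0, 1, 0, 0) \<in> carrier Q8" "(0, 0, 1, 0) \<in> carrier Q8" "Q.q (0, 1, 0, 0)" "Q.q (0, 0, 1, 0)" "\<not> Q.com (0, 1, 0, 0) (0, 0, 1, 0)"
    unfolding Q.q_def Q.com_def by (simp_all add: Q8_def)
  show ?thesis unfolding D8_central_Q8_def
    by (intro exI, rule quadratic_basis_central_product[OF quadratic_basis_D8 quadratic_group_Q8 f _ refl]) (rule cov)
qed

lemma quadratic_basis_times_C2:
  assumes "\<exists>z a b i j r. quadratic_basis G z a b i j r False E"
  shows "\<exists>z a b i j r. quadratic_basis (G \<times>\<times> integer_mod_group 2) z a b i j r True E"
proof -
  have "carrier (integer_mod_group 2) = {\<one>\<^bsub>integer_mod_group 2\<^esub>, 1}" by (auto simp: carrier_integer_mod_group)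
  moreover obtain z a b i j r where "quadratic_basis G z a b i j r False E" using assms by blast
  ultimately have "quadratic_basis (G \<times>\<times> integer_mod_group 2) (z, \<one>\<^bsub>integer_mod_group 2\<^esub>) (a, \<one>\<^bsub>integer_mod_group 2\<^esub>)
      (b, \<one>\<^bsub>integer_mod_group 2\<^esub>) (i, \<one>\<^bsub>integer_mod_group 2\<^esub>) (j, \<one>\<^bsub>integer_mod_group 2\<^esub>) (\<one>\<^bsub>G\<^esub>, 1) True E"
    by (intro quadratic_basis_times_involution group_integer_mod_group) simp_all
  then show ?thesis by (intro exI)
qed

lemma quadratic_basis_iso_ex:
  "quadratic_basis G z a b i j r T E \<Longrightarrow> \<exists>z a b i j r. quadratic_basis H z a b i j r T E \<Longrightarrow> G \<cong> H"
  by (elim exE) (rule quadratic_basis_iso)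

lemma quadratic_basis_classification:
  assumes "quadratic_basis G z a b i j r T E"
  shows "G \<cong> D8 \<or> G \<cong> D8 \<times>\<times> integer_mod_group 2 \<or> G \<cong> D8_central_Q8 \<or> G \<cong> D8_central_Q8 \<times>\<times> integer_mod_group 2"
proof -
  note c = quadratic_basis_D8_central_Q8
  have d: "\<exists>z a b i j r. quadratic_basis D8 z a b i j r False False" by (intro exI) (rule quadratic_basis_D8)
  have d2: "\<exists>z a b i j r. quadratic_basis (D8 \<times>\<times> integer_mod_group 2) z a b i j r True False"
    using quadratic_basis_times_C2[OF d] .
  have c2: "\<exists>z a b i j r. quadratic_basis (D8_central_Q8 \<times>\<times> integer_mod_group 2) z a b i j r True True"
    using quadratic_basis_times_C2[OF c] .
  have "T = False \<and> E = False \<or> T = True \<and> E = False \<or> T = False \<and> E = True \<or> T = True \<and> E = True" by blast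
  then show ?thesis
  proof (elim disjE conjE)
    assume "T = False" "E = False"
    from quadratic_basis_iso_ex[OF assms[unfolded this] d] show ?thesis by blast
  next
    assume "T = True" "E = False"
    from quadratic_basis_iso_ex[OF assms[unfolded this] d2] show ?thesis by blast
  next
    assume "T = False" "E = True"
    from quadratic_basis_iso_ex[OF assms[unfolded this] c] show ?thesis by blast
  next
    assume "T = True" "E = True"
    from quadratic_basis_iso_ex[OF assms[unfolded this] c2] show ?thesis by blast
  qed
qed

lemma quadratic_basis_imp_group: "quadratic_basis G z a b i j r T E \<Longrightarrow> group G"
  unfolding quadratic_basis_def quadratic_group_def by blast

lemma (in group) filled_if_iso:
  assumes "G \<cong> H" "group H" "filled H"
  shows "filled G"
  using filled_iso[OF assms(2) is_group iso_sym[OF assms(1)] assms(3)] .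

lemma (in group) filled_if_iso_basis:
  assumes "G \<cong> H" "\<exists>z a b i j r. quadratic_basis H z a b i j r T E"
  shows "filled G"
proof -
  obtain z a b i j r where H: "quadratic_basis H z a b i j r T E" using assms(2) by blast
  show ?thesis
    by (rule filled_if_iso[OF assms(1) quadratic_basis_imp_group[OF H] quadratic_basis.basis_filled[OF H]])
qed

lemma (in group) nilpotent_filled_classification:
  assumes fin: "finite (carrier G)" and nil: "nilpotent G" and f: "filled G"
  shows "elementary_abelian 2 G \<or> G \<cong> integer_mod_group 3 \<or> G \<cong> integer_mod_group 5 \<or>
    (\<exists>z a b i j r T E. quadratic_basis G z a b i j r T E)"
proof -
  have cyc: "G \<cong> integer_mod_group (order G)" if p: "Factorial_Ring.prime (order G)"
  proof -
    obtain x where "x \<in> carrier G" "ord x = order G" using exists_prime_order_element[OF fin p dvd_refl] .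
    then show ?thesis using group.iso_sym[OF group_integer_mod_group integer_mod_group_iso[OF fin]] by blast
  qed
  from nilpotent_filled_cases[OF fin nil f] consider "\<forall>x\<in>carrier G. x \<otimes> x \<in> lower_central_series G 1" | "order G = 3" | "order G = 5" by blast
  then show ?thesis
  proof cases
    case 1
    show ?thesis
    proof (cases "lower_central_series G 1 = {\<one>}")
      case True
      have "x \<otimes> y = y \<otimes> x" if "x \<in> carrier G" "y \<in> carrier G" for x y
        using commutator_in_lower_central_series[of x 0 y] commutator_eq_one_iff[OF that] that True by simp
      then have "comm_group G" by (rule group_comm_groupI)
      moreover have "x [^] (2::nat) = \<one>" if "x \<in> carrier G" for x
        using 1 that True by (auto simp: numeral_2_eq_2)
      ultimately show ?thesis unfolding elementary_abelian_def by blast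
    next
      case False
      then obtain z where z: "quadratic_group G z" using nilpotent_filled_quadratic[OF fin nil f] 1 by blast
      interpret quadratic_group G z by (rule z)
      obtain x y where "x \<in> carrier G" "y \<in> carrier G" "\<not> com x y"
        using lower_central_series_1_trivial False unfolding com_def by blast
      from filled_basis[OF f this] show ?thesis by blast
    qed
  next
    case 2
    then show ?thesis using cyc by simp
  next
    case 3
    then show ?thesis using cyc by simp
  qed
qed

theorem theorem3p12:
  fixes G :: "('a, 'b) monoid_scheme"
  assumes "group G" and "finite (carrier G)" and "nilpotent G"
  shows "filled G \<longleftrightarrow>
    elementary_abelian 2 G \<or>
    G \<cong> integer_mod_group 3 \<or> G \<cong> integer_mod_group 5 \<or> G \<cong> D8 \<or>
    G \<cong> D8 \<times>\<times> integer_mod_group 2 \<or>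
    G \<cong> D8_central_Q8 \<or>
    G \<cong> D8_central_Q8 \<times>\<times> integer_mod_group 2"
proof -
  interpret group G by fact
  have d: "\<exists>z a b i j r. quadratic_basis D8 z a b i j r False False" by (intro exI) (rule quadratic_basis_D8)
  have "elementary_abelian 2 G \<or>
    G \<cong> integer_mod_group 3 \<or> G \<cong> integer_mod_group 5 \<or> G \<cong> D8 \<or>
    G \<cong> D8 \<times>\<times> integer_mod_group 2 \<or>
    G \<cong> D8_central_Q8 \<or>
    G \<cong> D8_central_Q8 \<times>\<times> integer_mod_group 2" if f: "filled G"
    using nilpotent_filled_classification[OF assms(2,3) f] quadratic_basis_classification[of G] by blast
  moreover have "filled G" if "elementary_abelian 2 G"
  proof (rule elementary_abelian_filled)
    show "x \<otimes>\<^bsub>G\<^esub> x = \<one>\<^bsub>G\<^esub>" if x: "x \<in> carrier G" for x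
      using \<open>elementary_abelian 2 G\<close> x unfolding elementary_abelian_def by (auto simp: numeral_2_eq_2)
  qed
  moreover have "filled G" if "G \<cong> integer_mod_group 3"
    by (rule filled_if_iso[OF that group_integer_mod_group filled_integer_mod_group_3])
  moreover have "filled G" if "G \<cong> integer_mod_group 5"
    by (rule filled_if_iso[OF that group_integer_mod_group filled_integer_mod_group_5])
  moreover have "filled G" if "G \<cong> D8"
    using filled_if_iso_basis[OF that d] .
  moreover have "filled G" if "G \<cong> D8 \<times>\<times> integer_mod_group 2"
    using filled_if_iso_basis[OF that quadratic_basis_times_C2[OF d]] .
  moreover have "filled G" if "G \<cong> D8_central_Q8"
    using filled_if_iso_basis[OF that quadratic_basis_D8_central_Q8] .
  moreover have "filled G" if "G \<cong> D8_central_Q8 \<times>\<times> integer_mod_group 2"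
    using filled_if_iso_basis[OF that quadratic_basis_times_C2[OF quadratic_basis_D8_central_Q8]] .
  ultimately show ?thesis by blast
qed

end
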